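(* Let $p\ge3$ be a fixed integer, $0<\beta<\beta_f$, and $h=h_N=\rho N^{-\alpha}$ with $\rho>0$ and $\alpha\ge\tfrac14$. With $\alpha_c,\gamma_1,\gamma_2,\gamma_3,v_{k,\ell}$ as defined in the context, as $N\to\infty$: (a) (Sub-critical regime) If $\alpha\in[\alpha_c,\infty)$, then $N^{\gamma_1/2}\log\hat Z_N(\beta,h)\to\mathrm N(0,v_1^2)$ in distribution, where, if $\alpha>\alpha_c$, $v_1^2=v_{3,0}(\beta)^2$ for $p$ even and $v_1^2=v_{4,0}(\beta)^2$ for $p$ odd; and, if $\alpha=\alpha_c$, $$v_1^2=\begin{cases}v_{3,0}(\beta)^2+v_{2,2}(\beta,\rho)^2, & p\text{ even},\\ v_{4,0}(\beta)^2+v_{3,1}(\beta,\rho)^2+v_{2,2}(\beta,\rho)^2,& p\text{ odd}.\end{cases}$$ (b) (Unified regime I) If $\alpha\in[\tfrac12,\alpha_c)$, then $N^{\gamma_2(\alpha)/2}\log\hat Z_N(\beta,h)\to\mathrm N(0,v_2^2)$ in distribution, where $v_2^2=v_{2,2}(\beta,\rho)^2+v_{1,p}(\beta,\rho)^2$ if $\alpha=\tfrac12$ and $v_2^2=v_{2,2}(\beta,\rho)^2$ if $\tfrac12<\alpha<\alpha_c$. (c) (Unified regime II) If $\alpha\in[\tfrac14,\tfrac12)$, then $N^{\gamma_3(\alpha)/2}\log\hat Z_N(\beta,h)\to\mathrm N(0,v_3^2)$ in distribution, where $v_3^2=v_{1,p}(\beta,\rho)^2$.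
   Context: Pure $p$-spin model. $\mathcal E_{N,p}$ is the set of $p$-tuples $\boldsymbol i=(i_1,\dots,i_p)$ with $1\le i_1<\cdots<i_p\le N$; for $\sigma\in\{-1,+1\}^N$, $\sigma_{\boldsymbol i}=\prod_{j=1}^p\sigma_{i_j}$. The variables $(J_{\boldsymbol i})_{\boldsymbol i\in\mathcal E_{N,p}}$ are i.i.d., symmetrically distributed with mean zero, variance one and finite fourth moment. Define $$\hat Z_N(\beta,h)=\mathbb E_h\prod_{\boldsymbol i\in\mathcal E_{N,p}}\big(1+\sigma_{\boldsymbol i}\tanh(\beta J_{\boldsymbol i}/N^{(p-1)/2})\big),$$ where under $\mathbb E_h$ the $\sigma_i$ are i.i.d., independent of $J$, with $\mathbb P_h(\sigma_i=\pm1)=e^{\pm h}/(e^h+e^{-h})$. $\beta_f=\min_{x\in(0,1)}\sqrt{p!\,I(x)/x^p}$ with $I(x)=\frac12(1+x)\log(1+x)+\frac12(1-x)\log(1-x)$. $\alpha_c=p/8$ for $p$ even and $\alpha_c=(p-1)/4$ for $p$ odd. $\ell_p=3$ for $p$ even and $\ell_p=4$ for $p$ odd. $\gamma_1=\frac12\ell_p(p-2)$, $\gamma_2(\alpha)=\gamma_1-4(\alpha_c-\alpha)$, $\gamma_3(\alpha)=2\alpha p-1$. With $\eta\sim\mathrm N(0,1)$ and $H_k$ the (probabilists', monic) Hermite polynomial of degree $k$, $$v_{k,\ell}(\beta,\rho)^2=\frac{\beta^{2k}\rho^{2\ell}}{k!\,\ell!\,p!^{k/2}}\,\mathbb E\Big(H_k\big(H_p(\eta)/\sqrt{p!}\big)H_\ell(\eta)\Big),\qquad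 v_{k,0}(\beta)^2:=v_{k,0}(\beta,\rho)^2,$$ the latter not depending on $\rho$.
   Formalization: In (a), when α=α_c=1/2 (only p=3 or p=4), the limiting variance v_1^2 gets the extra summand v_{1,p}(β,ρ)^2; without it the claim is false, since single edges contribute at the same order because γ_3(1/2)=p-1=γ_1. *)

theory Defs
  imports "HOL-Probability.Probability" "HOL-Computational_Algebra.Polynomial"
begin

definition edges :: "nat \<Rightarrow> nat \<Rightarrow> nat list set" where
  "edges p N = {i. length i = p \<and> sorted_wrt (<) i \<and> set i \<subseteq> {1..N}}"

definition spin_pmf :: "real \<Rightarrow> real pmf" where
  "spin_pmf h = map_pmf (\<lambda>b. if b then 1 else -1) (bernoulli_pmf (exp h / (exp h + exp (-h))))"

definition spins_pmf :: "nat \<Rightarrow> real \<Rightarrow> (nat \<Rightarrow> real) pmf" where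
  "spins_pmf N h = Pi_pmf {1..N} 1 (\<lambda>_. spin_pmf h)"

definition Zhat :: "nat \<Rightarrow> nat \<Rightarrow> real \<Rightarrow> real \<Rightarrow> (nat list \<Rightarrow> real) \<Rightarrow> real" where
  "Zhat p N \<beta> h J = measure_pmf.expectation (spins_pmf N h)
     (\<lambda>\<sigma>. \<Prod>i\<in>edges p N.
        1 + (\<Prod>j<p. \<sigma> (i ! j)) * tanh (\<beta> * J i / real N powr ((real p - 1) / 2)))"

definition entropy_fun :: "real \<Rightarrow> real" where
  "entropy_fun x = (1 + x) * ln (1 + x) / 2 + (1 - x) * ln (1 - x) / 2"

(* The infimum is a minimum for p \<ge> 3: the function blows up at 0, and its logarithmic
   derivative tends to +infinity at 1. *)
definition beta_f :: "nat \<Rightarrow> real" where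
  "beta_f p = (INF x\<in>{0<..<1}. sqrt (fact p * entropy_fun x / x ^ p))"

definition alpha_c :: "nat \<Rightarrow> real" where
  "alpha_c p = (if even p then real p / 8 else (real p - 1) / 4)"

definition ell :: "nat \<Rightarrow> nat" where
  "ell p = (if even p then 3 else 4)"

definition gamma1 :: "nat \<Rightarrow> real" where
  "gamma1 p = real (ell p) * (real p - 2) / 2"

definition gamma2 :: "nat \<Rightarrow> real \<Rightarrow> real" where
  "gamma2 p \<alpha> = gamma1 p - 4 * (alpha_c p - \<alpha>)"

definition gamma3 :: "nat \<Rightarrow> real \<Rightarrow> real" where
  "gamma3 p \<alpha> = 2 * \<alpha> * real p - 1"

fun hermite :: "nat \<Rightarrow> real poly" where
  "hermite 0 = 1"
| "hermite (Suc 0) = [:0, 1:]"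
| "hermite (Suc (Suc n)) = [:0, 1:] * hermite (Suc n) - smult (real (Suc n)) (hermite n)"

(* The square of v_{k,l}; for l = 0 the value does not depend on \<rho>, since \<rho> ^ 0 = 1. *)
definition v_sq :: "nat \<Rightarrow> nat \<Rightarrow> nat \<Rightarrow> real \<Rightarrow> real \<Rightarrow> real" where
  "v_sq p k l \<beta> \<rho> =
     \<beta> ^ (2 * k) * \<rho> ^ (2 * l) / (fact k * fact l * fact p powr (real k / 2)) *
     (LINT x|std_normal_distribution.
        poly (hermite k) (poly (hermite p) x / sqrt (fact p)) * poly (hermite l) x)"

(* The published formula for the case \<alpha> = alpha_c p has no v_{1,p} term. That is correct
   for p \<ge> 5, where alpha_c p > 1/2 and the extra summand below is 0. For p = 3 and p = 4
   however alpha_c p = 1/2, so gamma3 p (1/2) = p - 1 = gamma1 p, and the single-edge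
   clusters, whose total variance is of order N powr (- gamma3 p \<alpha>) and which are
   uncorrelated with all other clusters, contribute v_{1,p} at leading order, exactly as they
   do for \<alpha> = 1/2 < alpha_c p (see v2_sq). *)
definition v1_sq :: "nat \<Rightarrow> real \<Rightarrow> real \<Rightarrow> real \<Rightarrow> real" where
  "v1_sq p \<alpha> \<beta> \<rho> =
     (if \<alpha> = alpha_c p
      then (if even p then v_sq p 3 0 \<beta> \<rho> + v_sq p 2 2 \<beta> \<rho>
            else v_sq p 4 0 \<beta> \<rho> + v_sq p 3 1 \<beta> \<rho> + v_sq p 2 2 \<beta> \<rho>)
           + (if \<alpha> = 1/2 then v_sq p 1 p \<beta> \<rho> else 0)
      else (if even p then v_sq p 3 0 \<beta> \<rho> else v_sq p 4 0 \<beta> \<rho>))"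

definition v2_sq :: "nat \<Rightarrow> real \<Rightarrow> real \<Rightarrow> real \<Rightarrow> real" where
  "v2_sq p \<alpha> \<beta> \<rho> =
     (if \<alpha> = 1/2 then v_sq p 2 2 \<beta> \<rho> + v_sq p 1 p \<beta> \<rho> else v_sq p 2 2 \<beta> \<rho>)"

definition v3_sq :: "nat \<Rightarrow> real \<Rightarrow> real \<Rightarrow> real" where
  "v3_sq p \<beta> \<rho> = v_sq p 1 p \<beta> \<rho>"

definition disorder_law :: "real measure \<Rightarrow> bool" where
  "disorder_law \<mu> \<longleftrightarrow> real_distribution \<mu> \<and> distr \<mu> borel uminus = \<mu> \<and>
     integrable \<mu> (\<lambda>x. x ^ 4) \<and> integral\<^sup>L \<mu> (\<lambda>x. x) = 0 \<and>
     prob_space.variance \<mu> (\<lambda>x. x) = 1"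

definition iid_on :: "'i set \<Rightarrow> 'a measure \<Rightarrow> ('i \<Rightarrow> 'a \<Rightarrow> real) \<Rightarrow> real measure \<Rightarrow> bool" where
  "iid_on I M X \<mu> \<longleftrightarrow> prob_space M \<and> prob_space.indep_vars M (\<lambda>_. borel) X I \<and>
     (\<forall>i\<in>I. distr M borel (X i) = \<mu>)"

(* Convergence in law of X N, each living on its own probability space, to N(0, v), v > 0. *)
definition tendsto_normal :: "(nat \<Rightarrow> 'a measure) \<Rightarrow> (nat \<Rightarrow> 'a \<Rightarrow> real) \<Rightarrow> real \<Rightarrow> bool" where
  "tendsto_normal M X v \<longleftrightarrow>
     weak_conv_m (\<lambda>N. distr (M N) borel (X N)) (density lborel (normal_density 0 (sqrt v)))"

end

theory Submission
  imports Defs "HOL-Real_Asymp.Real_Asymp"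
begin

text \<open>
  The random variable \<open>Zhat\<close> has an explicit cluster expansion. Write \<open>t e\<close> for the weight
  \<open>tanh (\<beta> J e / N powr ((p - 1) / 2))\<close> of a hyperedge. Multiplying out the product and averaging over the
  spins gives \<open>Zhat = (\<Sum>\<Gamma>. tanh h ^ card (bdry \<Gamma>) * (\<Prod>e\<in>\<Gamma>. t e))\<close>, where \<open>\<Gamma>\<close> runs over all sets of
  hyperedges and \<open>bdry \<Gamma>\<close> is the set of vertices of odd degree (\<open>Zhat_expansion\<close>). The weights are
  independent and symmetric, so different clusters are orthogonal. A cluster with \<open>k\<close> edges and \<open>l\<close>
  odd vertices has at most \<open>(k p + l) / 2\<close> vertices, hence the clusters of type \<open>(k, l)\<close> together have
  variance of order \<open>N powr (- eps k l)\<close> with \<open>eps k l = k (p - 2) / 2 + l (2 \<alpha> - 1 / 2)\<close>. The three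
  regimes of the theorem are the three ways in which this exponent can be minimal among the types that
  occur, and the leading types always belong to \<open>{(1, p), (2, 2), (3, 0), (3, 1), (4, 0)}\<close>.

  Four facts turn this heuristic into a proof.

  \<^item> Clusters with at least five edges are negligible throughout \<open>\<beta> < beta_f p\<close> (\<open>cluster_tail\<close>). Their
    total variance is a partial sum of the annealed partition function of two replicas, which is at most
    linear in \<open>N\<close> for some \<open>\<beta>' > \<beta>\<close>: this is the place where the entropy in the definition of \<open>beta_f\<close>
    meets a Chernoff bound for the overlap. Passing from \<open>\<beta>'\<close> back to \<open>\<beta>\<close> gains an exponential factor
    for clusters with more than \<open>N powr \<epsilon>\<close> edges, and the remaining ones are counted by their supports.

  \<^item> The number of clusters of type \<open>(k, l)\<close> is an expectation, over uniform spins, of products of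
    elementary symmetric polynomials. On \<open>\<plusminus>1\<close> variables these are Krawtchouk polynomials of the
    normalised sum, which converge to Hermite polynomials; since the sum has asymptotically normal moments,
    this yields the constants \<open>v_sq\<close> (\<open>nclusters_asymp\<close>, \<open>v_sq_cluster_const\<close>).

  \<^item> The sum over the leading clusters is asymptotically normal. This is Stein's method for characteristic
    functions: \<open>\<phi>' s\<close> is close to \<open>- s V \<phi> s\<close> as soon as a quadratic statistic \<open>Tf\<close> concentrates around the
    variance \<open>V\<close>, and the errors are sums over quadruples of clusters that cover every hyperedge an even
    number of times (\<open>gaussian_approximation\<close>).

  \<^item> In such a quadruple every vertex lies in at least two of the four clusters, so its union has at most
    a quarter of the sum of \<open>k p + l\<close> over the four clusters as its number of vertices. Equality forces every vertex to lie in
    exactly two clusters, and because leading clusters are connected the quadruple then consists of two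
    disjoint pairs of equal clusters, which do not contribute (\<open>quad_vertex_count\<close>, \<open>quad_pairing\<close>). All
    other quadruples lose a factor \<open>N powr (- 1 / 4)\<close>.

  Finally \<open>Zhat - 1\<close> tends to \<open>0\<close> in mean square, so \<open>ln Zhat\<close> can be replaced by \<open>Zhat - 1\<close>, and the
  continuity theorem of Levy concludes.
\<close>

section \<open>Clusters of hyperedges\<close>

definition supp :: "nat list set \<Rightarrow> nat set" where
  "supp \<Gamma> = (\<Union>e\<in>\<Gamma>. set e)"

definition vdeg :: "nat list set \<Rightarrow> nat \<Rightarrow> nat" where
  "vdeg \<Gamma> v = card {e\<in>\<Gamma>. v \<in> set e}"

text \<open>
  The boundary modulo 2. Averaging over spins of mean \<open>tanh h\<close> turns a cluster into the factor
  \<open>tanh h ^ card (bdry \<Gamma>)\<close>, because a spin raised to an even power is \<open>1\<close>.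
\<close>
definition bdry :: "nat list set \<Rightarrow> nat set" where
  "bdry \<Gamma> = {v. odd (vdeg \<Gamma> v)}"

lemma edgesD:
  assumes "e \<in> edges p N"
  shows "length e = p" "distinct e" "set e \<subseteq> {1..N}" "card (set e) = p" "finite (set e)"
  using assms by (auto simp: edges_def strict_sorted_iff distinct_card)

lemma finite_edges [simp]: "finite (edges p N)"
proof -
  have "edges p N \<subseteq> {i. set i \<subseteq> {1..N} \<and> length i = p}" by (auto simp: edges_def)
  then show ?thesis by (rule finite_subset) (simp add: finite_lists_length_eq)
qed

text \<open>
  A hyperedge is a strictly increasing list, so nothing is lost by thinking of it as a set.
\<close>
lemma inj_on_set_edges: "inj_on set (edges p N)"
  by (intro inj_onI) (auto simp: edges_def strict_sorted_equal)

lemma bij_betw_set_edges: "bij_betw set (edges p N) {B. B \<subseteq> {1..N} \<and> card B = p}"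
proof (rule bij_betw_imageI[OF inj_on_set_edges], safe)
  fix B assume "B \<subseteq> {1..N}"
  then have "finite B" using finite_subset by blast
  with \<open>B \<subseteq> {1..N}\<close> show "B \<in> set ` edges (card B) N"
    by (intro image_eqI[of _ _ "sorted_list_of_set B"]) (auto simp: edges_def)
qed (use edgesD(3,4) in blast)+

lemma card_edges: "card (edges p N) = N choose p"
  using bij_betw_same_card[OF bij_betw_set_edges] by (simp add: n_subsets)

lemma finite_cluster: "\<Gamma> \<subseteq> edges p N \<Longrightarrow> finite \<Gamma>"
  using finite_edges finite_subset by blast

lemma supp_subset: "\<Gamma> \<subseteq> edges p N \<Longrightarrow> supp \<Gamma> \<subseteq> {1..N}"
  unfolding supp_def using edgesD(3)[of _ p N] by blast

lemma finite_supp: "\<Gamma> \<subseteq> edges p N \<Longrightarrow> finite (supp \<Gamma>)"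
  using finite_subset[OF supp_subset] by simp

lemma vdeg_pos_iff: "finite \<Gamma> \<Longrightarrow> 0 < vdeg \<Gamma> v \<longleftrightarrow> v \<in> supp \<Gamma>"
  by (auto simp: vdeg_def supp_def card_gt_0_iff)

lemma bdry_subset_supp: "finite \<Gamma> \<Longrightarrow> bdry \<Gamma> \<subseteq> supp \<Gamma>"
  using vdeg_pos_iff[of \<Gamma>] odd_pos by (auto simp: bdry_def)

lemma sum_vdeg:
  assumes "\<Gamma> \<subseteq> edges p N" "supp \<Gamma> \<subseteq> W" "finite W"
  shows "(\<Sum>v\<in>W. vdeg \<Gamma> v) = card \<Gamma> * p"
proof -
  have f: "finite \<Gamma>" using assms finite_cluster by blast
  have "(\<Sum>v\<in>W. vdeg \<Gamma> v) = (\<Sum>v\<in>W. \<Sum>e\<in>\<Gamma>. of_bool (v \<in> set e))"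
    unfolding vdeg_def using f by (intro sum.cong) (auto simp: Int_def)
  also have "\<dots> = (\<Sum>e\<in>\<Gamma>. \<Sum>v\<in>W. of_bool (v \<in> set e))" by (rule sum.swap)
  also have "\<dots> = (\<Sum>e\<in>\<Gamma>. p)"
  proof (rule sum.cong)
    fix e assume e: "e \<in> \<Gamma>"
    then have "W \<inter> {v. v \<in> set e} = set e" using assms by (auto simp: supp_def)
    then show "(\<Sum>v\<in>W. of_bool (v \<in> set e)) = p"
      using assms e edgesD(4)[of e p N] by auto
  qed simp
  finally show ?thesis by simp
qed

text \<open>
  Handshake count with every degree rounded up to an even number. This rounding is what makes the
  number of vertices of a cluster comparable with its type.
\<close>
lemma sum_vdeg_rounded:
  assumes "\<Gamma> \<subseteq> edges p N" "supp \<Gamma> \<subseteq> W" "finite W"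
  shows "(\<Sum>v\<in>W. vdeg \<Gamma> v + vdeg \<Gamma> v mod 2) = card \<Gamma> * p + card (bdry \<Gamma>)"
proof -
  have "bdry \<Gamma> \<subseteq> W"
    using bdry_subset_supp[OF finite_cluster[OF assms(1)]] assms(2) by blast
  then have "W \<inter> {v. odd (vdeg \<Gamma> v)} = bdry \<Gamma>" by (auto simp: bdry_def)
  moreover have "(\<Sum>v\<in>W. vdeg \<Gamma> v mod 2) = (\<Sum>v\<in>W. of_bool (odd (vdeg \<Gamma> v)))"
    by (intro sum.cong) (auto simp: odd_iff_mod_2_eq_one)
  ultimately show ?thesis
    using assms by (simp add: sum.distrib sum_vdeg)
qed

lemma rounded_ge: "finite \<Gamma> \<Longrightarrow> v \<in> supp \<Gamma> \<Longrightarrow> 2 \<le> vdeg \<Gamma> v + vdeg \<Gamma> v mod 2"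
  using vdeg_pos_iff[of \<Gamma> v] by (cases "vdeg \<Gamma> v = 1") auto

text \<open>
  Every vertex of a cluster has rounded degree at least two. Hence \<open>(k p + l) / 2\<close> is the largest possible
  number of vertices of a cluster with \<open>k\<close> edges and \<open>l\<close> odd vertices.
\<close>
lemma card_supp_le:
  assumes "\<Gamma> \<subseteq> edges p N"
  shows "2 * card (supp \<Gamma>) \<le> card \<Gamma> * p + card (bdry \<Gamma>)"
proof -
  have "2 * card (supp \<Gamma>) = (\<Sum>v\<in>supp \<Gamma>. 2)" by simp
  also have "\<dots> \<le> (\<Sum>v\<in>supp \<Gamma>. vdeg \<Gamma> v + vdeg \<Gamma> v mod 2)"
    by (intro sum_mono rounded_ge finite_cluster[OF assms])
  finally show ?thesis
    unfolding sum_vdeg_rounded[OF assms order_refl finite_supp[OF assms]] .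
qed

lemma card_supp_le': "\<Gamma> \<subseteq> edges p N \<Longrightarrow> card (supp \<Gamma>) \<le> card \<Gamma> * p"
proof -
  assume \<Gamma>: "\<Gamma> \<subseteq> edges p N"
  have "card (supp \<Gamma>) \<le> (\<Sum>e\<in>\<Gamma>. card (set e))"
    unfolding supp_def by (intro card_UN_le finite_cluster[OF \<Gamma>])
  also have "\<dots> = (\<Sum>e\<in>\<Gamma>. p)" using \<Gamma> edgesD(4) by (intro sum.cong) auto
  finally show ?thesis by simp
qed

lemma card_bdry_le:
  assumes "\<Gamma> \<subseteq> edges p N" shows "card (bdry \<Gamma>) \<le> card \<Gamma> * p"
proof -
  have "card (bdry \<Gamma>) \<le> card (supp \<Gamma>)"
    by (intro card_mono finite_supp[OF assms] bdry_subset_supp finite_cluster[OF assms])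
  with card_supp_le'[OF assms] show ?thesis by simp
qed

text \<open>
  A parity obstruction: it excludes half of the types.
\<close>
lemma even_bdry:
  assumes "\<Gamma> \<subseteq> edges p N" shows "even (card \<Gamma> * p + card (bdry \<Gamma>))"
proof -
  have "even (\<Sum>v\<in>supp \<Gamma>. vdeg \<Gamma> v + vdeg \<Gamma> v mod 2)"
    by (intro dvd_sum) presburger
  then show ?thesis
    unfolding sum_vdeg_rounded[OF assms order_refl finite_supp[OF assms]] .
qed

lemma bdry_singleton: "bdry {e} = set e"
proof -
  have "{x. x = e \<and> v \<in> set x} = (if v \<in> set e then {e} else {})" for v by auto
  then show ?thesis by (auto simp: bdry_def vdeg_def)
qed

lemma bdry_doubleton:
  assumes "a \<noteq> b" shows "bdry {a, b} = (set a - set b) \<union> (set b - set a)"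
proof -
  have "{x. (x = a \<or> x = b) \<and> v \<in> set x} =
      (if v \<in> set a then {a} else {}) \<union> (if v \<in> set b then {b} else {})" for v by auto
  then show ?thesis using assms by (auto simp: bdry_def vdeg_def)
qed

lemma card_bdry_1: "\<Gamma> \<subseteq> edges p N \<Longrightarrow> card \<Gamma> = 1 \<Longrightarrow> card (bdry \<Gamma>) = p"
  by (auto simp: card_1_singleton_iff bdry_singleton edgesD)

text \<open>
  Two distinct sets of the same cardinality differ in at least two points.
\<close>
lemma card_bdry_2:
  assumes "\<Gamma> \<subseteq> edges p N" "card \<Gamma> = 2" shows "2 \<le> card (bdry \<Gamma>)"
proof -
  obtain a b where ab: "\<Gamma> = {a, b}" "a \<noteq> b" using assms(2) by (auto simp: card_2_iff)
  then have e: "a \<in> edges p N" "b \<in> edges p N" using assms by auto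
  then have ne: "set a \<noteq> set b" using ab inj_on_set_edges by (auto dest: inj_onD)
  have "\<not> set a \<subseteq> set b" "\<not> set b \<subseteq> set a"
    using ne card_subset_eq edgesD(4,5) e by metis+
  then obtain x y where xy: "x \<in> set a - set b" "y \<in> set b - set a" by blast
  then have "{x, y} \<subseteq> bdry \<Gamma>" "x \<noteq> y" using ab bdry_doubleton by auto
  moreover have "finite (bdry \<Gamma>)"
    using finite_subset[OF bdry_subset_supp finite_supp] finite_cluster assms by blast
  ultimately show ?thesis using card_mono[of "bdry \<Gamma>" "{x,y}"] by simp
qed

text \<open>
  Connectedness of the hypergraph \<open>\<Gamma>\<close>: no proper part is vertex-disjoint from the rest.
\<close>
definition vconn :: "nat list set \<Rightarrow> bool" where
  "vconn \<Gamma> \<longleftrightarrow> (\<forall>\<Delta>. \<Delta> \<subseteq> \<Gamma> \<longrightarrow> \<Delta> \<noteq> {} \<longrightarrow> \<Delta> \<noteq> \<Gamma> \<longrightarrow> supp \<Delta> \<inter> supp (\<Gamma> - \<Delta>) \<noteq> {})"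

text \<open>
  For vertex-disjoint parts the odd vertices simply add up. A disconnected cluster therefore needs many odd
  vertices, one edge alone already having \<open>p\<close> of them.
\<close>
lemma card_bdry_split:
  assumes \<Gamma>: "\<Gamma> \<subseteq> edges p N" and \<Delta>: "\<Delta> \<subseteq> \<Gamma>" and d: "supp \<Delta> \<inter> supp (\<Gamma> - \<Delta>) = {}"
  shows "card (bdry \<Gamma>) = card (bdry \<Delta>) + card (bdry (\<Gamma> - \<Delta>))"
proof -
  have f: "finite \<Gamma>" "finite \<Delta>" "finite (\<Gamma> - \<Delta>)"
    using finite_cluster[OF \<Gamma>] \<Delta> finite_subset by auto
  have deg: "vdeg \<Gamma> v = vdeg \<Delta> v + vdeg (\<Gamma> - \<Delta>) v" for v
  proof -
    have "{e\<in>\<Gamma>. v \<in> set e} = {e\<in>\<Delta>. v \<in> set e} \<union> {e\<in>\<Gamma> - \<Delta>. v \<in> set e}" using \<Delta> by auto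
    then show ?thesis unfolding vdeg_def using f by (simp add: card_Un_disjoint disjoint_iff)
  qed
  have z: "vdeg \<Delta> v = 0 \<or> vdeg (\<Gamma> - \<Delta>) v = 0" for v
    using d f vdeg_pos_iff by blast
  have "bdry \<Gamma> = bdry \<Delta> \<union> bdry (\<Gamma> - \<Delta>)" "bdry \<Delta> \<inter> bdry (\<Gamma> - \<Delta>) = {}"
    using z by (auto simp: bdry_def deg) (metis even_zero)+
  moreover have "finite (bdry \<Delta>)" "finite (bdry (\<Gamma> - \<Delta>))"
    using f \<Gamma> \<Delta> by (meson bdry_subset_supp finite_subset finite_supp subset_trans Diff_subset)+
  ultimately show ?thesis by (simp add: card_Un_disjoint)
qed

text \<open>
  If one of these clusters were disconnected, it would have a component of at most two edges. Such a
  component has too many odd vertices for the type in question.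
\<close>
lemma vconn_small:
  assumes p: "p \<ge> 3" and \<Gamma>: "\<Gamma> \<subseteq> edges p N"
    and type: "(card \<Gamma>, card (bdry \<Gamma>)) \<in> {(1, p), (2, 2), (3, 0), (3, 1), (4, 0)}"
  shows "vconn \<Gamma>"
  unfolding vconn_def
proof (intro allI impI notI)
  fix \<Delta> assume \<Delta>: "\<Delta> \<subseteq> \<Gamma>" "\<Delta> \<noteq> {}" "\<Delta> \<noteq> \<Gamma>" and d: "supp \<Delta> \<inter> supp (\<Gamma> - \<Delta>) = {}"
  let ?\<Delta>' = "\<Gamma> - \<Delta>"
  have f: "finite \<Gamma>" "finite \<Delta>" "finite ?\<Delta>'"
    using finite_cluster[OF \<Gamma>] \<Delta> finite_subset by auto
  have sub: "\<Delta> \<subseteq> edges p N" "?\<Delta>' \<subseteq> edges p N" using \<Gamma> \<Delta> by auto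
  have c: "card \<Gamma> = card \<Delta> + card ?\<Delta>'" "card \<Delta> > 0" "card ?\<Delta>' > 0"
    using \<Delta> f by (simp_all add: card_Diff_subset card_mono psubset_card_mono psubset_eq card_gt_0_iff)
  have b: "card (bdry \<Gamma>) = card (bdry \<Delta>) + card (bdry ?\<Delta>')"
    using card_bdry_split[OF \<Gamma> \<Delta>(1) d] .
  have "card \<Delta> = 1 \<or> card ?\<Delta>' = 1 \<or> card \<Gamma> = 4 \<and> card \<Delta> = 2" using c type by auto
  then show False
    using b c type p card_bdry_1[OF sub(1)] card_bdry_1[OF sub(2)] card_bdry_2[OF sub(1)] by auto
qed

section \<open>Quadruples of clusters that cover every edge evenly\<close>

text \<open>
  In how many of the four sets \<open>e\<close> lies. A product of four multilinear monomials in independent symmetric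
  variables has mean zero unless all these numbers are even.
\<close>
definition cover :: "'e set \<Rightarrow> 'e set \<Rightarrow> 'e set \<Rightarrow> 'e set \<Rightarrow> 'e \<Rightarrow> nat" where
  "cover A B C D e = of_bool (e \<in> A) + of_bool (e \<in> B) + of_bool (e \<in> C) + of_bool (e \<in> D)"

text \<open>
  Twice the maximal number of vertices of a cluster of the type of \<open>\<Gamma>\<close>; its contribution to a fourth
  moment is weighted by \<open>N powr (- qsize p \<Gamma> / 4)\<close>.
\<close>
definition qsize :: "nat \<Rightarrow> nat list set \<Rightarrow> nat" where
  "qsize p \<Gamma> = card \<Gamma> * p + card (bdry \<Gamma>)"

text \<open>
  An evenly covered hyperedge lies in at least two of the four clusters, so each of its vertices has rounded
  degree at least two in at least two of them, hence total rounded degree at least four. A vertex of three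
  clusters makes the inequality strict.
\<close>
lemma quad_vertex_count:
  assumes sub: "A \<subseteq> edges p N" "B \<subseteq> edges p N" "C \<subseteq> edges p N" "D \<subseteq> edges p N"
    and ev: "\<And>e. even (cover A B C D e)"
  defines "W \<equiv> supp A \<union> supp B \<union> supp C \<union> supp D"
  shows "4 * card W \<le> qsize p A + qsize p B + qsize p C + qsize p D"
    and "v \<in> W \<Longrightarrow> cover (supp A) (supp B) (supp C) (supp D) v > 2 \<Longrightarrow>
          4 * card W < qsize p A + qsize p B + qsize p C + qsize p D"
proof -
  define r where "r \<Gamma> v = vdeg \<Gamma> v + vdeg \<Gamma> v mod 2" for \<Gamma> v
  define R where "R v = r A v + r B v + r C v + r D v" for v
  have W: "finite W" "supp A \<subseteq> W" "supp B \<subseteq> W" "supp C \<subseteq> W" "supp D \<subseteq> W"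
    using sub by (auto simp: W_def finite_supp)
  have sz: "(\<Sum>v\<in>W. r \<Gamma> v) = qsize p \<Gamma>" if "\<Gamma> \<subseteq> edges p N" "supp \<Gamma> \<subseteq> W" for \<Gamma>
    unfolding r_def qsize_def by (rule sum_vdeg_rounded[OF that W(1)])
  have sumR: "(\<Sum>v\<in>W. R v) = qsize p A + qsize p B + qsize p C + qsize p D"
    by (simp only: R_def sum.distrib sz[OF sub(1) W(2)] sz[OF sub(2) W(3)] sz[OF sub(3) W(4)] sz[OF sub(4) W(5)])
  have r: "2 * of_bool (v \<in> supp \<Gamma>) \<le> r \<Gamma> v" if "\<Gamma> \<subseteq> edges p N" for \<Gamma> v
    using rounded_ge[OF finite_cluster[OF that], of v] by (auto simp: r_def)
  have R: "2 * cover (supp A) (supp B) (supp C) (supp D) v \<le> R v" for v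
    unfolding R_def cover_def distrib_left by (intro add_mono r sub)
  have cov2: "2 \<le> cover (supp A) (supp B) (supp C) (supp D) v" if vW: "v \<in> W" for v
  proof -
    obtain e where e: "v \<in> set e" "e \<in> A \<union> B \<union> C \<union> D" using vW by (auto simp: W_def supp_def)
    then have "cover A B C D e \<ge> 2" using ev[of e] by (auto simp: cover_def of_bool_def split: if_splits)
    moreover have "cover A B C D e \<le> cover (supp A) (supp B) (supp C) (supp D) v"
      unfolding cover_def using e(1) by (intro add_mono) (auto simp: supp_def of_bool_def)
    ultimately show ?thesis by simp
  qed
  have R4: "4 \<le> R v" if "v \<in> W" for v using R[of v] cov2[OF that] by linarith
  have "4 * card W = (\<Sum>v\<in>W. 4)" by simp
  also have "\<dots> \<le> (\<Sum>v\<in>W. R v)" by (intro sum_mono R4)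
  finally show "4 * card W \<le> qsize p A + qsize p B + qsize p C + qsize p D" using sumR by simp
  assume v: "v \<in> W" "cover (supp A) (supp B) (supp C) (supp D) v > 2"
  have "4 * card W = (\<Sum>v\<in>W. 4)" by simp
  also have "\<dots> < (\<Sum>v\<in>W. R v)"
    using R[of v] v W R4 by (intro sum_strict_mono_ex1 bexI[of _ v]) auto
  finally show "4 * card W < qsize p A + qsize p B + qsize p C + qsize p D" using sumR by simp
qed

text \<open>
  Suppose that no vertex belongs to three of the clusters. An edge of \<open>A\<close> outside \<open>B\<close> lies in \<open>C\<close> or \<open>D\<close>,
  so it cannot touch an edge of \<open>A \<inter> B\<close>; as \<open>A\<close> is connected and meets \<open>B\<close>, it is contained in \<open>B\<close>.
  The other inclusions follow by symmetry.
\<close>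
lemma quad_pairing:
  assumes conn: "vconn A" "vconn B" "vconn C" "vconn D"
    and ev: "\<And>e. even (cover A B C D e)" and p: "p > 0"
    and sub: "A \<subseteq> edges p N" "B \<subseteq> edges p N" "C \<subseteq> edges p N" "D \<subseteq> edges p N"
    and e: "e \<in> A" "e \<in> B" and f: "f \<in> C" "f \<in> D"
    and cov: "\<And>v. cover (supp A) (supp B) (supp C) (supp D) v \<le> 2"
  shows "A = B \<and> C = D \<and> A \<inter> C = {}"
proof -
  have gen: "X \<subseteq> Y" if c: "vconn X" and e: "e \<in> X" "e \<in> Y"
    and ev: "\<And>e. even (cover X Y Z U e)"
    and cov: "\<And>v. cover (supp X) (supp Y) (supp Z) (supp U) v \<le> 2" for X Y Z U :: "nat list set" and e
  proof (rule ccontr)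
    assume "\<not> X \<subseteq> Y"
    then have "supp (X \<inter> Y) \<inter> supp (X - X \<inter> Y) \<noteq> {}" using c e by (auto simp: vconn_def)
    then obtain v x y where vxy: "x \<in> X" "x \<in> Y" "v \<in> set x" "y \<in> X" "y \<notin> Y" "v \<in> set y"
      by (auto simp: supp_def)
    then have "y \<in> Z \<or> y \<in> U" using ev[of y] by (auto simp: cover_def)
    then have "cover (supp X) (supp Y) (supp Z) (supp U) v > 2"
      using vxy by (auto simp: cover_def supp_def of_bool_def)
    with cov[of v] show False by simp
  qed
  have "A \<subseteq> B" by (rule gen[OF conn(1) e ev cov])
  moreover have "B \<subseteq> A"
    by (rule gen[OF conn(2) e(2,1), of C D]) (use ev cov in \<open>simp_all add: cover_def add.commute\<close>)
  moreover have "C \<subseteq> D"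
    by (rule gen[OF conn(3) f, of A B]) (use ev cov in \<open>simp_all add: cover_def ac_simps\<close>)
  moreover have "D \<subseteq> C"
    by (rule gen[OF conn(4) f(2,1), of A B]) (use ev cov in \<open>simp_all add: cover_def ac_simps\<close>)
  moreover have "A \<inter> C = {}"
  proof (rule ccontr)
    assume "A \<inter> C \<noteq> {}"
    then obtain x where x: "x \<in> A" "x \<in> C" by auto
    then have "length x = p" using sub edgesD(1) by blast
    then have "set x \<noteq> {}" using p by auto
    then obtain v where "v \<in> set x" by (meson all_not_in_conv)
    then have "cover (supp A) (supp B) (supp C) (supp D) v > 2"
      using x \<open>A \<subseteq> B\<close> \<open>C \<subseteq> D\<close> by (auto simp: cover_def supp_def of_bool_def)
    with cov[of v] show False by simp
  qed
  ultimately show ?thesis by blast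
qed

section \<open>Counting clusters by their supports\<close>

text \<open>
  The weight \<open>N powr (- card (S x))\<close> exactly compensates the number of possible supports of a given
  cardinality, so a sum over objects reduces to the number of objects with a given support.
\<close>
lemma support_count:
  fixes S :: "'x \<Rightarrow> nat set" and A :: nat
  assumes fin: "finite X" and S: "\<And>x. x \<in> X \<Longrightarrow> S x \<subseteq> {1..N}" "\<And>x. x \<in> X \<Longrightarrow> card (S x) \<le> B"
    and A: "\<And>W. card W \<le> B \<Longrightarrow> finite W \<Longrightarrow> card {x\<in>X. S x = W} \<le> A" and N: "N \<ge> 1"
  shows "(\<Sum>x\<in>X. (1 / real N) ^ card (S x)) \<le> real A * (real B + 1)"
proof -
  have "(\<Sum>x\<in>X. (1 / real N) ^ card (S x)) =
      (\<Sum>W\<in>Pow {1..N}. \<Sum>x\<in>{x\<in>X. S x = W}. (1 / real N) ^ card (S x))"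
    using S fin by (intro sum.group[symmetric]) auto
  also have "\<dots> \<le> (\<Sum>W\<in>Pow {1..N}. of_bool (card W \<le> B) * (real A * (1 / real N) ^ card W))"
  proof (intro sum_mono)
    fix W assume "W \<in> Pow {1..N}"
    then have fW: "finite W" using finite_subset by blast
    have "(\<Sum>x\<in>{x\<in>X. S x = W}. (1 / real N) ^ card (S x))
        = real (card {x\<in>X. S x = W}) * (1 / real N) ^ card W" by simp
    also have "\<dots> \<le> of_bool (card W \<le> B) * (real A * (1 / real N) ^ card W)"
    proof (cases "card W \<le> B")
      case True
      then show ?thesis using A[OF True fW] by (simp add: mult_right_mono)
    next
      case False
      then have "{x\<in>X. S x = W} = {}" using S by auto
      then show ?thesis using False by (simp only: card.empty) simp
    qed
    finally show "(\<Sum>x\<in>{x\<in>X. S x = W}. (1 / real N) ^ card (S x)) \<le> \<dots>" .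
  qed
  also have "\<dots> = (\<Sum>w\<in>{..N}. \<Sum>W\<in>{W\<in>Pow {1..N}. card W = w}.
      of_bool (card W \<le> B) * (real A * (1 / real N) ^ card W))"
    by (intro sum.group[symmetric]) (use card_mono[of "{1..N}"] in auto)
  also have "\<dots> = (\<Sum>w\<in>{..N}. real (N choose w) * (of_bool (w \<le> B) * (real A * (1 / real N) ^ w)))"
  proof (intro sum.cong refl)
    fix w
    have "(\<Sum>W\<in>{W\<in>Pow {1..N}. card W = w}. of_bool (card W \<le> B) * (real A * (1 / real N) ^ card W))
      = (\<Sum>W\<in>{W\<in>Pow {1..N}. card W = w}. of_bool (w \<le> B) * (real A * (1 / real N) ^ w))"
      by (intro sum.cong) auto
    also have "\<dots> = real (card {W. W \<subseteq> {1..N} \<and> card W = w}) * (of_bool (w \<le> B) * (real A * (1 / real N) ^ w))"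
      by (simp add: Pow_def)
    finally show "(\<Sum>W\<in>{W\<in>Pow {1..N}. card W = w}. of_bool (card W \<le> B) * (real A * (1 / real N) ^ card W))
      = real (N choose w) * (of_bool (w \<le> B) * (real A * (1 / real N) ^ w))"
      by (simp add: n_subsets)
  qed
  also have "\<dots> \<le> (\<Sum>w\<in>{..N}. of_bool (w \<le> B) * real A)"
  proof (intro sum_mono)
    fix w assume "w \<in> {..N}"
    then have "real (N choose w) \<le> real N ^ w"
      using binomial_le_pow[of w N] by (metis atMost_iff of_nat_le_iff of_nat_power)
    then have "real (N choose w) * (1 / real N) ^ w \<le> 1"
      using N by (simp add: power_one_over field_simps)
    from mult_left_mono[OF this, of "of_bool (w \<le> B) * real A"]
    show "real (N choose w) * (of_bool (w \<le> B) * (real A * (1 / real N) ^ w)) \<le> of_bool (w \<le> B) * real A"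
      by (simp add: mult_ac)
  qed
  also have "\<dots> = real A * real (card ({..N} \<inter> {w. w \<le> B}))" by (simp add: mult.commute)
  also have "\<dots> \<le> real A * (real B + 1)"
  proof (intro mult_left_mono)
    have "card ({..N} \<inter> {w. w \<le> B}) \<le> card {..B}" by (intro card_mono) auto
    then show "real (card ({..N} \<inter> {w. w \<le> B})) \<le> real B + 1" by simp
  qed simp
  finally show ?thesis .
qed

lemma card_edges_within: 
  assumes "finite W" shows "card {e\<in>edges p N. set e \<subseteq> W} \<le> card W ^ p"
  using card_mono[OF finite_lists_length_eq[OF assms, of p], of "{e\<in>edges p N. set e \<subseteq> W}"]
  by (auto simp: card_lists_length_eq[OF assms] dest: edgesD)

text \<open>
  The bound must remain useful while \<open>k\<close> grows like a small power of \<open>N\<close>: within a support of at most \<open>k p\<close>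
  vertices there are at most \<open>(k p) ^ p\<close> edges, from which \<open>k\<close> are chosen.
\<close>
lemma sum_clusters_support:
  assumes "N \<ge> 1"
  shows "(\<Sum>\<Gamma> | \<Gamma> \<subseteq> edges p N \<and> card \<Gamma> = k. (1 / real N) ^ card (supp \<Gamma>))
           \<le> real ((k * p) ^ (p * k)) * (real (k * p) + 1)"
proof (rule support_count[OF _ _ _ _ assms])
  fix W :: "nat set" assume W: "card W \<le> k * p" "finite W"
  let ?E = "{e\<in>edges p N. set e \<subseteq> W}"
  have "card {\<Gamma> \<in> {\<Gamma>. \<Gamma> \<subseteq> edges p N \<and> card \<Gamma> = k}. supp \<Gamma> = W}
      \<le> card {\<Gamma>. \<Gamma> \<subseteq> ?E \<and> card \<Gamma> = k}"
    by (intro card_mono) (auto simp: supp_def)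
  also have "\<dots> = card ?E choose k" by (simp add: n_subsets)
  also have "\<dots> \<le> card ?E ^ k"
    by (cases "k \<le> card ?E") (simp_all add: binomial_le_pow binomial_eq_0)
  also have "\<dots> \<le> (card W ^ p) ^ k" by (intro power_mono card_edges_within W) simp
  also have "\<dots> \<le> ((k * p) ^ p) ^ k" by (intro power_mono W) simp_all
  finally show "card {\<Gamma> \<in> {\<Gamma>. \<Gamma> \<subseteq> edges p N \<and> card \<Gamma> = k}. supp \<Gamma> = W} \<le> (k * p) ^ (p * k)"
    by (simp add: power_mult)
qed (use supp_subset card_supp_le' in auto)

lemma sum_quads_support:
  assumes N: "N \<ge> 1"
  shows "(\<Sum>(A, B, C, D) \<in> {(A, B, C, D). A \<subseteq> edges p N \<and> B \<subseteq> edges p N \<and> C \<subseteq> edges p N \<and> D \<subseteq> edges p N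
             \<and> card A \<le> 4 \<and> card B \<le> 4 \<and> card C \<le> 4 \<and> card D \<le> 4}.
           (1 / real N) ^ card (supp A \<union> supp B \<union> supp C \<union> supp D))
        \<le> real ((2 ^ ((16 * p) ^ p)) ^ 4) * (real (16 * p) + 1)" (is "sum ?f ?X \<le> _")
proof -
  let ?S = "\<lambda>(A, B, C, D). supp A \<union> supp B \<union> supp C \<union> supp D"
  have sub: "?X \<subseteq> Pow (edges p N) \<times> Pow (edges p N) \<times> Pow (edges p N) \<times> Pow (edges p N)" by auto
  have fin: "finite ?X" by (rule finite_subset[OF sub]) auto
  have "sum ?f ?X = (\<Sum>x\<in>?X. (1 / real N) ^ card (?S x))" by (intro sum.cong) auto
  also have "\<dots> \<le> real ((2 ^ ((16 * p) ^ p)) ^ 4) * (real (16 * p) + 1)"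
  proof (rule support_count[OF fin _ _ _ N])
    fix x assume x: "x \<in> ?X"
    then show "?S x \<subseteq> {1..N}" using supp_subset by (auto split: prod.splits)
    obtain A B C D where [simp]: "x = (A, B, C, D)" by (metis prod.exhaust)
    have le: "card (supp \<Gamma>) \<le> 4 * p" if "\<Gamma> \<subseteq> edges p N" "card \<Gamma> \<le> 4" for \<Gamma>
      using card_supp_le'[OF that(1)] that(2) by (meson le_trans mult_le_mono1)
    have "card (?S x) \<le> card (supp A) + card (supp B) + card (supp C) + card (supp D)"
      using card_Un_le[of "supp A \<union> supp B \<union> supp C" "supp D"] card_Un_le[of "supp A \<union> supp B" "supp C"]
        card_Un_le[of "supp A" "supp B"] by simp
    also have "\<dots> \<le> 16 * p" using x le[of A] le[of B] le[of C] le[of D] by simp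
    finally show "card (?S x) \<le> 16 * p" .
  next
    fix W :: "nat set" assume W: "card W \<le> 16 * p" "finite W"
    let ?E = "{e\<in>edges p N. set e \<subseteq> W}"
    have "card {x\<in>?X. ?S x = W} \<le> card (Pow ?E \<times> Pow ?E \<times> Pow ?E \<times> Pow ?E)"
      by (intro card_mono) (auto simp: supp_def)
    also have "\<dots> = (2 ^ card ?E) ^ 4"
      by (simp add: card_cartesian_product card_Pow power4_eq_xxxx)
    also have "\<dots> \<le> (2 ^ ((16 * p) ^ p)) ^ 4"
      by (intro power_mono power_increasing order_trans[OF card_edges_within[OF W(2)]] W) simp_all
    finally show "card {x\<in>?X. ?S x = W} \<le> (2 ^ ((16 * p) ^ p)) ^ 4" .
  qed
  finally show ?thesis .
qed

section \<open>The cluster expansion\<close>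

lemma expectation_spin_power:
  "measure_pmf.expectation (spin_pmf h) (\<lambda>x. x ^ d) = (if even d then 1 else tanh h)"
proof -
  let ?q = "exp h / (exp h + exp (-h))"
  have q: "0 \<le> ?q" "?q \<le> 1" by (auto simp: field_simps add_pos_pos)
  have "measure_pmf.expectation (spin_pmf h) (\<lambda>x. x ^ d) = ?q * 1 ^ d + (1 - ?q) * (-1) ^ d"
    unfolding spin_pmf_def using q by (simp add: integral_map_pmf)
  also have "1 - ?q = exp (-h) / (exp h + exp (-h))"
    using add_pos_pos[of "exp h" "exp (-h)"] by (simp add: field_simps)
  also have "?q * 1 ^ d + exp (-h) / (exp h + exp (-h)) * (-1) ^ d = (if even d then 1 else tanh h)"
    using add_pos_pos[of "exp h" "exp (-h)"]
    by (auto simp: tanh_altdef diff_divide_distrib add_divide_distrib[symmetric])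
  finally show ?thesis .
qed

lemma set_spin_pmf: "set_pmf (spin_pmf h) \<subseteq> {1, -1}"
  by (auto simp: spin_pmf_def)

lemma set_spins_pmf:
  assumes "\<sigma> \<in> set_pmf (spins_pmf N h)" "v \<in> {1..N}"
  shows "\<sigma> v = 1 \<or> \<sigma> v = -1"
  using assms set_spin_pmf unfolding spins_pmf_def
  by (fastforce simp: set_Pi_pmf PiE_dflt_def)

lemma finite_set_spins_pmf: "finite (set_pmf (spins_pmf N h))"
proof -
  have "set_pmf (spins_pmf N h) \<subseteq> PiE_dflt {1..N} 1 (\<lambda>_. {1, -1})"
    unfolding spins_pmf_def using set_spin_pmf by (force simp: set_Pi_pmf PiE_dflt_def)
  then show ?thesis by (rule finite_subset) auto
qed

lemma integrable_spins_pmf [simp]: "integrable (measure_pmf (spins_pmf N h)) (f :: _ \<Rightarrow> real)"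
  by (rule integrable_measure_pmf_finite[OF finite_set_spins_pmf])

lemma expectation_spins_prod:
  fixes f :: "nat \<Rightarrow> real \<Rightarrow> real"
  shows "measure_pmf.expectation (spins_pmf N h) (\<lambda>\<sigma>. \<Prod>v\<in>{1..N}. f v (\<sigma> v))
       = (\<Prod>v\<in>{1..N}. measure_pmf.expectation (spin_pmf h) (f v))"
proof -
  have ind: "prob_space.indep_vars (measure_pmf (spins_pmf N h)) (\<lambda>_. borel) (\<lambda>v \<sigma>. f v (\<sigma> v)) {1..N}"
    unfolding spins_pmf_def
    by (rule prob_space.indep_vars_compose2[OF measure_pmf.prob_space_axioms indep_vars_Pi_pmf]) auto
  have "measure_pmf.expectation (spins_pmf N h) (\<lambda>\<sigma>. \<Prod>v\<in>{1..N}. f v (\<sigma> v))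
     = (\<Prod>v\<in>{1..N}. measure_pmf.expectation (spins_pmf N h) (\<lambda>\<sigma>. f v (\<sigma> v)))"
    by (rule prob_space.indep_vars_lebesgue_integral[OF measure_pmf.prob_space_axioms _ ind]) auto
  also have "\<dots> = (\<Prod>v\<in>{1..N}. measure_pmf.expectation (spin_pmf h) (f v))"
  proof (rule prod.cong)
    fix v assume "v \<in> {1..N}"
    then have "map_pmf (\<lambda>\<sigma>. \<sigma> v) (spins_pmf N h) = spin_pmf h"
      unfolding spins_pmf_def by (simp add: Pi_pmf_component)
    then show "measure_pmf.expectation (spins_pmf N h) (\<lambda>\<sigma>. f v (\<sigma> v)) = measure_pmf.expectation (spin_pmf h) (f v)"
      by (metis integral_map_pmf)
  qed simp
  finally show ?thesis .
qed

lemma expectation_spins_powers: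
  "measure_pmf.expectation (spins_pmf N h) (\<lambda>\<sigma>. \<Prod>v\<in>{1..N}. \<sigma> v ^ d v)
     = tanh h ^ card {v\<in>{1..N}. odd (d v)}"
proof -
  have "measure_pmf.expectation (spins_pmf N h) (\<lambda>\<sigma>. \<Prod>v\<in>{1..N}. \<sigma> v ^ d v)
      = (\<Prod>v\<in>{1..N}. if odd (d v) then tanh h else 1)"
    using expectation_spins_prod[of N h "\<lambda>v x. x ^ d v"] by (simp add: expectation_spin_power if_not_P cong: if_cong) (intro prod.cong, auto)
  also have "\<dots> = tanh h ^ card {v\<in>{1..N}. odd (d v)}"
    by (subst prod.If_cases) (auto simp: Int_def)
  finally show ?thesis .
qed

lemma cluster_spin_prod:
  fixes \<sigma> :: "nat \<Rightarrow> real"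
  assumes "\<Gamma> \<subseteq> edges p N"
  shows "(\<Prod>e\<in>\<Gamma>. \<Prod>v\<in>set e. \<sigma> v) = (\<Prod>v\<in>{1..N}. \<sigma> v ^ vdeg \<Gamma> v)"
proof -
  have f: "finite \<Gamma>" using finite_cluster[OF assms] .
  have "(\<Prod>e\<in>\<Gamma>. \<Prod>v\<in>set e. \<sigma> v) = (\<Prod>e\<in>\<Gamma>. \<Prod>v\<in>{1..N}. if v \<in> set e then \<sigma> v else 1)"
  proof (rule prod.cong)
    fix e assume "e \<in> \<Gamma>"
    then have "{1..N} \<inter> set e = set e" using assms edgesD(3) by blast
    then show "(\<Prod>v\<in>set e. \<sigma> v) = (\<Prod>v\<in>{1..N}. if v \<in> set e then \<sigma> v else 1)"
      by (simp add: prod.inter_restrict[symmetric])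
  qed simp
  also have "\<dots> = (\<Prod>v\<in>{1..N}. \<Prod>e\<in>\<Gamma>. if v \<in> set e then \<sigma> v else 1)" by (rule prod.swap)
  also have "\<dots> = (\<Prod>v\<in>{1..N}. \<sigma> v ^ vdeg \<Gamma> v)"
    using f by (intro prod.cong refl) (simp add: prod.If_cases vdeg_def Int_def)
  finally show ?thesis .
qed

lemma bdry_subset: "\<Gamma> \<subseteq> edges p N \<Longrightarrow> bdry \<Gamma> \<subseteq> {1..N}"
  using bdry_subset_supp[OF finite_cluster] supp_subset by blast

lemma expectation_cluster:
  assumes "\<Gamma> \<subseteq> edges p N"
  shows "measure_pmf.expectation (spins_pmf N h) (\<lambda>\<sigma>. \<Prod>e\<in>\<Gamma>. \<Prod>v\<in>set e. \<sigma> v) = tanh h ^ card (bdry \<Gamma>)"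
proof -
  have "{v\<in>{1..N}. odd (vdeg \<Gamma> v)} = bdry \<Gamma>" using bdry_subset[OF assms] by (auto simp: bdry_def)
  then show ?thesis by (simp only: cluster_spin_prod[OF assms] expectation_spins_powers)
qed

lemma expectation_spins_sum:
  fixes f :: "'i \<Rightarrow> _ \<Rightarrow> real"
  shows "measure_pmf.expectation (spins_pmf N h) (\<lambda>\<sigma>. \<Sum>i\<in>I. f i \<sigma>) = (\<Sum>i\<in>I. measure_pmf.expectation (spins_pmf N h) (f i))"
  by (rule Bochner_Integration.integral_sum) simp

text \<open>
  Expand the product over the hyperedges into a sum over clusters. With \<open>t\<close> the random weights this is the
  cluster expansion of \<open>Zhat\<close>; with constant \<open>t\<close> and another field it computes the sum of all variances.
\<close>
lemma expectation_prod_edges: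
  "measure_pmf.expectation (spins_pmf N h) (\<lambda>\<sigma>. \<Prod>e\<in>edges p N. 1 + (\<Prod>v\<in>set e. \<sigma> v) * t e)
     = (\<Sum>\<Gamma>\<in>Pow (edges p N). tanh h ^ card (bdry \<Gamma>) * (\<Prod>e\<in>\<Gamma>. t e))"
proof -
  have "(\<lambda>\<sigma>. \<Prod>e\<in>edges p N. 1 + (\<Prod>v\<in>set e. \<sigma> v) * t e)
     = (\<lambda>\<sigma>. \<Sum>\<Gamma>\<in>Pow (edges p N). (\<Prod>e\<in>\<Gamma>. \<Prod>v\<in>set e. \<sigma> v) * (\<Prod>e\<in>\<Gamma>. t e))"
    by (subst add.commute) (simp add: prod_add prod.distrib)
  then show ?thesis
    by (simp add: expectation_spins_sum expectation_cluster)
qed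

lemma Zhat_expansion:
  "Zhat p N \<beta> h J = (\<Sum>\<Gamma>\<in>Pow (edges p N). tanh h ^ card (bdry \<Gamma>) *
      (\<Prod>e\<in>\<Gamma>. tanh (\<beta> * J e / real N powr ((real p - 1) / 2))))"
proof -
  have "(\<Prod>j<p. \<sigma> (e ! j)) = (\<Prod>v\<in>set e. \<sigma> v)" if "e \<in> edges p N" for e and \<sigma> :: "nat \<Rightarrow> real"
  proof -
    have "bij_betw (\<lambda>j. e ! j) {..<p} (set e)"
      using edgesD(1,2)[OF that] by (metis bij_betw_nth)
    then show ?thesis by (rule prod.reindex_bij_betw)
  qed
  then show ?thesis unfolding Zhat_def expectation_prod_edges[symmetric]
    by (intro arg_cong[where f="measure_pmf.expectation _"] ext prod.cong) auto
qed

section \<open>Elementary symmetric polynomials\<close>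

definition esym :: "nat \<Rightarrow> ('i \<Rightarrow> real) \<Rightarrow> 'i set \<Rightarrow> real" where
  "esym k x I = (\<Sum>B | B \<subseteq> I \<and> card B = k. \<Prod>i\<in>B. x i)"

lemma esym_0: "finite I \<Longrightarrow> esym 0 x I = 1"
proof -
  assume "finite I"
  then have "{B. B \<subseteq> I \<and> card B = 0} = {{}}" by (auto dest: finite_subset)
  then show ?thesis by (simp add: esym_def)
qed

lemma esym_1: "finite I \<Longrightarrow> esym (Suc 0) x I = (\<Sum>i\<in>I. x i)"
proof -
  have "{B. B \<subseteq> I \<and> card B = Suc 0} = (\<lambda>i. {i}) ` I" by (auto simp: card_Suc_eq)
  then show ?thesis by (simp add: esym_def sum.reindex)
qed

lemma esym_empty: "esym (Suc k) x {} = 0"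
proof -
  have "{B. B = {} \<and> card B = Suc k} = {}" by auto
  then show ?thesis by (simp add: esym_def)
qed

lemma esym_insert:
  assumes "finite I" "i \<notin> I"
  shows "esym (Suc k) x (insert i I) = esym (Suc k) x I + x i * esym k x I"
proof -
  have "{B. B \<subseteq> insert i I \<and> card B = Suc k}
      = {B. B \<subseteq> I \<and> card B = Suc k} \<union> insert i ` {B. B \<subseteq> I \<and> card B = k}" (is "?L = ?R1 \<union> insert i ` ?R2")
  proof (intro equalityI subsetI)
    fix B assume B: "B \<in> ?L"
    then have fB: "finite B" using assms finite_subset[of B "insert i I"] by auto
    show "B \<in> ?R1 \<union> insert i ` ?R2"
    proof (cases "i \<in> B")
      case True
      then have "B = insert i (B - {i})" "B - {i} \<in> ?R2" using B fB by auto
      then show ?thesis by blast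
    qed (use B in auto)
  next
    fix B assume "B \<in> ?R1 \<union> insert i ` ?R2"
    then show "B \<in> ?L"
    proof
      assume "B \<in> insert i ` ?R2"
      then obtain B' where B': "B = insert i B'" "B' \<subseteq> I" "card B' = k" by auto
      moreover have "i \<notin> B'" "finite B'" using assms B' finite_subset by auto
      ultimately show ?thesis by auto
    qed auto
  qed
  moreover have "?R1 \<inter> insert i ` ?R2 = {}" using assms by auto
  moreover have fin: "finite ?R1" "finite ?R2" using assms by auto
  moreover have inj: "inj_on (insert i) ?R2" using assms by (auto simp: inj_on_def)
  ultimately have "esym (Suc k) x (insert i I) = (\<Sum>B\<in>?R1. \<Prod>i\<in>B. x i) + (\<Sum>B\<in>?R2. \<Prod>j\<in>insert i B. x j)"
    unfolding esym_def by (simp add: sum.union_disjoint sum.reindex)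
  also have "(\<Sum>B\<in>?R2. \<Prod>j\<in>insert i B. x j) = (\<Sum>B\<in>?R2. x i * (\<Prod>j\<in>B. x j))"
  proof (rule sum.cong)
    fix B assume "B \<in> ?R2"
    then have "finite B" "i \<notin> B" using assms finite_subset by auto
    then show "(\<Prod>j\<in>insert i B. x j) = x i * (\<Prod>j\<in>B. x j)" by simp
  qed simp
  finally show ?thesis by (simp add: esym_def sum_distrib_left)
qed

text \<open>
  The three-term recurrence of the Krawtchouk polynomials. When a product of distinct variables is multiplied
  by \<open>x i\<close>, either \<open>i\<close> is new and enlarges the product, or it is already present and is removed because
  \<open>x i ^ 2 = 1\<close>.
\<close>
lemma esym_recurrence:
  assumes "finite I" "\<And>i. i \<in> I \<Longrightarrow> x i ^ 2 = 1"
  shows "esym (Suc 0) x I * esym (Suc k) x I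
       = real (k + 2) * esym (Suc (Suc k)) x I + (real (card I) - real k) * esym k x I"
  using assms
proof (induction I arbitrary: k rule: finite_induct)
  case empty
  then show ?case by (cases k) (simp_all add: esym_empty esym_0)
next
  case (insert i I)
  have x: "x i * x i = 1" using insert.prems[of i] by (simp add: power2_eq_square)
  have IH: "esym (Suc 0) x I * esym (Suc k) x I
       = real (k + 2) * esym (Suc (Suc k)) x I + (real (card I) - real k) * esym k x I" for k
    using insert.IH insert.prems by simp
  show ?case
  proof (cases k)
    case 0
    have "(esym (Suc 0) x I + x i) * (esym (Suc 0) x I + x i)
        = 2 * (esym (Suc (Suc 0)) x I + x i * esym (Suc 0) x I) + (real (card I) + 1)"
      using IH[of 0] insert.hyps x by (simp add: esym_0 algebra_simps)
    then show ?thesis using insert.hyps 0 by (simp add: esym_insert esym_0)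
  next
    case (Suc j)
    define a where "a = esym (Suc 0) x I"
    have "(a + x i) * (esym (Suc k) x I + x i * esym k x I)
       = a * esym (Suc k) x I + x i * (a * esym k x I) + x i * esym (Suc k) x I + (x i * x i) * esym k x I"
      by (simp add: algebra_simps)
    also have "a * esym (Suc k) x I = real (k + 2) * esym (Suc (Suc k)) x I + (real (card I) - real k) * esym k x I"
      using IH[of k] by (simp add: a_def)
    also have "a * esym k x I = real (j + 2) * esym (Suc k) x I + (real (card I) - real j) * esym j x I"
      using IH[of j] Suc by (simp add: a_def)
    finally have "(a + x i) * (esym (Suc k) x I + x i * esym k x I)
       = real (k + 2) * (esym (Suc (Suc k)) x I + x i * esym (Suc k) x I)
        + (real (card I) + 1 - real k) * (esym k x I + x i * esym j x I)"
      using x Suc by (simp add: algebra_simps)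
    then show ?thesis using insert.hyps Suc by (simp add: esym_insert esym_0 a_def algebra_simps)
  qed
qed

lemma abs_esym_le:
  assumes "finite I" "\<And>i. i \<in> I \<Longrightarrow> \<bar>x i\<bar> \<le> 1"
  shows "\<bar>esym k x I\<bar> \<le> real (card I) ^ k"
proof -
  have "\<bar>esym k x I\<bar> \<le> (\<Sum>B | B \<subseteq> I \<and> card B = k. \<Prod>i\<in>B. \<bar>x i\<bar>)"
    unfolding esym_def abs_prod[symmetric] by (rule sum_abs)
  also have "\<dots> \<le> (\<Sum>B | B \<subseteq> I \<and> card B = k. 1)"
    using assms by (intro sum_mono prod_le_1) auto
  also have "\<dots> = real (card I choose k)" using assms by (simp add: n_subsets)
  also have "\<dots> \<le> real (card I) ^ k"
    by (cases "k \<le> card I") (auto simp: binomial_eq_0 binomial_le_pow simp flip: of_nat_power)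
  finally show ?thesis .
qed

text \<open>
  On variables \<open>\<plusminus>1\<close>, the \<open>j\<close>-th power of the sum differs from \<open>fact j * esym j\<close> only by the tuples with a
  repetition; there are of order \<open>card I ^ (j - 1)\<close> of them. For \<open>j = p\<close> this error contributes a bounded amount
  to the energy.
\<close>
lemma esym_approx:
  "\<exists>C\<ge>0. \<forall>(I :: 'i set) (x :: 'i \<Rightarrow> real). finite I \<longrightarrow> (\<forall>i\<in>I. x i ^ 2 = 1) \<longrightarrow>
      \<bar>(\<Sum>i\<in>I. x i) ^ j - fact j * esym j x I\<bar> \<le> C * real (card I) ^ (j - 1)"
proof (induction j)
  case 0
  show ?case by (intro exI[of _ 0]) (auto simp: esym_0)
next
  case (Suc j)
  then obtain C where C: "C \<ge> 0" "\<And>(I :: 'i set) (x :: 'i \<Rightarrow> real). finite I \<Longrightarrow> (\<forall>i\<in>I. x i ^ 2 = 1) \<Longrightarrow>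
      \<bar>(\<Sum>i\<in>I. x i) ^ j - fact j * esym j x I\<bar> \<le> C * real (card I) ^ (j - 1)" by blast
  show ?case
  proof (cases j)
    case 0
    then show ?thesis by (intro exI[of _ 0]) (auto simp: esym_1)
  next
    case (Suc i)
    show ?thesis
    proof (intro exI[of _ "C + fact j"] conjI allI impI)
      fix I :: "'i set" and x :: "'i \<Rightarrow> real" assume I: "finite I" and x: "\<forall>i\<in>I. x i ^ 2 = 1"
      have x1: "\<And>i. i \<in> I \<Longrightarrow> \<bar>x i\<bar> \<le> 1" using x by (simp add: abs_square_le_1[symmetric])
      let ?S = "\<Sum>i\<in>I. x i" and ?n = "real (card I)"
      have S: "\<bar>?S\<bar> \<le> ?n" using order_trans[OF sum_abs sum_bounded_above[of I "\<lambda>i. \<bar>x i\<bar>" 1]] x1 by auto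
      have "?S * esym j x I = real (Suc j) * esym (Suc j) x I + (?n - real i) * esym i x I"
        using esym_recurrence[OF I, of x i] x Suc I by (simp add: esym_1)
      then have r: "real (Suc j) * esym (Suc j) x I = ?S * esym j x I - (?n - real i) * esym i x I" by simp
      have "fact (Suc j) * esym (Suc j) x I = fact j * (real (Suc j) * esym (Suc j) x I)" by simp
      then have "?S ^ Suc j - fact (Suc j) * esym (Suc j) x I
         = ?S * (?S ^ j - fact j * esym j x I) + fact j * ((?n - real i) * esym i x I)"
        unfolding r by (simp add: algebra_simps)
      also have "\<bar>\<dots>\<bar> \<le> \<bar>?S * (?S ^ j - fact j * esym j x I)\<bar> + \<bar>fact j * ((?n - real i) * esym i x I)\<bar>"
        by (rule abs_triangle_ineq)
      also have "\<dots> \<le> ?n * (C * ?n ^ (j - 1)) + fact j * (?n * ?n ^ i)"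
      proof (intro add_mono)
        show "\<bar>?S * (?S ^ j - fact j * esym j x I)\<bar> \<le> ?n * (C * ?n ^ (j - 1))"
          unfolding abs_mult using S C(2)[OF I x] by (intro mult_mono) auto
        have "\<bar>(?n - real i) * esym i x I\<bar> \<le> ?n * ?n ^ i"
        proof (cases "i \<le> card I")
          case True
          then show ?thesis unfolding abs_mult by (intro mult_mono abs_esym_le I x1) auto
        next
          case False
          then have "esym i x I = 0"
            unfolding esym_def using I by (intro sum.neutral) (auto dest: card_mono[of I])
          then show ?thesis by simp
        qed
        then show "\<bar>fact j * ((?n - real i) * esym i x I)\<bar> \<le> fact j * (?n * ?n ^ i)"
          by (simp add: abs_mult)
      qed
      also have "\<dots> = (C + fact j) * ?n ^ (Suc j - 1)" using Suc by (simp add: algebra_simps)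
      finally show "\<bar>?S ^ Suc j - fact (Suc j) * esym (Suc j) x I\<bar> \<le> (C + fact j) * ?n ^ (Suc j - 1)" .
    qed (use C in auto)
  qed
qed

lemma sum_edges_eq_esym: "(\<Sum>e\<in>edges p N. \<Prod>v\<in>set e. \<sigma> v) = esym p \<sigma> {1..N}"
  unfolding esym_def by (rule sum.reindex_bij_betw[OF bij_betw_set_edges])

section \<open>The annealed two-replica partition function\<close>

lemma expectation_exp_spins:
  "measure_pmf.expectation (spins_pmf N h) (\<lambda>\<sigma>. exp (l * (\<Sum>v\<in>{1..N}. \<sigma> v)))
     = (cosh l + tanh h * sinh l) ^ N"
proof -
  have e: "measure_pmf.expectation (spin_pmf h) (\<lambda>x. exp (l * x)) = cosh l + tanh h * sinh l"
  proof -
    have "measure_pmf.expectation (spin_pmf h) (\<lambda>x. exp (l * x))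
      = measure_pmf.expectation (spin_pmf h) (\<lambda>x. cosh l * x ^ 0 + sinh l * x ^ 1)"
      using set_spin_pmf[of h]
      by (intro integral_cong_AE AE_pmfI) (auto simp: cosh_minus_sinh cosh_plus_sinh)
    also have "\<dots> = cosh l * measure_pmf.expectation (spin_pmf h) (\<lambda>x. x ^ 0)
        + sinh l * measure_pmf.expectation (spin_pmf h) (\<lambda>x. x ^ 1)"
      using integrable_measure_pmf_finite[OF finite_subset[OF set_spin_pmf[of h]], of "\<lambda>x. x"] by simp
    finally show ?thesis unfolding expectation_spin_power by (simp add: mult.commute)
  qed
  have "(\<lambda>\<sigma>. exp (l * (\<Sum>v\<in>{1..N}. \<sigma> v))) = (\<lambda>\<sigma>. \<Prod>v\<in>{1..N}. exp (l * \<sigma> v))"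
    by (simp add: exp_sum sum_distrib_left)
  then show ?thesis using expectation_spins_prod[of N h "\<lambda>v x. exp (l * x)"] e by simp
qed

text \<open>
  The entropy has second derivative \<open>1 / (1 - y\<^sup>2) \<ge> 1\<close>.
\<close>
lemma entropy_ge_square:
  assumes "0 \<le> y" "y < 1" shows "y\<^sup>2 / 2 \<le> entropy_fun y"
proof -
  define g where "g y = (ln (1 + y) - ln (1 - y)) / 2 - y" for y :: real
  have g: "0 \<le> g x" if "0 \<le> x" "x < 1" for x
  proof -
    have "g 0 \<le> g x"
    proof (rule DERIV_nonneg_imp_nondecreasing[OF that(1)])
      fix z assume z: "0 \<le> z" "z \<le> x"
      then have "z\<^sup>2 < 1" using that abs_square_less_1[of z] by simp
      moreover have "(g has_real_derivative ((1 / (1 + z) + 1 / (1 - z)) / 2 - 1)) (at z)"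
        unfolding g_def using z that by (auto intro!: derivative_eq_intros)
      moreover have "(1 / (1 + z) + 1 / (1 - z)) / 2 - 1 = z\<^sup>2 / (1 - z\<^sup>2)"
        using z that calculation(1) by (simp add: field_simps power2_eq_square)
      ultimately show "\<exists>y. (g has_real_derivative y) (at z) \<and> 0 \<le> y" by force
    qed
    then show ?thesis by (simp add: g_def)
  qed
  have "entropy_fun 0 - 0\<^sup>2 / 2 \<le> entropy_fun y - y\<^sup>2 / 2"
  proof (rule DERIV_nonneg_imp_nondecreasing[OF assms(1)])
    fix z assume z: "0 \<le> z" "z \<le> y"
    have "((\<lambda>y. (1 + y) * ln (1 + y)) has_real_derivative ln (1 + z) + 1) (at z)"
      "((\<lambda>y. (1 - y) * ln (1 - y)) has_real_derivative - ln (1 - z) - 1) (at z)"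
      using z assms by (auto intro!: derivative_eq_intros)
    then have "((\<lambda>y. entropy_fun y - y\<^sup>2 / 2) has_real_derivative
        ((ln (1 + z) + 1) / 2 + (- ln (1 - z) - 1) / 2 - z)) (at z)"
      unfolding entropy_fun_def
      by (intro DERIV_diff DERIV_add DERIV_cdivide) (auto intro!: derivative_eq_intros)
    moreover have "(ln (1 + z) + 1) / 2 + (- ln (1 - z) - 1) / 2 - z = g z"
      by (simp add: g_def field_simps)
    ultimately show "\<exists>d. ((\<lambda>y. entropy_fun y - y\<^sup>2 / 2) has_real_derivative d) (at z) \<and> 0 \<le> d"
      using g[of z] z assms by auto
  qed
  then show ?thesis by (simp add: entropy_fun_def)
qed

text \<open>
  The definition of \<open>beta_f\<close> as an infimum, in the form in which the energy of an overlap \<open>y\<close> is dominated by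
  its entropy.
\<close>
lemma beta_f_le:
  assumes "0 < y" "y < 1" "0 \<le> b" "b \<le> beta_f p"
  shows "b\<^sup>2 * y ^ p \<le> fact p * entropy_fun y"
proof -
  let ?q = "fact p * entropy_fun y / y ^ p"
  have nn: "0 \<le> fact p * entropy_fun x / x ^ p" if "0 < x" "x < 1" for x
    using entropy_ge_square[of x] that by (auto intro!: divide_nonneg_nonneg mult_nonneg_nonneg order_trans[OF _ entropy_ge_square])
  have "beta_f p \<le> sqrt ?q"
    unfolding beta_f_def using assms nn by (intro cINF_lower bdd_belowI[of _ 0]) auto
  then have "b\<^sup>2 \<le> (sqrt ?q)\<^sup>2" using assms by (intro power_mono) auto
  also have "\<dots> = ?q" using nn assms by simp
  finally show ?thesis using assms by (simp add: field_simps)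
qed

lemma tanh_artanh_real:
  assumes "\<bar>y\<bar> < (1::real)" shows "tanh (artanh y) = y"
proof -
  have "exp (- 2 * artanh y) = (1 - y) / (1 + y)"
    using assms by (simp add: artanh_def exp_minus abs_less_iff)
  then have "tanh (artanh y) = (1 - (1 - y) / (1 + y)) / (1 + (1 - y) / (1 + y))"
    by (simp only: tanh_real_altdef)
  also have "1 - (1 - y) / (1 + y) = 2 * y / (1 + y)"
    using assms by (auto simp: field_simps abs_less_iff)
  also have "1 + (1 - y) / (1 + y) = 2 / (1 + y)"
    using assms by (auto simp: field_simps abs_less_iff)
  finally show ?thesis using assms by (auto simp: abs_less_iff)
qed

text \<open>
  \<open>artanh y\<close> is the optimal tilt in the Chernoff bound and \<open>entropy_fun\<close> is the Legendre transform of
  \<open>ln cosh\<close>.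
\<close>
lemma cosh_artanh_entropy:
  assumes "0 \<le> y" "y < (1::real)"
  shows "ln (cosh (artanh y)) - y * artanh y = - entropy_fun y"
proof -
  have y2: "y\<^sup>2 < 1" using assms abs_square_less_1[of y] by simp
  have "inverse ((cosh (artanh y))\<^sup>2) = 1 - (tanh (artanh y))\<^sup>2"
  proof -
    have s2: "(sinh (artanh y))\<^sup>2 = (cosh (artanh y))\<^sup>2 - 1" by (simp add: cosh_square_eq)
    have "cosh (artanh y) \<noteq> 0" using cosh_real_pos[of "artanh y"] by simp
    then show ?thesis unfolding tanh_def power_divide s2 by (simp add: diff_divide_distrib inverse_eq_divide)
  qed
  then have "(cosh (artanh y))\<^sup>2 = inverse (1 - y\<^sup>2)" using assms by (simp add: artanh_tanh_real tanh_artanh_real inverse_eq_iff_eq) (metis inverse_inverse_eq)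
  then have "2 * ln (cosh (artanh y)) = - ln (1 - y\<^sup>2)"
    using ln_realpow[of "cosh (artanh y)" 2] y2 by (simp add: ln_inverse cosh_real_pos)
  also have "1 - y\<^sup>2 = (1 + y) * (1 - y)" by (simp add: power2_eq_square algebra_simps)
  also have "ln \<dots> = ln (1 + y) + ln (1 - y)" using assms by (simp add: ln_mult)
  finally have "ln (cosh (artanh y)) = - (ln (1 + y) + ln (1 - y)) / 2" by simp
  moreover have "artanh y = (ln (1 + y) - ln (1 - y)) / 2"
    using assms by (simp add: artanh_def ln_div)
  ultimately show ?thesis
    by (simp only: entropy_fun_def) (simp add: add_divide_distrib diff_divide_distrib algebra_simps)
qed

lemma cosh_plus_tanh_sinh_nonneg: "0 \<le> cosh l + tanh h * sinh (l::real)"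
proof -
  have "\<bar>tanh h * sinh l\<bar> \<le> 1 * \<bar>sinh l\<bar>"
    unfolding abs_mult using tanh_real_lt_1[of h] tanh_real_gt_neg1[of h] by (intro mult_right_mono) auto
  moreover have "\<bar>sinh l\<bar> \<le> cosh l"
    using sinh_le_cosh_real[of l] sinh_le_cosh_real[of "-l"] by (auto simp: abs_le_iff)
  ultimately show ?thesis by auto
qed

text \<open>
  The tilt that is optimal for \<open>y\<close> instead of \<open>\<bar>s\<bar> / N\<close>. Requiring only \<open>y * N \<le> \<bar>s\<bar>\<close> with \<open>y < 1\<close> keeps
  the tilt finite when all spins agree.
\<close>
lemma chernoff_spins:
  assumes m: "0 \<le> tanh h" "tanh h < 1" and y: "0 \<le> y" "y < 1" "y * real N \<le> \<bar>s\<bar>"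
  shows "\<exists>l. exp (- l * s) * (cosh l + tanh h * sinh l) ^ N
           \<le> exp (real N * (tanh h * y - entropy_fun y))"
proof (intro exI)
  define a where "a = artanh y"
  define l where "l = sgn s * a"
  have a0: "a \<ge> 0" unfolding a_def using y by (simp add: artanh_def ln_div)
  have ta: "tanh a = y" unfolding a_def using y by (simp add: tanh_artanh_real)
  have ls: "l * s = a * \<bar>s\<bar>" by (simp add: l_def abs_sgn mult_ac)
  have cl: "cosh l = cosh a" if "s \<noteq> 0" using that by (cases "s > 0") (auto simp: l_def sgn_if)
  have tl: "tanh l \<le> y" using ta y by (auto simp: l_def sgn_if)
  have "cosh l + tanh h * sinh l = cosh l * (1 + tanh h * tanh l)"
    using cosh_real_pos[of l] by (simp add: tanh_def field_simps)
  also have "\<dots> \<le> exp (ln (cosh a)) * exp (tanh h * y)"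
  proof (intro mult_mono)
    have "cosh l \<le> cosh a"
    proof (cases "s = 0")
      case True
      then show ?thesis by (simp add: l_def cosh_real_ge_1)
    qed (simp add: cl)
    then show "cosh l \<le> exp (ln (cosh a))" by (simp add: cosh_real_pos)
    have "tanh h * tanh l \<le> tanh h * y" using tl m by (intro mult_left_mono)
    then show "1 + tanh h * tanh l \<le> exp (tanh h * y)" using exp_ge_add_one_self[of "tanh h * y"] by linarith
    have "\<bar>tanh h * tanh l\<bar> \<le> 1 * 1"
      unfolding abs_mult using m tanh_real_lt_1[of l] tanh_real_gt_neg1[of l] by (intro mult_mono) auto
    then show "0 \<le> 1 + tanh h * tanh l" by auto
  qed simp
  finally have le: "cosh l + tanh h * sinh l \<le> exp (ln (cosh a) + tanh h * y)" by (simp add: exp_add)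
  have nn: "0 \<le> cosh l + tanh h * sinh l" by (rule cosh_plus_tanh_sinh_nonneg)
  have "exp (- l * s) * (cosh l + tanh h * sinh l) ^ N
      \<le> exp (- (a * \<bar>s\<bar>)) * exp (ln (cosh a) + tanh h * y) ^ N"
    using ls by (intro mult_mono power_mono le nn) (auto simp: nn)
  also have "\<dots> = exp (real N * (ln (cosh a) + tanh h * y) - a * \<bar>s\<bar>)"
    by (simp add: exp_of_nat_mult[symmetric] exp_add[symmetric] exp_diff exp_minus field_simps)
  also have "\<dots> \<le> exp (real N * (ln (cosh a) + tanh h * y) - a * (y * real N))"
    using mult_left_mono[OF y(3) a0] by simp
  also have "\<dots> = exp (real N * (tanh h * y - entropy_fun y))"
  proof -
    have "ln (cosh a) = y * a - entropy_fun y" using cosh_artanh_entropy[OF y(1,2)] by (simp add: a_def)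
    then show ?thesis by (simp only:) (simp add: algebra_simps)
  qed
  finally show "exp (- l * s) * (cosh l + tanh h * sinh l) ^ N \<le> exp (real N * (tanh h * y - entropy_fun y))" .
qed

lemma spins_integer_sum:
  assumes "\<And>v. v \<in> I \<Longrightarrow> \<sigma> v = 1 \<or> \<sigma> v = (-1::real)" "finite I"
  shows "\<exists>s\<in>{- int (card I)..int (card I)}. (\<Sum>v\<in>I. \<sigma> v) = real_of_int s"
  using assms(2,1)
proof (induction I rule: finite_induct)
  case (insert i I)
  then obtain s where s: "s\<in>{- int (card I)..int (card I)}" "(\<Sum>v\<in>I. \<sigma> v) = real_of_int s" by auto
  have "\<sigma> i = 1 \<or> \<sigma> i = -1" using insert.prems by simp
  then show ?case
    using s insert.hyps
    by (elim disjE) (rule bexI[of _ "s + 1"], auto intro: bexI[of _ "s - 1"])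
qed auto

text \<open>
  The overlap takes only \<open>2 N + 1\<close> values, so a bound for each value costs a factor linear in \<open>N\<close>. For a
  single value the energy is beaten by a fraction of the entropy. The rest of the entropy is quadratic
  in \<open>sqrt N * y\<close> and absorbs the drift, which is linear in the same quantity by the assumption on \<open>tanh h\<close>.
\<close>
lemma exponential_moment:
  assumes p: "p \<ge> 1" and b: "0 < b" "b < beta_f p" and c: "0 \<le> c"
  shows "\<exists>K\<ge>0. \<forall>N h. N \<ge> 1 \<longrightarrow> 0 \<le> tanh h \<longrightarrow> tanh h \<le> c / sqrt N \<longrightarrow>
    measure_pmf.expectation (spins_pmf N h)
      (\<lambda>\<sigma>. exp (b\<^sup>2 / fact p * real N * ((\<Sum>v\<in>{1..N}. \<sigma> v) / real N) ^ p)) \<le> K * real N"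
proof -
  obtain b' where b': "b < b'" "b' < beta_f p" using b dense by blast
  define d0 where "d0 = b / b'"
  have d0: "0 < d0" "d0 < 1" using b b' by (auto simp: d0_def)
  (* Replacing the overlap x by y = th * x leaves room for a finite tilt; th ^ p = b / b' pays for this
     with half of the slack between b ^ 2 and b' ^ 2. *)
  define th where "th = root p d0"
  have th: "0 < th" "th < 1" "th ^ p = d0" using d0 p by (auto simp: th_def)
  define d where "d = 1 - d0"
  have d: "0 < d" using d0 by (simp add: d_def)
  define K where "K = exp (c\<^sup>2 / (2 * d))"
  define F where "F N s = exp (b\<^sup>2 / fact p * real N * (s / real N) ^ p)" for N and s :: real
  have main: "\<exists>l. F N s * (exp (- l * s) * (cosh l + tanh h * sinh l) ^ N) \<le> K"
    if N: "N \<ge> 1" and h: "0 \<le> tanh h" "tanh h \<le> c / sqrt N" and s: "\<bar>s\<bar> \<le> real N" for N h s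
  proof (cases "s = 0 \<or> (odd p \<and> s < 0)")
    case True
    have "(s / real N) ^ p \<le> 0" using True p by (auto simp: zero_less_power_eq power_le_zero_eq divide_nonpos_nonneg)
    then have "b\<^sup>2 / fact p * real N * (s / real N) ^ p \<le> 0" by (intro mult_nonneg_nonpos) auto
    then have "F N s \<le> 1" by (simp add: F_def)
    also have "1 \<le> K" using d by (simp add: K_def)
    finally show ?thesis by (intro exI[of _ 0]) simp
  next
    case False
    define x where "x = \<bar>s\<bar> / real N"
    define y where "y = th * x"
    have x: "0 < x" "x \<le> 1" using False s N by (auto simp: x_def divide_le_eq)
    have y: "0 < y" "y < 1" "y * real N \<le> \<bar>s\<bar>"
    proof -
      show "0 < y" using x th by (simp add: y_def)
      show "y < 1" using mult_le_less_imp_less[of x 1 th 1] x th by (simp add: y_def mult.commute)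
      have "th * \<bar>s\<bar> \<le> 1 * \<bar>s\<bar>" using th by (intro mult_right_mono) auto
      then show "y * real N \<le> \<bar>s\<bar>" using N by (simp add: y_def x_def)
    qed
    have sx: "(s / real N) ^ p = x ^ p"
      using False by (cases "s < 0") (auto simp: x_def power_divide)
    have "b\<^sup>2 * x ^ p = d0 * (b'\<^sup>2 * y ^ p)"
      using th b b' by (simp add: y_def power_mult_distrib d0_def field_simps power2_eq_square)
    also have "\<dots> \<le> d0 * (fact p * entropy_fun y)"
      using beta_f_le[OF y(1,2), of b' p] b b' d0 by (intro mult_left_mono) auto
    finally have le: "b\<^sup>2 / fact p * x ^ p \<le> d0 * entropy_fun y" by (simp add: field_simps)
    obtain l where l: "exp (- l * s) * (cosh l + tanh h * sinh l) ^ N \<le> exp (real N * (tanh h * y - entropy_fun y))"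
      using chernoff_spins[OF h(1) tanh_real_lt_1 _ y(2,3)] y(1) by auto
    have "F N s * (exp (- l * s) * (cosh l + tanh h * sinh l) ^ N)
        \<le> exp (real N * (d0 * entropy_fun y)) * exp (real N * (tanh h * y - entropy_fun y))"
      using mult_left_mono[OF le, of "real N"] cosh_plus_tanh_sinh_nonneg[of l h]
      by (intro mult_mono l) (auto simp: F_def sx mult_ac)
    also have "\<dots> = exp (real N * (tanh h * y - d * entropy_fun y))"
      by (simp add: exp_add[symmetric] d_def algebra_simps)
    also have "\<dots> \<le> exp (c * (sqrt N * y) - d * (sqrt N * y)\<^sup>2 / 2)"
    proof -
      have "real N * (tanh h * y) \<le> real N * (c / sqrt N * y)"
        using h(2) y by (intro mult_left_mono mult_right_mono) auto
      also have "\<dots> = c * (sqrt N * y)" using N by (simp add: field_simps flip: real_sqrt_mult)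
      finally have 1: "real N * (tanh h * y) \<le> c * (sqrt N * y)" .
      have "real N * (d * (y\<^sup>2 / 2)) \<le> real N * (d * entropy_fun y)"
        using entropy_ge_square[of y] y d by (intro mult_left_mono) auto
      then show ?thesis using 1 by (simp add: power_mult_distrib algebra_simps)
    qed
    also have "\<dots> \<le> K"
    proof -
      define a where "a = sqrt N * y"
      have "0 \<le> (d * a - c)\<^sup>2" by simp
      then have "c * a - d * a\<^sup>2 / 2 \<le> c\<^sup>2 / (2 * d)" using d by (simp add: field_simps power2_eq_square)
      then show ?thesis by (simp add: K_def a_def)
    qed
    finally show ?thesis by blast
  qed
  show ?thesis
  proof (intro exI[of _ "3 * K"] conjI allI impI)
    fix N :: nat and h :: real
    assume N: "N \<ge> 1" and h: "0 \<le> tanh h" "tanh h \<le> c / sqrt N"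
    let ?E = "measure_pmf.expectation (spins_pmf N h)"
    let ?S = "\<lambda>\<sigma>. \<Sum>v\<in>{1..N}. \<sigma> v"
    let ?R = "{- int N..int N}"
    have "\<forall>s\<in>?R. \<exists>l. F N (real_of_int s) * (exp (- l * real_of_int s) * (cosh l + tanh h * sinh l) ^ N) \<le> K"
    proof
      fix s assume "s \<in> ?R"
      then have "\<bar>real_of_int s\<bar> \<le> real N" by auto
      then show "\<exists>l. F N (real_of_int s) * (exp (- l * real_of_int s) * (cosh l + tanh h * sinh l) ^ N) \<le> K"
        using main[OF N h] by blast
    qed
    then obtain l where l: "\<And>s. s \<in> ?R \<Longrightarrow> F N (real_of_int s) * (exp (- l s * real_of_int s) * (cosh (l s) + tanh h * sinh (l s)) ^ N) \<le> K"
      by metis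
    have "?E (\<lambda>\<sigma>. F N (?S \<sigma>)) \<le> ?E (\<lambda>\<sigma>. \<Sum>s\<in>?R. F N (real_of_int s) * (exp (- l s * real_of_int s) * exp (l s * ?S \<sigma>)))"
    proof (rule integral_mono_AE, simp, simp, rule AE_pmfI)
      fix \<sigma> assume "\<sigma> \<in> set_pmf (spins_pmf N h)"
      then obtain s where s: "s \<in> ?R" "?S \<sigma> = real_of_int s"
        using spins_integer_sum[of "{1..N}" \<sigma>] set_spins_pmf[of \<sigma> N h] by auto
      have "F N (?S \<sigma>) = F N (real_of_int s) * (exp (- l s * real_of_int s) * exp (l s * ?S \<sigma>))"
        by (simp only: s exp_add[symmetric]) simp
      also have "\<dots> \<le> (\<Sum>s\<in>?R. F N (real_of_int s) * (exp (- l s * real_of_int s) * exp (l s * ?S \<sigma>)))"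
        using s(1) by (intro member_le_sum) (auto simp: F_def)
      finally show "F N (?S \<sigma>) \<le> \<dots>" .
    qed
    also have "\<dots> = (\<Sum>s\<in>?R. F N (real_of_int s) * (exp (- l s * real_of_int s) * (cosh (l s) + tanh h * sinh (l s)) ^ N))"
      by (simp only: expectation_spins_sum integral_mult_right_zero expectation_exp_spins)
    also have "\<dots> \<le> (\<Sum>s\<in>?R. K)" by (intro sum_mono l)
    also have "\<dots> = (2 * real N + 1) * K" by simp
    also have "\<dots> \<le> 3 * K * real N"
    proof -
      have "(2 * real N + 1) * K \<le> (3 * real N) * K" using N by (intro mult_right_mono) (auto simp: K_def)
      then show ?thesis by (simp add: mult_ac)
    qed
    finally show "?E (\<lambda>\<sigma>. exp (b\<^sup>2 / fact p * real N * (?S \<sigma> / real N) ^ p)) \<le> 3 * K * real N"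
      by (simp add: F_def)
  qed (simp add: K_def)
qed

text \<open>
  The sum of the variances of all clusters is an exponential moment of the overlap of two replicas. The
  elementary symmetric polynomial is replaced by a power of the sum at the cost of a constant factor.
\<close>
lemma partition_function_bound:
  assumes p: "p \<ge> 1" and b: "0 < b" "b < beta_f p" and c: "0 \<le> c"
  shows "\<exists>K\<ge>0. \<forall>N h. N \<ge> 1 \<longrightarrow> b\<^sup>2 \<le> real N ^ (p - 1) \<longrightarrow> 0 \<le> tanh h \<longrightarrow> tanh h \<le> c / sqrt N \<longrightarrow>
    (\<Sum>\<Gamma>\<in>Pow (edges p N). tanh h ^ card (bdry \<Gamma>) * (b\<^sup>2 / real N ^ (p - 1)) ^ card \<Gamma>) \<le> K * real N"
proof -
  obtain K where K: "K \<ge> 0" "\<And>N h. N \<ge> 1 \<Longrightarrow> 0 \<le> tanh h \<Longrightarrow> tanh h \<le> c / sqrt N \<Longrightarrow>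
    measure_pmf.expectation (spins_pmf N h)
      (\<lambda>\<sigma>. exp (b\<^sup>2 / fact p * real N * ((\<Sum>v\<in>{1..N}. \<sigma> v) / real N) ^ p)) \<le> K * real N"
    using exponential_moment[OF p b c] by blast
  obtain C where C: "C \<ge> 0" "\<And>(I :: nat set) (x :: nat \<Rightarrow> real). finite I \<Longrightarrow> (\<forall>i\<in>I. x i ^ 2 = 1) \<Longrightarrow>
      \<bar>(\<Sum>i\<in>I. x i) ^ p - fact p * esym p x I\<bar> \<le> C * real (card I) ^ (p - 1)"
    using esym_approx[where j=p and 'i=nat] by blast
  show ?thesis
  proof (intro exI[of _ "exp (b\<^sup>2 * C / fact p) * K"] conjI allI impI)
    fix N :: nat and h :: real
    assume N: "N \<ge> 1" and bN: "b\<^sup>2 \<le> real N ^ (p - 1)" and h: "0 \<le> tanh h" "tanh h \<le> c / sqrt N"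
    define t where "t = b\<^sup>2 / real N ^ (p - 1)"
    have t: "0 \<le> t" "t \<le> 1" using N bN by (auto simp: t_def divide_le_eq)
    let ?E = "measure_pmf.expectation (spins_pmf N h)"
    let ?S = "\<lambda>\<sigma>. \<Sum>v\<in>{1..N}. \<sigma> v"
    have "(\<Sum>\<Gamma>\<in>Pow (edges p N). tanh h ^ card (bdry \<Gamma>) * t ^ card \<Gamma>)
        = ?E (\<lambda>\<sigma>. \<Prod>e\<in>edges p N. 1 + (\<Prod>v\<in>set e. \<sigma> v) * t)"
      by (simp add: expectation_prod_edges)
    also have "\<dots> \<le> ?E (\<lambda>\<sigma>. exp (b\<^sup>2 * C / fact p) * exp (b\<^sup>2 / fact p * real N * (?S \<sigma> / real N) ^ p))"
    proof (rule integral_mono_AE, simp, simp, rule AE_pmfI)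
      fix \<sigma> assume \<sigma>: "\<sigma> \<in> set_pmf (spins_pmf N h)"
      have sv: "\<sigma> v = 1 \<or> \<sigma> v = -1" if "v \<in> {1..N}" for v using set_spins_pmf[OF \<sigma> that] .
      have "\<bar>\<Prod>v\<in>set e. \<sigma> v\<bar> \<le> 1" if "e \<in> edges p N" for e
        unfolding abs_prod using sv edgesD(3)[OF that] by (intro prod_le_1) force
      then have pm: "\<bar>(\<Prod>v\<in>set e. \<sigma> v) * t\<bar> \<le> 1" if "e \<in> edges p N" for e
        unfolding abs_mult using that t by (intro mult_le_one) auto
      have "(\<Prod>e\<in>edges p N. 1 + (\<Prod>v\<in>set e. \<sigma> v) * t) \<le> (\<Prod>e\<in>edges p N. exp ((\<Prod>v\<in>set e. \<sigma> v) * t))"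
      proof (rule prod_mono, safe)
        fix e assume "e \<in> edges p N"
        then show "0 \<le> 1 + (\<Prod>v\<in>set e. \<sigma> v) * t" using pm[of e] by (auto simp: abs_le_iff)
      qed (simp add: exp_ge_add_one_self)
      also have "\<dots> = exp (t * esym p \<sigma> {1..N})"
        by (simp only: exp_sum[OF finite_edges, symmetric] sum_distrib_right[symmetric] sum_edges_eq_esym) (simp only: mult.commute)
      also have "\<dots> \<le> exp (b\<^sup>2 * C / fact p + b\<^sup>2 / fact p * real N * (?S \<sigma> / real N) ^ p)"
      proof -
        have sq: "\<forall>i\<in>{1..N}. \<sigma> i ^ 2 = 1" using sv by force
        have "fact p * esym p \<sigma> {1..N} \<le> ?S \<sigma> ^ p + C * real N ^ (p - 1)"
          using C(2)[OF _ sq] by (simp add: abs_le_iff)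
        then have "esym p \<sigma> {1..N} \<le> (?S \<sigma> ^ p + C * real N ^ (p - 1)) / fact p"
          by (simp add: field_simps)
        then have "t * esym p \<sigma> {1..N} \<le> t * ((?S \<sigma> ^ p + C * real N ^ (p - 1)) / fact p)"
          using t by (intro mult_left_mono)
        also have "\<dots> = b\<^sup>2 * C / fact p + b\<^sup>2 / fact p * real N * (?S \<sigma> / real N) ^ p"
        proof -
          have "real N ^ p = real N * real N ^ (p - 1)" using p by (cases p) auto
          then show ?thesis using N by (simp add: t_def field_simps)
        qed
        finally show ?thesis by simp
      qed
      finally show "(\<Prod>e\<in>edges p N. 1 + (\<Prod>v\<in>set e. \<sigma> v) * t)
          \<le> exp (b\<^sup>2 * C / fact p) * exp (b\<^sup>2 / fact p * real N * (?S \<sigma> / real N) ^ p)"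
        by (simp add: exp_add)
    qed
    also have "\<dots> = exp (b\<^sup>2 * C / fact p) * ?E (\<lambda>\<sigma>. exp (b\<^sup>2 / fact p * real N * (?S \<sigma> / real N) ^ p))"
      by simp
    also have "\<dots> \<le> exp (b\<^sup>2 * C / fact p) * (K * real N)"
      by (intro mult_left_mono K(2) N h) simp
    finally show "(\<Sum>\<Gamma>\<in>Pow (edges p N). tanh h ^ card (bdry \<Gamma>) * (b\<^sup>2 / real N ^ (p - 1)) ^ card \<Gamma>)
        \<le> exp (b\<^sup>2 * C / fact p) * K * real N"
      by (simp add: t_def mult.assoc)
  qed (simp add: K)
qed

section \<open>Negligibility of large clusters\<close>

text \<open>
  The weight of the odd vertices, traded for the number of vertices: every odd vertex costs \<open>N powr (- 1 / 2)\<close>.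
\<close>
lemma power_bdry_le:
  assumes \<Gamma>: "\<Gamma> \<subseteq> edges p N" and N: "N \<ge> 1" and c: "c \<ge> 1" and q: "0 \<le> q" "q \<le> c / sqrt (real N)"
  shows "q ^ card (bdry \<Gamma>) \<le> c ^ (card \<Gamma> * p) * sqrt (real N) ^ (card \<Gamma> * p) * (1 / real N) ^ card (supp \<Gamma>)"
proof -
  let ?n = "sqrt (real N)" and ?l = "card (bdry \<Gamma>)" and ?k = "card \<Gamma> * p" and ?w = "card (supp \<Gamma>)"
  have n: "?n \<ge> 1" using N by simp
  have "?n ^ (2 * ?w) \<le> ?n ^ (?k + ?l)" using card_supp_le[OF \<Gamma>] n by (intro power_increasing)
  moreover have "?n ^ (2 * ?w) = real N ^ ?w" by (simp add: power_mult)
  ultimately have w: "real N ^ ?w \<le> ?n ^ ?k * ?n ^ ?l" by (simp add: power_add)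
  have "q ^ ?l \<le> (c / ?n) ^ ?l" using q by (intro power_mono)
  also have "\<dots> = c ^ ?l * (1 / ?n ^ ?l)" by (simp add: power_divide)
  also have "\<dots> \<le> c ^ ?k * (?n ^ ?k / real N ^ ?w)"
    using w n N c card_bdry_le[OF \<Gamma>] by (intro mult_mono power_increasing) (auto simp: field_simps)
  finally show ?thesis by (simp add: power_one_over field_simps)
qed

lemma sum_clusters_bound:
  assumes N: "N \<ge> 1" and c: "c \<ge> 1" and q: "0 \<le> q" "q \<le> c / sqrt (real N)"
  shows "(\<Sum>\<Gamma> | \<Gamma> \<subseteq> edges p N \<and> card \<Gamma> = k. q ^ card (bdry \<Gamma>))
      \<le> (c * sqrt (real N) * real (k * p)) ^ (k * p) * (real (k * p) + 1)"
proof -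
  have "(\<Sum>\<Gamma> | \<Gamma> \<subseteq> edges p N \<and> card \<Gamma> = k. q ^ card (bdry \<Gamma>))
      \<le> (\<Sum>\<Gamma> | \<Gamma> \<subseteq> edges p N \<and> card \<Gamma> = k. (c * sqrt (real N)) ^ (k * p) * (1 / real N) ^ card (supp \<Gamma>))"
    using power_bdry_le[OF _ N c q] by (intro sum_mono) (auto simp: power_mult_distrib)
  also have "\<dots> = (c * sqrt (real N)) ^ (k * p) *
      (\<Sum>\<Gamma> | \<Gamma> \<subseteq> edges p N \<and> card \<Gamma> = k. (1 / real N) ^ card (supp \<Gamma>))"
    by (simp add: sum_distrib_left)
  also have "\<dots> \<le> (c * sqrt (real N)) ^ (k * p) * (real ((k * p) ^ (p * k)) * (real (k * p) + 1))"
    using c by (intro mult_left_mono sum_clusters_support N) auto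
  finally show ?thesis by (simp add: power_mult_distrib mult_ac)
qed

text \<open>
  Let \<open>b < b' < beta_f p\<close>. Clusters with more than \<open>N powr \<epsilon>\<close> edges gain the factor \<open>(b / b') ^ (2 * N powr \<epsilon>)\<close>
  over the sum at \<open>b'\<close>, which grows only linearly. Smaller clusters are counted by their supports; for them the sum
  over \<open>k \<ge> 5\<close> is geometric with a ratio close to \<open>N powr (- (p - 2) / 2)\<close>. The fifth power of this ratio is
  smaller than \<open>N powr (- 2 * (p - 2))\<close>, the smallest scale in the theorem.
\<close>
lemma cluster_tail:
  fixes h :: "nat \<Rightarrow> real"
  assumes p: "p \<ge> 3" and b: "0 < b" "b < beta_f p" and c: "c \<ge> 1" and g: "g \<le> 2 * (real p - 2)"
    and h: "\<forall>\<^sub>F N in sequentially. 0 \<le> tanh (h N) \<and> tanh (h N) \<le> c / sqrt (real N)"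
  shows "(\<lambda>N. real N powr g * (\<Sum>\<Gamma> | \<Gamma> \<subseteq> edges p N \<and> 5 \<le> card \<Gamma>.
            tanh (h N) ^ card (bdry \<Gamma>) * (b\<^sup>2 / real N ^ (p - 1)) ^ card \<Gamma>)) \<longlonglongrightarrow> 0"
proof -
  obtain b' where b': "b < b'" "b' < beta_f p" using b dense by blast
  define r where "r = (b / b')\<^sup>2"
  define \<kappa> where "\<kappa> = - ln r"
  have r: "0 < r" "r < 1" using b b' by (auto simp: r_def power_less_one_iff)
  then have \<kappa>: "0 < \<kappa>" by (simp add: \<kappa>_def)
  obtain K where K: "K \<ge> 0" "\<And>N h. N \<ge> 1 \<Longrightarrow> b'\<^sup>2 \<le> real N ^ (p - 1) \<Longrightarrow> 0 \<le> tanh h \<Longrightarrow> tanh h \<le> c / sqrt N \<Longrightarrow>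
    (\<Sum>\<Gamma>\<in>Pow (edges p N). tanh h ^ card (bdry \<Gamma>) * (b'\<^sup>2 / real N ^ (p - 1)) ^ card \<Gamma>) \<le> K * real N"
    using partition_function_bound[of p b' c] p b b' c by auto
  (* The counting bound loses at most N powr (p * \<epsilon>) per edge, which must stay below the gain
     N powr ((p - 2) / 2), and five edges together must beat N powr (2 * (p - 2)). *)
  define \<epsilon> where "\<epsilon> = 1 / (16 * real p)"
  have \<epsilon>: "0 < \<epsilon>" "\<epsilon> \<le> 1 / 48" "real p * \<epsilon> = 1 / 16" using p by (auto simp: \<epsilon>_def field_simps)
  define B where "B = b\<^sup>2 * c ^ p * real p ^ p"
  have B: "B > 0" using b c p by (simp add: B_def)
  define z where "z N = B * real N powr (1 / 16 - (real p - 2) / 2)" for N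
  define w where "w N \<Gamma> = tanh (h N) ^ card (bdry \<Gamma>) * (b\<^sup>2 / real N ^ (p - 1)) ^ card \<Gamma>" for N \<Gamma>
  define G where "G = 2 * (real p - 2)"
  define U1 where "U1 N = real N powr G * (exp (- \<kappa> * real N powr \<epsilon>) * (K * real N))" for N
  define U2 where "U2 N = real N powr G * (real N powr \<epsilon> * ((real p + 1) * real N powr \<epsilon> * z N ^ 5))" for N
  have bound: "real N powr g * (\<Sum>\<Gamma> | \<Gamma> \<subseteq> edges p N \<and> 5 \<le> card \<Gamma>. w N \<Gamma>) \<le> U1 N + U2 N"
    if N: "N \<ge> 1" and hN: "0 \<le> tanh (h N)" "tanh (h N) \<le> c / sqrt (real N)"
      and bN: "b'\<^sup>2 \<le> real N ^ (p - 1)" and zN: "z N \<le> 1" for N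
  proof -
    let ?L = "real N powr \<epsilon>" and ?T = "{\<Gamma>. \<Gamma> \<subseteq> edges p N \<and> 5 \<le> card \<Gamma>}"
    have L: "?L \<ge> 1" using N \<epsilon> by (simp add: ge_one_powr_ge_zero)
    have w0: "w N \<Gamma> \<ge> 0" for \<Gamma> using hN by (simp add: w_def)
    have fT: "finite ?T" by (rule finite_subset[of _ "Pow (edges p N)"]) auto
    have split: "(\<Sum>\<Gamma>\<in>?T. w N \<Gamma>) = (\<Sum>\<Gamma>\<in>{\<Gamma>\<in>?T. ?L < real (card \<Gamma>)}. w N \<Gamma>) + (\<Sum>\<Gamma>\<in>{\<Gamma>\<in>?T. real (card \<Gamma>) \<le> ?L}. w N \<Gamma>)"
      using fT by (subst sum.union_disjoint[symmetric]) (auto intro!: sum.cong)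
    have "(\<Sum>\<Gamma>\<in>{\<Gamma>\<in>?T. ?L < real (card \<Gamma>)}. w N \<Gamma>)
       \<le> (\<Sum>\<Gamma>\<in>{\<Gamma>\<in>?T. ?L < real (card \<Gamma>)}. exp (- \<kappa> * ?L) * (tanh (h N) ^ card (bdry \<Gamma>) * (b'\<^sup>2 / real N ^ (p - 1)) ^ card \<Gamma>))"
    proof (rule sum_mono, safe)
      fix \<Gamma> :: "nat list set" assume k: "?L < real (card \<Gamma>)"
      have "r ^ card \<Gamma> = exp (- \<kappa> * real (card \<Gamma>))" using r by (simp add: \<kappa>_def exp_of_nat2_mult)
      also have "\<dots> \<le> exp (- \<kappa> * ?L)" using k \<kappa> by simp
      finally have rk: "r ^ card \<Gamma> \<le> exp (- \<kappa> * ?L)" .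
      have "b\<^sup>2 / real N ^ (p - 1) = r * (b'\<^sup>2 / real N ^ (p - 1))"
        using b b' by (simp add: r_def power_divide)
      then have "(b\<^sup>2 / real N ^ (p - 1)) ^ card \<Gamma> = r ^ card \<Gamma> * (b'\<^sup>2 / real N ^ (p - 1)) ^ card \<Gamma>"
        by (simp only: power_mult_distrib)
      then have "w N \<Gamma> = r ^ card \<Gamma> * (tanh (h N) ^ card (bdry \<Gamma>) * (b'\<^sup>2 / real N ^ (p - 1)) ^ card \<Gamma>)"
        by (simp only: w_def mult_ac)
      also have "\<dots> \<le> exp (- \<kappa> * ?L) * (tanh (h N) ^ card (bdry \<Gamma>) * (b'\<^sup>2 / real N ^ (p - 1)) ^ card \<Gamma>)"
        using hN by (intro mult_right_mono rk mult_nonneg_nonneg zero_le_power) auto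
      finally show "w N \<Gamma> \<le> \<dots>" .
    qed
    also have "\<dots> \<le> (\<Sum>\<Gamma>\<in>Pow (edges p N). exp (- \<kappa> * ?L) * (tanh (h N) ^ card (bdry \<Gamma>) * (b'\<^sup>2 / real N ^ (p - 1)) ^ card \<Gamma>))"
      using hN by (intro sum_mono2) auto
    also have "\<dots> \<le> exp (- \<kappa> * ?L) * (K * real N)"
      unfolding sum_distrib_left[symmetric] by (intro mult_left_mono K(2) N bN hN) auto
    finally have part1: "(\<Sum>\<Gamma>\<in>{\<Gamma>\<in>?T. ?L < real (card \<Gamma>)}. w N \<Gamma>) \<le> exp (- \<kappa> * ?L) * (K * real N)" .
    define M where "M = nat \<lfloor>?L\<rfloor>"
    have M: "real M \<le> ?L" by (simp add: M_def)
    have kM: "real k \<le> ?L \<longleftrightarrow> k \<le> M" for k by (simp add: M_def le_nat_floor le_floor_iff nat_le_iff le_nat_iff)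
    have z0: "z N > 0" using B N by (simp add: z_def)
    have "(\<Sum>\<Gamma>\<in>{\<Gamma>\<in>?T. real (card \<Gamma>) \<le> ?L}. w N \<Gamma>)
        = (\<Sum>k\<in>{5..M}. \<Sum>\<Gamma>\<in>{\<Gamma>\<in>{\<Gamma>\<in>?T. real (card \<Gamma>) \<le> ?L}. card \<Gamma> = k}. w N \<Gamma>)"
      using fT kM by (intro sum.group[symmetric]) auto
    also have "\<dots> \<le> (\<Sum>k\<in>{5..M}. (real p + 1) * ?L * z N ^ 5)"
    proof (rule sum_mono)
      fix k assume k: "k \<in> {5..M}"
      then have kL: "real k \<le> ?L" using kM by auto
      have "{\<Gamma>\<in>{\<Gamma>\<in>?T. real (card \<Gamma>) \<le> ?L}. card \<Gamma> = k} = {\<Gamma>. \<Gamma> \<subseteq> edges p N \<and> card \<Gamma> = k}" using k kL by auto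
      then have "(\<Sum>\<Gamma>\<in>{\<Gamma>\<in>{\<Gamma>\<in>?T. real (card \<Gamma>) \<le> ?L}. card \<Gamma> = k}. w N \<Gamma>)
         = (b\<^sup>2 / real N ^ (p - 1)) ^ k * (\<Sum>\<Gamma> | \<Gamma> \<subseteq> edges p N \<and> card \<Gamma> = k. tanh (h N) ^ card (bdry \<Gamma>))"
        by (simp add: w_def sum_distrib_left mult.commute)
      also have "\<dots> \<le> (b\<^sup>2 / real N ^ (p - 1)) ^ k * ((c * sqrt (real N) * real (k * p)) ^ (k * p) * (real (k * p) + 1))"
        by (intro mult_left_mono sum_clusters_bound N c hN) auto
      also have "\<dots> = (b\<^sup>2 / real N ^ (p - 1) * (c * sqrt (real N) * real (k * p)) ^ p) ^ k * (real k * real p + 1)"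
      proof -
        have "x ^ (k * p) = (x ^ p) ^ k" for x :: real by (simp add: power_mult[symmetric] mult.commute)
        then show ?thesis by (simp only: power_mult_distrib[of "b\<^sup>2 / real N ^ (p - 1)"] mult.assoc of_nat_mult)
      qed
      also have "\<dots> \<le> z N ^ k * ((real p + 1) * ?L)"
      proof (intro mult_mono power_mono)
        have "b\<^sup>2 / real N ^ (p - 1) * (c * sqrt (real N) * real (k * p)) ^ p
           \<le> b\<^sup>2 / real N ^ (p - 1) * (c * sqrt (real N) * (?L * real p)) ^ p"
          using kL c p by (intro mult_left_mono power_mono mult_right_mono) auto
        also have "\<dots> = B * (sqrt (real N) ^ p * ?L ^ p / real N ^ (p - 1))"
          by (simp add: B_def power_mult_distrib)
        also have "sqrt (real N) ^ p * ?L ^ p / real N ^ (p - 1) = real N powr (1 / 16 - (real p - 2) / 2)"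
        proof -
          have "sqrt (real N) ^ p = real N powr (real p / 2)"
            using N by (simp add: powr_half_sqrt[symmetric] powr_powr powr_realpow[symmetric])
          moreover have "?L ^ p = real N powr (1 / 16)"
            using N powr_power[of "real N" \<epsilon> p] unfolding \<epsilon>(3) by simp
          moreover have "real N ^ (p - 1) = real N powr (real p - 1)"
            using N p by (simp add: powr_realpow[symmetric] of_nat_diff)
          ultimately have "sqrt (real N) ^ p * ?L ^ p / real N ^ (p - 1) = real N powr (real p / 2 + 1 / 16 - (real p - 1))"
            by (simp only: powr_add powr_diff)
          also have "real p / 2 + 1 / 16 - (real p - 1) = 1 / 16 - (real p - 2) / 2" by (simp add: field_simps)
          finally show ?thesis .
        qed
        finally show "b\<^sup>2 / real N ^ (p - 1) * (c * sqrt (real N) * real (k * p)) ^ p \<le> z N" by (simp add: z_def)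
        have "real k * real p \<le> ?L * real p" using kL by (intro mult_right_mono) auto
        then show "real k * real p + 1 \<le> (real p + 1) * ?L" using L by (simp add: algebra_simps)
      qed (use c z0 in auto)
      also have "\<dots> \<le> z N ^ 5 * ((real p + 1) * ?L)"
        using k z0 zN by (intro mult_right_mono power_decreasing) auto
      finally show "(\<Sum>\<Gamma>\<in>{\<Gamma>\<in>{\<Gamma>\<in>?T. real (card \<Gamma>) \<le> ?L}. card \<Gamma> = k}. w N \<Gamma>) \<le> (real p + 1) * ?L * z N ^ 5"
        by (simp add: mult_ac)
    qed
    also have "\<dots> \<le> ?L * ((real p + 1) * ?L * z N ^ 5)"
    proof -
      have "real (card {5..M}) \<le> ?L" using M by simp
      then show ?thesis using z0 by (simp only: sum_constant) (intro mult_right_mono, auto)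
    qed
    finally have part2: "(\<Sum>\<Gamma>\<in>{\<Gamma>\<in>?T. real (card \<Gamma>) \<le> ?L}. w N \<Gamma>) \<le> ?L * ((real p + 1) * ?L * z N ^ 5)" .
    have "real N powr g * (\<Sum>\<Gamma>\<in>?T. w N \<Gamma>) \<le> real N powr G * (\<Sum>\<Gamma>\<in>?T. w N \<Gamma>)"
      using N g w0 by (intro mult_right_mono powr_mono sum_nonneg) (auto simp: G_def)
    also have "\<dots> \<le> real N powr G * (exp (- \<kappa> * ?L) * (K * real N) + ?L * ((real p + 1) * ?L * z N ^ 5))"
      unfolding split by (intro mult_left_mono add_mono part1 part2) simp
    also have "\<dots> = U1 N + U2 N" by (simp add: U1_def U2_def distrib_left)
    finally show ?thesis .
  qed
  have "U1 \<longlonglongrightarrow> 0" unfolding U1_def using \<epsilon>(1) \<kappa> by real_asymp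
  moreover have "U2 \<longlonglongrightarrow> 0"
  proof -
    define \<delta> where "\<delta> = (real p - 2) / 2 - 5 / 16 - 2 * \<epsilon>"
    have "real p \<ge> 3" using p by simp
    then have \<delta>: "\<delta> > 0" using \<epsilon>(2) by (simp add: \<delta>_def field_simps)
    have "U2 N = ((real p + 1) * B ^ 5) * real N powr (- \<delta>)" if "N \<ge> 1" for N
    proof -
      have "z N ^ 5 = B ^ 5 * real N powr (5 * (1 / 16 - (real p - 2) / 2))"
        using that powr_power[of "real N" "1 / 16 - (real p - 2) / 2" 5] by (simp add: z_def power_mult_distrib)
      then have "U2 N = ((real p + 1) * B ^ 5) * (real N powr G * real N powr \<epsilon> * real N powr \<epsilon> * real N powr (5 * (1 / 16 - (real p - 2) / 2)))"
        by (simp add: U2_def mult_ac)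
      also have "real N powr G * real N powr \<epsilon> * real N powr \<epsilon> * real N powr (5 * (1 / 16 - (real p - 2) / 2)) = real N powr (- \<delta>)"
        unfolding powr_add[symmetric] by (rule arg_cong[where f="\<lambda>x. real N powr x"]) (simp add: G_def \<delta>_def field_simps)
      finally show ?thesis .
    qed
    then have ev: "\<forall>\<^sub>F N in sequentially. ((real p + 1) * B ^ 5) * real N powr (- \<delta>) = U2 N"
      by (intro eventually_sequentiallyI[of 1]) simp
    have "(\<lambda>N. ((real p + 1) * B ^ 5) * real N powr (- \<delta>)) \<longlonglongrightarrow> 0" using \<delta> by real_asymp
    then show ?thesis by (rule Lim_transform_eventually[OF _ ev])
  qed
  ultimately have U: "(\<lambda>N. U1 N + U2 N) \<longlonglongrightarrow> 0" using tendsto_add_zero by blast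
  have "z \<longlonglongrightarrow> 0"
  proof -
    have "1 / 16 - (real p - 2) / 2 < 0" using p by (simp add: field_simps)
    then show ?thesis unfolding z_def by real_asymp
  qed
  then have zev: "\<forall>\<^sub>F N in sequentially. z N \<le> 1"
    by (rule eventually_mono[OF order_tendstoD(2)[of _ _ _ 1]]) auto
  have bev: "\<forall>\<^sub>F N in sequentially. b'\<^sup>2 \<le> real N ^ (p - 1)"
  proof -
    have "filterlim (\<lambda>N::nat. real N ^ (p - 1)) at_top sequentially"
      using p by (intro filterlim_pow_at_top filterlim_real_sequentially) auto
    then show ?thesis by (simp add: filterlim_at_top)
  qed
  show ?thesis
  proof (rule tendsto_sandwich[OF _ _ tendsto_const U])
    show "\<forall>\<^sub>F N in sequentially. real N powr g * (\<Sum>\<Gamma> | \<Gamma> \<subseteq> edges p N \<and> 5 \<le> card \<Gamma>.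
            tanh (h N) ^ card (bdry \<Gamma>) * (b\<^sup>2 / real N ^ (p - 1)) ^ card \<Gamma>) \<le> U1 N + U2 N"
      using h zev bev eventually_ge_at_top[of 1]
      by eventually_elim (use bound in \<open>auto simp: w_def\<close>)
    show "\<forall>\<^sub>F N in sequentially. 0 \<le> real N powr g * (\<Sum>\<Gamma> | \<Gamma> \<subseteq> edges p N \<and> 5 \<le> card \<Gamma>.
            tanh (h N) ^ card (bdry \<Gamma>) * (b\<^sup>2 / real N ^ (p - 1)) ^ card \<Gamma>)"
      using h by eventually_elim (auto intro!: mult_nonneg_nonneg sum_nonneg)
  qed
qed

section \<open>Hermite polynomials under the normal law\<close>

definition gaussE :: "real poly \<Rightarrow> real" where
  "gaussE q = (LINT x|std_normal_distribution. poly q x)"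

lemma integrable_poly_normal: "integrable std_normal_distribution (poly q)"
  unfolding poly_altdef[abs_def]
  by (intro Bochner_Integration.integrable_sum integrable_mult_right integrable_std_normal_distribution_moment)

lemma gaussE_add: "gaussE (q + r) = gaussE q + gaussE r"
  unfolding gaussE_def poly_add by (intro Bochner_Integration.integral_add integrable_poly_normal)

lemma gaussE_smult: "gaussE (smult a q) = a * gaussE q"
  unfolding gaussE_def poly_smult by simp

lemma gaussE_diff: "gaussE (q - r) = gaussE q - gaussE r"
  unfolding gaussE_def poly_diff by (intro Bochner_Integration.integral_diff integrable_poly_normal)

lemma gaussE_0 [simp]: "gaussE 0 = 0" by (simp add: gaussE_def)

lemma gaussE_sum: "gaussE (\<Sum>i\<in>I. f i) = (\<Sum>i\<in>I. gaussE (f i))"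
  by (induction I rule: infinite_finite_induct) (simp_all add: gaussE_add)

lemma gaussE_1 [simp]: "gaussE 1 = 1"
proof -
  interpret real_distribution std_normal_distribution by (rule real_dist_normal_dist)
  have "poly 1 = (\<lambda>_::real. 1::real)" by auto
  then show ?thesis unfolding gaussE_def using prob_space by simp
qed

lemma gaussE_monom: "gaussE (monom a n) = a * (LINT x|std_normal_distribution. x ^ n)"
  by (simp add: gaussE_def poly_monom)

lemma normal_moment_Suc:
  "(LINT x|std_normal_distribution. x ^ Suc n) = real n * (LINT x|std_normal_distribution. x ^ (n - 1))"
proof (cases "even n")
  case True
  then show ?thesis
    using integral_std_normal_distribution_moment_odd[of "Suc n"] integral_std_normal_distribution_moment_odd[of "n - 1"]
    by (cases "n = 0") auto
next
  case False
  then obtain k where n: "n = 2 * k + 1" by (elim oddE)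
  then have "Suc n = 2 * Suc k" "n - 1 = 2 * k" by auto
  then have m1: "(LINT x|std_normal_distribution. x ^ Suc n) = fact (2 * Suc k) / (2 ^ Suc k * fact (Suc k))"
    and m: "(LINT x|std_normal_distribution. x ^ (n - 1)) = fact (2 * k) / (2 ^ k * fact k)"
    using std_normal_distribution_even_moments(1)[of "Suc k"] std_normal_distribution_even_moments(1)[of k]
    by simp_all
  have f1: "fact (2 * Suc k) = (2 * real k + 2) * ((2 * real k + 1) * fact (2 * k))" by (simp add: algebra_simps)
  have f2: "2 ^ Suc k * fact (Suc k) = (2 * real k + 2) * (2 ^ k * fact k)" by (simp add: algebra_simps)
  note m1[unfolded f1 f2]
  also have "((2 * real k + 2) * ((2 * real k + 1) * fact (2 * k))) / ((2 * real k + 2) * (2 ^ k * fact k))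
      = ((2 * real k + 1) * fact (2 * k)) / (2 ^ k * fact k)"
    by (rule mult_divide_mult_cancel_left) simp
  finally have "(LINT x|std_normal_distribution. x ^ Suc n) = (2 * real k + 1) * (LINT x|std_normal_distribution. x ^ (n - 1))"
    unfolding m by simp
  then show ?thesis by (simp add: n)
qed

text \<open>
  Gaussian integration by parts, read off from the moments.
\<close>
lemma gaussE_mult_X: "gaussE (pCons 0 q) = gaussE (pderiv q)"
proof -
  have m: "gaussE (pCons 0 (monom a n)) = gaussE (pderiv (monom a n))" for a n
    using normal_moment_Suc[of n] by (simp add: pderiv_monom gaussE_monom flip: monom_Suc)
  have q: "q = (\<Sum>i\<le>degree q. monom (coeff q i) i)" by (simp add: poly_as_sum_of_monoms)
  have pC: "pCons 0 (\<Sum>i\<in>I. f i) = (\<Sum>i\<in>I. pCons 0 (f i))" for I :: "nat set" and f :: "nat \<Rightarrow> real poly"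
    by (induction I rule: infinite_finite_induct) (simp_all, metis add_pCons add.right_neutral)
  have pd: "pderiv (\<Sum>i\<in>I. f i) = (\<Sum>i\<in>I. pderiv (f i))" for I :: "nat set" and f :: "nat \<Rightarrow> real poly"
    by (induction I rule: infinite_finite_induct) (simp_all add: pderiv_add)
  have "gaussE (pCons 0 (\<Sum>i\<le>degree q. monom (coeff q i) i)) = gaussE (pderiv (\<Sum>i\<le>degree q. monom (coeff q i) i))"
    unfolding pC pd gaussE_sum m ..
  then show ?thesis unfolding q[symmetric] .
qed

lemma hermite_rec: "hermite (Suc (Suc n)) = pCons 0 (hermite (Suc n)) - smult (real (Suc n)) (hermite n)"
  by simp

declare hermite.simps(3) [simp del]

lemma hermite_rec': "hermite (Suc n) = pCons 0 (hermite n) - smult (real n) (hermite (n - 1))"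
  by (cases n) (simp_all add: hermite_rec)

lemma pderiv_hermite: "pderiv (hermite n) = smult (real n) (hermite (n - 1))"
proof (induction n rule: hermite.induct)
  case (3 n)
  have "pderiv (hermite (Suc (Suc n))) = hermite (Suc n) + pCons 0 (pderiv (hermite (Suc n))) - smult (real (Suc n)) (pderiv (hermite n))"
    by (simp only: hermite_rec[of n] pderiv_diff pderiv_smult pderiv_pCons)
  also have "\<dots> = hermite (Suc n) + smult (real (Suc n)) (pCons 0 (hermite n) - smult (real n) (hermite (n - 1)))"
    by (simp only: 3 diff_Suc_1 smult_diff_right smult_pCons mult_zero_right add_diff_eq)
  also have "\<dots> = hermite (Suc n) + smult (real (Suc n)) (hermite (Suc n))"
    by (simp only: hermite_rec'[symmetric])
  also have "\<dots> = smult (1 + real (Suc n)) (hermite (Suc n))" by (simp only: smult_add_left smult_1_left)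
  finally show ?case by simp
qed (auto simp: pderiv_pCons)

text \<open>
  The Hermite polynomials are generated by the adjoint \<open>q \<mapsto> X q - q'\<close> of the derivative.
\<close>
lemma hermite_Suc: "hermite (Suc n) = pCons 0 (hermite n) - pderiv (hermite n)"
  by (simp only: hermite_rec'[of n] pderiv_hermite)

lemma degree_lead_hermite: "degree (hermite n) = n \<and> coeff (hermite n) n = 1"
proof (induction n)
  case (Suc n)
  have d: "degree (pderiv (hermite n)) < Suc n" using Suc by (simp add: degree_pderiv)
  have "degree (pCons 0 (hermite n)) = Suc n" using Suc by (auto simp: degree_pCons_eq)
  then have "degree (hermite (Suc n)) = Suc n"
    unfolding hermite_Suc diff_conv_add_uminus using d by (subst degree_add_eq_left) auto
  moreover have "coeff (hermite (Suc n)) (Suc n) = 1"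
    unfolding hermite_Suc using d Suc by (simp add: coeff_eq_0)
  ultimately show ?case by simp
qed simp

text \<open>
  Up to a factorial, the linearisation coefficients of products of Hermite polynomials; integration by parts gives a
  recurrence with nonnegative coefficients, from which their signs can be read off.
\<close>
definition hermite3 :: "nat \<Rightarrow> nat \<Rightarrow> nat \<Rightarrow> real" where
  "hermite3 a b c = gaussE (hermite a * hermite b * hermite c)"

lemma hermite3_Suc: "hermite3 (Suc a) b c = real b * hermite3 a (b - 1) c + real c * hermite3 a b (c - 1)"
proof -
  have "hermite3 (Suc a) b c = gaussE (pCons 0 (hermite a * hermite b * hermite c)) - gaussE (pderiv (hermite a) * hermite b * hermite c)"
    unfolding hermite3_def hermite_Suc by (simp add: left_diff_distrib gaussE_diff)
  also have "gaussE (pCons 0 (hermite a * hermite b * hermite c)) = gaussE (pderiv (hermite a * hermite b * hermite c))"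
    by (rule gaussE_mult_X)
  also have "pderiv (hermite a * hermite b * hermite c)
      = pderiv (hermite a) * hermite b * hermite c + smult (real b) (hermite a * hermite (b - 1) * hermite c)
        + smult (real c) (hermite a * hermite b * hermite (c - 1))"
    by (simp add: pderiv_mult pderiv_hermite[of b] pderiv_hermite[of c] algebra_simps)
  finally show ?thesis by (simp add: gaussE_add gaussE_smult hermite3_def)
qed

lemma hermite3_commute: "hermite3 a b c = hermite3 b a c"
  by (simp add: hermite3_def mult.commute)

lemma hermite3_0: "hermite3 b 0 c = (if b = c then fact b else 0)"
proof (induction b arbitrary: c)
  case 0
  show ?case
  proof (cases c)
    case (Suc c')
    have "hermite3 0 0 c = hermite3 (Suc c') 0 0" by (simp add: hermite3_def Suc mult_ac)
    then show ?thesis using Suc by (simp add: hermite3_Suc)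
  qed (simp add: hermite3_def)
next
  case (Suc b)
  then show ?case by (cases c) (auto simp: hermite3_Suc)
qed

lemma gaussE_hermite: "gaussE (hermite n) = (if n = 0 then 1 else 0)"
  using hermite3_0[of n 0] by (simp add: hermite3_def)

lemma gaussE_hermite_square: "gaussE (hermite n * hermite n) = fact n"
  using hermite3_0[of n n] by (simp add: hermite3_def)

lemma hermite3_nonneg: "0 \<le> hermite3 a b c"
proof (induction a arbitrary: b c)
  case 0
  show ?case unfolding hermite3_commute[of 0] hermite3_0 by simp
qed (simp add: hermite3_Suc)

text \<open>
  One of the two terms of the recurrence again satisfies the parity and triangle conditions.
\<close>
lemma hermite3_pos:
  "even (a + b + c) \<Longrightarrow> a \<le> b + c \<Longrightarrow> b \<le> a + c \<Longrightarrow> c \<le> a + b \<Longrightarrow> 0 < hermite3 a b c"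
proof (induction a arbitrary: b c)
  case 0
  then show ?case unfolding hermite3_commute[of 0] hermite3_0 by simp
next
  case (Suc a)
  show ?case
  proof (cases "b > 0 \<and> c \<le> a + (b - 1)")
    case True
    then have "0 < hermite3 a (b - 1) c" using Suc.prems by (intro Suc.IH) auto
    then show ?thesis unfolding hermite3_Suc using True hermite3_nonneg by (intro add_pos_nonneg) auto
  next
    case False
    have c: "c = Suc (a + b)"
    proof (rule ccontr)
      assume "c \<noteq> Suc (a + b)"
      then have "c = a + b" using False Suc.prems by (cases b) auto
      then show False using Suc.prems(1) by simp
    qed
    then have "c > 0" "0 < hermite3 a b (c - 1)" by (auto intro!: Suc.IH)
    then show ?thesis unfolding hermite3_Suc using hermite3_nonneg by (intro add_nonneg_pos) auto
  qed
qed

lemma hermite3_top: "hermite3 (b + c) b c = fact (b + c)"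
proof -
  have "a = b + c \<Longrightarrow> hermite3 a b c = fact a" for a
  proof (induction a arbitrary: b c)
    case 0
    then show ?case by (simp add: hermite3_0)
  next
    case (Suc a)
    have b: "real b * hermite3 a (b - 1) c = real b * fact a"
    proof (cases "b = 0")
      case False
      then have "a = (b - 1) + c" using Suc.prems by simp
      from Suc.IH[OF this] show ?thesis by simp
    qed simp
    have c: "real c * hermite3 a b (c - 1) = real c * fact a"
    proof (cases "c = 0")
      case False
      then have "a = b + (c - 1)" using Suc.prems by simp
      from Suc.IH[OF this] show ?thesis by simp
    qed simp
    have "real b + real c = real (Suc a)" using Suc.prems by simp
    then show ?case unfolding hermite3_Suc[of a b c] b c distrib_right[symmetric] fact_Suc by (simp only:)
  qed
  then show ?thesis by simp
qed

lemma gaussE_nonneg: "(\<And>x. 0 \<le> poly q x) \<Longrightarrow> 0 \<le> gaussE q"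
  unfolding gaussE_def by (rule Bochner_Integration.integral_nonneg) auto

lemma poly_square_expand:
  fixes q k :: "real poly"
  shows "(q * q - k - [:f:]) * (q * q - k - [:f:])
     = q ^ 4 + k * k + smult (f\<^sup>2) 1 - smult 2 (k * q * q) - smult (2 * f) (q * q) + smult (2 * f) k"
proof -
  have "poly ((q * q - k - [:f:]) * (q * q - k - [:f:])) x
     = poly (q ^ 4 + k * k + smult (f\<^sup>2) 1 - smult 2 (k * q * q) - smult (2 * f) (q * q) + smult (2 * f) k) x" for x
    by (simp add: poly_power) (simp add: power4_eq_xxxx power2_eq_square algebra_simps)
  then show ?thesis by (intro poly_eq_poly_eq_iff[THEN iffD1] ext)
qed

text \<open>
  Bessel's inequality: the projections of \<open>hermite p ^ 2\<close> to \<open>1\<close> and to \<open>hermite (2 * p)\<close> are \<open>fact p\<close> and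
  \<open>hermite (2 * p)\<close> itself, so the fourth moment is at least \<open>(fact p)\<^sup>2 + fact (2 * p)\<close>.
\<close>
lemma gaussE_hermite_fourth:
  assumes "p \<ge> 2" shows "gaussE (hermite p ^ 4) > 3 * (fact p)\<^sup>2"
proof -
  let ?H = "hermite p * hermite p" and ?K = "hermite (2 * p)"
  have t: "gaussE (?K * hermite p * hermite p) = fact (2 * p)"
    using hermite3_top[of p p] unfolding hermite3_def mult_2 by simp
  have k0: "gaussE ?K = 0" using assms by (simp add: gaussE_hermite)
  (* the squared norm of the component orthogonal to both projections *)
  have "0 \<le> gaussE ((?H - ?K - [:fact p:]) * (?H - ?K - [:fact p:]))" by (rule gaussE_nonneg) simp
  also have "gaussE ((?H - ?K - [:fact p:]) * (?H - ?K - [:fact p:])) = gaussE (hermite p ^ 4) + fact (2 * p) + (fact p)\<^sup>2 - 2 * fact (2 * p) - 2 * fact p * fact p"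
    unfolding poly_square_expand gaussE_add gaussE_diff gaussE_smult gaussE_hermite_square gaussE_1 t k0 by simp
  finally have 1: "gaussE (hermite p ^ 4) \<ge> fact (2 * p) + (fact p)\<^sup>2" by (simp add: power2_eq_square)
  have "fact (2 * p) = fact p * fact p * real (2 * p choose p)"
    using binomial_fact_lemma[of p "2 * p"] by (metis diff_add_inverse le_add1 mult_2 of_nat_fact of_nat_mult)
  moreover have "real (2 * p choose p) > 2"
  proof -
    have "2 * p choose 1 < 2 * p choose p" using assms by (intro binomial_strict_mono) auto
    then show ?thesis using assms by simp
  qed
  then have "(fact p * fact p) * real (2 * p choose p) > (fact p * fact p) * 2"
    by (intro mult_strict_left_mono) auto
  ultimately show ?thesis using 1 unfolding power2_eq_square by linarith
qed

section \<open>Moments of the simple random walk\<close>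

text \<open>
  Polynomials of bounded degree whose coefficients converge. This is the mode of convergence under which
  expectations pass to the limit once all moments converge.
\<close>
definition coeff_conv :: "(nat \<Rightarrow> real poly) \<Rightarrow> real poly \<Rightarrow> bool" where
  "coeff_conv qs q \<longleftrightarrow> (\<exists>d. \<forall>N. degree (qs N) \<le> d) \<and> (\<forall>i. (\<lambda>N. coeff (qs N) i) \<longlonglongrightarrow> coeff q i)"

lemma coeff_conv_const: "coeff_conv (\<lambda>_. q) q"
  by (auto simp: coeff_conv_def)

lemma coeff_conv_diff:
  assumes "coeff_conv qs q" "coeff_conv rs r" shows "coeff_conv (\<lambda>N. qs N - rs N) (q - r)"
proof -
  obtain d e where "\<And>N. degree (qs N) \<le> d" "\<And>N. degree (rs N) \<le> e" using assms unfolding coeff_conv_def by blast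
  then have "degree (qs N - rs N) \<le> max d e" for N
    by (intro order_trans[OF degree_diff_le_max]) (meson max.mono)
  then show ?thesis using assms unfolding coeff_conv_def by (auto intro!: tendsto_diff)
qed

lemma coeff_conv_mult:
  assumes "coeff_conv qs q" "coeff_conv rs r" shows "coeff_conv (\<lambda>N. qs N * rs N) (q * r)"
proof -
  obtain d e where "\<And>N. degree (qs N) \<le> d" "\<And>N. degree (rs N) \<le> e" using assms unfolding coeff_conv_def by blast
  then have "degree (qs N * rs N) \<le> d + e" for N
    by (intro order_trans[OF degree_mult_le] add_mono)
  moreover have "(\<lambda>N. coeff (qs N * rs N) i) \<longlonglongrightarrow> coeff (q * r) i" for i
    unfolding coeff_mult using assms by (intro tendsto_sum tendsto_mult) (auto simp: coeff_conv_def)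
  ultimately show ?thesis unfolding coeff_conv_def by blast
qed

lemma coeff_conv_smult:
  assumes "coeff_conv qs q" "a \<longlonglongrightarrow> b" shows "coeff_conv (\<lambda>N. smult (a N) (qs N)) (smult b q)"
proof -
  obtain d where "\<And>N. degree (qs N) \<le> d" using assms unfolding coeff_conv_def by blast
  then have "degree (smult (a N) (qs N)) \<le> d" for N
    by (intro order_trans[OF degree_smult_le])
  then show ?thesis using assms unfolding coeff_conv_def by (auto intro!: tendsto_mult)
qed

text \<open>
  The normalised Krawtchouk polynomials for \<open>n\<close> signs, evaluated at the polynomial \<open>R\<close>. The argument \<open>R\<close>
  is carried along because for the hyperedges the normalised sum is itself such a polynomial in the sum of the spins.
\<close>
fun krawtchouk :: "real \<Rightarrow> real poly \<Rightarrow> nat \<Rightarrow> real poly" where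
  "krawtchouk n R 0 = 1"
| "krawtchouk n R (Suc 0) = R"
| "krawtchouk n R (Suc (Suc k)) = R * krawtchouk n R (Suc k) - smult (real (Suc k) * (1 - real k / n)) (krawtchouk n R k)"

declare krawtchouk.simps(3) [simp del]

lemma coeff_conv_krawtchouk:
  assumes R: "coeff_conv R r" and n: "filterlim n at_top sequentially"
  shows "coeff_conv (\<lambda>N. krawtchouk (n N) (R N) k) (pcompose (hermite k) r)"
proof (induction k rule: hermite.induct)
  case 1
  show ?case by (simp add: coeff_conv_const pcompose_1)
next
  case 2
  show ?case using R by (simp add: pcompose_pCons)
next
  case (3 k)
  have "(\<lambda>N. real k / n N) \<longlonglongrightarrow> 0" by (rule tendsto_divide_0[OF tendsto_const filterlim_at_top_imp_at_infinity[OF n]])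
  then have "(\<lambda>N. real (Suc k) * (1 - real k / n N)) \<longlonglongrightarrow> real (Suc k) * (1 - 0)"
    by (intro tendsto_intros)
  then have "coeff_conv (\<lambda>N. krawtchouk (n N) (R N) (Suc (Suc k)))
     (r * pcompose (hermite (Suc k)) r - smult (real (Suc k) * (1 - 0)) (pcompose (hermite k) r))"
    unfolding krawtchouk.simps(3) by (intro coeff_conv_diff coeff_conv_mult coeff_conv_smult R 3)
  moreover have "r * pcompose (hermite (Suc k)) r - smult (real (Suc k) * (1 - 0)) (pcompose (hermite k) r)
     = pcompose (hermite (Suc (Suc k))) r"
    by (simp add: hermite_rec pcompose_diff pcompose_smult pcompose_pCons)
  ultimately show ?case by simp
qed

text \<open>
  Up to normalisation, the recurrence of the elementary symmetric polynomials is the one that defines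
  \<open>krawtchouk\<close>.
\<close>
lemma poly_krawtchouk_esym:
  assumes I: "finite I" "I \<noteq> {}" and x: "\<And>i. i \<in> I \<Longrightarrow> x i ^ 2 = 1"
    and R: "poly R y = (\<Sum>i\<in>I. x i) / sqrt (real (card I))"
  shows "poly (krawtchouk (real (card I)) R k) y = fact k * esym k x I / sqrt (real (card I)) ^ k"
proof (induction k rule: hermite.induct)
  case 1
  show ?case using I by (simp add: esym_0)
next
  case 2
  show ?case using I R by (simp add: esym_1)
next
  case (3 k)
  define n where "n = real (card I)"
  define s where "s = sqrt n"
  have n: "n > 0" using I by (simp add: n_def card_gt_0_iff)
  have s: "s > 0" "s * s = n" using n by (auto simp: s_def)
  have rec: "(\<Sum>i\<in>I. x i) * esym (Suc k) x I = real (k + 2) * esym (Suc (Suc k)) x I + (n - real k) * esym k x I"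
    using esym_recurrence[OF I(1) x, where k=k] I by (simp add: esym_1 n_def)
  have "poly (krawtchouk n R (Suc (Suc k))) y
     = (\<Sum>i\<in>I. x i) / s * (fact (Suc k) * esym (Suc k) x I / s ^ Suc k)
       - real (Suc k) * (1 - real k / n) * (fact k * esym k x I / s ^ k)"
    using 3 R by (simp add: krawtchouk.simps(3) n_def s_def)
  also have "(\<Sum>i\<in>I. x i) / s * (fact (Suc k) * esym (Suc k) x I / s ^ Suc k)
     = fact (Suc k) * ((\<Sum>i\<in>I. x i) * esym (Suc k) x I) / s ^ (k + 2)"
    by (simp add: field_simps)
  also have "real (Suc k) * (1 - real k / n) * (fact k * esym k x I / s ^ k)
     = fact (Suc k) * ((n - real k) * esym k x I) / s ^ (k + 2)"
  proof -
    have "1 - real k / n = (n - real k) / (s * s)" using n s(2) by (simp add: field_simps)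
    then show ?thesis by (simp add: power_add power2_eq_square mult_ac)
  qed
  finally show ?case unfolding rec n_def[symmetric] s_def[symmetric]
    by (simp add: diff_divide_distrib[symmetric] algebra_simps)
qed

text \<open>
  Expectation of a function of the normalised endpoint of a simple random walk, that is, of independent
  uniform signs.
\<close>
definition walkE :: "nat \<Rightarrow> (real \<Rightarrow> real) \<Rightarrow> real" where
  "walkE N f = measure_pmf.expectation (spins_pmf N 0) (\<lambda>\<sigma>. f ((\<Sum>v\<in>{1..N}. \<sigma> v) / sqrt (real N)))"

lemma walkE_poly: "degree q \<le> d \<Longrightarrow> walkE N (poly q) = (\<Sum>i\<le>d. coeff q i * walkE N (\<lambda>x. x ^ i))"
proof -
  assume "degree q \<le> d"
  then have "poly q x = (\<Sum>i\<le>d. coeff q i * x ^ i)" for x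
    unfolding poly_altdef by (intro sum.mono_neutral_left) (auto simp: coeff_eq_0)
  then show ?thesis unfolding walkE_def by (simp only: expectation_spins_sum integral_mult_right_zero)
qed

lemma expectation_esym: "measure_pmf.expectation (spins_pmf N 0) (\<lambda>\<sigma>. esym (Suc k) \<sigma> {1..N}) = 0"
proof -
  have "measure_pmf.expectation (spins_pmf N 0) (\<lambda>\<sigma>. \<Prod>v\<in>B. \<sigma> v) = 0"
    if B: "B \<subseteq> {1..N}" "card B = Suc k" for B
  proof -
    have "(\<Prod>v\<in>B. \<sigma> v) = (\<Prod>v\<in>{1..N}. \<sigma> v ^ of_bool (v \<in> B))" for \<sigma> :: "nat \<Rightarrow> real"
      using B by (intro prod.mono_neutral_cong_left) auto
    moreover have "{v \<in> {1..N}. odd (of_bool (v \<in> B) :: nat)} = B" using B by auto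
    ultimately show ?thesis using B expectation_spins_powers[of N 0 "\<lambda>v. of_bool (v \<in> B)"] by (simp only:) simp
  qed
  then show ?thesis unfolding esym_def expectation_spins_sum by (intro sum.neutral) auto
qed

lemma spins_square: "\<sigma> \<in> set_pmf (spins_pmf N h) \<Longrightarrow> v \<in> {1..N} \<Longrightarrow> \<sigma> v ^ 2 = 1"
  using set_spins_pmf by fastforce

lemma walkE_krawtchouk:
  assumes "N \<ge> 1" shows "walkE N (poly (krawtchouk (real N) [:0, 1:] (Suc k))) = 0"
proof -
  have "walkE N (poly (krawtchouk (real N) [:0, 1:] (Suc k)))
     = measure_pmf.expectation (spins_pmf N 0) (\<lambda>\<sigma>. fact (Suc k) / sqrt (real N) ^ Suc k * esym (Suc k) \<sigma> {1..N})"
    unfolding walkE_def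
  proof (intro integral_cong_AE AE_pmfI)
    fix \<sigma> assume "\<sigma> \<in> set_pmf (spins_pmf N 0)"
    then show "poly (krawtchouk (real N) [:0, 1:] (Suc k)) ((\<Sum>v\<in>{1..N}. \<sigma> v) / sqrt (real N))
       = fact (Suc k) / sqrt (real N) ^ Suc k * esym (Suc k) \<sigma> {1..N}"
      using poly_krawtchouk_esym[of "{1..N}" \<sigma> "[:0, 1:]" "(\<Sum>v\<in>{1..N}. \<sigma> v) / sqrt (real N)" "Suc k"]
        spins_square assms by simp
  qed simp_all
  also have "\<dots> = fact (Suc k) / sqrt (real N) ^ Suc k * measure_pmf.expectation (spins_pmf N 0) (\<lambda>\<sigma>. esym (Suc k) \<sigma> {1..N})"
    by (rule integral_mult_right_zero)
  finally show ?thesis unfolding expectation_esym by simp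
qed

text \<open>
  Convergence of the moments of the random walk, by induction on the degree. The Krawtchouk polynomial of degree
  \<open>n + 1\<close> has mean exactly zero and differs from the Hermite polynomial, whose normal mean is zero too, by a
  polynomial of lower degree whose coefficients tend to zero.
\<close>
lemma walkE_tendsto_aux:
  "degree q \<le> n \<Longrightarrow> (\<lambda>N. walkE N (poly q)) \<longlonglongrightarrow> gaussE q"
proof (induction n arbitrary: q)
  case 0
  then obtain a where q: "q = [:a:]" by (auto elim: degree_eq_zeroE)
  have "[:a:] = smult a 1" by simp
  then have "gaussE q = a" unfolding q gaussE_smult by (metis gaussE_1 gaussE_smult mult.right_neutral)
  moreover have "walkE N (poly q) = a" for N unfolding walkE_def q by simp
  ultimately show ?case by simp
next
  case (Suc n)
  let ?H = "hermite (Suc n)"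
  define D where "D N = ?H - krawtchouk (real N) [:0, 1:] (Suc n)" for N
  have X: "degree (krawtchouk m [:0,1:] k) = k \<and> coeff (krawtchouk m [:0,1:] k) k = 1" for m k
  proof (induction k rule: hermite.induct)
    case (3 k)
    have "degree ([:0, 1:] * krawtchouk m [:0, 1:] (Suc k)) = Suc (Suc k)"
      using 3 by (subst degree_mult_eq) auto
    moreover have "degree (smult (real (Suc k) * (1 - real k / m)) (krawtchouk m [:0,1:] k)) < Suc (Suc k)"
      using 3 by (intro le_less_trans[OF degree_smult_le]) simp
    moreover have "coeff ([:0, 1:] * krawtchouk m [:0, 1:] (Suc k)) (Suc (Suc k)) = 1" using 3 by simp
    moreover have "coeff (krawtchouk m [:0,1:] k) (Suc (Suc k)) = 0" using 3 by (intro coeff_eq_0) simp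
    ultimately show ?case unfolding krawtchouk.simps(3) diff_conv_add_uminus
      by (subst degree_add_eq_left) (auto simp: coeff_eq_0)
  qed simp_all
  have degD: "degree (D N) \<le> n" for N
  proof (rule degree_le, intro allI impI)
    fix i assume "n < i"
    then show "coeff (D N) i = 0"
      using X[of "real N" "Suc n"] degree_lead_hermite[of "Suc n"]
      by (cases "i = Suc n") (auto simp: D_def coeff_eq_0)
  qed
  have "coeff_conv D (?H - pcompose ?H [:0, 1:])"
    unfolding D_def[abs_def] by (intro coeff_conv_diff coeff_conv_const coeff_conv_krawtchouk filterlim_real_sequentially)
  then have c0: "(\<lambda>N. coeff (D N) i) \<longlonglongrightarrow> 0" for i by (simp add: coeff_conv_def)
  have mon: "(\<lambda>N. walkE N (\<lambda>x. x ^ i)) \<longlonglongrightarrow> gaussE (monom 1 i)" if "i \<le> n" for i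
    using Suc.IH[of "monom 1 i"] that by (simp add: degree_monom_eq poly_monom[abs_def])
  have "(\<lambda>N. \<Sum>i\<le>n. coeff (D N) i * walkE N (\<lambda>x. x ^ i)) \<longlonglongrightarrow> (\<Sum>i\<le>n. 0 * gaussE (monom 1 i))"
    by (intro tendsto_sum tendsto_mult c0 mon) auto
  then have "(\<lambda>N. walkE N (poly (D N))) \<longlonglongrightarrow> 0" unfolding walkE_poly[OF degD] by simp
  moreover have "\<forall>\<^sub>F N in sequentially. walkE N (poly (D N)) = walkE N (poly ?H)"
  proof (rule eventually_sequentiallyI[of 1])
    fix N :: nat assume N: "1 \<le> N"
    have "walkE N (poly (D N)) = walkE N (poly ?H) - walkE N (poly (krawtchouk (real N) [:0, 1:] (Suc n)))"
      unfolding walkE_def D_def by simp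
    then show "walkE N (poly (D N)) = walkE N (poly ?H)" using walkE_krawtchouk[OF N] by simp
  qed
  ultimately have H: "(\<lambda>N. walkE N (poly ?H)) \<longlonglongrightarrow> 0" by (rule Lim_transform_eventually)
  define a where "a = coeff q (Suc n)"
  define r where "r = q - smult a ?H"
  have "degree r \<le> n"
  proof (rule degree_le, intro allI impI)
    fix i assume "n < i"
    then show "coeff r i = 0"
      using Suc.prems degree_lead_hermite[of "Suc n"]
      by (cases "i = Suc n") (auto simp: r_def a_def coeff_eq_0)
  qed
  then have lim: "(\<lambda>N. a * walkE N (poly ?H) + walkE N (poly r)) \<longlonglongrightarrow> a * 0 + gaussE r"
    by (intro tendsto_intros H Suc.IH)
  have q: "q = smult a ?H + r" by (simp add: r_def)
  have rq: "walkE N (poly q) = a * walkE N (poly ?H) + walkE N (poly r)" for N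
    unfolding q walkE_def by simp
  have gq: "gaussE q = a * 0 + gaussE r" unfolding q gaussE_add gaussE_smult by (simp add: gaussE_hermite)
  show ?case unfolding rq gq by (rule lim)
qed

lemma walkE_tendsto:
  assumes "coeff_conv qs q" shows "(\<lambda>N. walkE N (poly (qs N))) \<longlonglongrightarrow> gaussE q"
proof -
  obtain d0 where d0: "\<And>N. degree (qs N) \<le> d0" using assms unfolding coeff_conv_def by blast
  define d where "d = max d0 (degree q)"
  have d: "degree (qs N) \<le> d" "degree q \<le> d" for N using d0[of N] by (auto simp: d_def)
  have "(\<lambda>N. walkE N (\<lambda>x. x ^ i)) \<longlonglongrightarrow> gaussE (monom 1 i)" for i
    using walkE_tendsto_aux[of "monom 1 i" i] by (simp add: degree_monom_eq poly_monom[abs_def])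
  then have "(\<lambda>N. \<Sum>i\<le>d. coeff (qs N) i * walkE N (\<lambda>x. x ^ i)) \<longlonglongrightarrow> (\<Sum>i\<le>d. coeff q i * gaussE (monom 1 i))"
    using assms by (intro tendsto_sum tendsto_mult) (auto simp: coeff_conv_def)
  moreover have "(\<Sum>i\<le>d. coeff q i * gaussE (monom 1 i)) = gaussE (\<Sum>i\<le>d. monom (coeff q i) i)"
    by (simp add: gaussE_sum gaussE_monom)
  moreover have "(\<Sum>i\<le>d. monom (coeff q i) i) = q" by (rule poly_as_sum_of_monoms'[OF d(2)])
  ultimately show ?thesis unfolding walkE_poly[OF d(1)] by simp
qed

section \<open>The number of clusters of a given type\<close>

definition nclusters :: "nat \<Rightarrow> nat \<Rightarrow> nat \<Rightarrow> nat \<Rightarrow> nat" where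
  "nclusters p N k l = card {\<Gamma>. \<Gamma> \<subseteq> edges p N \<and> card \<Gamma> = k \<and> card (bdry \<Gamma>) = l}"

text \<open>
  A cluster and a set \<open>B\<close> of vertices have spin products with nonzero uniform average exactly if \<open>B\<close> is the
  boundary of the cluster.
\<close>
lemma nclusters_expectation:
  "real (nclusters p N k l) = measure_pmf.expectation (spins_pmf N 0)
      (\<lambda>\<sigma>. esym k (\<lambda>e. \<Prod>v\<in>set e. \<sigma> v) (edges p N) * esym l \<sigma> {1..N})"
proof -
  let ?K = "{\<Gamma>. \<Gamma> \<subseteq> edges p N \<and> card \<Gamma> = k}" and ?L = "{B. B \<subseteq> {1..N} \<and> card B = l}"
  have fin: "finite ?K" "finite ?L" by (auto intro: finite_subset[of _ "Pow (edges p N)"] finite_subset[of _ "Pow {1..N}"])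
  have E: "measure_pmf.expectation (spins_pmf N 0) (\<lambda>\<sigma>. (\<Prod>e\<in>\<Gamma>. \<Prod>v\<in>set e. \<sigma> v) * (\<Prod>v\<in>B. \<sigma> v)) = of_bool (B = bdry \<Gamma>)"
    if \<Gamma>: "\<Gamma> \<subseteq> edges p N" and B: "B \<subseteq> {1..N}" for \<Gamma> B
  proof -
    define d where "d v = vdeg \<Gamma> v + of_bool (v \<in> B)" for v
    have "(\<Prod>e\<in>\<Gamma>. \<Prod>v\<in>set e. \<sigma> v) * (\<Prod>v\<in>B. \<sigma> v) = (\<Prod>v\<in>{1..N}. \<sigma> v ^ d v)" for \<sigma> :: "nat \<Rightarrow> real"
    proof -
      have "(\<Prod>v\<in>B. \<sigma> v) = (\<Prod>v\<in>{1..N}. \<sigma> v ^ of_bool (v \<in> B))"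
        using B by (intro prod.mono_neutral_cong_left) auto
      then show ?thesis unfolding cluster_spin_prod[OF \<Gamma>] d_def by (simp add: power_add prod.distrib)
    qed
    moreover have "{v \<in> {1..N}. odd (d v)} = (bdry \<Gamma> - B) \<union> (B - bdry \<Gamma>)"
      using B bdry_subset[OF \<Gamma>] by (auto simp: d_def bdry_def)
    moreover have "card ((bdry \<Gamma> - B) \<union> (B - bdry \<Gamma>)) = 0 \<longleftrightarrow> B = bdry \<Gamma>"
    proof -
      have "finite ((bdry \<Gamma> - B) \<union> (B - bdry \<Gamma>))"
        using B bdry_subset[OF \<Gamma>] by (auto intro: finite_subset)
      then show ?thesis by auto
    qed
    ultimately show ?thesis unfolding expectation_spins_powers[of N 0 d, symmetric]
      using expectation_spins_powers[of N 0 d] by (simp add: power_0_left)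
  qed
  have "measure_pmf.expectation (spins_pmf N 0)
      (\<lambda>\<sigma>. esym k (\<lambda>e. \<Prod>v\<in>set e. \<sigma> v) (edges p N) * esym l \<sigma> {1..N})
     = (\<Sum>\<Gamma>\<in>?K. \<Sum>B\<in>?L. of_bool (B = bdry \<Gamma>))"
    unfolding esym_def sum_product expectation_spins_sum by (intro sum.cong refl E) auto
  also have "\<dots> = (\<Sum>\<Gamma>\<in>?K. of_bool (card (bdry \<Gamma>) = l))"
  proof (rule sum.cong)
    fix \<Gamma> assume "\<Gamma> \<in> ?K"
    then have "bdry \<Gamma> \<subseteq> {1..N}" using bdry_subset by blast
    then show "(\<Sum>B\<in>?L. of_bool (B = bdry \<Gamma>)) = (of_bool (card (bdry \<Gamma>) = l) :: real)"
      using fin by (cases "card (bdry \<Gamma>) = l") (auto simp: of_bool_def)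
  qed simp
  also have "\<dots> = real (card (?K \<inter> {\<Gamma>. card (bdry \<Gamma>) = l}))" using fin by simp
  also have "?K \<inter> {\<Gamma>. card (bdry \<Gamma>) = l} = {\<Gamma>. \<Gamma> \<subseteq> edges p N \<and> card \<Gamma> = k \<and> card (bdry \<Gamma>) = l}" by auto
  finally show ?thesis by (simp add: nclusters_def)
qed

lemma binomial_asymp: "(\<lambda>N. real (N choose p) / real N ^ p) \<longlonglongrightarrow> 1 / fact p"
proof (induction p)
  case 0
  show ?case by simp
next
  case (Suc p)
  have "(\<lambda>N. (real (N choose p) / real N ^ p) * ((1 - real p / real N) / real (Suc p))) \<longlonglongrightarrow> 1 / fact p * ((1 - 0) / real (Suc p))"
    by (intro tendsto_mult Suc.IH tendsto_divide tendsto_diff tendsto_const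
        tendsto_divide_0[OF tendsto_const filterlim_at_top_imp_at_infinity[OF filterlim_real_sequentially]]) simp
  moreover have "\<forall>\<^sub>F N in sequentially. (real (N choose p) / real N ^ p) * ((1 - real p / real N) / real (Suc p)) = real (N choose Suc p) / real N ^ Suc p"
  proof (rule eventually_sequentiallyI[of "Suc p"])
    fix N assume N: "Suc p \<le> N"
    have "real (Suc p) * real (N choose Suc p) = (real N - real p) * real (N choose p)"
    proof -
      have "Suc p * (N choose Suc p) = (N - p) * (N choose p)"
        by (simp only: binomial_absorb_comp binomial_absorption)
      then show ?thesis using N by (metis Suc_leD of_nat_diff of_nat_mult)
    qed
    then have e: "real (N choose Suc p) = (real N - real p) * real (N choose p) / real (Suc p)" by (simp add: field_simps)
    have "1 - real p / real N = (real N - real p) / real N" using N by (simp add: field_simps)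
    then show "(real (N choose p) / real N ^ p) * ((1 - real p / real N) / real (Suc p)) = real (N choose Suc p) / real N ^ Suc p"
      unfolding e by (simp add: mult_ac)
  qed
  ultimately have "(\<lambda>N. real (N choose Suc p) / real N ^ Suc p) \<longlonglongrightarrow> 1 / fact p * ((1 - 0) / real (Suc p))"
    by (rule Lim_transform_eventually)
  then show ?case by (simp add: field_simps)
qed

text \<open>
  The limit of the normalised number of clusters; \<open>v_sq\<close> is this constant times powers of \<open>\<beta>\<close> and \<open>\<rho>\<close>.
\<close>
definition cluster_const :: "nat \<Rightarrow> nat \<Rightarrow> nat \<Rightarrow> real" where
  "cluster_const p k l = gaussE (pcompose (hermite k) (smult (1 / sqrt (fact p)) (hermite p)) * hermite l)
      / (fact k * fact l * sqrt (fact p) ^ k)"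

text \<open>
  Both elementary symmetric polynomials are Krawtchouk polynomials of the walk: the one of the spins directly, the
  one of the hyperedges after composition, since the sum of all \<open>p\<close>-spin products is again elementary symmetric.
\<close>
lemma nclusters_asymp:
  assumes p: "p \<ge> 1"
  shows "(\<lambda>N. real (nclusters p N k l) / sqrt (real N) ^ (k * p + l)) \<longlonglongrightarrow> cluster_const p k l"
proof -
  define n where "n N = real (N choose p)" for N
  (* the ratio of the normalisations of the sum over hyperedges as a polynomial in the spins and as a sum of n N signs *)
  define r where "r N = sqrt (real N) ^ p / (fact p * sqrt (n N))" for N
  define R where "R N = smult (r N) (krawtchouk (real N) [:0, 1:] p)" for N
  define q where "q N = krawtchouk (n N) (R N) k * krawtchouk (real N) [:0, 1:] l" for N
  have sq: "(\<lambda>N. sqrt (n N / real N ^ p)) \<longlonglongrightarrow> sqrt (1 / fact p)"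
    unfolding n_def by (intro tendsto_real_sqrt binomial_asymp)
  have sqN: "sqrt (n N / real N ^ p) = sqrt (n N) / sqrt (real N) ^ p" for N
    by (simp add: real_sqrt_divide real_sqrt_power)
  have "(\<lambda>N. 1 / (fact p * sqrt (n N / real N ^ p))) \<longlonglongrightarrow> 1 / (fact p * sqrt (1 / fact p))"
    by (intro tendsto_intros sq) simp
  moreover have "1 / (fact p * sqrt (n N / real N ^ p)) = r N" for N unfolding sqN r_def by simp
  moreover have "1 / (fact p * sqrt (1 / fact p)) = 1 / sqrt (fact p :: real)"
    by (simp add: real_sqrt_divide field_simps)
  ultimately have rlim: "r \<longlonglongrightarrow> 1 / sqrt (fact p)" by simp
  have ntop: "filterlim n at_top sequentially"
  proof -
    have "filterlim (\<lambda>N::nat. real N ^ p) at_top sequentially"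
      using p by (intro filterlim_pow_at_top filterlim_real_sequentially) auto
    then have "filterlim (\<lambda>N. n N / real N ^ p * real N ^ p) at_top sequentially"
      unfolding n_def by (rule filterlim_tendsto_pos_mult_at_top[OF binomial_asymp, rotated]) simp
    then show ?thesis
      by (rule filterlim_cong[OF refl refl, THEN iffD1, rotated]) (rule eventually_sequentiallyI[of 1], simp)
  qed
  have X: "pcompose h [:0, 1:] = h" for h :: "real poly" by simp
  have "coeff_conv (\<lambda>N. krawtchouk (real N) [:0, 1:] j) (hermite j)" for j
    using coeff_conv_krawtchouk[OF coeff_conv_const filterlim_real_sequentially, of "[:0,1:]" j] by simp
  then have "coeff_conv q (pcompose (hermite k) (smult (1 / sqrt (fact p)) (hermite p)) * hermite l)"
    unfolding q_def[abs_def] R_def[abs_def] by (intro coeff_conv_mult coeff_conv_krawtchouk coeff_conv_smult rlim ntop)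
  from walkE_tendsto[OF this]
  have lim: "(\<lambda>N. walkE N (poly (q N))) \<longlonglongrightarrow> gaussE (pcompose (hermite k) (smult (1 / sqrt (fact p)) (hermite p)) * hermite l)" .
  have eq: "walkE N (poly (q N)) = fact k * fact l / (sqrt (n N) ^ k * sqrt (real N) ^ l) * real (nclusters p N k l)"
    if N: "N \<ge> p" "N \<ge> 1" for N
  proof -
    let ?S = "\<lambda>\<sigma>. (\<Sum>v\<in>{1..N}. \<sigma> v) / sqrt (real N)"
    have nc: "n N = real (card (edges p N))" by (simp add: n_def card_edges)
    have npos: "n N > 0" using N by (simp add: n_def)
    have ene: "edges p N \<noteq> {}" using npos nc by auto
    have "walkE N (poly (q N)) = measure_pmf.expectation (spins_pmf N 0)
      (\<lambda>\<sigma>. fact k * fact l / (sqrt (n N) ^ k * sqrt (real N) ^ l) * (esym k (\<lambda>e. \<Prod>v\<in>set e. \<sigma> v) (edges p N) * esym l \<sigma> {1..N}))"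
      unfolding walkE_def
    proof (intro integral_cong_AE AE_pmfI)
      fix \<sigma> assume \<sigma>: "\<sigma> \<in> set_pmf (spins_pmf N 0)"
      have sv: "\<And>v. v \<in> {1..N} \<Longrightarrow> \<sigma> v ^ 2 = 1" using spins_square[OF \<sigma>] .
      have k1: "poly (krawtchouk (real N) [:0, 1:] j) (?S \<sigma>) = fact j * esym j \<sigma> {1..N} / sqrt (real N) ^ j" for j
        using poly_krawtchouk_esym[of "{1..N}" \<sigma> "[:0, 1:]" "?S \<sigma>" j] sv N by simp
      have ev: "(\<Prod>v\<in>set e. \<sigma> v) ^ 2 = 1" if "e \<in> edges p N" for e
        unfolding prod_power_distrib using sv edgesD(3)[OF that] by (intro prod.neutral) blast
      have "poly (R N) (?S \<sigma>) = (\<Sum>e\<in>edges p N. \<Prod>v\<in>set e. \<sigma> v) / sqrt (real (card (edges p N)))"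
        unfolding R_def poly_smult k1 sum_edges_eq_esym r_def nc using N by simp
      from poly_krawtchouk_esym[OF finite_edges ene ev this, of k]
      have k2: "poly (krawtchouk (n N) (R N) k) (?S \<sigma>) = fact k * esym k (\<lambda>e. \<Prod>v\<in>set e. \<sigma> v) (edges p N) / sqrt (n N) ^ k"
        unfolding nc .
      show "poly (q N) (?S \<sigma>) = fact k * fact l / (sqrt (n N) ^ k * sqrt (real N) ^ l) * (esym k (\<lambda>e. \<Prod>v\<in>set e. \<sigma> v) (edges p N) * esym l \<sigma> {1..N})"
        unfolding q_def poly_mult k1 k2 by (simp add: mult_ac)
    qed simp_all
    then show ?thesis unfolding nclusters_expectation integral_mult_right_zero .
  qed
  have "(\<lambda>N. walkE N (poly (q N)) * sqrt (n N / real N ^ p) ^ k / (fact k * fact l))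
     \<longlonglongrightarrow> gaussE (pcompose (hermite k) (smult (1 / sqrt (fact p)) (hermite p)) * hermite l) * sqrt (1 / fact p) ^ k / (fact k * fact l)"
    by (intro tendsto_intros lim sq) simp
  moreover have "\<forall>\<^sub>F N in sequentially. walkE N (poly (q N)) * sqrt (n N / real N ^ p) ^ k / (fact k * fact l)
      = real (nclusters p N k l) / sqrt (real N) ^ (k * p + l)"
  proof (rule eventually_sequentiallyI[of p])
    fix N assume N: "p \<le> N"
    then have npos: "sqrt (n N) > 0" by (simp add: n_def)
    have e: "walkE N (poly (q N)) = fact k * fact l / (sqrt (n N) ^ k * sqrt (real N) ^ l) * real (nclusters p N k l)"
      using N p by (intro eq) auto
    have "sqrt (real N) ^ (k * p + l) = (sqrt (real N) ^ p) ^ k * sqrt (real N) ^ l"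
      by (simp add: power_add power_mult[symmetric] mult.commute)
    then show "walkE N (poly (q N)) * sqrt (n N / real N ^ p) ^ k / (fact k * fact l)
      = real (nclusters p N k l) / sqrt (real N) ^ (k * p + l)"
      unfolding e sqN using npos by (simp add: power_divide field_simps)
  qed
  ultimately have "(\<lambda>N. real (nclusters p N k l) / sqrt (real N) ^ (k * p + l))
     \<longlonglongrightarrow> gaussE (pcompose (hermite k) (smult (1 / sqrt (fact p)) (hermite p)) * hermite l) * sqrt (1 / fact p) ^ k / (fact k * fact l)"
    by (rule Lim_transform_eventually)
  then show ?thesis unfolding cluster_const_def by (simp add: real_sqrt_divide power_divide field_simps)
qed

lemma v_sq_cluster_const: "v_sq p k l \<beta> \<rho> = \<beta> ^ (2 * k) * \<rho> ^ (2 * l) * cluster_const p k l"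
proof -
  have "(fact p :: real) powr (real k / 2) = sqrt (fact p) ^ k"
    by (simp add: powr_half_sqrt[symmetric] powr_power)
  moreover have "(LINT x|std_normal_distribution. poly (hermite k) (poly (hermite p) x / sqrt (fact p)) * poly (hermite l) x)
     = gaussE (pcompose (hermite k) (smult (1 / sqrt (fact p)) (hermite p)) * hermite l)"
    unfolding gaussE_def by (intro Bochner_Integration.integral_cong) (simp_all add: poly_pcompose)
  ultimately show ?thesis unfolding v_sq_def cluster_const_def by simp
qed

lemma cluster_const_nonneg: "p \<ge> 1 \<Longrightarrow> 0 \<le> cluster_const p k l"
  by (rule LIMSEQ_le_const[OF nclusters_asymp]) auto

lemma gaussE_hermite_pow: "gaussE (hermite p ^ 2) = fact p"
  using gaussE_hermite_square[of p] by (simp add: power2_eq_square)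

lemma pcompose_power: "pcompose (q ^ n) r = pcompose q r ^ n" for q r :: "real poly"
  by (induction n) (simp_all add: pcompose_mult pcompose_1)

text \<open>
  In each case the Hermite polynomial in the outer position is expanded; the terms that survive are
  positive by the properties of \<open>hermite3\<close>, and for four edges by Bessel's inequality.
\<close>
lemma cluster_const_pos:
  assumes p: "p \<ge> 2"
  shows "0 < cluster_const p 1 p" "0 < cluster_const p 2 2"
    "even p \<Longrightarrow> 0 < cluster_const p 3 0" "0 < cluster_const p 4 0"
proof -
  define s where "s = 1 / sqrt (fact p :: real)"
  have s: "s > 0" "s ^ 2 * fact p = 1" by (simp_all add: s_def power_divide)
  define P where "P = hermite p"
  have pos: "0 < cluster_const p k l" if "0 < gaussE (pcompose (hermite k) (smult s P) * hermite l)" for k l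
    using that unfolding cluster_const_def s_def P_def by (intro divide_pos_pos mult_pos_pos) auto
  have h2: "hermite 2 = [:0,1:] ^ 2 - 1"
    by (simp add: numeral_2_eq_2 hermite_rec one_pCons)
  have h3: "hermite 3 = [:0,1:] ^ 3 - smult 3 [:0,1:]"
    by (simp add: numeral_3_eq_3 hermite_rec one_pCons)
  have h4: "hermite 4 = [:0,1:] ^ 4 - smult 6 ([:0,1:] ^ 2) + smult 3 1"
    by (simp add: numeral_eq_Suc hermite_rec one_pCons)
  have c2: "pcompose (hermite 2) q = q ^ 2 - 1" and c3: "pcompose (hermite 3) q = q ^ 3 - smult 3 q"
    and c4: "pcompose (hermite 4) q = q ^ 4 - smult 6 (q ^ 2) + smult 3 1" for q :: "real poly"
    unfolding h2 h3 h4 by (simp_all add: pcompose_diff pcompose_add pcompose_smult pcompose_power pcompose_1 pcompose_pCons)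
  have P0: "gaussE P = 0" using p by (simp add: P_def gaussE_hermite)
  show "0 < cluster_const p 1 p"
  proof (rule pos)
    have "pcompose (hermite 1) (smult s P) * hermite p = smult s (P * P)" by (simp add: P_def pcompose_pCons)
    then show "0 < gaussE (pcompose (hermite 1) (smult s P) * hermite p)"
      using s by (simp add: gaussE_smult P_def gaussE_hermite_square)
  qed
  show "0 < cluster_const p 2 2"
  proof (rule pos)
    have "pcompose (hermite 2) (smult s P) * hermite 2 = smult (s ^ 2) (hermite p * hermite p * hermite 2) - hermite 2"
      unfolding c2 by (simp add: P_def power2_eq_square algebra_simps smult_power)
    then have "gaussE (pcompose (hermite 2) (smult s P) * hermite 2) = s ^ 2 * hermite3 p p 2"
      by (simp add: gaussE_diff gaussE_smult hermite3_def gaussE_hermite)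
    then show "0 < gaussE (pcompose (hermite 2) (smult s P) * hermite 2)"
      using s hermite3_pos[of p p 2] p by simp
  qed
  show "0 < cluster_const p 3 0" if "even p"
  proof (rule pos)
    have "pcompose (hermite 3) (smult s P) * hermite 0 = smult (s ^ 3) (hermite p * hermite p * hermite p) - smult (3 * s) P"
      unfolding c3 by (simp add: P_def smult_power power3_eq_cube mult_ac)
    then have "gaussE (pcompose (hermite 3) (smult s P) * hermite 0) = s ^ 3 * hermite3 p p p"
      by (simp add: gaussE_diff gaussE_smult hermite3_def P0)
    then show "0 < gaussE (pcompose (hermite 3) (smult s P) * hermite 0)"
      using s hermite3_pos[of p p p] that by simp
  qed
  show "0 < cluster_const p 4 0"
  proof (rule pos)
    have "pcompose (hermite 4) (smult s P) * hermite 0 = smult (s ^ 4) (P ^ 4) - smult (6 * s ^ 2) (P ^ 2) + smult 3 1"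
      unfolding c4 by (simp add: smult_power)
    then have "gaussE (pcompose (hermite 4) (smult s P) * hermite 0) = s ^ 4 * gaussE (P ^ 4) - 6 * (s ^ 2 * fact p) + 3"
      by (simp only: gaussE_diff gaussE_smult gaussE_add gaussE_1) (simp add: P_def gaussE_hermite_pow)
    also have "\<dots> = s ^ 4 * (gaussE (P ^ 4) - 3 * (fact p)\<^sup>2)"
    proof -
      have "s ^ 4 * (fact p)\<^sup>2 = (s ^ 2 * fact p) ^ 2" by (simp add: power_mult_distrib flip: power_mult)
      then show ?thesis unfolding s(2) by (simp add: algebra_simps)
    qed
    finally show "0 < gaussE (pcompose (hermite 4) (smult s P) * hermite 0)"
      using s gaussE_hermite_fourth[OF p] by (simp add: P_def)
  qed
qed

section \<open>Normal approximation of a multilinear chaos\<close>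

definition mon :: "'e set \<Rightarrow> ('e \<Rightarrow> real) \<Rightarrow> real" where
  "mon \<Gamma> y = (\<Prod>e\<in>\<Gamma>. y e)"

text \<open>
  Independent weights with vanishing odd moments whose moments of order two and four are those of variables of size at most
  \<open>\<kappa>\<close>. Boundedness makes every integrability question trivial.
\<close>
locale weak_disorder = prob_space M for M :: "'a measure" +
  fixes t :: "'e \<Rightarrow> 'a \<Rightarrow> real" and E :: "'e set" and \<tau> \<kappa> :: real
  assumes finE: "finite E"
    and indep: "indep_vars (\<lambda>_. borel) t E"
    and bounded: "\<And>e \<omega>. e \<in> E \<Longrightarrow> \<bar>t e \<omega>\<bar> \<le> 1"
    and odd_moment: "\<And>e n. e \<in> E \<Longrightarrow> odd n \<Longrightarrow> expectation (\<lambda>\<omega>. t e \<omega> ^ n) = 0"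
    and second_moment: "\<And>e. e \<in> E \<Longrightarrow> expectation (\<lambda>\<omega>. t e \<omega> ^ 2) = \<tau>"
    and fourth_moment: "\<And>e. e \<in> E \<Longrightarrow> expectation (\<lambda>\<omega>. t e \<omega> ^ 4) \<le> \<kappa> ^ 4"
    and \<tau>_le: "0 \<le> \<tau>" "\<tau> \<le> \<kappa> ^ 2" and \<kappa>0: "0 \<le> \<kappa>"
begin

text \<open>
  A class of integrable functions that is closed under all operations used below.
\<close>
definition bdd_rv :: "('a \<Rightarrow> 'b::{real_normed_field,banach,second_countable_topology}) \<Rightarrow> bool" where
  "bdd_rv f \<longleftrightarrow> f \<in> borel_measurable M \<and> (\<exists>B. \<forall>\<omega>. norm (f \<omega>) \<le> B)"

lemma bdd_rv_integrable: "bdd_rv f \<Longrightarrow> integrable M f"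
  unfolding bdd_rv_def by (auto intro: integrable_const_bound)

lemma bdd_rv_const [intro, simp]: "bdd_rv (\<lambda>_. c)"
  by (auto simp: bdd_rv_def)

lemma bdd_rv_add [intro]:
  assumes "bdd_rv f" "bdd_rv g" shows "bdd_rv (\<lambda>\<omega>. f \<omega> + g \<omega>)"
proof -
  obtain A B where "\<And>\<omega>. norm (f \<omega>) \<le> A" "\<And>\<omega>. norm (g \<omega>) \<le> B" using assms unfolding bdd_rv_def by blast
  then have "norm (f \<omega> + g \<omega>) \<le> A + B" for \<omega> by (intro order_trans[OF norm_triangle_ineq] add_mono)
  then show ?thesis using assms unfolding bdd_rv_def by auto
qed

lemma bdd_rv_diff [intro]:
  assumes "bdd_rv f" "bdd_rv g" shows "bdd_rv (\<lambda>\<omega>. f \<omega> - g \<omega>)"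
proof -
  obtain A B where "\<And>\<omega>. norm (f \<omega>) \<le> A" "\<And>\<omega>. norm (g \<omega>) \<le> B" using assms unfolding bdd_rv_def by blast
  then have "norm (f \<omega> - g \<omega>) \<le> A + B" for \<omega> by (intro order_trans[OF norm_triangle_ineq4] add_mono)
  then show ?thesis using assms unfolding bdd_rv_def by auto
qed

lemma bdd_rv_mult [intro]:
  assumes "bdd_rv f" "bdd_rv g" shows "bdd_rv (\<lambda>\<omega>. f \<omega> * g \<omega>)"
proof -
  obtain A B where AB: "\<And>\<omega>. norm (f \<omega>) \<le> A" "\<And>\<omega>. norm (g \<omega>) \<le> B" using assms unfolding bdd_rv_def by blast
  have "0 \<le> A" using AB(1) norm_ge_zero order_trans by blast
  then have "norm (f \<omega> * g \<omega>) \<le> A * B" for \<omega> unfolding norm_mult using AB by (intro mult_mono) auto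
  then show ?thesis using assms unfolding bdd_rv_def by auto
qed

lemma bdd_rv_power [intro]: "bdd_rv f \<Longrightarrow> bdd_rv (\<lambda>\<omega>. f \<omega> ^ n)"
  by (induction n) auto

lemma bdd_rv_sum [intro]: "(\<And>i. i \<in> I \<Longrightarrow> bdd_rv (f i)) \<Longrightarrow> bdd_rv (\<lambda>\<omega>. \<Sum>i\<in>I. f i \<omega>)"
  by (induction I rule: infinite_finite_induct) auto

lemma bdd_rv_prod [intro]: "(\<And>i. i \<in> I \<Longrightarrow> bdd_rv (f i)) \<Longrightarrow> bdd_rv (\<lambda>\<omega>. \<Prod>i\<in>I. f i \<omega>)"
  by (induction I rule: infinite_finite_induct) auto

lemma bdd_rv_abs [intro]: "bdd_rv (f :: 'a \<Rightarrow> real) \<Longrightarrow> bdd_rv (\<lambda>\<omega>. \<bar>f \<omega>\<bar>)"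
  by (auto simp: bdd_rv_def)

lemma bdd_rv_divide [intro]: "bdd_rv f \<Longrightarrow> bdd_rv (\<lambda>\<omega>. f \<omega> / c)"
  using bdd_rv_mult[of f "\<lambda>_. inverse c"] by (simp add: divide_inverse)

lemma bdd_rv_of_real [intro]: "bdd_rv f \<Longrightarrow> bdd_rv (\<lambda>\<omega>. complex_of_real (f \<omega>))"
  by (auto simp: bdd_rv_def)

lemma bdd_rv_iexp [intro]: "bdd_rv f \<Longrightarrow> bdd_rv (\<lambda>\<omega>. iexp (f \<omega>))"
  by (auto simp: bdd_rv_def intro!: exI[of _ 1])

lemma expectation_sum:
  fixes f :: "'i \<Rightarrow> 'a \<Rightarrow> real"
  shows "(\<And>i. i \<in> I \<Longrightarrow> bdd_rv (f i)) \<Longrightarrow> expectation (\<lambda>\<omega>. \<Sum>i\<in>I. f i \<omega>) = (\<Sum>i\<in>I. expectation (f i))"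
  by (rule Bochner_Integration.integral_sum) (rule bdd_rv_integrable)

lemma bdd_rv_t [intro]: "e \<in> E \<Longrightarrow> bdd_rv (t e)"
  using indep bounded by (auto simp: bdd_rv_def indep_vars_def)

abbreviation Y :: "'a \<Rightarrow> 'e \<Rightarrow> real" where "Y \<omega> \<equiv> (\<lambda>e. t e \<omega>)"

lemma bdd_rv_mon [intro]: "\<Gamma> \<subseteq> E \<Longrightarrow> bdd_rv (\<lambda>\<omega>. mon \<Gamma> (Y \<omega>))"
  unfolding mon_def by (intro bdd_rv_prod) auto

lemma expectation_powers:
  "expectation (\<lambda>\<omega>. \<Prod>e\<in>E. t e \<omega> ^ n e) = (\<Prod>e\<in>E. expectation (\<lambda>\<omega>. t e \<omega> ^ n e))"
proof (rule indep_vars_lebesgue_integral[OF finE])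
  show "indep_vars (\<lambda>_. borel) (\<lambda>e \<omega>. t e \<omega> ^ n e) E"
    by (rule indep_vars_compose2[OF indep]) auto
  show "integrable M (\<lambda>\<omega>. t e \<omega> ^ n e)" if "e \<in> E" for e
    using that by (intro bdd_rv_integrable) auto
qed

lemma abs_moment_le:
  assumes "e \<in> E" "n \<le> 4" shows "\<bar>expectation (\<lambda>\<omega>. t e \<omega> ^ n)\<bar> \<le> \<kappa> ^ n"
proof (cases "odd n")
  case False
  then have "n = 0 \<or> n = 2 \<or> n = 4" using assms(2) by (auto elim!: evenE)
  moreover have "0 \<le> expectation (\<lambda>\<omega>. t e \<omega> ^ 4)" by (intro Bochner_Integration.integral_nonneg) auto
  ultimately show ?thesis
    using second_moment[OF assms(1)] fourth_moment[OF assms(1)] \<tau>_le prob_space by auto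
qed (use odd_moment[OF assms(1)] \<kappa>0 in auto)

lemma cover_le: "cover A B C D e \<le> 4"
  by (auto simp: cover_def of_bool_def)

lemma mon_as_powers: "A \<subseteq> E \<Longrightarrow> mon A y = (\<Prod>e\<in>E. y e ^ of_bool (e \<in> A))"
  unfolding mon_def using finE by (intro prod.mono_neutral_cong_left) auto

lemma expectation_mon4:
  assumes "A \<subseteq> E" "B \<subseteq> E" "C \<subseteq> E" "D \<subseteq> E"
  shows "expectation (\<lambda>\<omega>. mon A (Y \<omega>) * mon B (Y \<omega>) * mon C (Y \<omega>) * mon D (Y \<omega>))
       = (\<Prod>e\<in>E. expectation (\<lambda>\<omega>. t e \<omega> ^ cover A B C D e))"
  unfolding mon_as_powers[OF assms(1)] mon_as_powers[OF assms(2)] mon_as_powers[OF assms(3)]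
    mon_as_powers[OF assms(4)] prod.distrib[symmetric] power_add[symmetric] cover_def[symmetric]
  by (rule expectation_powers)

lemma expectation_mon4_zero:
  assumes "A \<subseteq> E" "B \<subseteq> E" "C \<subseteq> E" "D \<subseteq> E" and "odd (cover A B C D e)"
  shows "expectation (\<lambda>\<omega>. mon A (Y \<omega>) * mon B (Y \<omega>) * mon C (Y \<omega>) * mon D (Y \<omega>)) = 0"
proof -
  have "e \<in> E" using assms by (auto simp: cover_def of_bool_def split: if_splits)
  then show ?thesis unfolding expectation_mon4[OF assms(1-4)]
    using finE odd_moment[OF _ assms(5)] by (auto simp: prod_zero_iff)
qed

lemma sum_cover:
  assumes "A \<subseteq> E" "B \<subseteq> E" "C \<subseteq> E" "D \<subseteq> E"
  shows "(\<Sum>e\<in>E. cover A B C D e) = card A + card B + card C + card D"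
proof -
  have "(\<Sum>e\<in>E. of_bool (e \<in> X)) = card X" if "X \<subseteq> E" for X
    using that finE by (simp add: Int_absorb1)
  then show ?thesis using assms by (simp add: cover_def sum.distrib del: sum_of_bool_eq)
qed

text \<open>
  The scale \<open>\<kappa>\<close> is chosen such that a moment of order \<open>n \<le> 4\<close> is at most \<open>\<kappa> ^ n\<close>; the exponents in a product
  of four monomials are at most four.
\<close>
lemma expectation_mon4_le:
  assumes "A \<subseteq> E" "B \<subseteq> E" "C \<subseteq> E" "D \<subseteq> E"
  shows "\<bar>expectation (\<lambda>\<omega>. mon A (Y \<omega>) * mon B (Y \<omega>) * mon C (Y \<omega>) * mon D (Y \<omega>))\<bar>
     \<le> \<kappa> ^ (card A + card B + card C + card D)"
proof -
  have "\<bar>\<Prod>e\<in>E. expectation (\<lambda>\<omega>. t e \<omega> ^ cover A B C D e)\<bar> \<le> (\<Prod>e\<in>E. \<kappa> ^ cover A B C D e)"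
    unfolding abs_prod by (intro prod_mono conjI abs_moment_le cover_le) auto
  also have "\<dots> = \<kappa> ^ (card A + card B + card C + card D)"
    by (simp add: power_sum[symmetric] sum_cover[OF assms])
  finally show ?thesis unfolding expectation_mon4[OF assms] .
qed

lemma mon_empty [simp]: "mon {} y = 1" by (simp add: mon_def)

lemma expectation_mon2:
  assumes "A \<subseteq> E" "B \<subseteq> E"
  shows "expectation (\<lambda>\<omega>. mon A (Y \<omega>) * mon B (Y \<omega>)) = (if A = B then \<tau> ^ card A else 0)"
proof (cases "A = B")
  case True
  have "expectation (\<lambda>\<omega>. mon A (Y \<omega>) * mon B (Y \<omega>)) = (\<Prod>e\<in>E. expectation (\<lambda>\<omega>. t e \<omega> ^ cover A B {} {} e))"
    using expectation_mon4[OF assms, of "{}" "{}"] by simp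
  also have "\<dots> = (\<Prod>e\<in>E. if e \<in> A then \<tau> else 1)"
    using second_moment True prob_space by (intro prod.cong) (auto simp: cover_def numeral_2_eq_2)
  also have "\<dots> = \<tau> ^ card A" using finE assms by (simp add: prod.If_cases Int_absorb1)
  finally show ?thesis using True by simp
next
  case False
  then obtain e where "(e \<in> A) \<noteq> (e \<in> B)" by blast
  then have "odd (cover A B {} {} e)" by (auto simp: cover_def)
  then show ?thesis using expectation_mon4_zero[OF assms, of "{}" "{}" e] False by simp
qed

lemma expectation_lincomb_square:
  assumes "finite G" "\<And>\<Gamma>. \<Gamma> \<in> G \<Longrightarrow> \<Gamma> \<subseteq> E"
  shows "expectation (\<lambda>\<omega>. (\<Sum>\<Gamma>\<in>G. c \<Gamma> * mon \<Gamma> (Y \<omega>))\<^sup>2) = (\<Sum>\<Gamma>\<in>G. (c \<Gamma>)\<^sup>2 * \<tau> ^ card \<Gamma>)"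
proof -
  have "expectation (\<lambda>\<omega>. (\<Sum>\<Gamma>\<in>G. c \<Gamma> * mon \<Gamma> (Y \<omega>))\<^sup>2)
     = expectation (\<lambda>\<omega>. \<Sum>\<Gamma>\<in>G. \<Sum>\<Delta>\<in>G. (c \<Gamma> * c \<Delta>) * (mon \<Gamma> (Y \<omega>) * mon \<Delta> (Y \<omega>)))"
    by (simp add: power2_eq_square sum_product mult_ac)
  also have "\<dots> = (\<Sum>\<Gamma>\<in>G. expectation (\<lambda>\<omega>. \<Sum>\<Delta>\<in>G. (c \<Gamma> * c \<Delta>) * (mon \<Gamma> (Y \<omega>) * mon \<Delta> (Y \<omega>))))"
    by (rule expectation_sum) (intro bdd_rv_sum bdd_rv_mult bdd_rv_mon bdd_rv_const assms(2))
  also have "\<dots> = (\<Sum>\<Gamma>\<in>G. \<Sum>\<Delta>\<in>G. expectation (\<lambda>\<omega>. (c \<Gamma> * c \<Delta>) * (mon \<Gamma> (Y \<omega>) * mon \<Delta> (Y \<omega>))))"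
    by (intro sum.cong refl expectation_sum bdd_rv_mult bdd_rv_mon bdd_rv_const assms(2))
  also have "\<dots> = (\<Sum>\<Gamma>\<in>G. \<Sum>\<Delta>\<in>G. (c \<Gamma> * c \<Delta>) * expectation (\<lambda>\<omega>. mon \<Gamma> (Y \<omega>) * mon \<Delta> (Y \<omega>)))"
    by (simp only: integral_mult_right_zero)
  also have "\<dots> = (\<Sum>\<Gamma>\<in>G. \<Sum>\<Delta>\<in>G. if \<Gamma> = \<Delta> then c \<Gamma> * c \<Delta> * \<tau> ^ card \<Gamma> else 0)"
    using assms by (intro sum.cong refl) (auto simp: expectation_mon2)
  finally show ?thesis using assms(1) by (simp add: power2_eq_square)
qed

lemma indep_split:
  fixes \<phi> :: "real \<Rightarrow> complex" and g :: "('e \<Rightarrow> real) \<Rightarrow> complex"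
  assumes e: "e \<in> E" and \<phi>: "\<phi> \<in> borel_measurable borel" and g: "g \<in> borel_measurable (PiM (E - {e}) (\<lambda>_. borel))"
    and int: "integrable M (\<lambda>\<omega>. \<phi> (t e \<omega>))" "integrable M (\<lambda>\<omega>. g (restrict (Y \<omega>) (E - {e})))"
  shows "expectation (\<lambda>\<omega>. \<phi> (t e \<omega>) * g (restrict (Y \<omega>) (E - {e})))
     = expectation (\<lambda>\<omega>. \<phi> (t e \<omega>)) * expectation (\<lambda>\<omega>. g (restrict (Y \<omega>) (E - {e})))"
proof -
  have "indep_var (PiM {e} (\<lambda>_. borel)) (\<lambda>\<omega>. restrict (Y \<omega>) {e}) (PiM (E - {e}) (\<lambda>_. borel)) (\<lambda>\<omega>. restrict (Y \<omega>) (E - {e}))"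
    by (rule indep_var_restrict[OF indep]) (use e in auto)
  moreover have "(\<lambda>z. \<phi> (z e)) \<in> borel_measurable (PiM {e} (\<lambda>_. borel))"
    using \<phi> by measurable
  ultimately have "indep_var borel ((\<lambda>z. \<phi> (z e)) \<circ> (\<lambda>\<omega>. restrict (Y \<omega>) {e})) borel (g \<circ> (\<lambda>\<omega>. restrict (Y \<omega>) (E - {e})))"
    using g by (rule indep_var_compose)
  then have "indep_var borel (\<lambda>\<omega>. \<phi> (t e \<omega>)) borel (\<lambda>\<omega>. g (restrict (Y \<omega>) (E - {e})))"
    by (simp add: comp_def)
  then show ?thesis using int by (rule indep_var_lebesgue_integral)
qed

end

text \<open>
  A polynomial \<open>Sf\<close> in the weights in which each monomial is a nonempty set of at most four edges. In
  the direction of an edge \<open>e\<close> it is affine, \<open>Sf = Rf e + y e * Df e\<close>, and \<open>Sf\<close> is the sum of \<open>y e * Af e\<close> if each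
  monomial is distributed evenly over its edges. The statistic \<open>Tf\<close> is the conditional variance proxy of
  Stein's method.
\<close>
locale multilinear_chaos = weak_disorder M t E \<tau> \<kappa> for M :: "'a measure" and t :: "'e \<Rightarrow> 'a \<Rightarrow> real" and E \<tau> \<kappa> +
  fixes G :: "'e set set" and c :: "'e set \<Rightarrow> real"
  assumes G: "\<And>\<Gamma>. \<Gamma> \<in> G \<Longrightarrow> \<Gamma> \<subseteq> E" "\<And>\<Gamma>. \<Gamma> \<in> G \<Longrightarrow> \<Gamma> \<noteq> {}" "\<And>\<Gamma>. \<Gamma> \<in> G \<Longrightarrow> card \<Gamma> \<le> 4"
    and c0: "\<And>\<Gamma>. \<Gamma> \<in> G \<Longrightarrow> 0 \<le> c \<Gamma>"
begin

lemma finG: "finite G"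
  using G(1) finE by (meson PowI finite_Pow_iff finite_subset subsetI)

lemma fin_cluster: "\<Gamma> \<in> G \<Longrightarrow> finite \<Gamma>"
  using G(1) finE finite_subset by blast

definition Gat :: "'e \<Rightarrow> 'e set set" where "Gat e = {\<Gamma>\<in>G. e \<in> \<Gamma>}"

definition Sf :: "('e \<Rightarrow> real) \<Rightarrow> real" where "Sf y = (\<Sum>\<Gamma>\<in>G. c \<Gamma> * mon \<Gamma> y)"
definition Df :: "'e \<Rightarrow> ('e \<Rightarrow> real) \<Rightarrow> real" where "Df e y = (\<Sum>\<Gamma>\<in>Gat e. c \<Gamma> * mon (\<Gamma> - {e}) y)"
definition Af :: "'e \<Rightarrow> ('e \<Rightarrow> real) \<Rightarrow> real" where "Af e y = (\<Sum>\<Gamma>\<in>Gat e. c \<Gamma> / real (card \<Gamma>) * mon (\<Gamma> - {e}) y)"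
definition Rf :: "'e \<Rightarrow> ('e \<Rightarrow> real) \<Rightarrow> real" where "Rf e y = (\<Sum>\<Gamma>\<in>{\<Gamma>\<in>G. e \<notin> \<Gamma>}. c \<Gamma> * mon \<Gamma> y)"
definition Tf :: "('e \<Rightarrow> real) \<Rightarrow> real" where "Tf y = \<tau> * (\<Sum>e\<in>E. Af e y * Df e y)"
definition V :: real where "V = (\<Sum>\<Gamma>\<in>G. (c \<Gamma>)\<^sup>2 * \<tau> ^ card \<Gamma>)"

lemma finGat: "finite (Gat e)" using finG by (simp add: Gat_def)

lemma V_nonneg: "0 \<le> V" unfolding V_def using \<tau>_le by (intro sum_nonneg) auto

lemma bdd_rv_S [intro]: "bdd_rv (\<lambda>\<omega>. Sf (Y \<omega>))"
  unfolding Sf_def using G by (intro bdd_rv_sum bdd_rv_mult bdd_rv_const bdd_rv_mon) auto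
lemma bdd_rv_D [intro]: "bdd_rv (\<lambda>\<omega>. Df e (Y \<omega>))"
  unfolding Df_def Gat_def by (intro bdd_rv_sum bdd_rv_mult bdd_rv_const bdd_rv_mon) (use G in auto)
lemma bdd_rv_A [intro]: "bdd_rv (\<lambda>\<omega>. Af e (Y \<omega>))"
  unfolding Af_def Gat_def by (intro bdd_rv_sum bdd_rv_mult bdd_rv_const bdd_rv_mon) (use G in auto)
lemma bdd_rv_R [intro]: "bdd_rv (\<lambda>\<omega>. Rf e (Y \<omega>))"
  unfolding Rf_def by (intro bdd_rv_sum bdd_rv_mult bdd_rv_const bdd_rv_mon) (use G in auto)
lemma bdd_rv_T [intro]: "bdd_rv (\<lambda>\<omega>. Tf (Y \<omega>))"
  unfolding Tf_def by (intro bdd_rv_sum bdd_rv_mult bdd_rv_const bdd_rv_A bdd_rv_D)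

lemma mon_remove: "\<Gamma> \<in> G \<Longrightarrow> e \<in> \<Gamma> \<Longrightarrow> mon \<Gamma> y = y e * mon (\<Gamma> - {e}) y"
  unfolding mon_def by (rule prod.remove[OF fin_cluster])

lemma S_split: "Sf y = Rf e y + y e * Df e y"
proof -
  have "G = {\<Gamma>\<in>G. e \<notin> \<Gamma>} \<union> Gat e" "{\<Gamma>\<in>G. e \<notin> \<Gamma>} \<inter> Gat e = {}" by (auto simp: Gat_def)
  then have "Sf y = Rf e y + (\<Sum>\<Gamma>\<in>Gat e. c \<Gamma> * mon \<Gamma> y)"
    unfolding Sf_def Rf_def using finG by (metis (no_types, lifting) finite_Un sum.union_disjoint)
  also have "(\<Sum>\<Gamma>\<in>Gat e. c \<Gamma> * mon \<Gamma> y) = y e * Df e y"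
    unfolding Df_def sum_distrib_left by (intro sum.cong refl) (auto simp: mon_remove Gat_def)
  finally show ?thesis .
qed

lemma sum_over_edges: "(\<Sum>e\<in>E. \<Sum>\<Gamma>\<in>Gat e. f \<Gamma> / real (card \<Gamma>)) = (\<Sum>\<Gamma>\<in>G. f \<Gamma>)"
proof -
  have "(\<Sum>e\<in>E. \<Sum>\<Gamma>\<in>Gat e. f \<Gamma> / real (card \<Gamma>)) = (\<Sum>e\<in>E. \<Sum>\<Gamma>\<in>G. if e \<in> \<Gamma> then f \<Gamma> / real (card \<Gamma>) else 0)"
    unfolding Gat_def using finG by (intro sum.cong refl sum.inter_filter)
  also have "\<dots> = (\<Sum>\<Gamma>\<in>G. \<Sum>e\<in>E. if e \<in> \<Gamma> then f \<Gamma> / real (card \<Gamma>) else 0)" by (rule sum.swap)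
  also have "\<dots> = (\<Sum>\<Gamma>\<in>G. f \<Gamma>)"
  proof (rule sum.cong)
    fix \<Gamma> assume \<Gamma>: "\<Gamma> \<in> G"
    then have "card \<Gamma> > 0" using G(2) fin_cluster by (auto simp: card_gt_0_iff)
    moreover have "(\<Sum>e\<in>E. if e \<in> \<Gamma> then f \<Gamma> / real (card \<Gamma>) else 0) = real (card \<Gamma>) * (f \<Gamma> / real (card \<Gamma>))"
      using finE G(1)[OF \<Gamma>] by (simp add: sum.inter_restrict[symmetric] Int_absorb1)
    ultimately show "(\<Sum>e\<in>E. if e \<in> \<Gamma> then f \<Gamma> / real (card \<Gamma>) else 0) = f \<Gamma>" by simp
  qed simp
  finally show ?thesis .
qed

lemma S_as_sum: "Sf y = (\<Sum>e\<in>E. y e * Af e y)"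
proof -
  have "(\<Sum>e\<in>E. y e * Af e y) = (\<Sum>e\<in>E. \<Sum>\<Gamma>\<in>Gat e. (c \<Gamma> * mon \<Gamma> y) / real (card \<Gamma>))"
    unfolding Af_def sum_distrib_left by (intro sum.cong refl) (auto simp: mon_remove Gat_def)
  then show ?thesis unfolding sum_over_edges Sf_def by simp
qed

text \<open>
  Forget the coordinate \<open>e\<close>. Functions that do not change under this operation are independent of the weight of \<open>e\<close>.
\<close>
definition off :: "'e \<Rightarrow> ('e \<Rightarrow> real) \<Rightarrow> 'e \<Rightarrow> real" where "off e y = restrict y (E - {e})"

lemma restrict_functions:
  "Df e (off e y) = Df e y" "Af e (off e y) = Af e y" "Rf e (off e y) = Rf e y"
proof -
  have m: "mon \<Delta> (off e y) = mon \<Delta> y" if "\<Delta> \<subseteq> E - {e}" for \<Delta>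
    unfolding mon_def off_def using that by (intro prod.cong) auto
  have "\<Gamma> - {e} \<subseteq> E - {e}" if "\<Gamma> \<in> Gat e" for \<Gamma> using that G(1) by (auto simp: Gat_def)
  then have "mon (\<Gamma> - {e}) (off e y) = mon (\<Gamma> - {e}) y" if "\<Gamma> \<in> Gat e" for \<Gamma> using that m by blast
  then show "Df e (off e y) = Df e y" "Af e (off e y) = Af e y"
    unfolding Df_def Af_def by (simp_all cong: sum.cong)
  show "Rf e (off e y) = Rf e y"
  proof -
    have "mon \<Gamma> (off e y) = mon \<Gamma> y" if "\<Gamma> \<in> G" "e \<notin> \<Gamma>" for \<Gamma>
      using that G(1)[of \<Gamma>] by (intro m) blast
    then show ?thesis unfolding Rf_def by (intro sum.cong) auto
  qed
qed

lemma measurable_functions [measurable]: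
  "Df e \<in> borel_measurable (PiM (E - {e}) (\<lambda>_. borel))" "Af e \<in> borel_measurable (PiM (E - {e}) (\<lambda>_. borel))"
  "Rf e \<in> borel_measurable (PiM (E - {e}) (\<lambda>_. borel))"
proof -
  have m: "mon \<Delta> \<in> borel_measurable (PiM (E - {e}) (\<lambda>_. borel))" if "\<Delta> \<subseteq> E - {e}" for \<Delta>
    unfolding mon_def[abs_def] using that by (intro borel_measurable_prod measurable_component_singleton) auto
  have "\<Gamma> - {e} \<subseteq> E - {e}" if "\<Gamma> \<in> Gat e" for \<Gamma> using that G(1) by (auto simp: Gat_def)
  then show "Df e \<in> borel_measurable (PiM (E - {e}) (\<lambda>_. borel))" "Af e \<in> borel_measurable (PiM (E - {e}) (\<lambda>_. borel))"
    unfolding Df_def[abs_def] Af_def[abs_def] by (intro borel_measurable_sum borel_measurable_times borel_measurable_const m; blast)+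
  show "Rf e \<in> borel_measurable (PiM (E - {e}) (\<lambda>_. borel))"
    unfolding Rf_def[abs_def] using G(1) by (auto intro!: borel_measurable_sum borel_measurable_times m)
qed

lemma split_expectation:
  fixes g :: "('e \<Rightarrow> real) \<Rightarrow> complex"
  assumes e: "e \<in> E" and g: "g \<in> borel_measurable (PiM (E - {e}) (\<lambda>_. borel))"
    and r: "\<And>y. g (off e y) = g y" and b: "bdd_rv (\<lambda>\<omega>. g (Y \<omega>))"
  shows "expectation (\<lambda>\<omega>. complex_of_real (t e \<omega> ^ n) * g (Y \<omega>)) = complex_of_real (expectation (\<lambda>\<omega>. t e \<omega> ^ n)) * expectation (\<lambda>\<omega>. g (Y \<omega>))"
proof -
  have "expectation (\<lambda>\<omega>. complex_of_real (t e \<omega> ^ n) * g (restrict (Y \<omega>) (E - {e})))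
     = expectation (\<lambda>\<omega>. complex_of_real (t e \<omega> ^ n)) * expectation (\<lambda>\<omega>. g (restrict (Y \<omega>) (E - {e})))"
  proof (rule indep_split[OF e _ g])
    show "integrable M (\<lambda>\<omega>. complex_of_real (t e \<omega> ^ n))"
      by (intro bdd_rv_integrable bdd_rv_of_real bdd_rv_power bdd_rv_t e)
    show "integrable M (\<lambda>\<omega>. g (restrict (Y \<omega>) (E - {e})))"
      unfolding off_def[symmetric] r by (rule bdd_rv_integrable[OF b])
  qed simp
  then show ?thesis unfolding off_def[symmetric] r by (simp only: integral_complex_of_real)
qed

lemma split_expectation_real:
  fixes g :: "('e \<Rightarrow> real) \<Rightarrow> real"
  assumes e: "e \<in> E" and g: "g \<in> borel_measurable (PiM (E - {e}) (\<lambda>_. borel))"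
    and r: "\<And>y. g (off e y) = g y" and b: "bdd_rv (\<lambda>\<omega>. g (Y \<omega>))"
  shows "expectation (\<lambda>\<omega>. t e \<omega> ^ n * g (Y \<omega>)) = expectation (\<lambda>\<omega>. t e \<omega> ^ n) * expectation (\<lambda>\<omega>. g (Y \<omega>))"
proof -
  have "complex_of_real (expectation (\<lambda>\<omega>. t e \<omega> ^ n * g (Y \<omega>)))
      = expectation (\<lambda>\<omega>. complex_of_real (t e \<omega> ^ n) * complex_of_real (g (Y \<omega>)))"
    by (subst integral_complex_of_real[symmetric]) simp
  also have "\<dots> = complex_of_real (expectation (\<lambda>\<omega>. t e \<omega> ^ n)) * expectation (\<lambda>\<omega>. complex_of_real (g (Y \<omega>)))"
    by (rule split_expectation[OF e]) (use g in measurable, simp only: r, intro bdd_rv_of_real b)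
  also have "\<dots> = complex_of_real (expectation (\<lambda>\<omega>. t e \<omega> ^ n) * expectation (\<lambda>\<omega>. g (Y \<omega>)))"
    by (simp add: integral_complex_of_real)
  finally show ?thesis by (simp only: of_real_eq_iff)
qed

text \<open>
  Integrate \<open>Sf\<^sup>2\<close> by parts in each edge: of \<open>Sf = Rf e + y e * Df e\<close> only the second term survives.
\<close>
lemma expectation_T: "expectation (\<lambda>\<omega>. Tf (Y \<omega>)) = V"
proof -
  have e: "expectation (\<lambda>\<omega>. t e \<omega> * Af e (Y \<omega>) * Sf (Y \<omega>)) = \<tau> * expectation (\<lambda>\<omega>. Af e (Y \<omega>) * Df e (Y \<omega>))" if e: "e \<in> E" for e
  proof -
    have "expectation (\<lambda>\<omega>. t e \<omega> * Af e (Y \<omega>) * Sf (Y \<omega>))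
       = expectation (\<lambda>\<omega>. t e \<omega> ^ 1 * (Af e (Y \<omega>) * Rf e (Y \<omega>)) + t e \<omega> ^ 2 * (Af e (Y \<omega>) * Df e (Y \<omega>)))"
      by (rule Bochner_Integration.integral_cong) (simp_all add: S_split[of _ e] power2_eq_square algebra_simps)
    also have "\<dots> = expectation (\<lambda>\<omega>. t e \<omega> ^ 1 * (Af e (Y \<omega>) * Rf e (Y \<omega>))) + expectation (\<lambda>\<omega>. t e \<omega> ^ 2 * (Af e (Y \<omega>) * Df e (Y \<omega>)))"
      by (intro Bochner_Integration.integral_add bdd_rv_integrable bdd_rv_mult bdd_rv_power bdd_rv_A bdd_rv_R bdd_rv_D bdd_rv_t e)
    also have "expectation (\<lambda>\<omega>. t e \<omega> ^ 1 * (Af e (Y \<omega>) * Rf e (Y \<omega>))) = expectation (\<lambda>\<omega>. t e \<omega> ^ 1) * expectation (\<lambda>\<omega>. Af e (Y \<omega>) * Rf e (Y \<omega>))"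
      by (rule split_expectation_real[OF e]) (measurable, simp only: restrict_functions, intro bdd_rv_mult bdd_rv_of_real bdd_rv_iexp bdd_rv_const bdd_rv_A bdd_rv_R bdd_rv_D bdd_rv_power)
    also have "expectation (\<lambda>\<omega>. t e \<omega> ^ 1) = 0" by (rule odd_moment[OF e]) simp
    also have "expectation (\<lambda>\<omega>. t e \<omega> ^ 2 * (Af e (Y \<omega>) * Df e (Y \<omega>))) = expectation (\<lambda>\<omega>. t e \<omega> ^ 2) * expectation (\<lambda>\<omega>. Af e (Y \<omega>) * Df e (Y \<omega>))"
      by (rule split_expectation_real[OF e]) (measurable, simp only: restrict_functions, intro bdd_rv_mult bdd_rv_of_real bdd_rv_iexp bdd_rv_const bdd_rv_A bdd_rv_R bdd_rv_D bdd_rv_power)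
    finally show ?thesis by (simp add: second_moment[OF e])
  qed
  have "V = expectation (\<lambda>\<omega>. (Sf (Y \<omega>))\<^sup>2)"
    unfolding V_def Sf_def by (rule expectation_lincomb_square[symmetric, OF finG G(1)])
  also have "\<dots> = expectation (\<lambda>\<omega>. \<Sum>e\<in>E. t e \<omega> * Af e (Y \<omega>) * Sf (Y \<omega>))"
    unfolding power2_eq_square by (subst (1) S_as_sum) (simp add: sum_distrib_right)
  also have "\<dots> = (\<Sum>e\<in>E. expectation (\<lambda>\<omega>. t e \<omega> * Af e (Y \<omega>) * Sf (Y \<omega>)))"
    by (intro expectation_sum bdd_rv_mult bdd_rv_t bdd_rv_A bdd_rv_S)
  also have "\<dots> = (\<Sum>e\<in>E. \<tau> * expectation (\<lambda>\<omega>. Af e (Y \<omega>) * Df e (Y \<omega>)))" by (intro sum.cong refl e)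
  also have "\<dots> = \<tau> * expectation (\<lambda>\<omega>. \<Sum>e\<in>E. Af e (Y \<omega>) * Df e (Y \<omega>))"
    by (subst expectation_sum) (auto simp: sum_distrib_left)
  finally show ?thesis by (simp add: Tf_def)
qed

lemma sum_A_square: "(\<Sum>e\<in>E. \<tau> * expectation (\<lambda>\<omega>. (Af e (Y \<omega>))\<^sup>2)) \<le> V"
proof -
  have "\<tau> * expectation (\<lambda>\<omega>. (Af e (Y \<omega>))\<^sup>2) \<le> (\<Sum>\<Gamma>\<in>Gat e. ((c \<Gamma>)\<^sup>2 * \<tau> ^ card \<Gamma>) / real (card \<Gamma>))" if e: "e \<in> E" for e
  proof -
    define c' where "c' \<Delta> = c (insert e \<Delta>) / real (card (insert e \<Delta>))" for \<Delta>
    define G' where "G' = (\<lambda>\<Gamma>. \<Gamma> - {e}) ` Gat e"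
    have inj: "inj_on (\<lambda>\<Gamma>. \<Gamma> - {e}) (Gat e)" by (auto simp: inj_on_def Gat_def)
    have ins: "insert e (\<Gamma> - {e}) = \<Gamma>" if "\<Gamma> \<in> Gat e" for \<Gamma> using that by (auto simp: Gat_def)
    have "Af e y = (\<Sum>\<Delta>\<in>G'. c' \<Delta> * mon \<Delta> y)" for y
      unfolding Af_def G'_def sum.reindex[OF inj] c'_def by (intro sum.cong) (auto simp: ins simp del: insert_Diff_single)
    then have "expectation (\<lambda>\<omega>. (Af e (Y \<omega>))\<^sup>2) = (\<Sum>\<Delta>\<in>G'. (c' \<Delta>)\<^sup>2 * \<tau> ^ card \<Delta>)"
      using finGat G(1) by (simp only:) (rule expectation_lincomb_square, auto simp: G'_def Gat_def)
    also have "\<dots> = (\<Sum>\<Gamma>\<in>Gat e. (c \<Gamma> / real (card \<Gamma>))\<^sup>2 * \<tau> ^ (card \<Gamma> - 1))"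
      unfolding G'_def sum.reindex[OF inj] c'_def
      by (intro sum.cong) (auto simp: ins Gat_def fin_cluster card_Diff_singleton insert_absorb)
    finally have "\<tau> * expectation (\<lambda>\<omega>. (Af e (Y \<omega>))\<^sup>2) = (\<Sum>\<Gamma>\<in>Gat e. \<tau> * ((c \<Gamma> / real (card \<Gamma>))\<^sup>2 * \<tau> ^ (card \<Gamma> - 1)))"
      by (simp add: sum_distrib_left)
    also have "\<dots> \<le> (\<Sum>\<Gamma>\<in>Gat e. ((c \<Gamma>)\<^sup>2 * \<tau> ^ card \<Gamma>) / real (card \<Gamma>))"
    proof (rule sum_mono)
      fix \<Gamma> assume "\<Gamma> \<in> Gat e"
      then have \<Gamma>: "card \<Gamma> > 0" using fin_cluster by (auto simp: Gat_def card_gt_0_iff)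
      then have "\<tau> * \<tau> ^ (card \<Gamma> - 1) = \<tau> ^ card \<Gamma>" by (cases "card \<Gamma>") auto
      then have "\<tau> * ((c \<Gamma> / real (card \<Gamma>))\<^sup>2 * \<tau> ^ (card \<Gamma> - 1)) = ((c \<Gamma>)\<^sup>2 * \<tau> ^ card \<Gamma> / real (card \<Gamma>)) / real (card \<Gamma>)"
        by (simp add: power_divide power2_eq_square mult_ac)
      also have "\<dots> \<le> ((c \<Gamma>)\<^sup>2 * \<tau> ^ card \<Gamma>) / real (card \<Gamma>) / 1"
        using \<Gamma> \<tau>_le by (intro divide_left_mono) auto
      finally show "\<tau> * ((c \<Gamma> / real (card \<Gamma>))\<^sup>2 * \<tau> ^ (card \<Gamma> - 1)) \<le> ((c \<Gamma>)\<^sup>2 * \<tau> ^ card \<Gamma>) / real (card \<Gamma>)" by simp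
    qed
    finally show ?thesis .
  qed
  then have "(\<Sum>e\<in>E. \<tau> * expectation (\<lambda>\<omega>. (Af e (Y \<omega>))\<^sup>2)) \<le> (\<Sum>e\<in>E. \<Sum>\<Gamma>\<in>Gat e. ((c \<Gamma>)\<^sup>2 * \<tau> ^ card \<Gamma>) / real (card \<Gamma>))"
    by (intro sum_mono)
  then show ?thesis unfolding sum_over_edges V_def .
qed

definition D4sum :: real where "D4sum = \<kappa> ^ 4 * (\<Sum>e\<in>E. expectation (\<lambda>\<omega>. (Df e (Y \<omega>)) ^ 4))"

text \<open>
  Stein's identity for one edge. Expand the exponential in the direction of \<open>e\<close>: the term of order zero
  vanishes by symmetry, the linear one is the main term, and the rest is of third order in the weight. The
  arithmetic-geometric inequality with the free parameter \<open>\<theta>\<close> splits it into a part controlled by the variance and a part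
  controlled by fourth moments. In the main term, \<open>Rf e\<close> is replaced by \<open>Sf\<close> in the exponent with an error
  of the same form.
\<close>
lemma stein_edge:
  assumes e: "e \<in> E" and \<theta>: "\<theta> > 0"
  shows "cmod (expectation (\<lambda>\<omega>. complex_of_real (t e \<omega> * Af e (Y \<omega>)) * iexp (s * Sf (Y \<omega>)))
            - \<i> * s * expectation (\<lambda>\<omega>. complex_of_real (\<tau> * (Af e (Y \<omega>) * Df e (Y \<omega>))) * iexp (s * Sf (Y \<omega>))))
     \<le> s\<^sup>2 * (\<theta> * (\<tau> * expectation (\<lambda>\<omega>. (Af e (Y \<omega>))\<^sup>2)) + \<kappa> ^ 4 * expectation (\<lambda>\<omega>. (Df e (Y \<omega>)) ^ 4) / \<theta>)"
proof -
  define A where "A \<omega> = Af e (Y \<omega>)" for \<omega>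
  define D where "D \<omega> = Df e (Y \<omega>)" for \<omega>
  define R where "R \<omega> = Rf e (Y \<omega>)" for \<omega>
  define S where "S \<omega> = Sf (Y \<omega>)" for \<omega>
  have S: "S \<omega> = R \<omega> + t e \<omega> * D \<omega>" for \<omega> by (simp add: S_def R_def D_def S_split[of _ e])
  have b [intro]: "bdd_rv A" "bdd_rv D" "bdd_rv R" "bdd_rv S" "bdd_rv (t e)"
    unfolding A_def[abs_def] D_def[abs_def] R_def[abs_def] S_def[abs_def] using e by auto
  note bi = bdd_rv_mult bdd_rv_add bdd_rv_diff bdd_rv_power bdd_rv_abs bdd_rv_of_real bdd_rv_iexp bdd_rv_const b bdd_rv_divide
  (* P collects the second-order remainder of the expansion, Q the change of the exponent from R back to S. *)
  define P where "P \<omega> = complex_of_real (t e \<omega> * A \<omega>) * (iexp (s * S \<omega>) - iexp (s * R \<omega>) * (1 + \<i> * (s * (t e \<omega> * D \<omega>))))" for \<omega>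
  define Q where "Q \<omega> = complex_of_real (\<tau> * (A \<omega> * D \<omega>)) * (iexp (s * R \<omega>) - iexp (s * S \<omega>))" for \<omega>
  have bP [intro]: "bdd_rv P" unfolding P_def by (intro bi)
  have bQ [intro]: "bdd_rv Q" unfolding Q_def by (intro bi)
  have z1: "expectation (\<lambda>\<omega>. complex_of_real (t e \<omega> ^ 1) * (complex_of_real (A \<omega>) * iexp (s * R \<omega>))) = 0"
  proof -
    have "expectation (\<lambda>\<omega>. complex_of_real (t e \<omega> ^ 1) * (complex_of_real (A \<omega>) * iexp (s * R \<omega>)))
       = complex_of_real (expectation (\<lambda>\<omega>. t e \<omega> ^ 1)) * expectation (\<lambda>\<omega>. complex_of_real (A \<omega>) * iexp (s * R \<omega>))"
      unfolding A_def R_def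
      by (rule split_expectation[OF e]) (measurable, simp only: restrict_functions, intro bdd_rv_mult bdd_rv_of_real bdd_rv_iexp bdd_rv_const bdd_rv_A bdd_rv_R bdd_rv_D bdd_rv_power)
    also have "expectation (\<lambda>\<omega>. t e \<omega> ^ 1) = 0" by (rule odd_moment[OF e]) simp
    finally show ?thesis by simp
  qed
  have z2: "expectation (\<lambda>\<omega>. complex_of_real (t e \<omega> ^ 2) * (complex_of_real (A \<omega> * D \<omega>) * iexp (s * R \<omega>)))
     = \<tau> * expectation (\<lambda>\<omega>. complex_of_real (A \<omega> * D \<omega>) * iexp (s * R \<omega>))"
  proof -
    have "expectation (\<lambda>\<omega>. complex_of_real (t e \<omega> ^ 2) * (complex_of_real (A \<omega> * D \<omega>) * iexp (s * R \<omega>)))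
       = complex_of_real (expectation (\<lambda>\<omega>. t e \<omega> ^ 2)) * expectation (\<lambda>\<omega>. complex_of_real (A \<omega> * D \<omega>) * iexp (s * R \<omega>))"
      unfolding A_def R_def D_def
      by (rule split_expectation[OF e]) (measurable, simp only: restrict_functions, intro bdd_rv_mult bdd_rv_of_real bdd_rv_iexp bdd_rv_const bdd_rv_A bdd_rv_R bdd_rv_D bdd_rv_power)
    then show ?thesis by (simp only: second_moment[OF e])
  qed
  have "expectation (\<lambda>\<omega>. complex_of_real (t e \<omega> * A \<omega>) * iexp (s * S \<omega>))
     = expectation (\<lambda>\<omega>. P \<omega> + (complex_of_real (t e \<omega> ^ 1) * (complex_of_real (A \<omega>) * iexp (s * R \<omega>))
         + (\<i> * s) * (complex_of_real (t e \<omega> ^ 2) * (complex_of_real (A \<omega> * D \<omega>) * iexp (s * R \<omega>)))))"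
    by (rule Bochner_Integration.integral_cong) (simp_all add: P_def algebra_simps power2_eq_square)
  also have "\<dots> = expectation P + (expectation (\<lambda>\<omega>. complex_of_real (t e \<omega> ^ 1) * (complex_of_real (A \<omega>) * iexp (s * R \<omega>)))
         + (\<i> * s) * expectation (\<lambda>\<omega>. complex_of_real (t e \<omega> ^ 2) * (complex_of_real (A \<omega> * D \<omega>) * iexp (s * R \<omega>))))"
    by (subst Bochner_Integration.integral_add, (intro bdd_rv_integrable bi bP)+)
       (subst Bochner_Integration.integral_add, (intro bdd_rv_integrable bi)+, simp only: integral_mult_right_zero)
  also have "\<dots> = expectation P + (\<i> * s) * (\<tau> * expectation (\<lambda>\<omega>. complex_of_real (A \<omega> * D \<omega>) * iexp (s * R \<omega>)))"
    unfolding z1 z2 by simp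
  also have "\<tau> * expectation (\<lambda>\<omega>. complex_of_real (A \<omega> * D \<omega>) * iexp (s * R \<omega>))
     = expectation (\<lambda>\<omega>. Q \<omega> + complex_of_real (\<tau> * (A \<omega> * D \<omega>)) * iexp (s * S \<omega>))"
    unfolding integral_mult_right_zero[symmetric]
    by (rule Bochner_Integration.integral_cong) (simp_all add: Q_def algebra_simps)
  also have "\<dots> = expectation Q + expectation (\<lambda>\<omega>. complex_of_real (\<tau> * (A \<omega> * D \<omega>)) * iexp (s * S \<omega>))"
    by (intro Bochner_Integration.integral_add bdd_rv_integrable bi bQ)
  finally have main: "expectation (\<lambda>\<omega>. complex_of_real (t e \<omega> * A \<omega>) * iexp (s * S \<omega>))
      - \<i> * s * expectation (\<lambda>\<omega>. complex_of_real (\<tau> * (A \<omega> * D \<omega>)) * iexp (s * S \<omega>))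
     = expectation P + (\<i> * s) * expectation Q" by (simp add: algebra_simps)
  have iexp1: "cmod (iexp x - 1) \<le> \<bar>x\<bar>" for x using iexp_approx1[of x 0] by simp
  have iexp2: "cmod (iexp x - (1 + \<i> * x)) \<le> x\<^sup>2 / 2" for x
    using iexp_approx1[of x 1] by (simp add: numeral_2_eq_2 power2_eq_square)
  have spl: "iexp (s * S \<omega>) = iexp (s * R \<omega>) * iexp (s * (t e \<omega> * D \<omega>))" for \<omega>
    unfolding S by (simp add: exp_add[symmetric] algebra_simps)
  have amgm: "2 * (x * y) \<le> \<theta> * x\<^sup>2 + y\<^sup>2 / \<theta>" for x y
  proof -
    have "0 \<le> (\<theta> * x - y)\<^sup>2 / \<theta>" using \<theta> by simp
    also have "\<dots> = \<theta> * x\<^sup>2 + y\<^sup>2 / \<theta> - 2 * (x * y)" using \<theta> by (simp add: power2_eq_square field_simps)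
    finally show ?thesis by simp
  qed
  have boundP: "cmod (P \<omega>) \<le> s\<^sup>2 / 2 * (\<theta> * (t e \<omega> ^ 2 * (A \<omega>)\<^sup>2) + (t e \<omega> ^ 4 * (D \<omega>) ^ 4) / \<theta>)" for \<omega>
  proof -
    have "P \<omega> = complex_of_real (t e \<omega> * A \<omega>) * iexp (s * R \<omega>) * (iexp (s * (t e \<omega> * D \<omega>)) - (1 + \<i> * (s * (t e \<omega> * D \<omega>))))"
      unfolding P_def spl by (simp add: algebra_simps)
    then have "cmod (P \<omega>) = \<bar>t e \<omega> * A \<omega>\<bar> * cmod (iexp (s * (t e \<omega> * D \<omega>)) - (1 + \<i> * complex_of_real (s * (t e \<omega> * D \<omega>))))"
      by (simp add: norm_mult abs_mult)
    also have "\<dots> \<le> \<bar>t e \<omega> * A \<omega>\<bar> * ((s * (t e \<omega> * D \<omega>))\<^sup>2 / 2)" by (intro mult_left_mono iexp2) simp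
    also have "\<dots> = s\<^sup>2 / 2 * (\<bar>t e \<omega> * A \<omega>\<bar> * (t e \<omega> * D \<omega>)\<^sup>2)" by (simp add: power_mult_distrib)
    also have "\<dots> \<le> s\<^sup>2 / 2 * (\<theta> * \<bar>t e \<omega> * A \<omega>\<bar>\<^sup>2 + ((t e \<omega> * D \<omega>)\<^sup>2)\<^sup>2 / \<theta>)"
    proof (intro mult_left_mono)
      have "0 \<le> \<bar>t e \<omega> * A \<omega>\<bar> * (t e \<omega> * D \<omega>)\<^sup>2" by simp
      then show "\<bar>t e \<omega> * A \<omega>\<bar> * (t e \<omega> * D \<omega>)\<^sup>2 \<le> \<theta> * \<bar>t e \<omega> * A \<omega>\<bar>\<^sup>2 + ((t e \<omega> * D \<omega>)\<^sup>2)\<^sup>2 / \<theta>"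
        using amgm[of "\<bar>t e \<omega> * A \<omega>\<bar>" "(t e \<omega> * D \<omega>)\<^sup>2"] by linarith
    qed simp
    finally show ?thesis by (simp add: power_mult_distrib)
  qed
  have boundQ: "cmod (Q \<omega>) \<le> \<bar>s\<bar> / 2 * (\<theta> * (\<tau> * (A \<omega>)\<^sup>2) + \<tau> * (t e \<omega> ^ 2 * (D \<omega>) ^ 4) / \<theta>)" for \<omega>
  proof -
    have "Q \<omega> = - (complex_of_real (\<tau> * (A \<omega> * D \<omega>)) * iexp (s * R \<omega>) * (iexp (s * (t e \<omega> * D \<omega>)) - 1))"
      unfolding Q_def spl by (simp add: algebra_simps)
    then have "cmod (Q \<omega>) = \<bar>\<tau> * (A \<omega> * D \<omega>)\<bar> * cmod (iexp (s * (t e \<omega> * D \<omega>)) - 1)"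
      by (simp add: norm_mult abs_mult)
    also have "\<dots> \<le> \<bar>\<tau> * (A \<omega> * D \<omega>)\<bar> * \<bar>s * (t e \<omega> * D \<omega>)\<bar>" by (intro mult_left_mono iexp1) simp
    also have "\<dots> = \<bar>s\<bar> * \<tau> / 2 * (2 * (\<bar>A \<omega>\<bar> * (\<bar>t e \<omega>\<bar> * (D \<omega>)\<^sup>2)))"
      using \<tau>_le by (simp add: abs_mult power2_eq_square)
    also have "\<dots> \<le> \<bar>s\<bar> * \<tau> / 2 * (\<theta> * \<bar>A \<omega>\<bar>\<^sup>2 + (\<bar>t e \<omega>\<bar> * (D \<omega>)\<^sup>2)\<^sup>2 / \<theta>)"
      using \<tau>_le by (intro mult_left_mono amgm) auto
    finally show ?thesis by (simp add: power_mult_distrib algebra_simps)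
  qed
  have EP: "cmod (expectation P) \<le> s\<^sup>2 / 2 * (\<theta> * (\<tau> * expectation (\<lambda>\<omega>. (A \<omega>)\<^sup>2)) + \<kappa> ^ 4 * expectation (\<lambda>\<omega>. (D \<omega>) ^ 4) / \<theta>)"
  proof -
    have "cmod (expectation P) \<le> expectation (\<lambda>\<omega>. cmod (P \<omega>))" by (rule integral_norm_bound)
    also have "\<dots> \<le> expectation (\<lambda>\<omega>. s\<^sup>2 / 2 * (\<theta> * (t e \<omega> ^ 2 * (A \<omega>)\<^sup>2) + (t e \<omega> ^ 4 * (D \<omega>) ^ 4) / \<theta>))"
      by (rule integral_mono) (use boundP bP in \<open>auto intro!: bdd_rv_integrable bi integrable_norm\<close>)
    also have "\<dots> = s\<^sup>2 / 2 * (\<theta> * expectation (\<lambda>\<omega>. t e \<omega> ^ 2 * (A \<omega>)\<^sup>2) + expectation (\<lambda>\<omega>. t e \<omega> ^ 4 * (D \<omega>) ^ 4) / \<theta>)"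
      by (simp only: integral_mult_right_zero, subst Bochner_Integration.integral_add, (intro bdd_rv_integrable bi)+)
         (simp only: integral_mult_right_zero integral_divide_zero)
    also have "expectation (\<lambda>\<omega>. t e \<omega> ^ 2 * (A \<omega>)\<^sup>2) = \<tau> * expectation (\<lambda>\<omega>. (A \<omega>)\<^sup>2)"
      unfolding A_def second_moment[OF e, symmetric] by (rule split_expectation_real[OF e]) (measurable, simp only: restrict_functions, intro bdd_rv_mult bdd_rv_of_real bdd_rv_iexp bdd_rv_const bdd_rv_A bdd_rv_R bdd_rv_D bdd_rv_power)
    also have "expectation (\<lambda>\<omega>. t e \<omega> ^ 4 * (D \<omega>) ^ 4) = expectation (\<lambda>\<omega>. t e \<omega> ^ 4) * expectation (\<lambda>\<omega>. (D \<omega>) ^ 4)"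
      unfolding D_def by (rule split_expectation_real[OF e]) (measurable, simp only: restrict_functions, intro bdd_rv_mult bdd_rv_of_real bdd_rv_iexp bdd_rv_const bdd_rv_A bdd_rv_R bdd_rv_D bdd_rv_power)
    also have "s\<^sup>2 / 2 * (\<theta> * (\<tau> * expectation (\<lambda>\<omega>. (A \<omega>)\<^sup>2)) + expectation (\<lambda>\<omega>. t e \<omega> ^ 4) * expectation (\<lambda>\<omega>. (D \<omega>) ^ 4) / \<theta>)
       \<le> s\<^sup>2 / 2 * (\<theta> * (\<tau> * expectation (\<lambda>\<omega>. (A \<omega>)\<^sup>2)) + \<kappa> ^ 4 * expectation (\<lambda>\<omega>. (D \<omega>) ^ 4) / \<theta>)"
      using \<theta> fourth_moment[OF e]
      by (intro mult_left_mono add_mono divide_right_mono mult_right_mono order_refl Bochner_Integration.integral_nonneg) auto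
    finally show ?thesis .
  qed
  have EQ: "cmod (expectation Q) \<le> \<bar>s\<bar> / 2 * (\<theta> * (\<tau> * expectation (\<lambda>\<omega>. (A \<omega>)\<^sup>2)) + \<kappa> ^ 4 * expectation (\<lambda>\<omega>. (D \<omega>) ^ 4) / \<theta>)"
  proof -
    have "cmod (expectation Q) \<le> expectation (\<lambda>\<omega>. cmod (Q \<omega>))" by (rule integral_norm_bound)
    also have "\<dots> \<le> expectation (\<lambda>\<omega>. \<bar>s\<bar> / 2 * (\<theta> * (\<tau> * (A \<omega>)\<^sup>2) + \<tau> * (t e \<omega> ^ 2 * (D \<omega>) ^ 4) / \<theta>))"
      by (rule integral_mono) (use boundQ bQ in \<open>auto intro!: bdd_rv_integrable bi integrable_norm\<close>)
    also have "\<dots> = \<bar>s\<bar> / 2 * (\<theta> * (\<tau> * expectation (\<lambda>\<omega>. (A \<omega>)\<^sup>2)) + \<tau> * expectation (\<lambda>\<omega>. t e \<omega> ^ 2 * (D \<omega>) ^ 4) / \<theta>)"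
      by (simp only: integral_mult_right_zero, subst Bochner_Integration.integral_add, (intro bdd_rv_integrable bi)+)
         (simp only: integral_mult_right_zero integral_divide_zero)
    also have "expectation (\<lambda>\<omega>. t e \<omega> ^ 2 * (D \<omega>) ^ 4) = \<tau> * expectation (\<lambda>\<omega>. (D \<omega>) ^ 4)"
      unfolding D_def second_moment[OF e, symmetric] by (rule split_expectation_real[OF e]) (measurable, simp only: restrict_functions, intro bdd_rv_mult bdd_rv_of_real bdd_rv_iexp bdd_rv_const bdd_rv_A bdd_rv_R bdd_rv_D bdd_rv_power)
    also have "\<tau> * (\<tau> * expectation (\<lambda>\<omega>. (D \<omega>) ^ 4)) = \<tau>\<^sup>2 * expectation (\<lambda>\<omega>. (D \<omega>) ^ 4)" by (simp add: power2_eq_square)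
    also have "\<bar>s\<bar> / 2 * (\<theta> * (\<tau> * expectation (\<lambda>\<omega>. (A \<omega>)\<^sup>2)) + \<tau>\<^sup>2 * expectation (\<lambda>\<omega>. (D \<omega>) ^ 4) / \<theta>)
       \<le> \<bar>s\<bar> / 2 * (\<theta> * (\<tau> * expectation (\<lambda>\<omega>. (A \<omega>)\<^sup>2)) + \<kappa> ^ 4 * expectation (\<lambda>\<omega>. (D \<omega>) ^ 4) / \<theta>)"
    proof -
      have "\<tau>\<^sup>2 \<le> (\<kappa> ^ 2)\<^sup>2" using \<tau>_le by (intro power_mono)
      then have "\<tau>\<^sup>2 \<le> \<kappa> ^ 4" by (simp add: power_mult[symmetric])
      then show ?thesis using \<theta>
        by (intro mult_left_mono add_mono divide_right_mono mult_right_mono order_refl Bochner_Integration.integral_nonneg) auto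
    qed
    finally show ?thesis .
  qed
  have "cmod (expectation P + (\<i> * s) * expectation Q) \<le> cmod (expectation P) + \<bar>s\<bar> * cmod (expectation Q)"
    by (rule order_trans[OF norm_triangle_ineq]) (simp add: norm_mult)
  also have "\<dots> \<le> s\<^sup>2 / 2 * (\<theta> * (\<tau> * expectation (\<lambda>\<omega>. (A \<omega>)\<^sup>2)) + \<kappa> ^ 4 * expectation (\<lambda>\<omega>. (D \<omega>) ^ 4) / \<theta>)
     + \<bar>s\<bar> * (\<bar>s\<bar> / 2 * (\<theta> * (\<tau> * expectation (\<lambda>\<omega>. (A \<omega>)\<^sup>2)) + \<kappa> ^ 4 * expectation (\<lambda>\<omega>. (D \<omega>) ^ 4) / \<theta>))"
    by (intro add_mono mult_left_mono EP EQ) simp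
  also have "\<dots> = s\<^sup>2 * (\<theta> * (\<tau> * expectation (\<lambda>\<omega>. (A \<omega>)\<^sup>2)) + \<kappa> ^ 4 * expectation (\<lambda>\<omega>. (D \<omega>) ^ 4) / \<theta>)"
    by (simp add: power2_eq_square)
  finally show ?thesis unfolding main[symmetric] unfolding A_def D_def S_def .
qed

lemma stein_identity:
  assumes \<theta>: "\<theta> > 0"
  shows "cmod (expectation (\<lambda>\<omega>. complex_of_real (Sf (Y \<omega>)) * iexp (s * Sf (Y \<omega>)))
            - \<i> * s * expectation (\<lambda>\<omega>. complex_of_real (Tf (Y \<omega>)) * iexp (s * Sf (Y \<omega>))))
     \<le> s\<^sup>2 * (\<theta> * V + D4sum / \<theta>)"
proof -
  define I where "I \<omega> = iexp (s * Sf (Y \<omega>))" for \<omega>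
  have bI: "bdd_rv I" unfolding I_def[abs_def] by (intro bdd_rv_iexp bdd_rv_mult bdd_rv_const bdd_rv_S)
  define a where "a e = expectation (\<lambda>\<omega>. complex_of_real (t e \<omega> * Af e (Y \<omega>)) * I \<omega>)" for e
  define d where "d e = expectation (\<lambda>\<omega>. complex_of_real (\<tau> * (Af e (Y \<omega>) * Df e (Y \<omega>))) * I \<omega>)" for e
  have "expectation (\<lambda>\<omega>. complex_of_real (Sf (Y \<omega>)) * I \<omega>) = expectation (\<lambda>\<omega>. \<Sum>e\<in>E. complex_of_real (t e \<omega> * Af e (Y \<omega>)) * I \<omega>)"
    by (subst S_as_sum) (simp add: sum_distrib_right)
  also have "\<dots> = (\<Sum>e\<in>E. a e)"
    unfolding a_def by (rule Bochner_Integration.integral_sum) (intro bdd_rv_integrable bdd_rv_mult bdd_rv_of_real bdd_rv_t bdd_rv_A bI)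
  finally have S: "expectation (\<lambda>\<omega>. complex_of_real (Sf (Y \<omega>)) * I \<omega>) = (\<Sum>e\<in>E. a e)" .
  have "expectation (\<lambda>\<omega>. complex_of_real (Tf (Y \<omega>)) * I \<omega>) = expectation (\<lambda>\<omega>. \<Sum>e\<in>E. complex_of_real (\<tau> * (Af e (Y \<omega>) * Df e (Y \<omega>))) * I \<omega>)"
    unfolding Tf_def by (simp add: sum_distrib_right sum_distrib_left)
  also have "\<dots> = (\<Sum>e\<in>E. d e)"
    unfolding d_def by (rule Bochner_Integration.integral_sum)
      (intro bdd_rv_integrable bdd_rv_mult bdd_rv_of_real bdd_rv_const bdd_rv_D bdd_rv_A bI)
  finally have T: "expectation (\<lambda>\<omega>. complex_of_real (Tf (Y \<omega>)) * I \<omega>) = (\<Sum>e\<in>E. d e)" .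
  have "cmod ((\<Sum>e\<in>E. a e) - \<i> * s * (\<Sum>e\<in>E. d e)) = cmod (\<Sum>e\<in>E. a e - \<i> * s * d e)"
    by (simp add: sum_subtractf sum_distrib_left)
  also have "\<dots> \<le> (\<Sum>e\<in>E. s\<^sup>2 * (\<theta> * (\<tau> * expectation (\<lambda>\<omega>. (Af e (Y \<omega>))\<^sup>2)) + \<kappa> ^ 4 * expectation (\<lambda>\<omega>. (Df e (Y \<omega>)) ^ 4) / \<theta>))"
    unfolding a_def d_def I_def by (intro sum_norm_le stein_edge \<theta>)
  also have "\<dots> = s\<^sup>2 * (\<theta> * (\<Sum>e\<in>E. \<tau> * expectation (\<lambda>\<omega>. (Af e (Y \<omega>))\<^sup>2)) + D4sum / \<theta>)"
    by (simp only: D4sum_def sum.distrib sum_distrib_left[symmetric] sum_divide_distrib[symmetric])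
  also have "\<dots> \<le> s\<^sup>2 * (\<theta> * V + D4sum / \<theta>)"
    using \<theta> by (intro mult_left_mono add_right_mono sum_A_square) auto
  finally show ?thesis unfolding S[unfolded I_def] T[unfolded I_def] .
qed

definition cf :: "real \<Rightarrow> complex" where "cf u = expectation (\<lambda>\<omega>. iexp (u * Sf (Y \<omega>)))"

lemma cf_derivative:
  "(cf has_vector_derivative \<i> * expectation (\<lambda>\<omega>. complex_of_real (Sf (Y \<omega>)) * iexp (u * Sf (Y \<omega>)))) (at u)"
proof -
  define F' where "F' = \<i> * expectation (\<lambda>\<omega>. complex_of_real (Sf (Y \<omega>)) * iexp (u * Sf (Y \<omega>)))"
  define K where "K = expectation (\<lambda>\<omega>. (Sf (Y \<omega>))\<^sup>2) / 2"
  note bi = bdd_rv_mult bdd_rv_add bdd_rv_diff bdd_rv_power bdd_rv_of_real bdd_rv_iexp bdd_rv_const bdd_rv_S bdd_rv_divide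
  have est: "cmod (cf (u + d) - cf u - d *\<^sub>R F') \<le> K * d\<^sup>2" for d
  proof -
    have eq: "cf (u + d) - cf u - d *\<^sub>R F'
      = expectation (\<lambda>\<omega>. iexp ((u + d) * Sf (Y \<omega>)) - iexp (u * Sf (Y \<omega>)) - (d * \<i>) * (complex_of_real (Sf (Y \<omega>)) * iexp (u * Sf (Y \<omega>))))"
      unfolding cf_def F'_def
      by (subst Bochner_Integration.integral_diff, (intro bdd_rv_integrable bi)+)
         (subst Bochner_Integration.integral_diff, (intro bdd_rv_integrable bi)+, simp only: integral_mult_right_zero scaleR_conv_of_real mult.assoc)
    have "cmod (cf (u + d) - cf u - d *\<^sub>R F') \<le> expectation (\<lambda>\<omega>. cmod (iexp ((u + d) * Sf (Y \<omega>)) - iexp (u * Sf (Y \<omega>)) - (d * \<i>) * (complex_of_real (Sf (Y \<omega>)) * iexp (u * Sf (Y \<omega>)))))"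
      unfolding eq by (rule integral_norm_bound)
    also have "\<dots> \<le> expectation (\<lambda>\<omega>. (d * Sf (Y \<omega>))\<^sup>2 / 2)"
    proof (rule integral_mono)
      fix \<omega>
      define x where "x = Sf (Y \<omega>)"
      have "iexp ((u + d) * x) = iexp (u * x) * iexp (d * x)" by (simp add: exp_add[symmetric] algebra_simps)
      moreover have "a * b - a - (d * \<i>) * (complex_of_real x * a) = a * (b - (1 + \<i> * (d * x)))" for a b :: complex
        by (simp add: algebra_simps)
      ultimately have "iexp ((u + d) * x) - iexp (u * x) - (d * \<i>) * (complex_of_real x * iexp (u * x)) = iexp (u * x) * (iexp (d * x) - (1 + \<i> * (d * x)))"
        by (simp only:)
      then have "cmod (iexp ((u + d) * x) - iexp (u * x) - (d * \<i>) * (complex_of_real x * iexp (u * x))) = cmod (iexp (d * x) - (1 + \<i> * complex_of_real (d * x)))"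
        by (simp add: norm_mult)
      also have "\<dots> \<le> (d * x)\<^sup>2 / 2"
        using iexp_approx1[of "d * x" 1] by (simp add: numeral_2_eq_2 power2_eq_square)
      finally show "cmod (iexp ((u + d) * Sf (Y \<omega>)) - iexp (u * Sf (Y \<omega>)) - (d * \<i>) * (complex_of_real (Sf (Y \<omega>)) * iexp (u * Sf (Y \<omega>)))) \<le> (d * Sf (Y \<omega>))\<^sup>2 / 2"
        by (simp add: x_def)
    qed (intro integrable_norm bdd_rv_integrable bi)+
    also have "\<dots> = K * d\<^sup>2" by (simp add: K_def power_mult_distrib mult.commute)
    finally show ?thesis .
  qed
  have "(\<lambda>d. norm (cf (u + d) - cf u - d *\<^sub>R F') / norm d) \<midarrow>0\<rightarrow> 0"
  proof (rule tendsto_sandwich[OF _ _ tendsto_const])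
    show "((\<lambda>d. K * \<bar>d\<bar>) \<longlongrightarrow> 0) (at 0)" by (auto intro!: tendsto_eq_intros)
    have "norm (cf (u + d) - cf u - d *\<^sub>R F') / norm d \<le> K * \<bar>d\<bar>" if "d \<noteq> 0" for d
      using est[of d] that by (simp add: divide_le_eq power2_eq_square abs_mult[symmetric] mult.assoc)
    then show "\<forall>\<^sub>F d in at 0. norm (cf (u + d) - cf u - d *\<^sub>R F') / norm d \<le> K * \<bar>d\<bar>"
      by (auto simp: eventually_at intro!: exI[of _ 1])
  qed auto
  then show ?thesis
    unfolding has_vector_derivative_def has_derivative_at F'_def by (auto intro: bounded_linear_scaleR_left)
qed

text \<open>
  By Stein's identity the function \<open>cf s * exp (V * s\<^sup>2 / 2)\<close> has a small derivative, and it is \<open>1\<close> at \<open>s = 0\<close>.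
\<close>
lemma cf_approx:
  assumes \<theta>: "\<theta> > 0"
  shows "cmod (cf s - exp (- V * s\<^sup>2 / 2)) \<le> \<bar>s\<bar> * (\<bar>s\<bar> * expectation (\<lambda>\<omega>. \<bar>Tf (Y \<omega>) - V\<bar>) + s\<^sup>2 * (\<theta> * V + D4sum / \<theta>))"
proof -
  define \<delta> where "\<delta> = expectation (\<lambda>\<omega>. \<bar>Tf (Y \<omega>) - V\<bar>)"
  define \<eta> where "\<eta> = \<theta> * V + D4sum / \<theta>"
  have \<delta>0: "0 \<le> \<delta>" unfolding \<delta>_def by (intro Bochner_Integration.integral_nonneg) auto
  have D40: "0 \<le> D4sum" unfolding D4sum_def by (intro mult_nonneg_nonneg sum_nonneg Bochner_Integration.integral_nonneg) auto
  have \<eta>0: "0 \<le> \<eta>" unfolding \<eta>_def using \<theta> V_nonneg D40 by (intro add_nonneg_nonneg) auto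
  define F' where "F' u = \<i> * expectation (\<lambda>\<omega>. complex_of_real (Sf (Y \<omega>)) * iexp (u * Sf (Y \<omega>)))" for u
  have F': "cmod (F' u + u * V * cf u) \<le> \<bar>u\<bar> * \<delta> + u\<^sup>2 * \<eta>" for u
  proof -
    define I where "I \<omega> = iexp (u * Sf (Y \<omega>))" for \<omega>
    have bI: "bdd_rv I" unfolding I_def[abs_def] by (intro bdd_rv_iexp bdd_rv_mult bdd_rv_const bdd_rv_S)
    define a where "a = expectation (\<lambda>\<omega>. complex_of_real (Sf (Y \<omega>)) * I \<omega>)"
    define b where "b = expectation (\<lambda>\<omega>. complex_of_real (Tf (Y \<omega>)) * I \<omega>)"
    have "F' u + u * V * cf u = \<i> * (a - \<i> * u * b) - u * (b - V * cf u)"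
      by (simp add: F'_def a_def I_def algebra_simps)
    also have "cmod \<dots> \<le> cmod (a - \<i> * u * b) + \<bar>u\<bar> * cmod (b - V * cf u)"
      by (rule order_trans[OF norm_triangle_ineq4]) (simp add: norm_mult)
    also have "\<dots> \<le> u\<^sup>2 * \<eta> + \<bar>u\<bar> * \<delta>"
    proof (intro add_mono mult_left_mono)
      show "cmod (a - \<i> * u * b) \<le> u\<^sup>2 * \<eta>"
        unfolding a_def b_def I_def \<eta>_def by (rule stein_identity[OF \<theta>])
      have "b - V * cf u = expectation (\<lambda>\<omega>. complex_of_real (Tf (Y \<omega>)) * I \<omega>) - expectation (\<lambda>\<omega>. complex_of_real V * I \<omega>)"
        by (simp add: b_def cf_def I_def)
      also have "\<dots> = expectation (\<lambda>\<omega>. complex_of_real (Tf (Y \<omega>)) * I \<omega> - complex_of_real V * I \<omega>)"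
        by (rule Bochner_Integration.integral_diff[symmetric]) (intro bdd_rv_integrable bdd_rv_mult bdd_rv_of_real bdd_rv_const bdd_rv_T bI)+
      finally have eq: "b - V * cf u = expectation (\<lambda>\<omega>. complex_of_real (Tf (Y \<omega>)) * I \<omega> - complex_of_real V * I \<omega>)" .
      have "cmod (b - V * cf u) \<le> expectation (\<lambda>\<omega>. cmod (complex_of_real (Tf (Y \<omega>)) * I \<omega> - complex_of_real V * I \<omega>))"
        unfolding eq by (rule integral_norm_bound)
      also have "\<dots> = \<delta>" unfolding \<delta>_def
        by (rule Bochner_Integration.integral_cong)
           (simp_all add: left_diff_distrib[symmetric] norm_mult I_def, metis norm_of_real of_real_diff)
      finally show "cmod (b - V * cf u) \<le> \<delta>" .
    qed simp
    finally show ?thesis by simp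
  qed
  (* the integrating factor of the differential equation \<phi>' = - s V \<phi> *)
  define g where "g u = cf u * complex_of_real (exp (V * u\<^sup>2 / 2))" for u
  define g' where "g' u = (F' u + u * V * cf u) * complex_of_real (exp (V * u\<^sup>2 / 2))" for u
  have der: "(g has_vector_derivative g' u) (at u within X)" for u X
  proof -
    have "((\<lambda>u. complex_of_real (exp (V * u\<^sup>2 / 2))) has_vector_derivative complex_of_real (exp (V * u\<^sup>2 / 2) * (V * u))) (at u within X)"
      by (rule has_vector_derivative_of_real) (auto intro!: derivative_eq_intros)
    from has_vector_derivative_mult[OF has_vector_derivative_at_within[OF cf_derivative] this]
    show ?thesis unfolding g_def[abs_def] g'_def F'_def by (simp add: algebra_simps)
  qed
  define B where "B = (\<bar>s\<bar> * \<delta> + s\<^sup>2 * \<eta>) * exp (V * s\<^sup>2 / 2)"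
  have bound: "norm (g' u) \<le> B" if "u \<in> closed_segment 0 s" for u
  proof -
    have us: "\<bar>u\<bar> \<le> \<bar>s\<bar>" using that by (auto simp: closed_segment_eq_real_ivl split: if_splits)
    then have us2: "u\<^sup>2 \<le> s\<^sup>2" by (simp add: abs_le_square_iff)
    have "norm (g' u) = cmod (F' u + u * V * cf u) * exp (V * u\<^sup>2 / 2)" by (simp add: g'_def norm_mult)
    also have "\<dots> \<le> (\<bar>s\<bar> * \<delta> + s\<^sup>2 * \<eta>) * exp (V * s\<^sup>2 / 2)"
    proof (rule mult_mono)
      show "cmod (F' u + u * V * cf u) \<le> \<bar>s\<bar> * \<delta> + s\<^sup>2 * \<eta>"
        using F'[of u] mult_right_mono[OF us \<delta>0] mult_right_mono[OF us2 \<eta>0] by linarith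
      show "exp (V * u\<^sup>2 / 2) \<le> exp (V * s\<^sup>2 / 2)" using mult_left_mono[OF us2 V_nonneg] by simp
    qed (use \<delta>0 \<eta>0 in auto)
    finally show ?thesis by (simp add: B_def)
  qed
  have "norm (g s - g 0) \<le> B * norm (s - 0)"
  proof (rule differentiable_bound[of "closed_segment 0 s" g "\<lambda>u h. h *\<^sub>R g' u"])
    show "(g has_derivative (\<lambda>h. h *\<^sub>R g' u)) (at u within closed_segment 0 s)" for u
      using der unfolding has_vector_derivative_def .
    show "onorm (\<lambda>h. h *\<^sub>R g' u) \<le> B" if "u \<in> closed_segment 0 s" for u
      using bound[OF that] by (intro onorm_le) (metis abs_ge_zero mult.commute mult_left_mono norm_scaleR real_norm_def)
  qed auto
  moreover have "g 0 = 1" using prob_space by (simp add: g_def cf_def)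
  moreover have "cf s - exp (- V * s\<^sup>2 / 2) = (g s - 1) * complex_of_real (exp (- V * s\<^sup>2 / 2))"
  proof -
    have "complex_of_real (exp (V * s\<^sup>2 / 2)) * complex_of_real (exp (- V * s\<^sup>2 / 2)) = 1"
      by (simp add: of_real_mult[symmetric] exp_add[symmetric] del: of_real_mult)
    then show ?thesis by (simp add: g_def left_diff_distrib mult.assoc)
  qed
  ultimately have "cmod (cf s - exp (- V * s\<^sup>2 / 2)) \<le> B * \<bar>s\<bar> * exp (- V * s\<^sup>2 / 2)"
    by (simp add: norm_mult mult_right_mono)
  also have "\<dots> = \<bar>s\<bar> * (\<bar>s\<bar> * \<delta> + s\<^sup>2 * \<eta>)"
  proof -
    have "exp (V * s\<^sup>2 / 2) * exp (- V * s\<^sup>2 / 2) = 1" by (simp add: exp_add[symmetric])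
    then have "x * exp (V * s\<^sup>2 / 2) * \<bar>s\<bar> * exp (- V * s\<^sup>2 / 2) = \<bar>s\<bar> * x" for x
      by (metis mult.assoc mult.commute mult.right_neutral)
    then show ?thesis unfolding B_def .
  qed
  finally show ?thesis by (simp add: \<delta>_def \<eta>_def)
qed

text \<open>
  The size of the term of \<open>\<Gamma>\<close>, in a fourth moment.
\<close>
definition u :: "'e set \<Rightarrow> real" where "u \<Gamma> = c \<Gamma> * \<kappa> ^ card \<Gamma>"

lemma u_nonneg: "\<Gamma> \<in> G \<Longrightarrow> 0 \<le> u \<Gamma>"
  using c0 \<kappa>0 by (simp add: u_def)

text \<open>
  A cluster has at most four edges, so summing over a common edge costs at most a factor four.
\<close>
lemma sum_pairs_le:
  assumes "\<And>A B. A \<in> G \<Longrightarrow> B \<in> G \<Longrightarrow> 0 \<le> f A B"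
  shows "(\<Sum>e\<in>E. \<Sum>A\<in>Gat e. \<Sum>B\<in>Gat e. f A B) \<le> 4 * (\<Sum>A\<in>G. \<Sum>B\<in>G. (f A B :: real))"
proof -
  have "(\<Sum>e\<in>E. \<Sum>A\<in>Gat e. \<Sum>B\<in>Gat e. f A B) \<le> (\<Sum>e\<in>E. \<Sum>A\<in>Gat e. \<Sum>B\<in>G. f A B)"
    using assms finG by (intro sum_mono sum_mono2) (auto simp: Gat_def)
  also have "\<dots> = (\<Sum>e\<in>E. \<Sum>A\<in>G. if e \<in> A then \<Sum>B\<in>G. f A B else 0)"
    unfolding Gat_def using finG by (intro sum.cong refl sum.inter_filter)
  also have "\<dots> = (\<Sum>A\<in>G. \<Sum>e\<in>E. if e \<in> A then \<Sum>B\<in>G. f A B else 0)" by (rule sum.swap)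
  also have "\<dots> = (\<Sum>A\<in>G. real (card A) * (\<Sum>B\<in>G. f A B))"
    using finE G(1) by (intro sum.cong refl) (simp add: sum.inter_restrict[symmetric] Int_absorb1)
  also have "\<dots> \<le> (\<Sum>A\<in>G. 4 * (\<Sum>B\<in>G. f A B))"
  proof (intro sum_mono mult_right_mono sum_nonneg)
    show "real (card A) \<le> 4" if "A \<in> G" for A using G(3)[OF that] by simp
  qed (use assms in auto)
  finally show ?thesis by (simp add: sum_distrib_left)
qed

lemma fourth_power_expansion:
  "D4sum = (\<Sum>e\<in>E. \<Sum>A\<in>Gat e. \<Sum>B\<in>Gat e. \<Sum>C\<in>Gat e. \<Sum>D\<in>Gat e. \<kappa> ^ 4 * (c A * c B * c C * c D) *
      expectation (\<lambda>\<omega>. mon (A - {e}) (Y \<omega>) * mon (B - {e}) (Y \<omega>) * mon (C - {e}) (Y \<omega>) * mon (D - {e}) (Y \<omega>)))"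
proof -
  have "expectation (\<lambda>\<omega>. (Df e (Y \<omega>)) ^ 4) = (\<Sum>A\<in>Gat e. \<Sum>B\<in>Gat e. \<Sum>C\<in>Gat e. \<Sum>D\<in>Gat e. (c A * c B * c C * c D) *
      expectation (\<lambda>\<omega>. mon (A - {e}) (Y \<omega>) * mon (B - {e}) (Y \<omega>) * mon (C - {e}) (Y \<omega>) * mon (D - {e}) (Y \<omega>)))"
    (is "_ = ?rhs") for e
  proof -
    have b: "bdd_rv (\<lambda>\<omega>. mon (A - {e}) (Y \<omega>))" if "A \<in> Gat e" for A
      using that G(1) by (intro bdd_rv_mon) (auto simp: Gat_def)
    have "(Df e y) ^ 4 = (\<Sum>A\<in>Gat e. \<Sum>B\<in>Gat e. \<Sum>C\<in>Gat e. \<Sum>D\<in>Gat e. (c A * c B * c C * c D) *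
       (mon (A - {e}) y * mon (B - {e}) y * mon (C - {e}) y * mon (D - {e}) y))" for y
    proof -
      have "(Df e y) ^ 4 = Df e y * (Df e y * (Df e y * Df e y))" by (simp add: power4_eq_xxxx mult.assoc)
      also have "\<dots> = (\<Sum>A\<in>Gat e. \<Sum>B\<in>Gat e. \<Sum>C\<in>Gat e. \<Sum>D\<in>Gat e.
          (c A * mon (A - {e}) y) * ((c B * mon (B - {e}) y) * ((c C * mon (C - {e}) y) * (c D * mon (D - {e}) y))))"
        unfolding Df_def by (simp only: sum_product) (simp only: sum_distrib_left)
      finally show ?thesis by (simp only: mult_ac)
    qed
    then have "expectation (\<lambda>\<omega>. (Df e (Y \<omega>)) ^ 4) = expectation (\<lambda>\<omega>. \<Sum>A\<in>Gat e. \<Sum>B\<in>Gat e. \<Sum>C\<in>Gat e. \<Sum>D\<in>Gat e. (c A * c B * c C * c D) *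
       (mon (A - {e}) (Y \<omega>) * mon (B - {e}) (Y \<omega>) * mon (C - {e}) (Y \<omega>) * mon (D - {e}) (Y \<omega>)))" by simp
    also have "\<dots> = ?rhs"
      by (simp only: expectation_sum bdd_rv_sum bdd_rv_mult bdd_rv_const b integral_mult_right_zero cong: sum.cong)
    finally show ?thesis .
  qed
  then show ?thesis unfolding D4sum_def by (simp only: sum_distrib_left mult.assoc)
qed

definition badsum :: "('e set \<Rightarrow> 'e set \<Rightarrow> 'e set \<Rightarrow> 'e set \<Rightarrow> bool) \<Rightarrow> real" where
  "badsum bad = (\<Sum>A\<in>G. \<Sum>B\<in>G. \<Sum>C\<in>G. \<Sum>D\<in>G. of_bool (bad A B C D) * (u A * u B * u C * u D))"

lemma remove_bound:
  assumes e: "A \<in> Gat e" "B \<in> Gat e" and f: "C \<in> Gat f" "D \<in> Gat f"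
  shows "\<kappa> ^ 4 * (c A * c B * c C * c D) * \<kappa> ^ (card (A - {e}) + card (B - {e}) + card (C - {f}) + card (D - {f}))
     = u A * u B * u C * u D"
proof -
  have c: "\<kappa> * \<kappa> ^ card (A - {e}) = \<kappa> ^ card A" if "A \<in> Gat e" for A e
  proof -
    have "card A = Suc (card (A - {e}))"
      using that fin_cluster card.remove[of A e] by (auto simp: Gat_def)
    then show ?thesis by simp
  qed
  have "\<kappa> ^ 4 * (c A * c B * c C * c D) * \<kappa> ^ (card (A - {e}) + card (B - {e}) + card (C - {f}) + card (D - {f}))
     = (c A * (\<kappa> * \<kappa> ^ card (A - {e}))) * (c B * (\<kappa> * \<kappa> ^ card (B - {e}))) * (c C * (\<kappa> * \<kappa> ^ card (C - {f}))) * (c D * (\<kappa> * \<kappa> ^ card (D - {f})))"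
    by (simp add: power_add power4_eq_xxxx mult_ac)
  then show ?thesis unfolding c[OF e(1)] c[OF e(2)] c[OF f(1)] c[OF f(2)] u_def .
qed

lemma Gat_subset: "A \<in> Gat e \<Longrightarrow> A - {f} \<subseteq> E"
  using G(1) by (auto simp: Gat_def)

text \<open>
  Four clusters through a common edge contribute to the fourth moment only if they cover all edges evenly.
\<close>
lemma D4sum_le:
  assumes bad: "\<And>A B C D e. A \<in> G \<Longrightarrow> B \<in> G \<Longrightarrow> C \<in> G \<Longrightarrow> D \<in> G \<Longrightarrow> e \<in> A \<Longrightarrow> e \<in> B \<Longrightarrow> e \<in> C \<Longrightarrow> e \<in> D \<Longrightarrow>
      (\<And>f. even (cover A B C D f)) \<Longrightarrow> bad A B C D"
  shows "D4sum \<le> 4 * badsum bad"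
proof -
  let ?w = "\<lambda>A B C D. of_bool (bad A B C D) * (u A * u B * u C * u D)"
  have w0: "0 \<le> ?w A B C D" if "A \<in> G" "B \<in> G" "C \<in> G" "D \<in> G" for A B C D
    using that u_nonneg by (intro mult_nonneg_nonneg) auto
  have "D4sum \<le> (\<Sum>e\<in>E. \<Sum>A\<in>Gat e. \<Sum>B\<in>Gat e. \<Sum>C\<in>Gat e. \<Sum>D\<in>Gat e. ?w A B C D)"
    unfolding fourth_power_expansion
  proof (intro sum_mono)
    fix e A B C D assume e: "e \<in> E" and g: "A \<in> Gat e" "B \<in> Gat e" "C \<in> Gat e" "D \<in> Gat e"
    let ?X = "expectation (\<lambda>\<omega>. mon (A - {e}) (Y \<omega>) * mon (B - {e}) (Y \<omega>) * mon (C - {e}) (Y \<omega>) * mon (D - {e}) (Y \<omega>))"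
    note sub = Gat_subset[OF g(1), of e] Gat_subset[OF g(2), of e] Gat_subset[OF g(3), of e] Gat_subset[OF g(4), of e]
    have gG: "A \<in> G" "B \<in> G" "C \<in> G" "D \<in> G" "e \<in> A" "e \<in> B" "e \<in> C" "e \<in> D" using g by (auto simp: Gat_def)
    show "\<kappa> ^ 4 * (c A * c B * c C * c D) * ?X \<le> ?w A B C D"
    proof (cases "bad A B C D")
      case True
      have "\<kappa> ^ 4 * (c A * c B * c C * c D) * ?X \<le> \<kappa> ^ 4 * (c A * c B * c C * c D) * \<kappa> ^ (card (A - {e}) + card (B - {e}) + card (C - {e}) + card (D - {e}))"
        using expectation_mon4_le[OF sub] gG c0 \<kappa>0 by (intro mult_left_mono mult_nonneg_nonneg) auto
      then show ?thesis unfolding remove_bound[OF g] using True by simp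
    next
      case False
      then obtain f where f: "odd (cover A B C D f)" using bad[of A B C D e] gG by blast
      then have "f \<noteq> e" using gG by (auto simp: cover_def)
      then have "odd (cover (A - {e}) (B - {e}) (C - {e}) (D - {e}) f)" using f by (simp add: cover_def)
      then show ?thesis using expectation_mon4_zero[OF sub] False by simp
    qed
  qed
  also have "\<dots> \<le> 4 * (\<Sum>A\<in>G. \<Sum>B\<in>G. \<Sum>C\<in>G. \<Sum>D\<in>G. ?w A B C D)"
  proof -
    have "(\<Sum>e\<in>E. \<Sum>A\<in>Gat e. \<Sum>B\<in>Gat e. \<Sum>C\<in>Gat e. \<Sum>D\<in>Gat e. ?w A B C D)
       \<le> (\<Sum>e\<in>E. \<Sum>A\<in>Gat e. \<Sum>B\<in>Gat e. \<Sum>C\<in>G. \<Sum>D\<in>G. ?w A B C D)"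
    proof (intro sum_mono)
      fix e A B assume g: "A \<in> Gat e" "B \<in> Gat e"
      have "(\<Sum>C\<in>Gat e. \<Sum>D\<in>Gat e. ?w A B C D) \<le> (\<Sum>C\<in>Gat e. \<Sum>D\<in>G. ?w A B C D)"
        using g finG w0 by (intro sum_mono sum_mono2) (auto simp: Gat_def)
      also have "\<dots> \<le> (\<Sum>C\<in>G. \<Sum>D\<in>G. ?w A B C D)"
        using g finG w0 by (intro sum_mono2 sum_nonneg) (auto simp: Gat_def)
      finally show "(\<Sum>C\<in>Gat e. \<Sum>D\<in>Gat e. ?w A B C D) \<le> (\<Sum>C\<in>G. \<Sum>D\<in>G. ?w A B C D)" .
    qed
    also have "\<dots> \<le> 4 * (\<Sum>A\<in>G. \<Sum>B\<in>G. \<Sum>C\<in>G. \<Sum>D\<in>G. ?w A B C D)"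
      by (intro sum_pairs_le sum_nonneg w0)
    finally show ?thesis .
  qed
  finally show ?thesis unfolding badsum_def .
qed

definition covar :: "'e set \<Rightarrow> 'e set \<Rightarrow> 'e set \<Rightarrow> 'e set \<Rightarrow> real" where
  "covar A B C D = expectation (\<lambda>\<omega>. mon A (Y \<omega>) * mon B (Y \<omega>) * mon C (Y \<omega>) * mon D (Y \<omega>))
     - expectation (\<lambda>\<omega>. mon A (Y \<omega>) * mon B (Y \<omega>)) * expectation (\<lambda>\<omega>. mon C (Y \<omega>) * mon D (Y \<omega>))"

lemma abs_covar_le:
  assumes "A \<subseteq> E" "B \<subseteq> E" "C \<subseteq> E" "D \<subseteq> E"
  shows "\<bar>covar A B C D\<bar> \<le> 2 * \<kappa> ^ (card A + card B + card C + card D)"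
proof -
  have 2: "\<bar>expectation (\<lambda>\<omega>. mon A (Y \<omega>) * mon B (Y \<omega>))\<bar> \<le> \<kappa> ^ (card A + card B)" if "A \<subseteq> E" "B \<subseteq> E" for A B
    using expectation_mon4_le[OF that, of "{}" "{}"] by simp
  have "\<bar>expectation (\<lambda>\<omega>. mon A (Y \<omega>) * mon B (Y \<omega>)) * expectation (\<lambda>\<omega>. mon C (Y \<omega>) * mon D (Y \<omega>))\<bar>
     \<le> \<kappa> ^ (card A + card B) * \<kappa> ^ (card C + card D)"
    unfolding abs_mult using assms \<kappa>0 by (intro mult_mono 2) auto
  then show ?thesis
    unfolding covar_def using expectation_mon4_le[OF assms] by (simp add: power_add mult_ac)
qed

text \<open>
  An edge covered an odd number of times annihilates the joint expectation, and also one of the two factors of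
  the product.
\<close>
lemma covar_odd_zero:
  assumes "A \<subseteq> E" "B \<subseteq> E" "C \<subseteq> E" "D \<subseteq> E" and odd: "odd (cover A B C D e)"
  shows "covar A B C D = 0"
proof -
  have "A \<noteq> B \<or> C \<noteq> D"
  proof (rule ccontr)
    assume "\<not> (A \<noteq> B \<or> C \<noteq> D)"
    then show False using odd by (auto simp: cover_def)
  qed
  then show ?thesis unfolding covar_def expectation_mon4_zero[OF assms] using assms
    by (auto simp: expectation_mon2)
qed

lemma covar_disjoint_zero:
  assumes "A \<subseteq> E" "C \<subseteq> E" "A \<inter> C = {}" shows "covar A A C C = 0"
proof -
  have "expectation (\<lambda>\<omega>. mon A (Y \<omega>) * mon A (Y \<omega>) * mon C (Y \<omega>) * mon C (Y \<omega>))
      = expectation (\<lambda>\<omega>. mon (A \<union> C) (Y \<omega>) * mon (A \<union> C) (Y \<omega>))"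
  proof -
    have "mon (A \<union> C) y = mon A y * mon C y" for y
      unfolding mon_def using assms finE by (intro prod.union_disjoint) (auto intro: finite_subset)
    then show ?thesis by (simp add: mult_ac)
  qed
  moreover have "card (A \<union> C) = card A + card C"
    using assms finE by (intro card_Un_disjoint) (auto intro: finite_subset)
  ultimately show ?thesis using assms unfolding covar_def by (simp add: expectation_mon2 power_add)
qed

lemma variance_expansion:
  "expectation (\<lambda>\<omega>. (Tf (Y \<omega>) - V)\<^sup>2)
    = (\<Sum>e\<in>E. \<Sum>A\<in>Gat e. \<Sum>B\<in>Gat e. \<Sum>f\<in>E. \<Sum>C\<in>Gat f. \<Sum>D\<in>Gat f.
        (\<tau> * (c A / real (card A)) * c B) * (\<tau> * (c C / real (card C)) * c D) * covar (A - {e}) (B - {e}) (C - {f}) (D - {f}))"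
proof -
  let ?a = "\<lambda>A B. \<tau> * (c A / real (card A)) * c B"
  let ?m = "\<lambda>e A B y. mon (A - {e}) y * mon (B - {e}) y"
  let ?E = "\<lambda>e A B. expectation (\<lambda>\<omega>. ?m e A B (Y \<omega>))"
  have b: "bdd_rv (\<lambda>\<omega>. mon (A - {e}) (Y \<omega>))" if "A \<in> Gat e" for A e
    using Gat_subset[OF that] by (intro bdd_rv_mon)
  have T: "Tf y = (\<Sum>e\<in>E. \<Sum>A\<in>Gat e. \<Sum>B\<in>Gat e. ?a A B * ?m e A B y)" for y
    unfolding Tf_def Af_def Df_def sum_distrib_left sum_distrib_right
    by (subst sum.swap) (simp add: mult_ac)
  have Vs: "V = (\<Sum>e\<in>E. \<Sum>A\<in>Gat e. \<Sum>B\<in>Gat e. ?a A B * ?E e A B)"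
    unfolding expectation_T[symmetric] T
    by (simp only: expectation_sum bdd_rv_sum bdd_rv_mult bdd_rv_const b integral_mult_right_zero cong: sum.cong)
  have "Tf y - V = (\<Sum>e\<in>E. \<Sum>A\<in>Gat e. \<Sum>B\<in>Gat e. ?a A B * (?m e A B y - ?E e A B))" for y
    unfolding T Vs by (simp only: sum_subtractf right_diff_distrib)
  then have "(Tf y - V)\<^sup>2 = (\<Sum>e\<in>E. \<Sum>A\<in>Gat e. \<Sum>B\<in>Gat e. ?a A B * (?m e A B y - ?E e A B)) *
     (\<Sum>f\<in>E. \<Sum>C\<in>Gat f. \<Sum>D\<in>Gat f. ?a C D * (?m f C D y - ?E f C D))" for y
    by (simp only: power2_eq_square)
  also have "\<dots> y = (\<Sum>e\<in>E. \<Sum>A\<in>Gat e. \<Sum>B\<in>Gat e. \<Sum>f\<in>E. \<Sum>C\<in>Gat f. \<Sum>D\<in>Gat f.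
      (?a A B * ?a C D) * ((?m e A B y - ?E e A B) * (?m f C D y - ?E f C D)))" for y
    by (simp only: sum_distrib_left sum_distrib_right) (simp only: mult_ac)
  finally have sq: "(Tf y - V)\<^sup>2 = (\<Sum>e\<in>E. \<Sum>A\<in>Gat e. \<Sum>B\<in>Gat e. \<Sum>f\<in>E. \<Sum>C\<in>Gat f. \<Sum>D\<in>Gat f.
      (?a A B * ?a C D) * ((?m e A B y - ?E e A B) * (?m f C D y - ?E f C D)))" for y .
  have cov: "expectation (\<lambda>\<omega>. (?m e A B (Y \<omega>) - ?E e A B) * (?m f C D (Y \<omega>) - ?E f C D)) = covar (A - {e}) (B - {e}) (C - {f}) (D - {f})"
    if g: "A \<in> Gat e" "B \<in> Gat e" "C \<in> Gat f" "D \<in> Gat f" for e f A B C D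
  proof -
    have "expectation (\<lambda>\<omega>. (?m e A B (Y \<omega>) - ?E e A B) * (?m f C D (Y \<omega>) - ?E f C D))
       = expectation (\<lambda>\<omega>. ?m e A B (Y \<omega>) * ?m f C D (Y \<omega>) - ?E e A B * ?m f C D (Y \<omega>) - ?E f C D * ?m e A B (Y \<omega>) + ?E e A B * ?E f C D)"
      by (simp add: algebra_simps)
    also have "\<dots> = expectation (\<lambda>\<omega>. ?m e A B (Y \<omega>) * ?m f C D (Y \<omega>)) - ?E e A B * ?E f C D - ?E f C D * ?E e A B + ?E e A B * ?E f C D"
      by (subst Bochner_Integration.integral_add, (intro bdd_rv_integrable bdd_rv_mult bdd_rv_diff bdd_rv_const b g)+,
          subst Bochner_Integration.integral_diff, (intro bdd_rv_integrable bdd_rv_mult bdd_rv_diff bdd_rv_const b g)+,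
          subst Bochner_Integration.integral_diff, (intro bdd_rv_integrable bdd_rv_mult bdd_rv_diff bdd_rv_const b g)+)
         (simp add: prob_space)
    finally show ?thesis unfolding covar_def by (simp add: mult_ac)
  qed
  have "expectation (\<lambda>\<omega>. (Tf (Y \<omega>) - V)\<^sup>2) = (\<Sum>e\<in>E. \<Sum>A\<in>Gat e. \<Sum>B\<in>Gat e. \<Sum>f\<in>E. \<Sum>C\<in>Gat f. \<Sum>D\<in>Gat f.
      (?a A B * ?a C D) * expectation (\<lambda>\<omega>. (?m e A B (Y \<omega>) - ?E e A B) * (?m f C D (Y \<omega>) - ?E f C D)))"
    unfolding sq
    by (simp only: expectation_sum bdd_rv_sum bdd_rv_mult bdd_rv_diff bdd_rv_const b integral_mult_right_zero cong: sum.cong)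
  also have "\<dots> = (\<Sum>e\<in>E. \<Sum>A\<in>Gat e. \<Sum>B\<in>Gat e. \<Sum>f\<in>E. \<Sum>C\<in>Gat f. \<Sum>D\<in>Gat f.
      (?a A B * ?a C D) * covar (A - {e}) (B - {e}) (C - {f}) (D - {f}))"
    by (intro sum.cong refl) (simp only: cov)
  finally show ?thesis .
qed

text \<open>
  The variance of \<open>Tf\<close> is a sum of covariances over pairs of pairs of clusters, each pair with a common edge. Adding
  these edges again does not change parities. Two disjoint pairs of equal clusters are independent, so only the
  quadruples in \<open>bad\<close> remain.
\<close>
lemma variance_le:
  assumes bad: "\<And>A B C D e f. A \<in> G \<Longrightarrow> B \<in> G \<Longrightarrow> C \<in> G \<Longrightarrow> D \<in> G \<Longrightarrow> e \<in> A \<Longrightarrow> e \<in> B \<Longrightarrow> f \<in> C \<Longrightarrow> f \<in> D \<Longrightarrow>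
      (\<And>f. even (cover A B C D f)) \<Longrightarrow> bad A B C D \<or> (A = B \<and> C = D \<and> A \<inter> C = {})"
  shows "expectation (\<lambda>\<omega>. (Tf (Y \<omega>) - V)\<^sup>2) \<le> 32 * badsum bad"
proof -
  let ?w = "\<lambda>A B C D. 2 * (of_bool (bad A B C D) * (u A * u B * u C * u D))"
  have w0: "0 \<le> ?w A B C D" if "A \<in> G" "B \<in> G" "C \<in> G" "D \<in> G" for A B C D
    using that u_nonneg by (intro mult_nonneg_nonneg) auto
  have "expectation (\<lambda>\<omega>. (Tf (Y \<omega>) - V)\<^sup>2) \<le> (\<Sum>e\<in>E. \<Sum>A\<in>Gat e. \<Sum>B\<in>Gat e. \<Sum>f\<in>E. \<Sum>C\<in>Gat f. \<Sum>D\<in>Gat f. ?w A B C D)"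
    unfolding variance_expansion
  proof (intro sum_mono)
    fix e A B f C D assume g: "A \<in> Gat e" "B \<in> Gat e" "C \<in> Gat f" "D \<in> Gat f"
    note sub = Gat_subset[OF g(1), of e] Gat_subset[OF g(2), of e] Gat_subset[OF g(3), of f] Gat_subset[OF g(4), of f]
    have gG: "A \<in> G" "B \<in> G" "C \<in> G" "D \<in> G" "e \<in> A" "e \<in> B" "f \<in> C" "f \<in> D" using g by (auto simp: Gat_def)
    let ?cv = "covar (A - {e}) (B - {e}) (C - {f}) (D - {f})"
    let ?a = "\<lambda>A B. \<tau> * (c A / real (card A)) * c B"
    show "?a A B * ?a C D * ?cv \<le> ?w A B C D"
    proof (cases "bad A B C D")
      case True
      have a: "0 \<le> ?a A B \<and> ?a A B \<le> \<kappa>\<^sup>2 * (c A * c B)" if "A \<in> G" "B \<in> G" for A B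
      proof -
        have "real (card A) \<ge> 1" using G(2)[OF that(1)] fin_cluster[OF that(1)] by (simp add: Suc_le_eq card_gt_0_iff)
        then have "c A / real (card A) \<le> c A" using c0[OF that(1)] by (simp add: divide_le_eq mult_left_mono[of 1 "real (card A)" "c A", simplified])
        then have "\<tau> * (c A / real (card A)) * c B \<le> \<kappa>\<^sup>2 * c A * c B"
          using \<tau>_le c0 that by (intro mult_mono) auto
        then show ?thesis using \<tau>_le c0 that by (auto simp: mult.assoc)
      qed
      have a1: "0 \<le> ?a A B" "?a A B \<le> \<kappa>\<^sup>2 * (c A * c B)" and a2: "0 \<le> ?a C D" "?a C D \<le> \<kappa>\<^sup>2 * (c C * c D)"
        using a[OF gG(1,2)] a[OF gG(3,4)] by blast+
      have "?a A B * ?a C D * ?cv \<le> ?a A B * ?a C D * \<bar>?cv\<bar>"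
        by (rule mult_left_mono[OF abs_ge_self mult_nonneg_nonneg[OF a1(1) a2(1)]])
      also have "\<dots> \<le> (\<kappa>\<^sup>2 * (c A * c B)) * (\<kappa>\<^sup>2 * (c C * c D)) * (2 * \<kappa> ^ (card (A - {e}) + card (B - {e}) + card (C - {f}) + card (D - {f})))"
      proof (rule mult_mono[OF mult_mono[OF a1(2) a2(2) _ a2(1)] abs_covar_le[OF sub]])
        show "0 \<le> \<kappa>\<^sup>2 * (c A * c B)" using a1 by linarith
        then show "0 \<le> \<kappa>\<^sup>2 * (c A * c B) * (\<kappa>\<^sup>2 * (c C * c D))" by (rule mult_nonneg_nonneg[OF _ order_trans[OF a2]])
      qed simp
      also have "\<dots> = 2 * (\<kappa> ^ 4 * (c A * c B * c C * c D) * \<kappa> ^ (card (A - {e}) + card (B - {e}) + card (C - {f}) + card (D - {f})))"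
        by (simp add: power2_eq_square power4_eq_xxxx mult_ac)
      finally show ?thesis unfolding remove_bound[OF g] using True by simp
    next
      case False
      have "?cv = 0"
      proof (cases "\<forall>x. even (cover A B C D x)")
        case True
        then have "A = B \<and> C = D \<and> A \<inter> C = {}" using bad[of A B C D e f] gG False by blast
        then show ?thesis using sub by (auto intro!: covar_disjoint_zero)
      next
        case even: False
        then obtain x where x: "odd (cover A B C D x)" by blast
        have "cover A B C D x = cover (A - {e}) (B - {e}) (C - {f}) (D - {f}) x + 2 * of_bool (x = e) + 2 * of_bool (x = f)"
          using gG by (auto simp: cover_def of_bool_def)
        then have "odd (cover (A - {e}) (B - {e}) (C - {f}) (D - {f}) x)" using x by simp
        then show ?thesis by (rule covar_odd_zero[OF sub])
      qed
      then show ?thesis using w0 gG by simp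
    qed
  qed
  also have "\<dots> \<le> (\<Sum>e\<in>E. \<Sum>A\<in>Gat e. \<Sum>B\<in>Gat e. 4 * (\<Sum>C\<in>G. \<Sum>D\<in>G. ?w A B C D))"
  proof (intro sum_mono sum_pairs_le)
    fix e A B C D assume "A \<in> Gat e" "B \<in> Gat e" "C \<in> G" "D \<in> G"
    then show "0 \<le> ?w A B C D" by (intro w0) (auto simp: Gat_def)
  qed
  also have "\<dots> \<le> 4 * (\<Sum>A\<in>G. \<Sum>B\<in>G. 4 * (\<Sum>C\<in>G. \<Sum>D\<in>G. ?w A B C D))"
    by (rule sum_pairs_le) (intro mult_nonneg_nonneg sum_nonneg w0; simp)
  also have "\<dots> = 32 * badsum bad"
    unfolding badsum_def by (simp add: sum_distrib_left mult_ac)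
  finally show ?thesis .
qed

lemma expectation_abs_le_sqrt:
  fixes X :: "'a \<Rightarrow> real"
  assumes "bdd_rv X" shows "expectation (\<lambda>\<omega>. \<bar>X \<omega>\<bar>) \<le> sqrt (expectation (\<lambda>\<omega>. (X \<omega>)\<^sup>2))"
proof (rule real_le_rsqrt)
  define m where "m = expectation (\<lambda>\<omega>. \<bar>X \<omega>\<bar>)"
  have "0 \<le> expectation (\<lambda>\<omega>. (\<bar>X \<omega>\<bar> - m)\<^sup>2)" by (intro Bochner_Integration.integral_nonneg) auto
  also have "\<dots> = expectation (\<lambda>\<omega>. (X \<omega>)\<^sup>2 - (2 * m) * \<bar>X \<omega>\<bar> + m\<^sup>2)"
    by (simp add: power2_diff algebra_simps)
  also have "\<dots> = expectation (\<lambda>\<omega>. (X \<omega>)\<^sup>2) - (2 * m) * m + m\<^sup>2"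
    by (subst Bochner_Integration.integral_add, (intro bdd_rv_integrable bdd_rv_power bdd_rv_mult bdd_rv_diff bdd_rv_const bdd_rv_abs assms)+,
        subst Bochner_Integration.integral_diff, (intro bdd_rv_integrable bdd_rv_power bdd_rv_mult bdd_rv_diff bdd_rv_const bdd_rv_abs assms)+)
       (simp add: prob_space m_def)
  finally show "(expectation (\<lambda>\<omega>. \<bar>X \<omega>\<bar>))\<^sup>2 \<le> expectation (\<lambda>\<omega>. (X \<omega>)\<^sup>2)" by (simp add: m_def power2_eq_square)
qed

text \<open>
  A chaos is approximately normal as soon as the evenly covered quadruples of clusters are rare, apart from
  those that consist of two disjoint equal pairs.
\<close>
lemma gaussian_approximation:
  assumes bad1: "\<And>A B C D e. A \<in> G \<Longrightarrow> B \<in> G \<Longrightarrow> C \<in> G \<Longrightarrow> D \<in> G \<Longrightarrow> e \<in> A \<Longrightarrow> e \<in> B \<Longrightarrow> e \<in> C \<Longrightarrow> e \<in> D \<Longrightarrow>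
      (\<And>f. even (cover A B C D f)) \<Longrightarrow> bad A B C D"
    and bad2: "\<And>A B C D e f. A \<in> G \<Longrightarrow> B \<in> G \<Longrightarrow> C \<in> G \<Longrightarrow> D \<in> G \<Longrightarrow> e \<in> A \<Longrightarrow> e \<in> B \<Longrightarrow> f \<in> C \<Longrightarrow> f \<in> D \<Longrightarrow>
      (\<And>f. even (cover A B C D f)) \<Longrightarrow> bad A B C D \<or> (A = B \<and> C = D \<and> A \<inter> C = {})"
    and \<theta>: "\<theta> > 0"
  shows "cmod (cf s - exp (- V * s\<^sup>2 / 2)) \<le> \<bar>s\<bar> * (\<bar>s\<bar> * sqrt (32 * badsum bad) + s\<^sup>2 * (\<theta> * V + 4 * badsum bad / \<theta>))"
proof -
  have "expectation (\<lambda>\<omega>. \<bar>Tf (Y \<omega>) - V\<bar>) \<le> sqrt (expectation (\<lambda>\<omega>. (Tf (Y \<omega>) - V)\<^sup>2))"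
    by (rule expectation_abs_le_sqrt) (intro bdd_rv_diff bdd_rv_T bdd_rv_const)
  also have "\<dots> \<le> sqrt (32 * badsum bad)" by (intro real_sqrt_le_mono variance_le) (rule bad2)
  finally have 1: "expectation (\<lambda>\<omega>. \<bar>Tf (Y \<omega>) - V\<bar>) \<le> sqrt (32 * badsum bad)" .
  have 2: "D4sum \<le> 4 * badsum bad" by (rule D4sum_le) (rule bad1)
  have "\<bar>s\<bar> * (\<bar>s\<bar> * expectation (\<lambda>\<omega>. \<bar>Tf (Y \<omega>) - V\<bar>) + s\<^sup>2 * (\<theta> * V + D4sum / \<theta>))
     \<le> \<bar>s\<bar> * (\<bar>s\<bar> * sqrt (32 * badsum bad) + s\<^sup>2 * (\<theta> * V + 4 * badsum bad / \<theta>))"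
    using \<theta> by (intro mult_left_mono add_mono divide_right_mono 1 2 order_refl) auto
  with cf_approx[OF \<theta>, of s] show ?thesis by linarith
qed

end

section \<open>The weights of the p-spin model\<close>

lemma char_normal:
  assumes "\<sigma> > 0"
  shows "real_distribution (density lborel (normal_density 0 \<sigma>))"
    and "char (density lborel (normal_density 0 \<sigma>)) s = complex_of_real (exp (- (s\<^sup>2 * \<sigma>\<^sup>2) / 2))"
proof -
  let ?M = "density lborel (normal_density 0 \<sigma>)"
  interpret prob_space ?M by (rule prob_space_normal_density[OF assms])
  show rd: "real_distribution ?M" by standard auto
  have "distributed ?M lborel (\<lambda>x. x) (normal_density 0 \<sigma>)"
    by (simp add: distributed_def) (simp add: distr_id2)
  then have "distributed ?M lborel (\<lambda>x. (x - 0) / \<sigma>) std_normal_density"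
    using normal_standard_normal_convert[OF assms, of "\<lambda>x. x" 0] by simp
  then have d: "distr ?M lborel (\<lambda>x. x / \<sigma>) = std_normal_distribution"
    by (simp add: distributed_def)
  have "char ?M s = (CLINT x|?M. iexp ((s * \<sigma>) * (x / \<sigma>)))"
    unfolding char_def using assms by simp
  also have "\<dots> = (CLINT y|distr ?M lborel (\<lambda>x. x / \<sigma>). iexp ((s * \<sigma>) * y))"
    by (subst integral_distr) auto
  also have "\<dots> = char std_normal_distribution (s * \<sigma>)" unfolding d char_def ..
  finally show "char ?M s = complex_of_real (exp (- (s\<^sup>2 * \<sigma>\<^sup>2) / 2))"
    by (simp add: char_std_normal_distribution power_mult_distrib)
qed

lemma abs_tanh_le: "\<bar>tanh x\<bar> \<le> \<bar>x::real\<bar>"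
proof -
  have "tanh x \<le> x" if "0 \<le> x" for x :: real
  proof -
    have "0 - tanh 0 \<le> x - tanh x"
    proof (rule DERIV_nonneg_imp_nondecreasing[OF that])
      fix z :: real
      show "\<exists>y. ((\<lambda>x. x - tanh x) has_real_derivative y) (at z) \<and> 0 \<le> y"
        by (intro exI[of _ "1 - (1 - tanh z ^ 2)"]) (auto intro!: derivative_eq_intros)
    qed
    then show ?thesis by simp
  qed
  from this[of "\<bar>x\<bar>"] show ?thesis by (cases "x \<ge> 0") (auto simp: abs_if)
qed

text \<open>
  The weights are asymptotically linear in the disorder.
\<close>
lemma tanh_scaled_limit:
  assumes a: "filterlim a at_top sequentially"
  shows "(\<lambda>N. a N * tanh (y / a N)) \<longlonglongrightarrow> (y::real)"
proof (cases "y = 0")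
  case False
  have "(tanh has_real_derivative 1 - tanh 0 ^ 2) (at 0)" by (auto intro!: derivative_eq_intros)
  then have "((\<lambda>z. (tanh (0 + z) - tanh 0) / z) \<longlongrightarrow> 1 - tanh 0 ^ 2) (at (0::real))"
    by (simp only: DERIV_def)
  then have t: "((\<lambda>z. tanh z / z) \<longlongrightarrow> 1) (at (0::real))" by simp
  have z: "(\<lambda>N. y / a N) \<longlonglongrightarrow> 0" by (rule tendsto_divide_0[OF tendsto_const filterlim_at_top_imp_at_infinity[OF a]])
  have pos: "\<forall>\<^sub>F N in sequentially. a N > 0" using a by (simp add: filterlim_at_top_dense)
  then have "filterlim (\<lambda>N. y / a N) (at 0) sequentially"
    using z False by (auto simp: filterlim_at elim: eventually_mono)
  from filterlim_compose[OF t this] have "(\<lambda>N. y * (tanh (y / a N) / (y / a N))) \<longlonglongrightarrow> y * 1"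
    by (intro tendsto_mult tendsto_const)
  moreover have "\<forall>\<^sub>F N in sequentially. y * (tanh (y / a N) / (y / a N)) = a N * tanh (y / a N)"
    using pos False by (auto elim!: eventually_mono)
  ultimately show ?thesis using Lim_transform_eventually by fastforce
qed simp

lemma tanh_borel: "(\<lambda>x. tanh (c * x / d) ^ n :: real) \<in> borel_measurable borel"
  unfolding divide_inverse
  by (intro borel_measurable_continuous_onI continuous_intros) (auto simp: cosh_real_nonzero)

locale pspin =
  fixes p :: nat and \<beta> \<rho> \<alpha> :: real and h :: "nat \<Rightarrow> real" and \<mu> :: "real measure"
    and M :: "nat \<Rightarrow> 'a measure" and J :: "nat \<Rightarrow> nat list \<Rightarrow> 'a \<Rightarrow> real"
  assumes p3: "p \<ge> 3" and \<beta>0: "0 < \<beta>" and \<beta>f: "\<beta> < beta_f p" and \<rho>0: "\<rho> > 0" and \<alpha>4: "\<alpha> \<ge> 1/4"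
    and h_eq: "\<And>N. h N = \<rho> * real N powr (- \<alpha>)"
    and law: "disorder_law \<mu>"
    and iid: "\<And>N. iid_on (edges p N) (M N) (J N) \<mu>"
begin

definition scale :: "nat \<Rightarrow> real" where "scale N = real N powr ((real p - 1) / 2)"
definition weight :: "nat \<Rightarrow> nat list \<Rightarrow> 'a \<Rightarrow> real" where "weight N e \<omega> = tanh (\<beta> * J N e \<omega> / scale N)"
definition magn :: "nat \<Rightarrow> real" where "magn N = tanh (h N)"
text \<open>
  The variance of the linearised weight \<open>\<beta> J e / scale N\<close>, which dominates that of the weight itself.
\<close>
definition varb :: "nat \<Rightarrow> real" where "varb N = \<beta>\<^sup>2 / real N ^ (p - 1)"
definition m4 :: real where "m4 = (LINT x|\<mu>. x ^ 4)"
definition K4 :: real where "K4 = root 4 m4"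
text \<open>
  A common scale for the second and the fourth moment of a weight.
\<close>
definition kappa :: "nat \<Rightarrow> real" where "kappa N = K4 * sqrt (varb N)"
definition tau :: "nat \<Rightarrow> real" where "tau N = (LINT x|\<mu>. tanh (\<beta> * x / scale N) ^ 2)"

lemma scale_sq: "N \<ge> 1 \<Longrightarrow> scale N ^ 2 = real N ^ (p - 1)"
proof -
  assume N: "N \<ge> 1"
  have "scale N ^ 2 = real N powr (real p - 1)" 
  proof -
    have e: "of_nat 2 * ((real p - 1) / 2) = real p - 1" by (simp add: field_simps)
    show ?thesis unfolding scale_def using N powr_power[of "real N" "(real p - 1) / 2" 2] unfolding e by simp
  qed
  also have "\<dots> = real N ^ (p - 1)" using N p3 by (simp add: powr_realpow[symmetric] of_nat_diff)
  finally show ?thesis .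
qed

lemma rd_mu: "real_distribution \<mu>" using law by (simp add: disorder_law_def)

sublocale mu: real_distribution \<mu> by (rule rd_mu)

lemma mu_sym: "distr \<mu> borel uminus = \<mu>" using law by (simp add: disorder_law_def)

lemma mu_odd:
  fixes f :: "real \<Rightarrow> real"
  assumes "f \<in> borel_measurable borel" "\<And>x. f (- x) = - f x" shows "(LINT x|\<mu>. f x) = 0"
proof -
  have "(LINT x|\<mu>. f x) = (LINT x|distr \<mu> borel uminus. f x)" by (simp add: mu_sym)
  also have "\<dots> = (LINT x|\<mu>. f (- x))" using assms(1) by (subst integral_distr) auto
  also have "\<dots> = - (LINT x|\<mu>. f x)" by (simp add: assms(2))
  finally show ?thesis by simp
qed

lemma int4: "integrable \<mu> (\<lambda>x. x ^ 4)" using law by (simp add: disorder_law_def)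

lemma int2: "integrable \<mu> (\<lambda>x. x ^ 2)"
proof (rule Bochner_Integration.integrable_bound[of _ "\<lambda>x. 1 + x ^ 4"])
  show "integrable \<mu> (\<lambda>x. 1 + x ^ 4)" using int4 by simp
  have "x ^ 2 \<le> 1 + x ^ 4" for x :: real
  proof -
    have "0 \<le> (x ^ 2 - 1) ^ 2 + x ^ 4 + 1" by simp
    then show ?thesis by (simp add: power2_diff power_mult[symmetric])
  qed
  then show "AE x in \<mu>. norm (x ^ 2) \<le> norm (1 + x ^ 4)" by (intro AE_I2) auto
qed auto

lemma second: "(LINT x|\<mu>. x ^ 2) = 1"
proof -
  have a: "(LINT x|\<mu>. x) = 0" and b: "(LINT x|\<mu>. (x - (LINT x|\<mu>. x))\<^sup>2) = 1"
    using law unfolding disorder_law_def by blast+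
  show ?thesis using b unfolding a by (simp only: diff_zero)
qed

text \<open>
  By Jensen's inequality; it makes one scale \<open>kappa\<close> serve for the second and the fourth moments.
\<close>
lemma m4_ge: "m4 \<ge> 1"
proof -
  have "0 \<le> (LINT x|\<mu>. (x ^ 2 - 1) ^ 2)" by (intro Bochner_Integration.integral_nonneg) auto
  also have "\<dots> = (LINT x|\<mu>. x ^ 4 - 2 * x ^ 2 + 1)"
    by (simp add: power2_diff power_mult[symmetric] algebra_simps)
  also have "\<dots> = m4 - 2 * 1 + 1"
  proof -
    have "mu.prob UNIV = 1" using mu.prob_space by simp
    then show ?thesis using int4 int2 second by (simp add: m4_def)
  qed
  finally show ?thesis by simp
qed

lemma K4: "K4 \<ge> 1" "K4 ^ 4 = m4"
  using m4_ge by (auto simp: K4_def)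

lemma varb_nonneg: "varb N \<ge> 0" by (simp add: varb_def)

lemma kap4: "kappa N ^ 4 = m4 * (varb N)\<^sup>2"
proof -
  have "sqrt (varb N) ^ 4 = (sqrt (varb N) ^ 2) ^ 2" by (simp flip: power_mult)
  then show ?thesis using K4 varb_nonneg[of N] by (simp add: kappa_def power_mult_distrib)
qed

lemma kap2: "varb N \<le> kappa N ^ 2"
proof -
  have "1 * varb N \<le> K4 ^ 2 * varb N" using K4 varb_nonneg by (intro mult_right_mono one_le_power) auto
  then show ?thesis using varb_nonneg[of N] by (simp add: kappa_def power_mult_distrib)
qed

lemma scaled_sq: "N \<ge> 1 \<Longrightarrow> (\<beta> * x / scale N) ^ 2 = varb N * x ^ 2"
  by (simp add: varb_def power_mult_distrib power_divide scale_sq)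

lemma tau_le: "N \<ge> 1 \<Longrightarrow> tau N \<le> varb N"
proof -
  assume N: "N \<ge> 1"
  have "tau N \<le> (LINT x|\<mu>. varb N * x ^ 2)"
    unfolding tau_def
  proof (rule integral_mono)
    show "integrable \<mu> (\<lambda>x. tanh (\<beta> * x / scale N) ^ 2)"
      by (rule mu.integrable_const_bound[of _ 1])
         (use tanh_borel[of \<beta> "scale N" 2] in \<open>auto intro!: AE_I2 simp: abs_square_le_1 abs_le_iff tanh_real_lt_1 less_imp_le tanh_real_gt_neg1 minus_le_iff\<close>)
    show "integrable \<mu> (\<lambda>x. varb N * x ^ 2)" using int2 by simp
    show "tanh (\<beta> * x / scale N) ^ 2 \<le> varb N * x ^ 2" for x
      unfolding scaled_sq[OF N, symmetric] using abs_tanh_le by (simp add: abs_le_square_iff)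
  qed
  then show ?thesis by (simp add: second)
qed

lemma tau_nonneg: "0 \<le> tau N"
  unfolding tau_def by (intro Bochner_Integration.integral_nonneg) auto

lemma fourth: "N \<ge> 1 \<Longrightarrow> (LINT x|\<mu>. tanh (\<beta> * x / scale N) ^ 4) \<le> kappa N ^ 4"
proof -
  assume N: "N \<ge> 1"
  have "(LINT x|\<mu>. tanh (\<beta> * x / scale N) ^ 4) \<le> (LINT x|\<mu>. (varb N)\<^sup>2 * x ^ 4)"
  proof (rule integral_mono)
    show "integrable \<mu> (\<lambda>x. tanh (\<beta> * x / scale N) ^ 4)"
    proof (rule mu.integrable_const_bound[of _ 1])
      have "\<bar>tanh z\<bar> ^ 4 \<le> 1" for z :: real
        using tanh_real_lt_1[of z] tanh_real_gt_neg1[of z] by (intro power_le_one) auto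
      then show "AE x in \<mu>. norm (tanh (\<beta> * x / scale N) ^ 4) \<le> 1" by (intro AE_I2) (simp add: power_abs)
    qed (use tanh_borel[of \<beta> "scale N" 4] in simp)
    show "integrable \<mu> (\<lambda>x. (varb N)\<^sup>2 * x ^ 4)" using int4 by simp
    show "tanh (\<beta> * x / scale N) ^ 4 \<le> (varb N)\<^sup>2 * x ^ 4" for x
    proof -
      have "tanh (\<beta> * x / scale N) ^ 2 \<le> varb N * x ^ 2"
        unfolding scaled_sq[OF N, symmetric] using abs_tanh_le by (simp add: abs_le_square_iff)
      then have "(tanh (\<beta> * x / scale N) ^ 2) ^ 2 \<le> (varb N * x ^ 2) ^ 2" by (intro power_mono) auto
      then show ?thesis by (simp add: power_mult_distrib flip: power_mult)
    qed
  qed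
  then show ?thesis by (simp add: kap4 m4_def mult.commute)
qed

lemma ps: "prob_space (M N)" using iid by (simp add: iid_on_def)

lemma J_rv: "e \<in> edges p N \<Longrightarrow> J N e \<in> borel_measurable (M N)"
  using iid[of N] unfolding iid_on_def by (auto simp: prob_space.indep_vars_def[OF ps])

lemma J_law:
  fixes f :: "real \<Rightarrow> real"
  assumes "e \<in> edges p N" "f \<in> borel_measurable borel" shows "(LINT \<omega>|M N. f (J N e \<omega>)) = (LINT x|\<mu>. f x)"
proof -
  have "distr (M N) borel (J N e) = \<mu>" using iid[of N] assms(1) by (simp add: iid_on_def)
  then have "(LINT x|\<mu>. f x) = (LINT x|distr (M N) borel (J N e). f x)" by simp
  also have "\<dots> = (LINT \<omega>|M N. f (J N e \<omega>))" by (rule integral_distr[OF J_rv[OF assms(1)] assms(2)])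
  finally show ?thesis by simp
qed

lemma weak_disorder_weights: "N \<ge> 1 \<Longrightarrow> weak_disorder (M N) (weight N) (edges p N) (tau N) (kappa N)"
proof -
  assume N: "N \<ge> 1"
  interpret prob_space "M N" by (rule ps)
  show ?thesis
  proof
    show "indep_vars (\<lambda>_. borel) (weight N) (edges p N)"
    proof -
      have iJ: "indep_vars (\<lambda>_. borel) (J N) (edges p N)" using iid[of N] unfolding iid_on_def by blast
      have "indep_vars (\<lambda>_. borel) (\<lambda>e \<omega>. (\<lambda>x. tanh (\<beta> * x / scale N)) (J N e \<omega>)) (edges p N)"
        by (rule indep_vars_compose2[OF iJ]) (use tanh_borel[of \<beta> "scale N" 1] in \<open>simp only: power_one_right\<close>)
      then show ?thesis unfolding weight_def[abs_def] .
    qed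
    show "\<bar>weight N e \<omega>\<bar> \<le> 1" for e \<omega>
      unfolding weight_def using tanh_real_lt_1[of "\<beta> * J N e \<omega> / scale N"] tanh_real_gt_neg1[of "\<beta> * J N e \<omega> / scale N"]
      by linarith
    show "expectation (\<lambda>\<omega>. weight N e \<omega> ^ n) = 0" if "e \<in> edges p N" "odd n" for e n
    proof -
      have "expectation (\<lambda>\<omega>. weight N e \<omega> ^ n) = (LINT x|\<mu>. tanh (\<beta> * x / scale N) ^ n)"
        unfolding weight_def by (rule J_law[OF that(1) tanh_borel])
      also have "\<dots> = 0" by (rule mu_odd[OF tanh_borel]) (use that(2) in simp)
      finally show ?thesis .
    qed
    show "expectation (\<lambda>\<omega>. weight N e \<omega> ^ 2) = tau N" if "e \<in> edges p N" for e
      unfolding weight_def tau_def by (rule J_law[OF that tanh_borel])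
    show "expectation (\<lambda>\<omega>. weight N e \<omega> ^ 4) \<le> kappa N ^ 4" if "e \<in> edges p N" for e
    proof -
      have "expectation (\<lambda>\<omega>. weight N e \<omega> ^ 4) = (LINT x|\<mu>. tanh (\<beta> * x / scale N) ^ 4)"
        unfolding weight_def by (rule J_law[OF that tanh_borel])
      then show ?thesis using fourth[OF N] by (simp only:)
    qed
    show "tau N \<le> (kappa N)\<^sup>2" using tau_le[OF N] kap2[of N] by simp
    show "0 \<le> kappa N" using K4 varb_nonneg by (simp add: kappa_def)
  qed (simp_all add: tau_nonneg)
qed

lemma scale_top: "filterlim scale at_top sequentially"
proof -
  have "(real p - 1) / 2 > 0" using p3 by simp
  then show ?thesis unfolding scale_def[abs_def] by real_asymp
qed

text \<open>
  Dominated convergence, with the square of the linearised weight as dominating function.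
\<close>
lemma tau_asymp: "(\<lambda>N. tau N * real N ^ (p - 1)) \<longlonglongrightarrow> \<beta>\<^sup>2"
proof -
  have "(\<lambda>N. LINT x|\<mu>. (scale N * tanh (\<beta> * x / scale N)) ^ 2) \<longlonglongrightarrow> (LINT x|\<mu>. (\<beta> * x) ^ 2)"
  proof (rule integral_dominated_convergence[where w="\<lambda>x. (\<beta> * x) ^ 2"])
    show "(\<lambda>x. (\<beta> * x) ^ 2) \<in> borel_measurable \<mu>" by simp
    show "(\<lambda>x. (scale N * tanh (\<beta> * x / scale N)) ^ 2) \<in> borel_measurable \<mu>" for N
      using tanh_borel[of \<beta> "scale N" 1] by simp
    show "integrable \<mu> (\<lambda>x. (\<beta> * x) ^ 2)" using int2 by (simp add: power_mult_distrib)
    show "AE x in \<mu>. (\<lambda>N. (scale N * tanh (\<beta> * x / scale N)) ^ 2) \<longlonglongrightarrow> (\<beta> * x) ^ 2"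
      by (intro AE_I2 tendsto_power tanh_scaled_limit scale_top)
    show "AE x in \<mu>. norm ((scale N * tanh (\<beta> * x / scale N)) ^ 2) \<le> (\<beta> * x) ^ 2" for N
    proof (rule AE_I2)
      fix x
      have "\<bar>scale N * tanh (\<beta> * x / scale N)\<bar> \<le> \<bar>scale N\<bar> * \<bar>\<beta> * x / scale N\<bar>"
        unfolding abs_mult[of "scale N"] by (intro mult_left_mono abs_tanh_le) simp
      also have "\<dots> \<le> \<bar>\<beta> * x\<bar>" by (cases "scale N = 0") (auto simp: abs_mult)
      finally show "norm ((scale N * tanh (\<beta> * x / scale N)) ^ 2) \<le> (\<beta> * x) ^ 2" by (simp add: abs_le_square_iff)
    qed
  qed
  also have "(LINT x|\<mu>. (\<beta> * x) ^ 2) = \<beta>\<^sup>2" by (simp add: power_mult_distrib second)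
  finally have lim: "(\<lambda>N. LINT x|\<mu>. (scale N * tanh (\<beta> * x / scale N)) ^ 2) \<longlonglongrightarrow> \<beta>\<^sup>2" .
  have "\<forall>\<^sub>F N in sequentially. (LINT x|\<mu>. (scale N * tanh (\<beta> * x / scale N)) ^ 2) = tau N * real N ^ (p - 1)"
  proof (rule eventually_sequentiallyI[of 1])
    fix N :: nat assume N: "1 \<le> N"
    show "(LINT x|\<mu>. (scale N * tanh (\<beta> * x / scale N)) ^ 2) = tau N * real N ^ (p - 1)"
      by (simp add: tau_def power_mult_distrib scale_sq[OF N])
  qed
  then show ?thesis by (rule Lim_transform_eventually[OF lim])
qed

lemma magn_bounds: "N \<ge> 1 \<Longrightarrow> 0 \<le> magn N \<and> magn N \<le> \<rho> * real N powr (- \<alpha>)"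
proof -
  assume N: "N \<ge> 1"
  have "h N \<ge> 0" using \<rho>0 by (simp add: h_eq)
  then have "0 \<le> tanh (h N)" by simp
  then show ?thesis using abs_tanh_le[of "h N"] \<open>h N \<ge> 0\<close> by (simp add: magn_def h_eq)
qed

lemma magn_asymp: "(\<lambda>N. magn N * real N powr \<alpha>) \<longlonglongrightarrow> \<rho>"
proof -
  have "filterlim (\<lambda>N::nat. real N powr \<alpha>) at_top sequentially"
  proof -
    have "\<alpha> > 0" using \<alpha>4 by simp
    then show ?thesis by real_asymp
  qed
  from tanh_scaled_limit[OF this, of \<rho>] show ?thesis
    by (simp add: magn_def h_eq powr_minus divide_inverse mult.commute)
qed

lemma magn_sq: "N \<ge> 1 \<Longrightarrow> magn N ^ 2 \<le> \<rho>\<^sup>2 / sqrt (real N)"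
proof -
  assume N: "N \<ge> 1"
  have "magn N ^ 2 \<le> (\<rho> * real N powr (- \<alpha>)) ^ 2" using magn_bounds[OF N] by (intro power_mono) auto
  also have "\<dots> = \<rho>\<^sup>2 * real N powr (- (2 * \<alpha>))" using N powr_power[of "real N" "-\<alpha>" 2] by (simp add: power_mult_distrib)
  also have "\<dots> \<le> \<rho>\<^sup>2 * real N powr (- (1/2))" using N \<alpha>4 by (intro mult_left_mono powr_mono) auto
  also have "\<dots> = \<rho>\<^sup>2 / sqrt (real N)"
  proof -
    have "real N powr (1/2) = sqrt (real N)" by (rule powr_half_sqrt) simp
    then show ?thesis by (simp only: powr_minus divide_inverse)
  qed
  finally show ?thesis .
qed

text \<open>
  The clusters with \<open>k\<close> edges and \<open>l\<close> odd vertices have total variance of order \<open>N powr (- eps k l)\<close>: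
  each edge has variance of order \<open>N powr (1 - p)\<close>, each odd vertex contributes \<open>N powr (- 2 * \<alpha>)\<close>, and there are
  about \<open>N powr ((k p + l) / 2)\<close> clusters. Both slopes are nonnegative because \<open>\<alpha> \<ge> 1 / 4\<close>.
\<close>
definition eps :: "nat \<Rightarrow> nat \<Rightarrow> real" where
  "eps k l = real k * (real p - 2) / 2 + real l * (2 * \<alpha> - 1 / 2)"

lemma Zhat_eq: "Zhat p N \<beta> (h N) (\<lambda>i. J N i \<omega>) = (\<Sum>\<Gamma>\<in>Pow (edges p N). magn N ^ card (bdry \<Gamma>) * mon \<Gamma> (\<lambda>e. weight N e \<omega>))"
  unfolding Zhat_expansion mon_def weight_def magn_def scale_def ..

end

text \<open>
  A regime is given by the minimal exponent \<open>\<gamma>\<close> and the set \<open>Dset\<close> of types that attain it. The premises of \<open>gap\<close> on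
  \<open>k\<close> and \<open>l\<close> are the constraints satisfied by the types that occur.
\<close>
locale pspin_regime = pspin p \<beta> \<rho> \<alpha> h \<mu> M J
  for p \<beta> \<rho> \<alpha> h \<mu> and M :: "nat \<Rightarrow> 'a measure" and J +
  fixes \<gamma> :: real and Dset :: "(nat \<times> nat) set"
  assumes Dset: "Dset \<subseteq> {(1, p), (2, 2), (3, 0), (3, 1), (4, 0)}"
    and \<gamma>: "0 < \<gamma>" "\<gamma> \<le> 2 * (real p - 2)"
    and eqD: "\<And>k l. (k, l) \<in> Dset \<Longrightarrow> eps k l = \<gamma>"
    and gap: "\<And>k l. 1 \<le> k \<Longrightarrow> k \<le> 4 \<Longrightarrow> (k, l) \<notin> Dset \<Longrightarrow> even (k * p + l) \<Longrightarrow>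
        (k = 1 \<Longrightarrow> l = p) \<Longrightarrow> (k = 2 \<Longrightarrow> 2 \<le> l) \<Longrightarrow> \<gamma> < eps k l"
begin

definition leading :: "nat \<Rightarrow> nat list set set" where
  "leading N = {\<Gamma>. \<Gamma> \<subseteq> edges p N \<and> (card \<Gamma>, card (bdry \<Gamma>)) \<in> Dset}"
definition coef :: "nat \<Rightarrow> nat list set \<Rightarrow> real" where
  "coef N \<Gamma> = real N powr (\<gamma> / 2) * magn N ^ card (bdry \<Gamma>)"
definition cluster_var :: "nat \<Rightarrow> nat list set \<Rightarrow> real" where
  "cluster_var N \<Gamma> = (magn N ^ 2) ^ card (bdry \<Gamma>) * varb N ^ card \<Gamma>"

lemma finDset: "finite Dset" using Dset by (rule finite_subset) auto

lemma leading_card: "\<Gamma> \<in> leading N \<Longrightarrow> 1 \<le> card \<Gamma> \<and> card \<Gamma> \<le> 4 \<and> card (bdry \<Gamma>) \<le> p"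
  using Dset p3 by (auto simp: leading_def)

lemma cluster_var_le:
  assumes N: "N \<ge> 1"
  shows "real N powr \<gamma> * cluster_var N \<Gamma> \<le> \<rho> ^ (2 * card (bdry \<Gamma>)) * \<beta> ^ (2 * card \<Gamma>) *
     real N powr (\<gamma> - eps (card \<Gamma>) (card (bdry \<Gamma>)) - (real (card \<Gamma> * p + card (bdry \<Gamma>))) / 2)"
proof -
  let ?k = "card \<Gamma>" and ?l = "card (bdry \<Gamma>)"
  have n: "real N > 0" using N by simp
  have "magn N ^ 2 \<le> (\<rho> * real N powr (- \<alpha>)) ^ 2" using magn_bounds[OF N] by (intro power_mono) auto
  then have "cluster_var N \<Gamma> \<le> ((\<rho> * real N powr (- \<alpha>)) ^ 2) ^ ?l * varb N ^ ?k"
    unfolding cluster_var_def using varb_nonneg by (intro mult_right_mono power_mono[where n="card (bdry \<Gamma>)"]) auto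
  also have "\<dots> = \<rho> ^ (2 * ?l) * \<beta> ^ (2 * ?k) * (real N powr (- \<alpha> * real (2 * ?l)) * real N powr (- (real p - 1) * real ?k))"
  proof -
    have "((\<rho> * real N powr (- \<alpha>)) ^ 2) ^ ?l = \<rho> ^ (2 * ?l) * real N powr (- \<alpha> * real (2 * ?l))"
      using n by (simp add: power_mult_distrib power_mult[symmetric] powr_realpow[symmetric] powr_powr mult_ac)
    moreover have "varb N ^ ?k = \<beta> ^ (2 * ?k) * real N powr (- (real p - 1) * real ?k)"
    proof -
      have "1 / real N ^ (p - 1) = real N powr (- (real p - 1))"
      proof -
        have "real N ^ (p - 1) = real N powr (real p - 1)"
          using n p3 by (simp add: powr_realpow[symmetric] of_nat_diff)
        then show ?thesis by (simp only: powr_minus divide_inverse mult_1_left)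
      qed
      then have "varb N = \<beta>\<^sup>2 * real N powr (- (real p - 1))" unfolding varb_def by (simp add: divide_inverse)
      then have "varb N ^ ?k = (\<beta>\<^sup>2) ^ ?k * (real N powr (- (real p - 1))) ^ ?k" by (simp only: power_mult_distrib)
      also have "(real N powr (- (real p - 1))) ^ ?k = real N powr (- (real p - 1) * real ?k)"
        using powr_power[of "real N" "- (real p - 1)" ?k] n by (simp add: mult.commute)
      finally show ?thesis by (simp add: power_mult)
    qed
    ultimately show ?thesis by (simp only: mult_ac)
  qed
  finally have "real N powr \<gamma> * cluster_var N \<Gamma> \<le> real N powr \<gamma> * (\<rho> ^ (2 * ?l) * \<beta> ^ (2 * ?k) * (real N powr (- \<alpha> * real (2 * ?l)) * real N powr (- (real p - 1) * real ?k)))"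
    by (intro mult_left_mono) auto
  also have "\<dots> = \<rho> ^ (2 * ?l) * \<beta> ^ (2 * ?k) * (real N powr \<gamma> * real N powr (- \<alpha> * real (2 * ?l)) * real N powr (- (real p - 1) * real ?k))"
    by (simp only: mult_ac)
  also have "real N powr \<gamma> * real N powr (- \<alpha> * real (2 * ?l)) * real N powr (- (real p - 1) * real ?k)
     = real N powr (\<gamma> + - \<alpha> * real (2 * ?l) + - (real p - 1) * real ?k)" by (simp only: powr_add)
  also have "\<gamma> + - \<alpha> * real (2 * ?l) + - (real p - 1) * real ?k = \<gamma> - eps ?k ?l - real (?k * p + ?l) / 2"
    by (simp add: eps_def field_simps)
  finally show ?thesis .
qed

lemma cluster_var_nonneg: "0 \<le> cluster_var N \<Gamma>" unfolding cluster_var_def using varb_nonneg by (intro mult_nonneg_nonneg) auto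

lemma supp_powr_le:
  assumes N: "N \<ge> 1" and \<Gamma>: "\<Gamma> \<subseteq> edges p N"
  shows "real N powr (- real (card \<Gamma> * p + card (bdry \<Gamma>)) / 2) \<le> (1 / real N) ^ card (supp \<Gamma>)"
proof -
  have "2 * card (supp \<Gamma>) \<le> card \<Gamma> * p + card (bdry \<Gamma>)" by (rule card_supp_le[OF \<Gamma>])
  then have "2 * real (card (supp \<Gamma>)) \<le> real (card \<Gamma> * p + card (bdry \<Gamma>))" by linarith
  then have "real N powr (- real (card \<Gamma> * p + card (bdry \<Gamma>)) / 2) \<le> real N powr (- real (card (supp \<Gamma>)))"
    using N by (intro powr_mono) auto
  also have "\<dots> = (1 / real N) ^ card (supp \<Gamma>)"
    using N by (simp add: powr_minus powr_realpow power_inverse divide_inverse)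
  finally show ?thesis .
qed

definition C0 :: real where "C0 = (max 1 \<rho>) ^ (8 * p) * (max 1 \<beta>) ^ 8"

text \<open>
  Only finitely many types have at most four edges, so the exponents of those outside \<open>Dset\<close> exceed \<open>\<gamma>\<close> by a
  common positive gap.
\<close>
lemma small_rest:
  "(\<lambda>N. real N powr \<gamma> * (\<Sum>\<Gamma> | \<Gamma> \<subseteq> edges p N \<and> 1 \<le> card \<Gamma> \<and> card \<Gamma> \<le> 4 \<and> \<Gamma> \<notin> leading N. cluster_var N \<Gamma>)) \<longlonglongrightarrow> 0"
proof -
  define F where "F = {(k, l). 1 \<le> k \<and> k \<le> 4 \<and> l \<le> 4 * p \<and> (k, l) \<notin> Dset \<and> even (k * p + l) \<and> (k = 1 \<longrightarrow> l = p) \<and> (k = 2 \<longrightarrow> 2 \<le> l)}"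
  have finF: "finite F" by (rule finite_subset[of _ "{1..4} \<times> {..4 * p}"]) (auto simp: F_def)
  define \<delta> where "\<delta> = Min (insert 1 ((\<lambda>(k, l). eps k l - \<gamma>) ` F))"
  have \<delta>0: "\<delta> > 0" unfolding \<delta>_def using finF gap by (subst Min_gr_iff) (auto simp: F_def)
  have \<delta>le: "\<delta> \<le> eps k l - \<gamma>" if "(k, l) \<in> F" for k l
    unfolding \<delta>_def using finF that by (intro Min_le) force+
  define B where "B = (\<Sum>k\<in>{1..4}. real ((k * p) ^ (p * k)) * (real (k * p) + 1))"
  have bound: "real N powr \<gamma> * (\<Sum>\<Gamma> | \<Gamma> \<subseteq> edges p N \<and> 1 \<le> card \<Gamma> \<and> card \<Gamma> \<le> 4 \<and> \<Gamma> \<notin> leading N. cluster_var N \<Gamma>) \<le> C0 * B * real N powr (- \<delta>)"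
    if N: "N \<ge> 1" for N
  proof -
    let ?X = "{\<Gamma>. \<Gamma> \<subseteq> edges p N \<and> 1 \<le> card \<Gamma> \<and> card \<Gamma> \<le> 4}"
    have fX: "finite ?X" by (rule finite_subset[of _ "Pow (edges p N)"]) auto
    have "real N powr \<gamma> * (\<Sum>\<Gamma> | \<Gamma> \<subseteq> edges p N \<and> 1 \<le> card \<Gamma> \<and> card \<Gamma> \<le> 4 \<and> \<Gamma> \<notin> leading N. cluster_var N \<Gamma>)
       = (\<Sum>\<Gamma> | \<Gamma> \<subseteq> edges p N \<and> 1 \<le> card \<Gamma> \<and> card \<Gamma> \<le> 4 \<and> \<Gamma> \<notin> leading N. real N powr \<gamma> * cluster_var N \<Gamma>)"
      by (rule sum_distrib_left)
    also have "\<dots> \<le> (\<Sum>\<Gamma> | \<Gamma> \<subseteq> edges p N \<and> 1 \<le> card \<Gamma> \<and> card \<Gamma> \<le> 4 \<and> \<Gamma> \<notin> leading N. C0 * real N powr (- \<delta>) * (1 / real N) ^ card (supp \<Gamma>))"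
    proof (rule sum_mono, clarify)
      fix \<Gamma> assume \<Gamma>: "\<Gamma> \<subseteq> edges p N" "1 \<le> card \<Gamma>" "card \<Gamma> \<le> 4" "\<Gamma> \<notin> leading N"
      let ?k = "card \<Gamma>" and ?l = "card (bdry \<Gamma>)"
      have l4: "?l \<le> 4 * p" using card_bdry_le[OF \<Gamma>(1)] \<Gamma>(3) by (meson le_trans mult_le_mono1)
      have inF: "(?k, ?l) \<in> F"
        unfolding F_def using \<Gamma> l4 even_bdry[OF \<Gamma>(1)] card_bdry_1[OF \<Gamma>(1)] card_bdry_2[OF \<Gamma>(1)] by (auto simp: leading_def)
      have c0: "\<rho> ^ (2 * ?l) * \<beta> ^ (2 * ?k) \<le> C0"
        unfolding C0_def
      proof (rule mult_mono)
        have "\<rho> ^ (2 * ?l) \<le> (max 1 \<rho>) ^ (2 * ?l)" using \<rho>0 by (intro power_mono) auto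
        also have "\<dots> \<le> (max 1 \<rho>) ^ (8 * p)" using l4 by (intro power_increasing) auto
        finally show "\<rho> ^ (2 * ?l) \<le> (max 1 \<rho>) ^ (8 * p)" .
        have "\<beta> ^ (2 * ?k) \<le> (max 1 \<beta>) ^ (2 * ?k)" using \<beta>0 by (intro power_mono) auto
        also have "\<dots> \<le> (max 1 \<beta>) ^ 8" using \<Gamma>(3) by (intro power_increasing) auto
        finally show "\<beta> ^ (2 * ?k) \<le> (max 1 \<beta>) ^ 8" .
      qed (use \<beta>0 in auto)
      have "real N powr \<gamma> * cluster_var N \<Gamma> \<le> \<rho> ^ (2 * ?l) * \<beta> ^ (2 * ?k) * real N powr (\<gamma> - eps ?k ?l - real (?k * p + ?l) / 2)"
        by (rule cluster_var_le[OF N])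
      also have "\<dots> \<le> C0 * real N powr (- \<delta> + - real (?k * p + ?l) / 2)"
      proof (intro mult_mono powr_mono c0)
        show "\<gamma> - eps ?k ?l - real (?k * p + ?l) / 2 \<le> - \<delta> + - real (?k * p + ?l) / 2"
          using \<delta>le[OF inF] by linarith
      qed (use N in \<open>auto simp: C0_def\<close>)
      also have "\<dots> = C0 * real N powr (- \<delta>) * real N powr (- real (?k * p + ?l) / 2)" by (simp only: powr_add mult.assoc)
      also have "\<dots> \<le> C0 * real N powr (- \<delta>) * (1 / real N) ^ card (supp \<Gamma>)"
        by (intro mult_left_mono supp_powr_le N \<Gamma>(1)) (simp add: C0_def)
      finally show "real N powr \<gamma> * cluster_var N \<Gamma> \<le> C0 * real N powr (- \<delta>) * (1 / real N) ^ card (supp \<Gamma>)" .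
    qed
    also have "\<dots> \<le> (\<Sum>\<Gamma>\<in>?X. C0 * real N powr (- \<delta>) * (1 / real N) ^ card (supp \<Gamma>))"
      using fX by (intro sum_mono2) (auto simp: C0_def)
    also have "\<dots> = C0 * real N powr (- \<delta>) * (\<Sum>\<Gamma>\<in>?X. (1 / real N) ^ card (supp \<Gamma>))" by (simp add: sum_distrib_left)
    also have "\<dots> \<le> C0 * real N powr (- \<delta>) * B"
    proof (intro mult_left_mono)
    have "(\<Sum>\<Gamma>\<in>?X. (1 / real N) ^ card (supp \<Gamma>)) = (\<Sum>k\<in>{1..4}. \<Sum>\<Gamma>\<in>{\<Gamma>\<in>?X. card \<Gamma> = k}. (1 / real N) ^ card (supp \<Gamma>))"
      using fX by (intro sum.group[symmetric]) auto
    also have "\<dots> \<le> B" unfolding B_def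
    proof (rule sum_mono)
      fix k :: nat assume k: "k \<in> {1..4}"
      then have "{\<Gamma>\<in>?X. card \<Gamma> = k} = {\<Gamma>. \<Gamma> \<subseteq> edges p N \<and> card \<Gamma> = k}" by auto
      then show "(\<Sum>\<Gamma>\<in>{\<Gamma>\<in>?X. card \<Gamma> = k}. (1 / real N) ^ card (supp \<Gamma>)) \<le> real ((k * p) ^ (p * k)) * (real (k * p) + 1)"
        using sum_clusters_support[OF N, of p k] by simp
    qed
    finally show "(\<Sum>\<Gamma>\<in>?X. (1 / real N) ^ card (supp \<Gamma>)) \<le> B" .
    qed (simp add: C0_def)
    finally show ?thesis by (simp only: mult_ac)
  qed
  show ?thesis
  proof (rule tendsto_sandwich[OF _ _ tendsto_const])
    show "(\<lambda>N. C0 * B * real N powr (- \<delta>)) \<longlonglongrightarrow> 0" using \<delta>0 by real_asymp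
    show "\<forall>\<^sub>F N in sequentially. real N powr \<gamma> * (\<Sum>\<Gamma> | \<Gamma> \<subseteq> edges p N \<and> 1 \<le> card \<Gamma> \<and> card \<Gamma> \<le> 4 \<and> \<Gamma> \<notin> leading N. cluster_var N \<Gamma>) \<le> C0 * B * real N powr (- \<delta>)"
      using bound by (rule eventually_sequentiallyI[of 1])
    show "\<forall>\<^sub>F N in sequentially. 0 \<le> real N powr \<gamma> * (\<Sum>\<Gamma> | \<Gamma> \<subseteq> edges p N \<and> 1 \<le> card \<Gamma> \<and> card \<Gamma> \<le> 4 \<and> \<Gamma> \<notin> leading N. cluster_var N \<Gamma>)"
      by (intro always_eventually allI mult_nonneg_nonneg sum_nonneg cluster_var_nonneg) auto
  qed
qed

text \<open>
  The squared magnetisation is again of the form \<open>tanh h'\<close>: it is the mean of a product of spins of two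
  replicas.
\<close>
lemma big_rest:
  "(\<lambda>N. real N powr \<gamma> * (\<Sum>\<Gamma> | \<Gamma> \<subseteq> edges p N \<and> 5 \<le> card \<Gamma>. cluster_var N \<Gamma>)) \<longlonglongrightarrow> 0"
proof -
  define c where "c = max 1 (\<rho>\<^sup>2)"
  define h' where "h' N = artanh (magn N ^ 2)" for N
  have m1: "magn N ^ 2 < 1" if "N \<ge> 1" for N
    using magn_bounds[OF that] tanh_real_lt_1[of "h N"] by (simp add: magn_def abs_square_less_1 abs_less_iff)
  have t: "tanh (h' N) = magn N ^ 2" if "N \<ge> 1" for N
    unfolding h'_def using m1[OF that] by (intro tanh_artanh_real) auto
  have "(\<lambda>N. real N powr \<gamma> * (\<Sum>\<Gamma> | \<Gamma> \<subseteq> edges p N \<and> 5 \<le> card \<Gamma>.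
            tanh (h' N) ^ card (bdry \<Gamma>) * (\<beta>\<^sup>2 / real N ^ (p - 1)) ^ card \<Gamma>)) \<longlonglongrightarrow> 0"
  proof (rule cluster_tail[where c=c])
    show "\<forall>\<^sub>F N in sequentially. 0 \<le> tanh (h' N) \<and> tanh (h' N) \<le> c / sqrt (real N)"
    proof (rule eventually_sequentiallyI[of 1])
      fix N :: nat assume N: "1 \<le> N"
      have "\<rho>\<^sup>2 / sqrt (real N) \<le> c / sqrt (real N)" unfolding c_def by (intro divide_right_mono) auto
      then show "0 \<le> tanh (h' N) \<and> tanh (h' N) \<le> c / sqrt (real N)"
        unfolding t[OF N] using magn_sq[OF N] by (auto intro: order_trans)
    qed
  qed (use p3 \<beta>0 \<beta>f \<gamma> in \<open>auto simp: c_def\<close>)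
  moreover have "\<forall>\<^sub>F N in sequentially. real N powr \<gamma> * (\<Sum>\<Gamma> | \<Gamma> \<subseteq> edges p N \<and> 5 \<le> card \<Gamma>.
            tanh (h' N) ^ card (bdry \<Gamma>) * (\<beta>\<^sup>2 / real N ^ (p - 1)) ^ card \<Gamma>)
       = real N powr \<gamma> * (\<Sum>\<Gamma> | \<Gamma> \<subseteq> edges p N \<and> 5 \<le> card \<Gamma>. cluster_var N \<Gamma>)"
    by (rule eventually_sequentiallyI[of 1]) (simp add: t cluster_var_def varb_def)
  ultimately show ?thesis by (rule Lim_transform_eventually)
qed

definition rest :: "nat \<Rightarrow> nat list set set" where
  "rest N = {\<Gamma>. \<Gamma> \<subseteq> edges p N \<and> \<Gamma> \<noteq> {} \<and> \<Gamma> \<notin> leading N}"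
definition rest_var :: "nat \<Rightarrow> real" where "rest_var N = (\<Sum>\<Gamma>\<in>rest N. (coef N \<Gamma>)\<^sup>2 * tau N ^ card \<Gamma>)"
definition leading_var :: "nat \<Rightarrow> real" where "leading_var N = (\<Sum>\<Gamma>\<in>leading N. (coef N \<Gamma>)\<^sup>2 * tau N ^ card \<Gamma>)"

lemma coef_sq: "N \<ge> 1 \<Longrightarrow> (coef N \<Gamma>)\<^sup>2 = real N powr \<gamma> * (magn N ^ 2) ^ card (bdry \<Gamma>)"
  using powr_power[of "real N" "\<gamma> / 2" 2] by (simp add: coef_def power_mult_distrib flip: power_mult) (simp add: mult.commute)

lemma rest_var_tendsto: "rest_var \<longlonglongrightarrow> 0"
proof (rule tendsto_sandwich[OF _ _ tendsto_const])
  let ?a = "\<lambda>N. real N powr \<gamma> * (\<Sum>\<Gamma> | \<Gamma> \<subseteq> edges p N \<and> 1 \<le> card \<Gamma> \<and> card \<Gamma> \<le> 4 \<and> \<Gamma> \<notin> leading N. cluster_var N \<Gamma>)"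
  let ?b = "\<lambda>N. real N powr \<gamma> * (\<Sum>\<Gamma> | \<Gamma> \<subseteq> edges p N \<and> 5 \<le> card \<Gamma>. cluster_var N \<Gamma>)"
  show "(\<lambda>N. ?a N + ?b N) \<longlonglongrightarrow> 0" using tendsto_add[OF small_rest big_rest] by simp
  show "\<forall>\<^sub>F N in sequentially. 0 \<le> rest_var N"
    unfolding rest_var_def by (auto intro!: always_eventually sum_nonneg mult_nonneg_nonneg simp: tau_nonneg)
  show "\<forall>\<^sub>F N in sequentially. rest_var N \<le> ?a N + ?b N"
  proof (rule eventually_sequentiallyI[of 1])
    fix N :: nat assume N: "1 \<le> N"
    let ?A = "{\<Gamma>. \<Gamma> \<subseteq> edges p N \<and> 1 \<le> card \<Gamma> \<and> card \<Gamma> \<le> 4 \<and> \<Gamma> \<notin> leading N}" and ?B = "{\<Gamma>. \<Gamma> \<subseteq> edges p N \<and> 5 \<le> card \<Gamma>}"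
    have fin: "finite ?A" "finite ?B" by (rule finite_subset[of _ "Pow (edges p N)"]; auto)+
    have "rest N \<subseteq> ?A \<union> ?B"
    proof
      fix \<Gamma> assume \<Gamma>: "\<Gamma> \<in> rest N"
      then have "card \<Gamma> \<ge> 1" using finite_cluster by (auto simp: rest_def Suc_le_eq card_gt_0_iff)
      then show "\<Gamma> \<in> ?A \<union> ?B" using \<Gamma> by (auto simp: rest_def)
    qed
    have "rest_var N \<le> (\<Sum>\<Gamma>\<in>rest N. real N powr \<gamma> * cluster_var N \<Gamma>)"
      unfolding rest_var_def
    proof (rule sum_mono)
      fix \<Gamma>
      have "(coef N \<Gamma>)\<^sup>2 * tau N ^ card \<Gamma> \<le> (real N powr \<gamma> * (magn N ^ 2) ^ card (bdry \<Gamma>)) * varb N ^ card \<Gamma>"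
        unfolding coef_sq[OF N] using tau_le[OF N] tau_nonneg by (intro mult_left_mono power_mono) auto
      then show "(coef N \<Gamma>)\<^sup>2 * tau N ^ card \<Gamma> \<le> real N powr \<gamma> * cluster_var N \<Gamma>" by (simp add: cluster_var_def mult.assoc)
    qed
    also have "\<dots> \<le> (\<Sum>\<Gamma>\<in>?A \<union> ?B. real N powr \<gamma> * cluster_var N \<Gamma>)"
      using fin \<open>rest N \<subseteq> ?A \<union> ?B\<close> cluster_var_nonneg by (intro sum_mono2) auto
    also have "\<dots> = ?a N + ?b N"
      using fin by (subst sum.union_disjoint) (auto simp: sum_distrib_left)
    finally show "rest_var N \<le> ?a N + ?b N" .
  qed
qed

definition vlim :: real where "vlim = (\<Sum>(k, l)\<in>Dset. v_sq p k l \<beta> \<rho>)"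

lemma leading_var_tendsto: "leading_var \<longlonglongrightarrow> vlim"
proof -
  define f where "f k l N = (magn N * real N powr \<alpha>) ^ (2 * l) * (tau N * real N ^ (p - 1)) ^ k *
     (real (nclusters p N k l) / sqrt (real N) ^ (k * p + l))" for k l N
  have "(\<lambda>N. f k l N) \<longlonglongrightarrow> v_sq p k l \<beta> \<rho>" for k l
  proof -
    have "(\<lambda>N. f k l N) \<longlonglongrightarrow> \<rho> ^ (2 * l) * (\<beta>\<^sup>2) ^ k * cluster_const p k l"
      unfolding f_def using p3 by (intro tendsto_mult tendsto_power magn_asymp tau_asymp nclusters_asymp) auto
    then show ?thesis by (simp only: v_sq_cluster_const power_mult[of \<beta> 2 k]) (simp only: mult_ac)
  qed
  then have lim: "(\<lambda>N. \<Sum>(k, l)\<in>Dset. f k l N) \<longlonglongrightarrow> vlim"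
    unfolding vlim_def by (intro tendsto_sum) auto
  have "\<forall>\<^sub>F N in sequentially. (\<Sum>(k, l)\<in>Dset. f k l N) = leading_var N"
  proof (rule eventually_sequentiallyI[of 1])
    fix N :: nat assume N: "1 \<le> N"
    have n: "real N > 0" using N by simp
    have fin: "finite (leading N)" by (rule finite_subset[of _ "Pow (edges p N)"]) (auto simp: leading_def)
    have "leading_var N = (\<Sum>d\<in>Dset. \<Sum>\<Gamma>\<in>{\<Gamma>\<in>leading N. (card \<Gamma>, card (bdry \<Gamma>)) = d}. (coef N \<Gamma>)\<^sup>2 * tau N ^ card \<Gamma>)"
      unfolding leading_var_def using fin finDset by (intro sum.group[symmetric]) (auto simp: leading_def)
    also have "\<dots> = (\<Sum>(k, l)\<in>Dset. f k l N)"
    proof (rule sum.cong[OF refl], clarify)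
      fix k l assume kl: "(k, l) \<in> Dset"
      have "{\<Gamma>\<in>leading N. (card \<Gamma>, card (bdry \<Gamma>)) = (k, l)} = {\<Gamma>. \<Gamma> \<subseteq> edges p N \<and> card \<Gamma> = k \<and> card (bdry \<Gamma>) = l}"
        using kl by (auto simp: leading_def)
      then have "(\<Sum>\<Gamma>\<in>{\<Gamma>\<in>leading N. (card \<Gamma>, card (bdry \<Gamma>)) = (k, l)}. (coef N \<Gamma>)\<^sup>2 * tau N ^ card \<Gamma>)
         = real (nclusters p N k l) * (real N powr \<gamma> * (magn N ^ 2) ^ l * tau N ^ k)"
        by (simp add: nclusters_def coef_sq[OF N])
      also have "\<dots> = f k l N"
      proof -
        have s: "sqrt (real N) ^ (k * p + l) = real N powr (real (k * p + l) / 2)"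
          using n powr_power[of "real N" "1 / 2" "k * p + l"] by (simp add: powr_half_sqrt)
        have a: "(real N powr \<alpha>) ^ (2 * l) = real N powr (real (2 * l) * \<alpha>)"
          using n powr_power[of "real N" \<alpha> "2 * l"] by simp
        have b: "(real N ^ (p - 1)) ^ k = real N powr (real ((p - 1) * k))"
          using n by (simp only: power_mult[symmetric] powr_realpow)
        have pw: "real (p - 1) = real p - 1" using p3 by (simp add: of_nat_diff)
        have "real N powr (real (2 * l) * \<alpha>) * real N powr (real ((p - 1) * k)) / real N powr (real (k * p + l) / 2)
           = real N powr (real (2 * l) * \<alpha> + real ((p - 1) * k) - real (k * p + l) / 2)"
          by (simp only: powr_add powr_diff)
        also have "real (2 * l) * \<alpha> + real ((p - 1) * k) - real (k * p + l) / 2 = eps k l"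
          using pw by (simp add: eps_def field_simps)
        also have "\<dots> = \<gamma>" by (rule eqD[OF kl])
        finally have e: "real N powr (real (2 * l) * \<alpha>) * real N powr (real ((p - 1) * k)) / real N powr (real (k * p + l) / 2) = real N powr \<gamma>" .
        have "f k l N = magn N ^ (2 * l) * tau N ^ k * real (nclusters p N k l) *
            (real N powr (real (2 * l) * \<alpha>) * real N powr (real ((p - 1) * k)) / real N powr (real (k * p + l) / 2))"
          unfolding f_def s power_mult_distrib a b by simp
        then show ?thesis unfolding e power_mult[of "magn N" 2 l] by (simp only: mult_ac)
      qed
      finally show "(\<Sum>\<Gamma>\<in>{\<Gamma>\<in>leading N. (card \<Gamma>, card (bdry \<Gamma>)) = (k, l)}. (coef N \<Gamma>)\<^sup>2 * tau N ^ card \<Gamma>) = f k l N" .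
    qed
    finally show "(\<Sum>(k, l)\<in>Dset. f k l N) = leading_var N" by simp
  qed
  then show ?thesis by (rule Lim_transform_eventually[OF lim])
qed

lemma leading_sub: "\<Gamma> \<in> leading N \<Longrightarrow> \<Gamma> \<subseteq> edges p N" by (simp add: leading_def)

lemma chaos_leading: "N \<ge> 1 \<Longrightarrow> multilinear_chaos (M N) (weight N) (edges p N) (tau N) (kappa N) (leading N) (coef N)"
proof -
  assume N: "N \<ge> 1"
  interpret weak_disorder "M N" "weight N" "edges p N" "tau N" "kappa N" by (rule weak_disorder_weights[OF N])
  show ?thesis
  proof
    show "\<Gamma> \<noteq> {}" "card \<Gamma> \<le> 4" if "\<Gamma> \<in> leading N" for \<Gamma> using leading_card[OF that] by auto
    show "0 \<le> coef N \<Gamma>" for \<Gamma> unfolding coef_def using magn_bounds[OF N] by simp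
  qed (rule leading_sub)
qed

text \<open>
  The quadruples whose union has fewer vertices than the extremal number, and which are therefore negligible.
\<close>
definition bad :: "nat list set \<Rightarrow> nat list set \<Rightarrow> nat list set \<Rightarrow> nat list set \<Rightarrow> bool" where
  "bad A B C D \<longleftrightarrow> 4 * card (supp A \<union> supp B \<union> supp C \<union> supp D) < qsize p A + qsize p B + qsize p C + qsize p D"

lemma bad_common_edge:
  assumes G: "A \<in> leading N" "B \<in> leading N" "C \<in> leading N" "D \<in> leading N" and e: "e \<in> A" "e \<in> B" "e \<in> C" "e \<in> D"
    and ev: "\<And>f. even (cover A B C D f)"
  shows "bad A B C D"
proof -
  have "length e = p" using leading_sub[OF G(1)] e(1) edgesD(1) by blast
  then have "set e \<noteq> {}" using p3 by auto
  then obtain v where v: "v \<in> set e" by (meson all_not_in_conv)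
  then have vs: "v \<in> supp A" "v \<in> supp B" "v \<in> supp C" "v \<in> supp D" using e by (auto simp: supp_def)
  show ?thesis unfolding bad_def
    by (rule quad_vertex_count(2)[OF leading_sub[OF G(1)] leading_sub[OF G(2)] leading_sub[OF G(3)] leading_sub[OF G(4)] ev, of v])
       (use vs in \<open>auto simp: cover_def\<close>)
qed

lemma leading_vconn: "\<Gamma> \<in> leading N \<Longrightarrow> vconn \<Gamma>"
  using vconn_small[OF p3, of \<Gamma> N] Dset by (auto simp: leading_def)

lemma bad_or_paired:
  assumes G: "A \<in> leading N" "B \<in> leading N" "C \<in> leading N" "D \<in> leading N" and e: "e \<in> A" "e \<in> B" and f: "f \<in> C" "f \<in> D"
    and ev: "\<And>f. even (cover A B C D f)"
  shows "bad A B C D \<or> (A = B \<and> C = D \<and> A \<inter> C = {})"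
proof (cases "bad A B C D")
  case False
  note sub = leading_sub[OF G(1)] leading_sub[OF G(2)] leading_sub[OF G(3)] leading_sub[OF G(4)]
  have cov: "cover (supp A) (supp B) (supp C) (supp D) v \<le> 2" for v
  proof (rule ccontr)
    assume gt: "\<not> cover (supp A) (supp B) (supp C) (supp D) v \<le> 2"
    then have "v \<in> supp A \<union> supp B \<union> supp C \<union> supp D" by (auto simp: cover_def of_bool_def split: if_splits)
    from quad_vertex_count(2)[OF sub ev this] gt have "bad A B C D" by (simp add: bad_def)
    with False show False by simp
  qed
  have "A = B \<and> C = D \<and> A \<inter> C = {}"
    by (rule quad_pairing[OF _ _ _ _ ev _ sub e f cov]) (use G leading_vconn p3 in auto)
  then show ?thesis by (rule disjI2)
qed (rule disjI1)

definition C1 :: real where "C1 = (max 1 \<rho>) ^ p * (max 1 (K4 * \<beta>)) ^ 4"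

text \<open>
  After normalisation by \<open>N powr (\<gamma> / 2)\<close>, a leading cluster has size \<open>N powr (- qsize p \<Gamma> / 4)\<close>, since its type
  attains the exponent \<open>\<gamma>\<close>.
\<close>
lemma u_le:
  assumes N: "N \<ge> 1" and \<Gamma>: "\<Gamma> \<in> leading N"
  shows "coef N \<Gamma> * kappa N ^ card \<Gamma> \<le> C1 * real N powr (- real (qsize p \<Gamma>) / 4)"
proof (rule power2_le_imp_le)
  let ?k = "card \<Gamma>" and ?l = "card (bdry \<Gamma>)"
  have kl: "eps ?k ?l = \<gamma>" using \<Gamma> eqD by (simp add: leading_def)
  have "(coef N \<Gamma> * kappa N ^ ?k)\<^sup>2 = (coef N \<Gamma>)\<^sup>2 * (kappa N ^ 2) ^ ?k" by (simp add: power_mult_distrib flip: power_mult) (simp add: mult.commute)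
  also have "kappa N ^ 2 = K4 ^ 2 * varb N" using varb_nonneg[of N] by (simp add: kappa_def power_mult_distrib)
  also have "(coef N \<Gamma>)\<^sup>2 * (K4 ^ 2 * varb N) ^ ?k = (K4 ^ 2) ^ ?k * (real N powr \<gamma> * cluster_var N \<Gamma>)"
    by (simp add: coef_sq[OF N] cluster_var_def power_mult_distrib)
  also have "\<dots> \<le> (K4 ^ 2) ^ ?k * (\<rho> ^ (2 * ?l) * \<beta> ^ (2 * ?k) * real N powr (\<gamma> - eps ?k ?l - real (?k * p + ?l) / 2))"
    by (intro mult_left_mono cluster_var_le N) auto
  also have "\<dots> = (\<rho> ^ ?l * (K4 * \<beta>) ^ ?k)\<^sup>2 * real N powr (- real (qsize p \<Gamma>) / 2)"
  proof -
    have "(K4 ^ 2) ^ ?k * (\<rho> ^ (2 * ?l) * \<beta> ^ (2 * ?k)) = (\<rho> ^ ?l * (K4 * \<beta>) ^ ?k)\<^sup>2"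
      by (simp add: power_mult_distrib mult_ac flip: power_mult)
    moreover have "\<gamma> - eps ?k ?l - real (?k * p + ?l) / 2 = - real (qsize p \<Gamma>) / 2"
      unfolding kl qsize_def by (simp only: diff_self diff_0 minus_divide_left)
    ultimately show ?thesis by (simp only: mult.assoc[symmetric])
  qed
  also have "\<dots> \<le> C1\<^sup>2 * real N powr (- real (qsize p \<Gamma>) / 2)"
  proof (intro mult_right_mono power_mono)
    have "\<rho> ^ ?l \<le> (max 1 \<rho>) ^ ?l" using \<rho>0 by (intro power_mono) auto
    also have "\<dots> \<le> (max 1 \<rho>) ^ p" using leading_card[OF \<Gamma>] by (intro power_increasing) auto
    finally have 1: "\<rho> ^ ?l \<le> (max 1 \<rho>) ^ p" .
    have "(K4 * \<beta>) ^ ?k \<le> (max 1 (K4 * \<beta>)) ^ ?k" using \<beta>0 K4 by (intro power_mono) auto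
    also have "\<dots> \<le> (max 1 (K4 * \<beta>)) ^ 4" using leading_card[OF \<Gamma>] by (intro power_increasing) auto
    finally have 2: "(K4 * \<beta>) ^ ?k \<le> (max 1 (K4 * \<beta>)) ^ 4" .
    show "\<rho> ^ ?l * (K4 * \<beta>) ^ ?k \<le> C1"
      unfolding C1_def using 1 2 \<beta>0 K4 by (intro mult_mono) auto
  qed (use \<rho>0 \<beta>0 K4 in auto)
  also have "\<dots> = (C1 * real N powr (- real (qsize p \<Gamma>) / 4))\<^sup>2"
    using N powr_power[of "real N" "- real (qsize p \<Gamma>) / 4" 2] by (simp add: power_mult_distrib)
  finally show "(coef N \<Gamma> * kappa N ^ card \<Gamma>)\<^sup>2 \<le> (C1 * real N powr (- real (qsize p \<Gamma>) / 4))\<^sup>2" .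
qed (simp add: C1_def)

definition CQ :: real where "CQ = C1 ^ 4 * (real ((2 ^ ((16 * p) ^ p)) ^ 4) * (real (16 * p) + 1))"

text \<open>
  The exponents of four clusters add up to more than the number of vertices of the union, by at least
  \<open>1 / 4\<close>, and the weight of the vertices is summable over all quadruples.
\<close>
lemma badsum_le:
  assumes N: "N \<ge> 1"
  shows "multilinear_chaos.badsum (kappa N) (leading N) (coef N) bad \<le> CQ * real N powr (- (1 / 4))"
proof -
  interpret X: multilinear_chaos "M N" "weight N" "edges p N" "tau N" "kappa N" "leading N" "coef N" by (rule chaos_leading[OF N])
  let ?Q = "{(A, B, C, D). A \<subseteq> edges p N \<and> B \<subseteq> edges p N \<and> C \<subseteq> edges p N \<and> D \<subseteq> edges p N
             \<and> card A \<le> 4 \<and> card B \<le> 4 \<and> card C \<le> 4 \<and> card D \<le> 4}"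
  let ?W = "\<lambda>A B C D. card (supp A \<union> supp B \<union> supp C \<union> supp D)"
  have C1: "C1 \<ge> 0" by (simp add: C1_def)
  have "X.badsum bad = (\<Sum>(A, B, C, D)\<in>leading N \<times> leading N \<times> leading N \<times> leading N. of_bool (bad A B C D) * (X.u A * X.u B * X.u C * X.u D))"
    unfolding X.badsum_def by (simp add: sum.cartesian_product)
  also have "\<dots> \<le> (\<Sum>(A, B, C, D)\<in>leading N \<times> leading N \<times> leading N \<times> leading N. C1 ^ 4 * real N powr (- (1 / 4)) * (1 / real N) ^ ?W A B C D)"
  proof (rule sum_mono, clarify)
    fix A B C D assume G: "A \<in> leading N" "B \<in> leading N" "C \<in> leading N" "D \<in> leading N"
    show "of_bool (bad A B C D) * (X.u A * X.u B * X.u C * X.u D) \<le> C1 ^ 4 * real N powr (- (1 / 4)) * (1 / real N) ^ ?W A B C D"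
    proof (cases "bad A B C D")
      case True
      define q where "q \<Gamma> = C1 * real N powr (- real (qsize p \<Gamma>) / 4)" for \<Gamma>
      have u: "X.u \<Gamma> \<le> q \<Gamma>" if "\<Gamma> \<in> leading N" for \<Gamma> unfolding X.u_def q_def by (rule u_le[OF N that])
      have q0: "0 \<le> q \<Gamma>" for \<Gamma> using C1 by (simp add: q_def)
      have "X.u A * X.u B * X.u C * X.u D \<le> q A * q B * q C * q D"
        using G X.u_nonneg q0 by (intro mult_mono u mult_nonneg_nonneg) auto
      also have "\<dots> = C1 ^ 4 * real N powr (- real (qsize p A) / 4 + - real (qsize p B) / 4 + - real (qsize p C) / 4 + - real (qsize p D) / 4)"
        unfolding powr_add q_def by (simp add: power4_eq_xxxx mult_ac)
      also have "\<dots> \<le> C1 ^ 4 * real N powr (- (1 / 4) + - real (?W A B C D))"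
      proof (intro mult_left_mono powr_mono)
        have "4 * ?W A B C D + 1 \<le> qsize p A + qsize p B + qsize p C + qsize p D" using True unfolding bad_def by linarith
        then have "4 * real (?W A B C D) + 1 \<le> real (qsize p A) + real (qsize p B) + real (qsize p C) + real (qsize p D)"
          by linarith
        then show "- real (qsize p A) / 4 + - real (qsize p B) / 4 + - real (qsize p C) / 4 + - real (qsize p D) / 4 \<le> - (1 / 4) + - real (?W A B C D)"
          by linarith
      qed (use N in auto)
      also have "\<dots> = C1 ^ 4 * real N powr (- (1 / 4)) * (1 / real N) ^ ?W A B C D"
      proof -
        have "real N powr (- real w) = (1 / real N) ^ w" for w
          using N by (simp add: powr_minus powr_realpow power_inverse divide_inverse)
        then show ?thesis by (simp only: powr_add mult.assoc)
      qed
      finally show ?thesis using True by simp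
    next
      case False
      then show ?thesis using C1 by simp
    qed
  qed
  also have "\<dots> \<le> (\<Sum>(A, B, C, D)\<in>?Q. C1 ^ 4 * real N powr (- (1 / 4)) * (1 / real N) ^ ?W A B C D)"
  proof (rule sum_mono2)
    have "?Q \<subseteq> Pow (edges p N) \<times> Pow (edges p N) \<times> Pow (edges p N) \<times> Pow (edges p N)" by auto
    then show "finite ?Q" by (rule finite_subset) auto
    show "leading N \<times> leading N \<times> leading N \<times> leading N \<subseteq> ?Q" using leading_card[of _ N] by (auto simp only: leading_def mem_Collect_eq mem_Sigma_iff split_conv)
  qed (use C1 in auto)
  also have "\<dots> = C1 ^ 4 * real N powr (- (1 / 4)) * (\<Sum>(A, B, C, D)\<in>?Q. (1 / real N) ^ ?W A B C D)"
    unfolding sum_distrib_left by (intro sum.cong) auto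
  also have "\<dots> \<le> C1 ^ 4 * real N powr (- (1 / 4)) * (real ((2 ^ ((16 * p) ^ p)) ^ 4) * (real (16 * p) + 1))"
    using C1 by (intro mult_left_mono sum_quads_support N) auto
  finally show ?thesis by (simp only: CQ_def mult_ac)
qed

text \<open>
  The choice \<open>\<theta> = N powr (- 1 / 8)\<close> balances the two error terms.
\<close>
lemma cf_tendsto:
  "(\<lambda>N. LINT \<omega>|M N. iexp (s * (\<Sum>\<Gamma>\<in>leading N. coef N \<Gamma> * mon \<Gamma> (\<lambda>e. weight N e \<omega>)))) \<longlonglongrightarrow> complex_of_real (exp (- vlim * s\<^sup>2 / 2))"
proof -
  define \<phi> where "\<phi> N = (LINT \<omega>|M N. iexp (s * (\<Sum>\<Gamma>\<in>leading N. coef N \<Gamma> * mon \<Gamma> (\<lambda>e. weight N e \<omega>))))" for N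
  define U where "U N = \<bar>s\<bar> * (\<bar>s\<bar> * sqrt (32 * (CQ * real N powr (- (1 / 4)))) + s\<^sup>2 * (real N powr (- (1 / 8)) * leading_var N + 4 * (CQ * real N powr (- (1 / 4))) / real N powr (- (1 / 8))))" for N
  have "norm (\<phi> N - complex_of_real (exp (- leading_var N * s\<^sup>2 / 2))) \<le> U N" if N: "N \<ge> 1" for N
  proof -
    interpret X: multilinear_chaos "M N" "weight N" "edges p N" "tau N" "kappa N" "leading N" "coef N" by (rule chaos_leading[OF N])
    have th: "real N powr (- (1 / 8)) > 0" using N by simp
    have "cmod (X.cf s - exp (- X.V * s\<^sup>2 / 2)) \<le> \<bar>s\<bar> * (\<bar>s\<bar> * sqrt (32 * X.badsum bad) + s\<^sup>2 * (real N powr (- (1 / 8)) * X.V + 4 * X.badsum bad / real N powr (- (1 / 8))))"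
      by (rule X.gaussian_approximation[OF _ _ th]) (fact bad_common_edge bad_or_paired)+
    also have "\<dots> \<le> \<bar>s\<bar> * (\<bar>s\<bar> * sqrt (32 * (CQ * real N powr (- (1 / 4)))) + s\<^sup>2 * (real N powr (- (1 / 8)) * X.V + 4 * (CQ * real N powr (- (1 / 4))) / real N powr (- (1 / 8))))"
      using badsum_le[OF N] by (intro mult_left_mono add_mono real_sqrt_le_mono divide_right_mono order_refl) auto
    finally show ?thesis
      by (simp only: \<phi>_def U_def X.cf_def X.Sf_def X.V_def leading_var_def)
  qed
  then have ev: "\<forall>\<^sub>F N in sequentially. norm (\<phi> N - complex_of_real (exp (- leading_var N * s\<^sup>2 / 2))) \<le> U N"
    by (rule eventually_sequentiallyI[of 1])
  have "U \<longlonglongrightarrow> \<bar>s\<bar> * (\<bar>s\<bar> * sqrt (32 * (CQ * 0)) + s\<^sup>2 * (0 * vlim + 4 * CQ * 0))"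
  proof -
    have a: "(\<lambda>N. real N powr (- (1 / 4))) \<longlonglongrightarrow> 0" "(\<lambda>N. real N powr (- (1 / 8))) \<longlonglongrightarrow> 0" by real_asymp+
    have b: "real N powr (- (1 / 4)) / real N powr (- (1 / 8)) = real N powr (- (1 / 8))" for N
      by (simp add: powr_diff[symmetric])
    have "(\<lambda>N. \<bar>s\<bar> * (\<bar>s\<bar> * sqrt (32 * (CQ * real N powr (- (1 / 4)))) + s\<^sup>2 * (real N powr (- (1 / 8)) * leading_var N + 4 * CQ * real N powr (- (1 / 8)))))
      \<longlonglongrightarrow> \<bar>s\<bar> * (\<bar>s\<bar> * sqrt (32 * (CQ * 0)) + s\<^sup>2 * (0 * vlim + 4 * CQ * 0))"
      by (intro tendsto_intros a leading_var_tendsto)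
    moreover have "4 * (CQ * real N powr (- (1 / 4))) / real N powr (- (1 / 8)) = 4 * CQ * real N powr (- (1 / 8))" for N
    proof -
      have "4 * (CQ * x) / y = 4 * CQ * (x / y)" for x y :: real by simp
      then show ?thesis by (simp only: b)
    qed
    ultimately show ?thesis unfolding U_def[abs_def] by (simp only:)
  qed
  then have "U \<longlonglongrightarrow> 0" by simp
  have "(\<lambda>N. norm (\<phi> N - complex_of_real (exp (- leading_var N * s\<^sup>2 / 2)))) \<longlonglongrightarrow> 0"
    by (rule tendsto_sandwich[OF _ ev tendsto_const \<open>U \<longlonglongrightarrow> 0\<close>]) simp
  then have "(\<lambda>N. \<phi> N - complex_of_real (exp (- leading_var N * s\<^sup>2 / 2))) \<longlonglongrightarrow> 0" by (simp only: tendsto_norm_zero_iff)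
  moreover have "(\<lambda>N. complex_of_real (exp (- leading_var N * s\<^sup>2 / 2))) \<longlonglongrightarrow> complex_of_real (exp (- vlim * s\<^sup>2 / 2))"
    by (intro tendsto_intros leading_var_tendsto) auto
  ultimately have "(\<lambda>N. (\<phi> N - complex_of_real (exp (- leading_var N * s\<^sup>2 / 2))) + complex_of_real (exp (- leading_var N * s\<^sup>2 / 2))) \<longlonglongrightarrow> 0 + complex_of_real (exp (- vlim * s\<^sup>2 / 2))"
    by (rule tendsto_add)
  then show ?thesis by (simp add: \<phi>_def)
qed

end

section \<open>From the leading clusters to the free energy\<close>

lemma cmod_iexp_diff: "cmod (iexp a - iexp b) \<le> \<bar>a - b\<bar>"
proof -
  have "iexp a - iexp b = iexp b * (iexp (a - b) - 1)"
    by (simp add: right_diff_distrib exp_add[symmetric])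
  then have "cmod (iexp a - iexp b) = cmod (iexp (a - b) - 1)" by (simp only: norm_mult) simp
  also have "\<dots> \<le> \<bar>a - b\<bar>" using iexp_approx1[of "a - b" 0] by simp
  finally show ?thesis .
qed

text \<open>
  If \<open>w\<close> is small, \<open>ln (1 + w) = w + O(w\<^sup>2)\<close>; if it is not, the trivial bound \<open>2\<close> is at most \<open>8 w\<^sup>2\<close>. In this form
  only the second moment of \<open>w = Zhat - 1\<close> is needed.
\<close>
lemma cmod_iexp_ln_diff:
  fixes w :: real
  assumes c: "c \<ge> 0"
  shows "cmod (iexp (s * (c * ln (1 + w))) - iexp (s * (c * w))) \<le> (2 * \<bar>s\<bar> * c + 8) * w\<^sup>2"
proof (cases "\<bar>w\<bar> \<le> 1 / 2")
  case True
  have "\<bar>ln (1 + w) - w\<bar> \<le> 2 * w\<^sup>2"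
  proof (cases "w \<ge> 0")
    case True': True
    have "\<bar>ln (1 + w) - w\<bar> \<le> w\<^sup>2" using True True' by (intro abs_ln_one_plus_x_minus_x_bound_nonneg) auto
    then show ?thesis using zero_le_power2[of w] by linarith
  next
    case False
    then show ?thesis using True by (intro abs_ln_one_plus_x_minus_x_bound_nonpos) auto
  qed
  then have "\<bar>s\<bar> * c * \<bar>ln (1 + w) - w\<bar> \<le> \<bar>s\<bar> * c * (2 * w\<^sup>2)" using c by (intro mult_left_mono) auto
  moreover have "cmod (iexp (s * (c * ln (1 + w))) - iexp (s * (c * w))) \<le> \<bar>s * (c * ln (1 + w)) - s * (c * w)\<bar>"
    by (rule cmod_iexp_diff)
  moreover have "\<bar>s * (c * ln (1 + w)) - s * (c * w)\<bar> = \<bar>s\<bar> * c * \<bar>ln (1 + w) - w\<bar>"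
    using c by (simp add: right_diff_distrib[symmetric] abs_mult)
  moreover have "(2 * \<bar>s\<bar> * c + 8) * w\<^sup>2 = \<bar>s\<bar> * c * (2 * w\<^sup>2) + 8 * w\<^sup>2" by (simp add: algebra_simps)
  ultimately show ?thesis using zero_le_power2[of w] by linarith
next
  case False
  have "(1 / 2)\<^sup>2 \<le> \<bar>w\<bar>\<^sup>2" using False by (intro power_mono) auto
  then have w: "2 \<le> 8 * w\<^sup>2" by (simp add: power2_eq_square)
  have "cmod (iexp (s * (c * ln (1 + w))) - iexp (s * (c * w))) \<le> cmod (iexp (s * (c * ln (1 + w)))) + cmod (iexp (s * (c * w)))"
    by (rule norm_triangle_ineq4)
  also have "\<dots> = 2" by simp
  also have "\<dots> \<le> 8 * w\<^sup>2" by (rule w)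
  also have "\<dots> \<le> (2 * \<bar>s\<bar> * c + 8) * w\<^sup>2" using c by (intro mult_right_mono) auto
  finally show ?thesis .
qed

context pspin_regime
begin

definition Zrv :: "nat \<Rightarrow> 'a \<Rightarrow> real" where "Zrv N \<omega> = Zhat p N \<beta> (h N) (\<lambda>i. J N i \<omega>)"
definition leading_sum :: "nat \<Rightarrow> 'a \<Rightarrow> real" where "leading_sum N \<omega> = (\<Sum>\<Gamma>\<in>leading N. coef N \<Gamma> * mon \<Gamma> (\<lambda>e. weight N e \<omega>))"
definition rest_sum :: "nat \<Rightarrow> 'a \<Rightarrow> real" where "rest_sum N \<omega> = (\<Sum>\<Gamma>\<in>rest N. coef N \<Gamma> * mon \<Gamma> (\<lambda>e. weight N e \<omega>))"

lemma weight_measurable: "e \<in> edges p N \<Longrightarrow> weight N e \<in> borel_measurable (M N)"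
  unfolding weight_def[abs_def]
  using measurable_compose[OF J_rv tanh_borel[of \<beta> "scale N" 1]] by simp

lemma Zrv_measurable: "Zrv N \<in> borel_measurable (M N)"
  unfolding Zrv_def[abs_def] Zhat_eq mon_def
  by (intro borel_measurable_sum borel_measurable_times borel_measurable_const borel_measurable_prod weight_measurable) auto

lemma finite_leading: "finite (leading N)" by (rule finite_subset[of _ "Pow (edges p N)"]) (auto simp: leading_def)
lemma finite_rest: "finite (rest N)" by (rule finite_subset[of _ "Pow (edges p N)"]) (auto simp: rest_def)
lemma leading_rest: "leading N \<inter> rest N = {}" "Pow (edges p N) = insert {} (leading N \<union> rest N)" "{} \<notin> leading N \<union> rest N"
  using leading_card[of "{}" N] by (auto simp: leading_def rest_def)

lemma Zrv_decomposition: "real N powr (\<gamma> / 2) * (Zrv N \<omega> - 1) = leading_sum N \<omega> + rest_sum N \<omega>"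
proof -
  let ?f = "\<lambda>\<Gamma>. magn N ^ card (bdry \<Gamma>) * mon \<Gamma> (\<lambda>e. weight N e \<omega>)"
  have b0: "bdry {} = {}" by (simp add: bdry_def vdeg_def)
  have "Zrv N \<omega> = ?f {} + (\<Sum>\<Gamma>\<in>leading N \<union> rest N. ?f \<Gamma>)"
    unfolding Zrv_def Zhat_eq leading_rest(2) using finite_leading finite_rest leading_rest(3) by (subst sum.insert) auto
  then have "Zrv N \<omega> - 1 = (\<Sum>\<Gamma>\<in>leading N. ?f \<Gamma>) + (\<Sum>\<Gamma>\<in>rest N. ?f \<Gamma>)"
    using finite_leading finite_rest leading_rest(1) by (simp add: b0 mon_def sum.union_disjoint)
  then show ?thesis by (simp add: leading_sum_def rest_sum_def coef_def distrib_left sum_distrib_left mult.assoc)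
qed

text \<open>
  Replace \<open>ln Zhat\<close> by \<open>Zhat - 1\<close>, and this by the sum over the leading clusters.
\<close>
lemma char_estimate:
  assumes N: "N \<ge> 1"
  shows "cmod ((LINT \<omega>|M N. iexp (s * (real N powr (\<gamma> / 2) * ln (Zrv N \<omega>)))) - (LINT \<omega>|M N. iexp (s * leading_sum N \<omega>)))
     \<le> (2 * \<bar>s\<bar> * real N powr (\<gamma> / 2) + 8) * (real N powr (- \<gamma>) * (leading_var N + rest_var N)) + \<bar>s\<bar> * sqrt (rest_var N)"
proof -
  interpret X: multilinear_chaos "M N" "weight N" "edges p N" "tau N" "kappa N" "leading N" "coef N" by (rule chaos_leading[OF N])
  define c where "c = real N powr (\<gamma> / 2)"
  have c0: "c > 0" using N by (simp add: c_def)
  define W where "W \<omega> = Zrv N \<omega> - 1" for \<omega>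
  have cW: "c * W \<omega> = leading_sum N \<omega> + rest_sum N \<omega>" for \<omega> unfolding c_def W_def by (rule Zrv_decomposition)
  have bS: "X.bdd_rv (leading_sum N)" unfolding leading_sum_def[abs_def] by (intro X.bdd_rv_sum X.bdd_rv_mult X.bdd_rv_const X.bdd_rv_mon leading_sub)
  have bR: "X.bdd_rv (rest_sum N)" unfolding rest_sum_def[abs_def]
    by (intro X.bdd_rv_sum X.bdd_rv_mult X.bdd_rv_const X.bdd_rv_mon) (simp add: rest_def)
  have "X.bdd_rv (\<lambda>\<omega>. (leading_sum N \<omega> + rest_sum N \<omega>) / c)" by (intro X.bdd_rv_divide X.bdd_rv_add bS bR)
  moreover have "(\<lambda>\<omega>. (leading_sum N \<omega> + rest_sum N \<omega>) / c) = W" using c0 by (auto simp: cW[symmetric])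
  ultimately have bW: "X.bdd_rv W" by simp
  have R2: "X.expectation (\<lambda>\<omega>. (rest_sum N \<omega>)\<^sup>2) = rest_var N"
    unfolding rest_sum_def rest_var_def by (rule X.expectation_lincomb_square[OF finite_rest]) (simp add: rest_def)
  have W2: "X.expectation (\<lambda>\<omega>. (W \<omega>)\<^sup>2) = real N powr (- \<gamma>) * (leading_var N + rest_var N)"
  proof -
    have "X.expectation (\<lambda>\<omega>. (c * W \<omega>)\<^sup>2) = X.expectation (\<lambda>\<omega>. (\<Sum>\<Gamma>\<in>leading N \<union> rest N. coef N \<Gamma> * mon \<Gamma> (\<lambda>e. weight N e \<omega>))\<^sup>2)"
      unfolding cW leading_sum_def rest_sum_def by (simp add: sum.union_disjoint[OF finite_leading finite_rest leading_rest(1)])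
    also have "\<dots> = (\<Sum>\<Gamma>\<in>leading N \<union> rest N. (coef N \<Gamma>)\<^sup>2 * tau N ^ card \<Gamma>)"
      by (rule X.expectation_lincomb_square) (auto simp: finite_leading finite_rest leading_def rest_def)
    also have "\<dots> = leading_var N + rest_var N" unfolding leading_var_def rest_var_def by (rule sum.union_disjoint[OF finite_leading finite_rest leading_rest(1)])
    finally have "c\<^sup>2 * X.expectation (\<lambda>\<omega>. (W \<omega>)\<^sup>2) = leading_var N + rest_var N" by (simp add: power_mult_distrib)
    moreover have "c\<^sup>2 = real N powr \<gamma>" using powr_power[of "real N" "\<gamma> / 2" 2] N by (simp add: c_def)
    ultimately show ?thesis using N by (simp add: powr_minus field_simps)
  qed
  define A where "A \<omega> = iexp (s * (c * ln (1 + W \<omega>)))" for \<omega>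
  define B where "B \<omega> = iexp (s * (c * W \<omega>))" for \<omega>
  define C where "C \<omega> = iexp (s * leading_sum N \<omega>)" for \<omega>
  have Wm: "W \<in> borel_measurable (M N)" using bW by (simp add: X.bdd_rv_def)
  have bA: "X.bdd_rv A"
    unfolding X.bdd_rv_def A_def[abs_def] using Wm by (auto intro!: exI[of _ 1])
  have bB: "X.bdd_rv B" unfolding B_def[abs_def] by (intro X.bdd_rv_iexp X.bdd_rv_mult X.bdd_rv_const bW)
  have bC: "X.bdd_rv C" unfolding C_def[abs_def] by (intro X.bdd_rv_iexp X.bdd_rv_mult X.bdd_rv_const bS)
  note int = X.bdd_rv_integrable
  have AB: "cmod (X.expectation A - X.expectation B) \<le> (2 * \<bar>s\<bar> * c + 8) * (real N powr (- \<gamma>) * (leading_var N + rest_var N))"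
  proof -
    have "cmod (X.expectation A - X.expectation B) = cmod (X.expectation (\<lambda>\<omega>. A \<omega> - B \<omega>))"
      by (subst Bochner_Integration.integral_diff[OF int[OF bA] int[OF bB]]) simp
    also have "\<dots> \<le> X.expectation (\<lambda>\<omega>. cmod (A \<omega> - B \<omega>))" by (rule integral_norm_bound)
    also have "\<dots> \<le> X.expectation (\<lambda>\<omega>. (2 * \<bar>s\<bar> * c + 8) * (W \<omega>)\<^sup>2)"
    proof (rule integral_mono)
      show "integrable (M N) (\<lambda>\<omega>. cmod (A \<omega> - B \<omega>))" by (intro integrable_norm int X.bdd_rv_diff bA bB)
      show "integrable (M N) (\<lambda>\<omega>. (2 * \<bar>s\<bar> * c + 8) * (W \<omega>)\<^sup>2)" by (intro int X.bdd_rv_mult X.bdd_rv_const X.bdd_rv_power bW)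
      show "cmod (A \<omega> - B \<omega>) \<le> (2 * \<bar>s\<bar> * c + 8) * (W \<omega>)\<^sup>2" for \<omega>
        unfolding A_def B_def using c0 by (intro cmod_iexp_ln_diff) simp
    qed
    also have "\<dots> = (2 * \<bar>s\<bar> * c + 8) * (real N powr (- \<gamma>) * (leading_var N + rest_var N))" by (simp only: integral_mult_right_zero W2)
    finally show ?thesis .
  qed
  have BC: "cmod (X.expectation B - X.expectation C) \<le> \<bar>s\<bar> * sqrt (rest_var N)"
  proof -
    have "cmod (X.expectation B - X.expectation C) = cmod (X.expectation (\<lambda>\<omega>. B \<omega> - C \<omega>))"
      by (subst Bochner_Integration.integral_diff[OF int[OF bB] int[OF bC]]) simp
    also have "\<dots> \<le> X.expectation (\<lambda>\<omega>. cmod (B \<omega> - C \<omega>))" by (rule integral_norm_bound)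
    also have "\<dots> \<le> X.expectation (\<lambda>\<omega>. \<bar>s\<bar> * \<bar>rest_sum N \<omega>\<bar>)"
    proof (rule integral_mono)
      show "integrable (M N) (\<lambda>\<omega>. cmod (B \<omega> - C \<omega>))" by (intro integrable_norm int X.bdd_rv_diff bB bC)
      show "integrable (M N) (\<lambda>\<omega>. \<bar>s\<bar> * \<bar>rest_sum N \<omega>\<bar>)" by (intro int X.bdd_rv_mult X.bdd_rv_const X.bdd_rv_abs bR)
      show "cmod (B \<omega> - C \<omega>) \<le> \<bar>s\<bar> * \<bar>rest_sum N \<omega>\<bar>" for \<omega>
      proof -
        have "cmod (B \<omega> - C \<omega>) \<le> \<bar>s * (c * W \<omega>) - s * leading_sum N \<omega>\<bar>" unfolding B_def C_def by (rule cmod_iexp_diff)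
        also have "s * (c * W \<omega>) - s * leading_sum N \<omega> = s * rest_sum N \<omega>" unfolding cW by (simp add: algebra_simps)
        finally show ?thesis by (simp add: abs_mult)
      qed
    qed
    also have "\<dots> = \<bar>s\<bar> * X.expectation (\<lambda>\<omega>. \<bar>rest_sum N \<omega>\<bar>)" by (rule integral_mult_right_zero)
    also have "\<dots> \<le> \<bar>s\<bar> * sqrt (rest_var N)"
      using X.expectation_abs_le_sqrt[OF bR] unfolding R2 by (intro mult_left_mono) auto
    finally show ?thesis .
  qed
  have "cmod (X.expectation A - X.expectation C) \<le> cmod (X.expectation A - X.expectation B) + cmod (X.expectation B - X.expectation C)"
    using norm_triangle_ineq[of "X.expectation A - X.expectation B" "X.expectation B - X.expectation C"] by simp
  also have "\<dots> \<le> (2 * \<bar>s\<bar> * c + 8) * (real N powr (- \<gamma>) * (leading_var N + rest_var N)) + \<bar>s\<bar> * sqrt (rest_var N)"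
    by (rule add_mono[OF AB BC])
  finally show ?thesis
    unfolding A_def C_def W_def c_def by simp
qed

lemma clt:
  assumes v: "0 < vlim"
  shows "tendsto_normal M (\<lambda>N \<omega>. real N powr (\<gamma> / 2) * ln (Zrv N \<omega>)) vlim"
  unfolding tendsto_normal_def
proof (rule levy_continuity)
  have m: "(\<lambda>\<omega>. real N powr (\<gamma> / 2) * ln (Zrv N \<omega>)) \<in> borel_measurable (M N)" for N
    using Zrv_measurable by simp
  show "real_distribution (distr (M N) borel (\<lambda>\<omega>. real N powr (\<gamma> / 2) * ln (Zrv N \<omega>)))" for N
    using prob_space.real_distribution_distr[OF ps m] .
  have sv: "sqrt vlim > 0" using v by simp
  show "real_distribution (density lborel (normal_density 0 (sqrt vlim)))" by (rule char_normal(1)[OF sv])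
  fix s
  define a where "a N = (LINT \<omega>|M N. iexp (s * (real N powr (\<gamma> / 2) * ln (Zrv N \<omega>))))" for N
  define b where "b N = (LINT \<omega>|M N. iexp (s * leading_sum N \<omega>))" for N
  define U where "U N = (2 * \<bar>s\<bar> * real N powr (\<gamma> / 2) + 8) * (real N powr (- \<gamma>) * (leading_var N + rest_var N)) + \<bar>s\<bar> * sqrt (rest_var N)" for N
  have "b \<longlonglongrightarrow> complex_of_real (exp (- vlim * s\<^sup>2 / 2))"
    unfolding b_def[abs_def] leading_sum_def by (rule cf_tendsto)
  moreover have "(\<lambda>N. a N - b N) \<longlonglongrightarrow> 0"
  proof -
    have "(\<lambda>N. (2 * \<bar>s\<bar> * real N powr (- \<gamma> / 2) + 8 * real N powr (- \<gamma>)) * (leading_var N + rest_var N) + \<bar>s\<bar> * sqrt (rest_var N))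
       \<longlonglongrightarrow> (2 * \<bar>s\<bar> * 0 + 8 * 0) * (vlim + 0) + \<bar>s\<bar> * sqrt 0"
    proof (intro tendsto_intros leading_var_tendsto rest_var_tendsto)
      show "(\<lambda>N. real N powr (- \<gamma> / 2)) \<longlonglongrightarrow> 0" using \<gamma>(1) by real_asymp
      show "(\<lambda>N. real N powr (- \<gamma>)) \<longlonglongrightarrow> 0" using \<gamma>(1) by real_asymp
    qed
    moreover have "U = (\<lambda>N. (2 * \<bar>s\<bar> * real N powr (- \<gamma> / 2) + 8 * real N powr (- \<gamma>)) * (leading_var N + rest_var N) + \<bar>s\<bar> * sqrt (rest_var N))"
    proof (rule ext)
      fix N
      have e: "real N powr (\<gamma> / 2) * real N powr (- \<gamma>) = real N powr (- \<gamma> / 2)"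
        unfolding powr_add[symmetric] by (simp add: field_simps)
      show "U N = (2 * \<bar>s\<bar> * real N powr (- \<gamma> / 2) + 8 * real N powr (- \<gamma>)) * (leading_var N + rest_var N) + \<bar>s\<bar> * sqrt (rest_var N)"
        unfolding U_def e[symmetric] by (simp only: distrib_right mult.assoc)
    qed
    ultimately have U0: "U \<longlonglongrightarrow> 0" by simp
    have evU: "\<forall>\<^sub>F N in sequentially. cmod (a N - b N) \<le> U N"
      by (rule eventually_sequentiallyI[of 1]) (simp only: a_def b_def U_def char_estimate)
    have "(\<lambda>N. cmod (a N - b N)) \<longlonglongrightarrow> 0"
      by (rule tendsto_sandwich[OF _ evU tendsto_const U0]) simp
    then show ?thesis by (simp only: tendsto_norm_zero_iff)
  qed
  ultimately have "(\<lambda>N. (a N - b N) + b N) \<longlonglongrightarrow> 0 + complex_of_real (exp (- vlim * s\<^sup>2 / 2))"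
    by (intro tendsto_add)
  then have "a \<longlonglongrightarrow> complex_of_real (exp (- vlim * s\<^sup>2 / 2))" by simp
  moreover have "char (distr (M N) borel (\<lambda>\<omega>. real N powr (\<gamma> / 2) * ln (Zrv N \<omega>))) s = a N" for N
    unfolding char_def a_def by (subst integral_distr[OF m]) auto
  moreover have "char (density lborel (normal_density 0 (sqrt vlim))) s = complex_of_real (exp (- vlim * s\<^sup>2 / 2))"
    unfolding char_normal(2)[OF sv] using v by (simp add: mult.commute)
  ultimately show "(\<lambda>N. char (distr (M N) borel (\<lambda>\<omega>. real N powr (\<gamma> / 2) * ln (Zrv N \<omega>))) s)
      \<longlonglongrightarrow> char (density lborel (normal_density 0 (sqrt vlim))) s"
    by simp
qed

end

section \<open>The three regimes\<close>

text \<open>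
  The types that can be leading. Closed clusters of three edges exist only for even \<open>p\<close>, and for odd \<open>p\<close> their
  place is taken by the types \<open>(3, 1)\<close> and \<open>(4, 0)\<close>.
\<close>
definition leading_types :: "nat \<Rightarrow> (nat \<times> nat) set" where
  "leading_types p = {(1, p), (2, 2)} \<union> (if even p then {(3, 0)} else {(3, 1), (4, 0)})"

context pspin
begin

lemma eps_mono: "l \<le> l' \<Longrightarrow> eps k l \<le> eps k l'"
  unfolding eps_def using \<alpha>4 by (intro add_left_mono mult_right_mono) auto

lemma eps_strict: "\<alpha> > 1/4 \<Longrightarrow> l < l' \<Longrightarrow> eps k l < eps k l'"
  unfolding eps_def by (intro add_strict_left_mono mult_strict_right_mono) auto

text \<open>
  Every type that occurs has at least as many odd vertices as a type in \<open>leading_types\<close> with the same number of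
  edges, with the exception of four edges and even \<open>p\<close>, which are beaten by three edges. More odd vertices strictly increase
  the exponent unless \<open>\<alpha> = 1 / 4\<close>; in that case single edges dominate strictly.
\<close>
lemma pspin_regimeI:
  assumes \<gamma>: "0 < \<gamma>" "\<gamma> \<le> 2 * (real p - 2)"
    and le: "\<And>k l. (k, l) \<in> leading_types p \<Longrightarrow> \<gamma> \<le> eps k l"
    and strict: "\<alpha> > 1/4 \<or> (\<forall>(k, l)\<in>leading_types p. k \<noteq> 1 \<longrightarrow> \<gamma> < eps k l)"
  shows "pspin_regime p \<beta> \<rho> \<alpha> h \<mu> M J \<gamma> {(k, l)\<in>leading_types p. eps k l = \<gamma>}"
proof
  show "{(k, l)\<in>leading_types p. eps k l = \<gamma>} \<subseteq> {(1, p), (2, 2), (3, 0), (3, 1), (4, 0)}"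
    by (auto simp: leading_types_def split: if_splits)
  fix k l assume k: "1 \<le> k" "k \<le> 4" and nin: "(k, l) \<notin> {(k, l)\<in>leading_types p. eps k l = \<gamma>}"
    and ev: "even (k * p + l)" and k1: "k = 1 \<Longrightarrow> l = p" and k2: "k = 2 \<Longrightarrow> 2 \<le> l"
  have base: "\<gamma> < eps k l" if l0: "(k, l0) \<in> leading_types p" "l0 \<le> l" and kn: "k \<noteq> 1" for l0
  proof (cases "l0 = l")
    case True
    then show ?thesis using le[OF l0(1)] nin l0(1) by auto
  next
    case False
    then have "l0 < l" using l0(2) by simp
    then show ?thesis
      using strict le[OF l0(1)] eps_strict[of l0 l k] eps_mono[of l0 l k] l0(1) kn by fastforce
  qed
  consider "k = 1" | "k = 2" | "k = 3" | "k = 4" using k by linarith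
  then show "\<gamma> < eps k l"
  proof cases
    case 1
    then have "l = p" by (rule k1)
    moreover have "(1, p) \<in> leading_types p" by (simp add: leading_types_def)
    ultimately show ?thesis using le[of 1 p] nin 1 by auto
  next
    case 2
    then show ?thesis using base[of 2] k2 by (simp add: leading_types_def)
  next
    case 3
    show ?thesis
    proof (cases "even p")
      case True
      then show ?thesis using base[of 0] 3 by (simp add: leading_types_def)
    next
      case False
      then have "odd l" using ev 3 by simp
      then have "1 \<le> l" by (cases l) auto
      then show ?thesis using base[of 1] 3 False by (simp add: leading_types_def)
    qed
  next
    case 4
    show ?thesis
    proof (cases "even p")
      case True
      then have "\<gamma> \<le> eps 3 0" using le[of 3 0] by (simp add: leading_types_def)
      also have "\<dots> < eps 4 0" using p3 by (simp add: eps_def)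
      also have "\<dots> \<le> eps k l" unfolding 4 by (rule eps_mono) simp
      finally show ?thesis .
    next
      case False
      then show ?thesis using base[of 0] 4 by (simp add: leading_types_def)
    qed
  qed
qed (use \<gamma> in auto)

lemma v_sq_nonneg: "0 \<le> v_sq p k l \<beta> \<rho>"
  unfolding v_sq_cluster_const using p3 \<beta>0 \<rho>0 by (intro mult_nonneg_nonneg cluster_const_nonneg) auto

lemma v_sq_pos: "0 < v_sq p 1 p \<beta> \<rho>" "0 < v_sq p 2 2 \<beta> \<rho>" "even p \<Longrightarrow> 0 < v_sq p 3 0 \<beta> \<rho>" "0 < v_sq p 4 0 \<beta> \<rho>"
  unfolding v_sq_cluster_const using p3 \<beta>0 \<rho>0 cluster_const_pos[of p] by auto

lemma clt_at_scale:
  assumes \<gamma>: "0 < \<gamma>" "\<gamma> \<le> 2 * (real p - 2)"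
    and le: "\<And>k l. (k, l) \<in> leading_types p \<Longrightarrow> \<gamma> \<le> eps k l"
    and strict: "\<alpha> > 1/4 \<or> (\<forall>(k, l)\<in>leading_types p. k \<noteq> 1 \<longrightarrow> \<gamma> < eps k l)"
    and v: "v = (\<Sum>(k, l)\<in>leading_types p. if eps k l = \<gamma> then v_sq p k l \<beta> \<rho> else 0)" "0 < v"
  shows "tendsto_normal M (\<lambda>N \<omega>. real N powr (\<gamma> / 2) * ln (Zhat p N \<beta> (h N) (\<lambda>i. J N i \<omega>))) v"
proof -
  interpret R: pspin_regime p \<beta> \<rho> \<alpha> h \<mu> M J \<gamma> "{(k, l)\<in>leading_types p. eps k l = \<gamma>}"
    by (rule pspin_regimeI[OF \<gamma> le strict])
  have fin: "finite (leading_types p)" by (simp add: leading_types_def)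
  have "R.vlim = (\<Sum>d\<in>{d\<in>leading_types p. eps (fst d) (snd d) = \<gamma>}. v_sq p (fst d) (snd d) \<beta> \<rho>)"
    unfolding R.vlim_def by (intro sum.cong) auto
  also have "\<dots> = (\<Sum>d\<in>leading_types p. if eps (fst d) (snd d) = \<gamma> then v_sq p (fst d) (snd d) \<beta> \<rho> else 0)"
    by (rule sum.inter_filter[OF fin])
  also have "\<dots> = v" unfolding v(1) by (intro sum.cong) auto
  finally have e: "R.vlim = v" .
  show ?thesis using R.clt v(2) unfolding e R.Zrv_def by blast
qed

lemma sum_leading_types:
  "(\<Sum>(k, l)\<in>leading_types p. f k l) = f 1 p + f 2 2 + (if even p then f 3 0 else f 3 1 + f 4 (0::nat) :: real)"
  by (simp add: leading_types_def)

lemma eps_values: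
  "eps 1 p = 2 * \<alpha> * real p - 1" "eps 2 2 = real p - 3 + 4 * \<alpha>" "eps 3 0 = 3 * (real p - 2) / 2"
  "eps 3 1 = 3 * (real p - 2) / 2 + 2 * \<alpha> - 1 / 2" "eps 4 0 = 2 * (real p - 2)"
  by (simp_all add: eps_def field_simps)

lemma alpha_c_ge: "1 / 2 \<le> alpha_c p"
proof (cases "even p")
  case True
  then have "p \<noteq> 3" by auto
  then have "p \<ge> 4" using p3 by simp
  then show ?thesis using True by (simp add: alpha_c_def)
qed (use p3 in \<open>simp add: alpha_c_def\<close>)

text \<open>
  At \<open>\<alpha> = alpha_c p\<close> the exponents of the closed clusters and of the type \<open>(2, 2)\<close>, and for odd \<open>p\<close> also of
  \<open>(3, 1)\<close>, coincide. Single edges reach the same exponent only for \<open>p \<le> 4\<close>, where \<open>alpha_c p = 1 / 2\<close>.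
\<close>
lemma subcritical:
  assumes \<alpha>: "alpha_c p \<le> \<alpha>"
  shows "tendsto_normal M (\<lambda>N \<omega>. real N powr (gamma1 p / 2) * ln (Zhat p N \<beta> (h N) (\<lambda>i. J N i \<omega>))) (v1_sq p \<alpha> \<beta> \<rho>)"
proof (cases "even p")
  case True
  then have "p \<noteq> 3" by auto
  then have p4: "real p \<ge> 4" using p3 by simp
  have \<gamma>: "gamma1 p = 3 * (real p - 2) / 2" using True by (simp add: gamma1_def ell_def)
  have ac: "alpha_c p = real p / 8" using True by (simp add: alpha_c_def)
  have "real p / 8 * real p \<le> \<alpha> * real p" using \<alpha> ac by (intro mult_right_mono) auto
  then have pa: "real p * real p / 4 \<le> 2 * \<alpha> * real p" by simp
  have q: "0 \<le> (real p - 2) * (real p - 4)" using p4 by (intro mult_nonneg_nonneg) auto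
  have qe: "(real p - 2) * (real p - 4) = real p * real p - 6 * real p + 8" by (simp add: algebra_simps)
  have le1: "gamma1 p \<le> eps 1 p" unfolding \<gamma> eps_values using pa q qe by (simp add: field_simps)
  have eq1: "eps 1 p = gamma1 p \<longleftrightarrow> \<alpha> = alpha_c p \<and> \<alpha> = 1 / 2"
  proof
    assume e: "eps 1 p = gamma1 p"
    then have e': "2 * \<alpha> * real p = (3 * real p - 4) / 2" unfolding \<gamma> eps_values by (simp add: field_simps)
    then have "(real p - 2) * (real p - 4) \<le> 0" unfolding qe using pa by (simp add: field_simps)
    then have "real p = 4" using p4 by (auto simp: mult_le_0_iff)
    then show "\<alpha> = alpha_c p \<and> \<alpha> = 1 / 2" using e' ac by simp
  next
    assume "\<alpha> = alpha_c p \<and> \<alpha> = 1 / 2"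
    then have "\<alpha> = 1 / 2" "real p = 4" using ac by auto
    then show "eps 1 p = gamma1 p" unfolding \<gamma> eps_values by simp
  qed
  have eq2: "eps 2 2 = gamma1 p \<longleftrightarrow> \<alpha> = alpha_c p" unfolding \<gamma> eps_values ac by (auto simp: field_simps)
  have eq3: "eps 3 0 = gamma1 p" unfolding \<gamma> eps_values ..
  have v: "v1_sq p \<alpha> \<beta> \<rho> = (\<Sum>(k, l)\<in>leading_types p. if eps k l = gamma1 p then v_sq p k l \<beta> \<rho> else 0)"
    unfolding sum_leading_types eq1 eq2 eq3 v1_sq_def using True by auto
  show ?thesis
  proof (rule clt_at_scale[OF _ _ _ _ v])
    show "0 < gamma1 p" "gamma1 p \<le> 2 * (real p - 2)" unfolding \<gamma> using p4 by auto
    show "gamma1 p \<le> eps k l" if "(k, l) \<in> leading_types p" for k l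
    proof -
      have "gamma1 p \<le> eps 2 2" unfolding \<gamma> eps_values using \<alpha> ac by (simp add: field_simps)
      then show ?thesis using that True le1 eq3 by (auto simp: leading_types_def)
    qed
    show "1 / 4 < \<alpha> \<or> (\<forall>(k, l)\<in>leading_types p. k \<noteq> 1 \<longrightarrow> gamma1 p < eps k l)" using \<alpha> alpha_c_ge by auto
    show "0 < v1_sq p \<alpha> \<beta> \<rho>"
      unfolding v1_sq_def using True v_sq_pos(3) v_sq_nonneg[of 2 2] v_sq_nonneg[of 1 p] by (auto intro: add_pos_nonneg)
  qed
next
  case False
  have P3: "real p \<ge> 3" using p3 by simp
  have \<gamma>: "gamma1 p = 2 * (real p - 2)" using False by (simp add: gamma1_def ell_def)
  have ac: "alpha_c p = (real p - 1) / 4" using False by (simp add: alpha_c_def)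
  have "(real p - 1) / 4 * real p \<le> \<alpha> * real p" using \<alpha> ac by (intro mult_right_mono) auto
  then have pa: "(real p * real p - real p) / 2 \<le> 2 * \<alpha> * real p" by (simp add: algebra_simps)
  have q: "0 \<le> (real p - 2) * (real p - 3)" using P3 by (intro mult_nonneg_nonneg) auto
  have qe: "(real p - 2) * (real p - 3) = real p * real p - 5 * real p + 6" by (simp add: algebra_simps)
  have le1: "gamma1 p \<le> eps 1 p" unfolding \<gamma> eps_values using pa q qe by (simp add: field_simps)
  have eq1: "eps 1 p = gamma1 p \<longleftrightarrow> \<alpha> = alpha_c p \<and> \<alpha> = 1 / 2"
  proof
    assume e: "eps 1 p = gamma1 p"
    then have e': "2 * \<alpha> * real p = 2 * real p - 3" unfolding \<gamma> eps_values by (simp add: field_simps)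
    then have "(real p - 2) * (real p - 3) \<le> 0" unfolding qe using pa by (simp add: field_simps)
    then have "real p = 3" using P3 by (auto simp: mult_le_0_iff)
    then show "\<alpha> = alpha_c p \<and> \<alpha> = 1 / 2" using e' ac by simp
  next
    assume "\<alpha> = alpha_c p \<and> \<alpha> = 1 / 2"
    then have "\<alpha> = 1 / 2" "real p = 3" using ac by auto
    then show "eps 1 p = gamma1 p" unfolding \<gamma> eps_values by simp
  qed
  have eq2: "eps 2 2 = gamma1 p \<longleftrightarrow> \<alpha> = alpha_c p" unfolding \<gamma> eps_values ac by (auto simp: field_simps)
  have eq3: "eps 3 1 = gamma1 p \<longleftrightarrow> \<alpha> = alpha_c p" unfolding \<gamma> eps_values ac by (auto simp: field_simps)
  have eq4: "eps 4 0 = gamma1 p" unfolding \<gamma> eps_values ..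
  have v: "v1_sq p \<alpha> \<beta> \<rho> = (\<Sum>(k, l)\<in>leading_types p. if eps k l = gamma1 p then v_sq p k l \<beta> \<rho> else 0)"
    unfolding sum_leading_types eq1 eq2 eq3 eq4 v1_sq_def using False by auto
  show ?thesis
  proof (rule clt_at_scale[OF _ _ _ _ v])
    show "0 < gamma1 p" "gamma1 p \<le> 2 * (real p - 2)" unfolding \<gamma> using P3 by auto
    show "gamma1 p \<le> eps k l" if "(k, l) \<in> leading_types p" for k l
    proof -
      have "gamma1 p \<le> eps 2 2" "gamma1 p \<le> eps 3 1" unfolding \<gamma> eps_values using \<alpha> ac by (simp_all add: field_simps)
      then show ?thesis using that False le1 eq4 by (auto simp: leading_types_def)
    qed
    show "1 / 4 < \<alpha> \<or> (\<forall>(k, l)\<in>leading_types p. k \<noteq> 1 \<longrightarrow> gamma1 p < eps k l)" using \<alpha> alpha_c_ge by auto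
    show "0 < v1_sq p \<alpha> \<beta> \<rho>"
      unfolding v1_sq_def using False v_sq_pos(4) v_sq_nonneg[of 2 2] v_sq_nonneg[of 1 p] v_sq_nonneg[of 3 1]
      by (auto intro: add_pos_nonneg)
  qed
qed

text \<open>
  The exponent \<open>gamma2\<close> is that of the type \<open>(2, 2)\<close>; single edges are worse by \<open>(p - 2) * (2 * \<alpha> - 1)\<close>.
\<close>
lemma unified_one:
  assumes \<alpha>: "1 / 2 \<le> \<alpha>" "\<alpha> < alpha_c p"
  shows "tendsto_normal M (\<lambda>N \<omega>. real N powr (gamma2 p \<alpha> / 2) * ln (Zhat p N \<beta> (h N) (\<lambda>i. J N i \<omega>))) (v2_sq p \<alpha> \<beta> \<rho>)"
proof -
  have P3: "real p \<ge> 3" using p3 by simp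
  have ac: "alpha_c p = (if even p then real p / 8 else (real p - 1) / 4)" by (simp add: alpha_c_def)
  have \<gamma>: "gamma2 p \<alpha> = real p - 3 + 4 * \<alpha>"
    by (simp add: gamma2_def gamma1_def ell_def alpha_c_def field_simps)
  have d: "eps 1 p - gamma2 p \<alpha> = (real p - 2) * (2 * \<alpha> - 1)" unfolding \<gamma> eps_values by (simp add: algebra_simps)
  have "0 \<le> (real p - 2) * (2 * \<alpha> - 1)" using P3 \<alpha> by (intro mult_nonneg_nonneg) auto
  then have le1: "gamma2 p \<alpha> \<le> eps 1 p" using d by linarith
  have "eps 1 p = gamma2 p \<alpha> \<longleftrightarrow> (real p - 2) * (2 * \<alpha> - 1) = 0" using d by linarith
  then have eq1: "eps 1 p = gamma2 p \<alpha> \<longleftrightarrow> \<alpha> = 1 / 2" unfolding mult_eq_0_iff using P3 by auto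
  have eq2: "eps 2 2 = gamma2 p \<alpha>" unfolding \<gamma> eps_values ..
  have lt3: "even p \<Longrightarrow> gamma2 p \<alpha> < eps 3 0" unfolding \<gamma> eps_values using \<alpha> ac by (simp add: field_simps)
  have lt4: "odd p \<Longrightarrow> gamma2 p \<alpha> < eps 3 1" "odd p \<Longrightarrow> gamma2 p \<alpha> < eps 4 0"
    unfolding \<gamma> eps_values using \<alpha> ac by (simp_all add: field_simps)
  have v: "v2_sq p \<alpha> \<beta> \<rho> = (\<Sum>(k, l)\<in>leading_types p. if eps k l = gamma2 p \<alpha> then v_sq p k l \<beta> \<rho> else 0)"
    unfolding sum_leading_types eq1 eq2 v2_sq_def using lt3 lt4 by auto
  show ?thesis
  proof (rule clt_at_scale[OF _ _ _ _ v])
    show "0 < gamma2 p \<alpha>" unfolding \<gamma> using P3 \<alpha> by simp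
    show "gamma2 p \<alpha> \<le> 2 * (real p - 2)" unfolding \<gamma> using P3 \<alpha> ac by (auto split: if_splits)
    show "gamma2 p \<alpha> \<le> eps k l" if "(k, l) \<in> leading_types p" for k l
      using that le1 eq2 lt3 lt4 by (auto simp: leading_types_def split: if_splits)
    show "1 / 4 < \<alpha> \<or> (\<forall>(k, l)\<in>leading_types p. k \<noteq> 1 \<longrightarrow> gamma2 p \<alpha> < eps k l)" using \<alpha> by auto
    show "0 < v2_sq p \<alpha> \<beta> \<rho>"
      unfolding v2_sq_def using v_sq_pos(2) v_sq_nonneg[of 1 p] by (auto intro: add_pos_nonneg)
  qed
qed

text \<open>
  Below \<open>\<alpha> = 1 / 2\<close> single edges dominate strictly.
\<close>
lemma unified_two:
  assumes \<alpha>: "\<alpha> < 1 / 2"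
  shows "tendsto_normal M (\<lambda>N \<omega>. real N powr (gamma3 p \<alpha> / 2) * ln (Zhat p N \<beta> (h N) (\<lambda>i. J N i \<omega>))) (v3_sq p \<beta> \<rho>)"
proof -
  have P3: "real p \<ge> 3" using p3 by simp
  have \<gamma>: "gamma3 p \<alpha> = 2 * \<alpha> * real p - 1" by (simp add: gamma3_def)
  have eq1: "eps 1 p = gamma3 p \<alpha>" unfolding \<gamma> eps_values ..
  have "2 * \<alpha> * real p < 1 * real p" using \<alpha> P3 by (intro mult_strict_right_mono) auto
  then have ub: "gamma3 p \<alpha> < real p - 1" unfolding \<gamma> by simp
  have "1 / 2 * real p \<le> 2 * \<alpha> * real p" using \<alpha>4 P3 by (intro mult_right_mono) auto
  then have pos: "0 < gamma3 p \<alpha>" unfolding \<gamma> using P3 by linarith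
  have "0 < (real p - 2) * (1 - 2 * \<alpha>)" using P3 \<alpha> by (intro mult_pos_pos) auto
  then have lt2: "gamma3 p \<alpha> < eps 2 2" unfolding \<gamma> eps_values by (simp add: algebra_simps)
  have lt3: "even p \<Longrightarrow> gamma3 p \<alpha> < eps 3 0"
  proof -
    assume "even p"
    then have "p \<noteq> 3" by auto
    then have "real p \<ge> 4" using p3 by simp
    then show ?thesis using ub unfolding eps_values by (simp add: field_simps)
  qed
  have "2 * \<alpha> * (real p - 1) < 1 * (real p - 1)" using \<alpha> P3 by (intro mult_strict_right_mono) auto
  then have "2 * \<alpha> * real p - 2 * \<alpha> < real p - 1" by (simp add: algebra_simps)
  moreover have "3 * (real p - 2) / 2 = 3 / 2 * real p - 3" by (simp add: field_simps)
  ultimately have lt31: "gamma3 p \<alpha> < eps 3 1" unfolding \<gamma> eps_values using P3 by linarith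
  have lt4: "gamma3 p \<alpha> < eps 4 0" unfolding eps_values using ub P3 by simp
  have v: "v3_sq p \<beta> \<rho> = (\<Sum>(k, l)\<in>leading_types p. if eps k l = gamma3 p \<alpha> then v_sq p k l \<beta> \<rho> else 0)"
    unfolding sum_leading_types eq1 v3_sq_def using lt2 lt3 lt31 lt4 by auto
  show ?thesis
  proof (rule clt_at_scale[OF pos _ _ _ v])
    show "gamma3 p \<alpha> \<le> 2 * (real p - 2)" using ub P3 by simp
    show "gamma3 p \<alpha> \<le> eps k l" if "(k, l) \<in> leading_types p" for k l
      using that eq1 lt2 lt3 lt31 lt4 by (auto simp: leading_types_def split: if_splits)
    show "1 / 4 < \<alpha> \<or> (\<forall>(k, l)\<in>leading_types p. k \<noteq> 1 \<longrightarrow> gamma3 p \<alpha> < eps k l)"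
      using lt2 lt3 lt31 lt4 by (auto simp: leading_types_def split: if_splits)
    show "0 < v3_sq p \<beta> \<rho>" unfolding v3_sq_def by (rule v_sq_pos(1))
  qed
qed

end

theorem theorem1p12:
  fixes p :: nat and \<beta> \<rho> \<alpha> :: real
    and h :: "nat \<Rightarrow> real"
    and \<mu> :: "real measure"
    and M :: "nat \<Rightarrow> 'a measure"
    and J :: "nat \<Rightarrow> nat list \<Rightarrow> 'a \<Rightarrow> real"
  assumes "p \<ge> 3"
    and "0 < \<beta>" and "\<beta> < beta_f p"
    and "\<rho> > 0" and "\<alpha> \<ge> 1/4"
    and "\<And>N. h N = \<rho> * real N powr (- \<alpha>)"
    and "disorder_law \<mu>"
    and "\<And>N. iid_on (edges p N) (M N) (J N) \<mu>"
  shows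
    "(\<alpha> \<ge> alpha_c p \<longrightarrow>
        tendsto_normal M
          (\<lambda>N \<omega>. real N powr (gamma1 p / 2) * ln (Zhat p N \<beta> (h N) (\<lambda>i. J N i \<omega>)))
          (v1_sq p \<alpha> \<beta> \<rho>)) \<and>
     (1/2 \<le> \<alpha> \<and> \<alpha> < alpha_c p \<longrightarrow>
        tendsto_normal M
          (\<lambda>N \<omega>. real N powr (gamma2 p \<alpha> / 2) * ln (Zhat p N \<beta> (h N) (\<lambda>i. J N i \<omega>)))
          (v2_sq p \<alpha> \<beta> \<rho>)) \<and>
     (1/4 \<le> \<alpha> \<and> \<alpha> < 1/2 \<longrightarrow>
        tendsto_normal M
          (\<lambda>N \<omega>. real N powr (gamma3 p \<alpha> / 2) * ln (Zhat p N \<beta> (h N) (\<lambda>i. J N i \<omega>)))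
          (v3_sq p \<beta> \<rho>))"
proof -
  interpret pspin p \<beta> \<rho> \<alpha> h \<mu> M J by standard (fact assms)+
  show ?thesis using subcritical unified_one unified_two by blast
qed

end
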